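(* Let $\Gamma$ be a countable group and $\Gamma \curvearrowright I$ a faithful transitive action such that $(\operatorname{Stab}_\Gamma i) \cdot j$ is infinite for all $i \neq j$ in $I$. Let $n \in \mathbb{N}$ and consider the generalized wreath product group $G = (\mathbb{Z}/n\mathbb{Z})^{(I)} \rtimes \Gamma$. If $C$ is an abelian group with $n \cdot C \neq C$, then no central extension $\widetilde{G}$ of $G$ by $C$ is W$^*$-superrigid. More precisely, for every $\Omega \in H^2(G,C)$, there exists an $\Omega' \in H^2(G,C)$ such that $\Omega \approx \Omega'$, meaning that $\omega \circ \Omega = \omega \circ \Omega'$ in $H^2(G,\mathbb{T})$ for all $\omega \in \widehat{C}$, and such that the corresponding central extensions $\widetilde{G}$ (of $\Omega$) and $\widetilde{\Lambda}$ (of $\Omega'$) satisfy $L(\widetilde{G}) \cong L(\widetilde{\Lambda})$ and $\widetilde{G} \not\cong \widetilde{\Lambda}$.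
   Context: All groups, including $C$, are countable and discrete. $L(G)$ is the group von Neumann algebra of $G$; $\cong$ between von Neumann algebras means $*$-isomorphism. A group $K$ is W$^*$-superrigid if for every group $\Lambda$, $L(K)\cong L(\Lambda)$ if and only if $K\cong\Lambda$. $\operatorname{Stab}_\Gamma i$ is the stabilizer of $i \in I$ in $\Gamma$, and $n \cdot C = \{nc \mid c \in C\}$, the abelian group $C$ being written additively. $(\mathbb{Z}/n\mathbb{Z})^{(I)}$ is the direct sum of copies of $\mathbb{Z}/n\mathbb{Z}$ indexed by $I$, on which $\Gamma$ acts by permuting the coordinates. $H^2(G,C)$ is the group of normalized $2$-cocycles $G\times G\to C$ (trivial action) modulo coboundaries; the central extension of $G$ by $C$ corresponding to $\Omega$ is $C\times G$ with product $(a,g)(b,h)=(a+b+\Omega(g,h),gh)$. $\widehat C$ is the Pontryagin dual of $C$ and $\mathbb T$ is the unit circle.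
   Formalization: The "more precisely" claim is stated only when I has at least two points; for a one-point I it can fail, e.g. n = 2 and C the direct sum of infinitely many copies of each Z/2^k, where every extension is isomorphic to C. The first claim is stated for all non-empty I, and n is at least 1. *)

theory Defs
  imports "HOL-Algebra.Product_Groups" "HOL-Algebra.Group_Action" "HOL-Analysis.Infinite_Sum"
begin

subsection \<open>Bounded operators on $\ell^2(S)$\<close>

text \<open>Vectors are functions on the whole type vanishing off \<open>S\<close>; operators are functions on
  vectors that are undefined off \<open>ell2 S\<close>, so that equal operators are equal HOL functions.\<close>

definition ell2 :: "'a set \<Rightarrow> ('a \<Rightarrow> complex) set" where
  "ell2 S = {f. (\<forall>x. x \<notin> S \<longrightarrow> f x = 0) \<and> (\<lambda>x. (cmod (f x))\<^sup>2) summable_on S}"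

definition ell2_inner :: "'a set \<Rightarrow> ('a \<Rightarrow> complex) \<Rightarrow> ('a \<Rightarrow> complex) \<Rightarrow> complex" where
  "ell2_inner S f g = (\<Sum>\<^sub>\<infinity>x\<in>S. f x * cnj (g x))"

definition ell2_norm :: "'a set \<Rightarrow> ('a \<Rightarrow> complex) \<Rightarrow> real" where
  "ell2_norm S f = sqrt (\<Sum>\<^sub>\<infinity>x\<in>S. (cmod (f x))\<^sup>2)"

type_synonym 'a operator = "('a \<Rightarrow> complex) \<Rightarrow> ('a \<Rightarrow> complex)"

definition bounded_operators :: "'a set \<Rightarrow> 'a operator set" where
  "bounded_operators S = {T \<in> ell2 S \<rightarrow>\<^sub>E ell2 S.
     (\<forall>f\<in>ell2 S. \<forall>g\<in>ell2 S. T (\<lambda>x. f x + g x) = (\<lambda>x. T f x + T g x)) \<and>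
     (\<forall>c. \<forall>f\<in>ell2 S. T (\<lambda>x. c * f x) = (\<lambda>x. c * T f x)) \<and>
     (\<exists>K. \<forall>f\<in>ell2 S. ell2_norm S (T f) \<le> K * ell2_norm S f)}"

definition op_add :: "'a set \<Rightarrow> 'a operator \<Rightarrow> 'a operator \<Rightarrow> 'a operator" where
  "op_add S T U = (\<lambda>f\<in>ell2 S. \<lambda>x. T f x + U f x)"

definition op_scale :: "'a set \<Rightarrow> complex \<Rightarrow> 'a operator \<Rightarrow> 'a operator" where
  "op_scale S c T = (\<lambda>f\<in>ell2 S. \<lambda>x. c * T f x)"

definition op_mult :: "'a set \<Rightarrow> 'a operator \<Rightarrow> 'a operator \<Rightarrow> 'a operator" where
  "op_mult S T U = compose (ell2 S) T U"

definition op_adjoint :: "'a set \<Rightarrow> 'a operator \<Rightarrow> 'a operator" where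
  "op_adjoint S T = (THE U. U \<in> bounded_operators S \<and>
     (\<forall>f\<in>ell2 S. \<forall>g\<in>ell2 S. ell2_inner S (T f) g = ell2_inner S f (U g)))"

definition commutant :: "'a set \<Rightarrow> 'a operator set \<Rightarrow> 'a operator set" where
  "commutant S M = {T \<in> bounded_operators S. \<forall>U\<in>M. op_mult S T U = op_mult S U T}"

text \<open>\<open>M\<close> and \<open>N\<close> are algebras of operators on $\ell^2(S)$ and $\ell^2(S')$.\<close>

definition star_isomorphic ::
    "'a set \<Rightarrow> 'a operator set \<Rightarrow> 'b set \<Rightarrow> 'b operator set \<Rightarrow> bool" where
  "star_isomorphic S M S' N \<longleftrightarrow> (\<exists>\<Phi>. bij_betw \<Phi> M N \<and>
     (\<forall>T\<in>M. \<forall>U\<in>M. \<Phi> (op_add S T U) = op_add S' (\<Phi> T) (\<Phi> U)) \<and>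
     (\<forall>c. \<forall>T\<in>M. \<Phi> (op_scale S c T) = op_scale S' c (\<Phi> T)) \<and>
     (\<forall>T\<in>M. \<forall>U\<in>M. \<Phi> (op_mult S T U) = op_mult S' (\<Phi> T) (\<Phi> U)) \<and>
     (\<forall>T\<in>M. \<Phi> (op_adjoint S T) = op_adjoint S' (\<Phi> T)))"


subsection \<open>Group von Neumann algebras\<close>

definition left_regular :: "('a, 'm) monoid_scheme \<Rightarrow> 'a \<Rightarrow> 'a operator" where
  "left_regular G g = (\<lambda>f\<in>ell2 (carrier G). \<lambda>x.
     if x \<in> carrier G then f (inv\<^bsub>G\<^esub> g \<otimes>\<^bsub>G\<^esub> x) else 0)"

text \<open>The von Neumann algebra generated by the left regular representation, as a bicommutant.\<close>

definition group_vN :: "('a, 'm) monoid_scheme \<Rightarrow> 'a operator set" where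
  "group_vN G = commutant (carrier G) (commutant (carrier G) (left_regular G ` carrier G))"

definition vN_equivalent :: "('a, 'm) monoid_scheme \<Rightarrow> ('b, 'k) monoid_scheme \<Rightarrow> bool" where
  "vN_equivalent G H \<longleftrightarrow> star_isomorphic (carrier G) (group_vN G) (carrier H) (group_vN H)"

text \<open>All groups are countable, so every competitor \<open>\<Lambda>\<close> has a copy whose carrier is a set of
  natural numbers; quantifying over those loses nothing.\<close>

definition W_star_superrigid :: "('a, 'm) monoid_scheme \<Rightarrow> bool" where
  "W_star_superrigid K \<longleftrightarrow>
     (\<forall>\<Lambda> :: nat monoid. group \<Lambda> \<longrightarrow> (vN_equivalent K \<Lambda> \<longleftrightarrow> K \<cong> \<Lambda>))"


subsection \<open>Generalized wreath products\<close>

text \<open>$(\mathbb{Z}/n\mathbb{Z})^{(I)} \rtimes \Gamma$, where $(g \cdot y)_i = y_{g^{-1} i}$.\<close>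

definition generalized_wreath ::
    "nat \<Rightarrow> 'i set \<Rightarrow> ('g, 'm) monoid_scheme \<Rightarrow> ('g \<Rightarrow> 'i \<Rightarrow> 'i) \<Rightarrow> (('i \<Rightarrow> int) \<times> 'g) monoid" where
  "generalized_wreath n I \<Gamma> \<phi> =
     (let N = sum_group I (\<lambda>_. integer_mod_group n) in
      \<lparr>carrier = carrier N \<times> carrier \<Gamma>,
       monoid.mult = (\<lambda>(x, g) (y, h). (x \<otimes>\<^bsub>N\<^esub> (\<lambda>i\<in>I. y (\<phi> (inv\<^bsub>\<Gamma>\<^esub> g) i)), g \<otimes>\<^bsub>\<Gamma>\<^esub> h)),
       one = (\<one>\<^bsub>N\<^esub>, \<one>\<^bsub>\<Gamma>\<^esub>)\<rparr>)"


subsection \<open>Second cohomology with trivial action, and central extensions\<close>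

text \<open>Here the coefficient group \<open>C\<close> is written multiplicatively.\<close>

definition Z2 :: "('g, 'm) monoid_scheme \<Rightarrow> ('c, 'k) monoid_scheme \<Rightarrow> ('g \<times> 'g \<Rightarrow> 'c) monoid" where
  "Z2 G C = (product_group (carrier G \<times> carrier G) (\<lambda>_. C)) \<lparr>carrier :=
     {\<xi> \<in> carrier G \<times> carrier G \<rightarrow>\<^sub>E carrier C.
        (\<forall>g\<in>carrier G. \<xi> (\<one>\<^bsub>G\<^esub>, g) = \<one>\<^bsub>C\<^esub> \<and> \<xi> (g, \<one>\<^bsub>G\<^esub>) = \<one>\<^bsub>C\<^esub>) \<and>
        (\<forall>g\<in>carrier G. \<forall>h\<in>carrier G. \<forall>k\<in>carrier G.
           \<xi> (g, h) \<otimes>\<^bsub>C\<^esub> \<xi> (g \<otimes>\<^bsub>G\<^esub> h, k) = \<xi> (h, k) \<otimes>\<^bsub>C\<^esub> \<xi> (g, h \<otimes>\<^bsub>G\<^esub> k))}\<rparr>"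

text \<open>The condition \<open>f \<one> = \<one>\<close> singles out the coboundaries that are normalized.\<close>

definition B2 :: "('g, 'm) monoid_scheme \<Rightarrow> ('c, 'k) monoid_scheme \<Rightarrow> ('g \<times> 'g \<Rightarrow> 'c) set" where
  "B2 G C = {(\<lambda>(g, h)\<in>carrier G \<times> carrier G. f g \<otimes>\<^bsub>C\<^esub> f h \<otimes>\<^bsub>C\<^esub> inv\<^bsub>C\<^esub> f (g \<otimes>\<^bsub>G\<^esub> h)) | f.
     f \<in> carrier G \<rightarrow> carrier C \<and> f \<one>\<^bsub>G\<^esub> = \<one>\<^bsub>C\<^esub>}"

definition H2 :: "('g, 'm) monoid_scheme \<Rightarrow> ('c, 'k) monoid_scheme \<Rightarrow> ('g \<times> 'g \<Rightarrow> 'c) set monoid" where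
  "H2 G C = Z2 G C Mod B2 G C"

text \<open>The map $H^2(G,C) \to H^2(G,D)$, $\Omega \mapsto \omega \circ \Omega$, induced by a
  homomorphism \<open>\<omega>\<close> from \<open>C\<close> to \<open>D\<close>. All terms of the union are the same coset.\<close>

definition H2_map :: "('g, 'm) monoid_scheme \<Rightarrow> ('d, 'k) monoid_scheme \<Rightarrow> ('c \<Rightarrow> 'd)
    \<Rightarrow> ('g \<times> 'g \<Rightarrow> 'c) set \<Rightarrow> ('g \<times> 'g \<Rightarrow> 'd) set" where
  "H2_map G D \<omega> \<Omega> =
     (\<Union>\<xi>\<in>\<Omega>. B2 G D #>\<^bsub>Z2 G D\<^esub> compose (carrier G \<times> carrier G) \<omega> \<xi>)"

definition circle_group :: "complex monoid" where
  "circle_group = \<lparr>carrier = {z. cmod z = 1}, monoid.mult = (*), one = 1\<rparr>"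

text \<open>The relation $\Omega \approx \Omega'$; since \<open>C\<close> is discrete, its Pontryagin dual consists of
  all homomorphisms to the circle.\<close>

definition dual_equivalent :: "('g, 'm) monoid_scheme \<Rightarrow> ('c, 'k) monoid_scheme
    \<Rightarrow> ('g \<times> 'g \<Rightarrow> 'c) set \<Rightarrow> ('g \<times> 'g \<Rightarrow> 'c) set \<Rightarrow> bool" where
  "dual_equivalent G C \<Omega> \<Omega>' \<longleftrightarrow>
     (\<forall>\<omega>\<in>hom C circle_group. H2_map G circle_group \<omega> \<Omega> = H2_map G circle_group \<omega> \<Omega>')"

definition cocycle_extension :: "('g, 'm) monoid_scheme \<Rightarrow> ('c, 'k) monoid_scheme
    \<Rightarrow> ('g \<times> 'g \<Rightarrow> 'c) \<Rightarrow> ('c \<times> 'g) monoid" where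
  "cocycle_extension G C \<xi> =
     \<lparr>carrier = carrier C \<times> carrier G,
      monoid.mult = (\<lambda>(a, g) (b, h). (a \<otimes>\<^bsub>C\<^esub> b \<otimes>\<^bsub>C\<^esub> \<xi> (g, h), g \<otimes>\<^bsub>G\<^esub> h)),
      one = (\<one>\<^bsub>C\<^esub>, \<one>\<^bsub>G\<^esub>)\<rparr>"

definition is_central_extension ::
    "('g, 'm) monoid_scheme \<Rightarrow> ('c, 'k) monoid_scheme \<Rightarrow> ('e, 'l) monoid_scheme \<Rightarrow> bool" where
  "is_central_extension G C E \<longleftrightarrow> group E \<and> (\<exists>\<iota> \<pi>. \<iota> \<in> mon C E \<and> \<pi> \<in> epi E G \<and>
     \<iota> ` carrier C = kernel E G \<pi> \<and>
     (\<forall>c\<in>carrier C. \<forall>e\<in>carrier E. \<iota> c \<otimes>\<^bsub>E\<^esub> e = e \<otimes>\<^bsub>E\<^esub> \<iota> c))"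

end

theory Submission
  imports Defs "HOL-Analysis.Topology_Euclidean_Space" "HOL-Analysis.Summation_Tests"
    "HOL-Real_Asymp.Real_Asymp" "HOL-Algebra.Multiplicative_Group"
    "HOL-Computational_Algebra.Primes"
begin

text \<open>Pull the carry cocycle of \<open>n\<int> \<rightarrow> \<int> \<rightarrow> \<int>/n\<int>\<close> back along the coordinate sum \<open>s : G \<rightarrow> \<int>/n\<int>\<close> and push it
  into \<open>C\<close> along \<open>1 \<mapsto> c\<close>. Since \<open>\<omega> c\<close> has an \<open>n\<close>-th root in the circle for every character \<open>\<omega>\<close>, adding
  it to \<open>\<Omega>\<close> is invisible to characters. Likewise the translation by \<open>c\<close> has an \<open>n\<close>-th root \<open>v\<close> among
  the unitaries of \<open>L(\<langle>c\<rangle>)\<close>; its convolution kernel is a Cauchy kernel \<open>1 / (1/n - j)\<close>, or the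
  corresponding discrete Fourier sum if \<open>c\<close> has finite order. The unitaries \<open>v\<^bsup>s x\<^esup> \<lambda>\<^sub>x\<close> multiply as in the
  twisted extension and have the trace of its regular representation, so both extensions have the
  same von Neumann algebra.

  The twist multiplies the \<open>n\<close>-th power of every lift of a generator \<open>unit i\<close> of the base by \<open>c\<close>.
  For \<open>|I| \<ge> 2\<close> the center of \<open>G\<close> is trivial and every automorphism of \<open>G\<close> maps some power of one
  generator to another, so whether some generator has a lift of order dividing \<open>n\<close> is an isomorphism
  invariant of the extension; as \<open>n C \<noteq> C\<close>, a suitable \<open>c\<close> changes it. For \<open>|I| = 1\<close> the extension is
  abelian and the twists can all be isomorphic when it contains elements of order \<open>p\<^sup>2\<close>. In that case
  Zorn's lemma, extending a group of trace-orthogonal unitaries by a suitable root at a time, gives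
  a group with the same von Neumann algebra but no element of order \<open>p\<^sup>2\<close> for any prime \<open>p\<close>.\<close>

section \<open>Operators between $\ell^2$ spaces\<close>

text \<open>Heuristically, the algebra of an extension decomposes over the dual of \<open>C\<close>
  into twisted group algebras of \<open>G\<close>, one for each \<omega> \<circ> \<Omega>, so it
  sees only these classes. A proof along these lines would need direct integrals and a measurable
  choice of trivialisations. The unitary \<open>v\<close> makes this choice in one stroke: it is a
  branch of the n-th root applied to the translation by \<open>c\<close>. No spectral theorem is
  involved, since \<open>v\<close> is given by its matrix. The function exp(2 pi i t / n) on 0 <= t
  < 1 has j-th Fourier coefficient proportional to 1 / (1/n - j), which is the origin of the Cauchy
  kernel; unitarity and the value of the n-th power become convolution identities. On the side of
  the groups, different cohomology classes are not enough, because automorphisms of \<open>C\<close>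
  and of \<open>G\<close> act on the classes and may identify the extensions. The generators
  \<open>unit i\<close> therefore have to be recognised inside the abstract group, up to powers, by
  a property that isomorphisms preserve.\<close>

definition delta :: "'a \<Rightarrow> 'a \<Rightarrow> complex" where
  "delta x = (\<lambda>y. if y = x then 1 else 0)"

lemma ell2_D: "f \<in> ell2 S \<Longrightarrow> x \<notin> S \<Longrightarrow> f x = 0"
  by (simp add: ell2_def)

lemma ell2_abs_summable_square:
  assumes "f \<in> ell2 S"
  shows "(\<lambda>x. f x * f x) abs_summable_on S"
  using assms by (simp add: ell2_def norm_mult power2_eq_square)

lemma ell2_abs_summable_cnj_square:
  assumes "f \<in> ell2 S"
  shows "(\<lambda>x. cnj (f x) * cnj (f x)) abs_summable_on S"
  using assms by (simp add: ell2_def norm_mult power2_eq_square)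

lemma inner_abs_summable:
  assumes "f \<in> ell2 S" "g \<in> ell2 S"
  shows "(\<lambda>x. f x * cnj (g x)) abs_summable_on S"
  by (rule abs_summable_product[OF ell2_abs_summable_square[OF assms(1)]
        ell2_abs_summable_cnj_square[OF assms(2)]])

lemma inner_summable:
  assumes "f \<in> ell2 S" "g \<in> ell2 S"
  shows "(\<lambda>x. f x * cnj (g x)) summable_on S"
  by (rule abs_summable_summable[OF inner_abs_summable[OF assms]])

lemma ell2_boundedI:
  assumes "\<And>x. x \<notin> S \<Longrightarrow> f x = 0"
    and "\<And>F. finite F \<Longrightarrow> F \<subseteq> S \<Longrightarrow> (\<Sum>x\<in>F. (cmod (f x))\<^sup>2) \<le> K\<^sup>2"
    and "0 \<le> K"
  shows "f \<in> ell2 S" "ell2_norm S f \<le> K"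
proof -
  have s: "(\<lambda>x. (cmod (f x))\<^sup>2) summable_on S"
    by (rule nonneg_bdd_above_summable_on) (auto intro!: bdd_aboveI2 assms(2))
  then show "f \<in> ell2 S" using assms(1) by (simp add: ell2_def)
  have "(\<Sum>\<^sub>\<infinity>x\<in>S. (cmod (f x))\<^sup>2) \<le> K\<^sup>2"
    by (rule infsum_le_finite_sums[OF s]) (auto intro: assms(2))
  then show "ell2_norm S f \<le> K"
    unfolding ell2_norm_def using assms(3) by (simp add: real_le_lsqrt)
qed

lemma ell2_norm_nonneg [simp]: "0 \<le> ell2_norm S f"
  by (simp add: ell2_norm_def infsum_nonneg)

lemma ell2_norm_square: "(ell2_norm S f)\<^sup>2 = (\<Sum>\<^sub>\<infinity>x\<in>S. (cmod (f x))\<^sup>2)"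
  by (simp add: ell2_norm_def infsum_nonneg)

lemma ell2_finite_sum_le:
  assumes "f \<in> ell2 S" "finite F" "F \<subseteq> S"
  shows "(\<Sum>x\<in>F. (cmod (f x))\<^sup>2) \<le> (ell2_norm S f)\<^sup>2"
  unfolding ell2_norm_square
  by (rule finite_sum_le_infsum) (use assms in \<open>auto simp: ell2_def\<close>)

lemma ell2_zero [simp]: "(\<lambda>x. 0) \<in> ell2 S"
  by (simp add: ell2_def)

lemma ell2_scale [simp]: "f \<in> ell2 S \<Longrightarrow> (\<lambda>x. c * f x) \<in> ell2 S"
  by (auto simp: ell2_def norm_mult power_mult_distrib intro: summable_on_cmult_right)

lemma ell2_add [simp]:
  assumes "f \<in> ell2 S" "g \<in> ell2 S"
  shows "(\<lambda>x. f x + g x) \<in> ell2 S"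
proof -
  let ?K = "sqrt (2 * (ell2_norm S f)\<^sup>2 + 2 * (ell2_norm S g)\<^sup>2)"
  show ?thesis
  proof (rule ell2_boundedI(1)[where K = ?K])
    fix F assume F: "finite F" "F \<subseteq> S"
    have "(cmod (a + b))\<^sup>2 \<le> 2 * (cmod a)\<^sup>2 + 2 * (cmod b)\<^sup>2" for a b
    proof -
      have "(cmod (a + b))\<^sup>2 \<le> (cmod a + cmod b)\<^sup>2"
        by (simp add: norm_triangle_ineq power_mono)
      also have "\<dots> \<le> 2 * (cmod a)\<^sup>2 + 2 * (cmod b)\<^sup>2"
        using sum_squares_bound[of "cmod a" "cmod b"] by (simp add: power2_sum)
      finally show ?thesis .
    qed
    then have "(\<Sum>x\<in>F. (cmod (f x + g x))\<^sup>2) \<le> (\<Sum>x\<in>F. 2 * (cmod (f x))\<^sup>2 + 2 * (cmod (g x))\<^sup>2)"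
      by (intro sum_mono)
    also have "\<dots> = 2 * (\<Sum>x\<in>F. (cmod (f x))\<^sup>2) + 2 * (\<Sum>x\<in>F. (cmod (g x))\<^sup>2)"
      by (simp add: sum.distrib sum_distrib_left)
    also have "\<dots> \<le> ?K\<^sup>2"
      using ell2_finite_sum_le[OF assms(1) F] ell2_finite_sum_le[OF assms(2) F] by simp
    finally show "(\<Sum>x\<in>F. (cmod (f x + g x))\<^sup>2) \<le> ?K\<^sup>2" .
  qed (use assms in \<open>auto simp: ell2_def\<close>)
qed

lemma ell2_diff [simp]:
  assumes "f \<in> ell2 S" "g \<in> ell2 S"
  shows "(\<lambda>x. f x - g x) \<in> ell2 S"
  using ell2_add[OF assms(1) ell2_scale[OF assms(2), of "-1"]] by simp

lemma ell2_sum [simp]: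
  "(\<And>i. i \<in> F \<Longrightarrow> f i \<in> ell2 S) \<Longrightarrow> (\<lambda>x. \<Sum>i\<in>F. f i x) \<in> ell2 S"
  by (induction F rule: infinite_finite_induct) auto

lemma delta_ell2 [simp]:
  assumes "x \<in> S"
  shows "delta x \<in> ell2 S"
proof (rule ell2_boundedI(1)[where K = 1])
  fix F :: "'a set" assume "finite F"
  have "(cmod (delta x y))\<^sup>2 = (if y = x then 1 else 0)" for y
    by (simp add: delta_def)
  then show "(\<Sum>y\<in>F. (cmod (delta x y))\<^sup>2) \<le> 1\<^sup>2"
    using \<open>finite F\<close> by simp
qed (use assms in \<open>auto simp: delta_def\<close>)

lemma inner_add_left:
  assumes "f \<in> ell2 S" "f' \<in> ell2 S" "g \<in> ell2 S"
  shows "ell2_inner S (\<lambda>x. f x + f' x) g = ell2_inner S f g + ell2_inner S f' g"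
  using assms by (simp add: ell2_inner_def distrib_right infsum_add inner_summable)

lemma inner_scale_left: "ell2_inner S (\<lambda>x. c * f x) g = c * ell2_inner S f g"
  by (simp add: ell2_inner_def mult.assoc infsum_cmult_right')

lemma inner_cnj: "cnj (ell2_inner S f g) = ell2_inner S g f"
  by (simp add: ell2_inner_def flip: infsum_cnj) (simp add: mult.commute)

lemma inner_add_right:
  assumes "f \<in> ell2 S" "f' \<in> ell2 S" "g \<in> ell2 S"
  shows "ell2_inner S g (\<lambda>x. f x + f' x) = ell2_inner S g f + ell2_inner S g f'"
  using arg_cong[OF inner_add_left[OF assms], where f = cnj] by (simp add: inner_cnj)

lemma inner_scale_right: "ell2_inner S g (\<lambda>x. c * f x) = cnj c * ell2_inner S g f"
  using arg_cong[OF inner_scale_left[of S c f g], where f = cnj] by (simp add: inner_cnj)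

lemma inner_zero_left [simp]: "ell2_inner S (\<lambda>x. 0) g = 0"
  by (simp add: ell2_inner_def)

lemma inner_sum_left:
  assumes "\<And>i. i \<in> F \<Longrightarrow> f i \<in> ell2 S" "g \<in> ell2 S"
  shows "ell2_inner S (\<lambda>x. \<Sum>i\<in>F. f i x) g = (\<Sum>i\<in>F. ell2_inner S (f i) g)"
  using assms(1)
proof (induction F rule: infinite_finite_induct)
  case (insert i F)
  then show ?case by (simp add: inner_add_left assms(2))
qed auto

lemma inner_sum_right:
  assumes "\<And>i. i \<in> F \<Longrightarrow> f i \<in> ell2 S" "g \<in> ell2 S"
  shows "ell2_inner S g (\<lambda>x. \<Sum>i\<in>F. f i x) = (\<Sum>i\<in>F. ell2_inner S g (f i))"
  using arg_cong[OF inner_sum_left[OF assms], where f = cnj] by (simp add: inner_cnj)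

lemma inner_self:
  assumes "f \<in> ell2 S"
  shows "ell2_inner S f f = of_real ((ell2_norm S f)\<^sup>2)"
proof -
  have "((\<lambda>x. of_real ((cmod (f x))\<^sup>2) :: complex) has_sum of_real ((ell2_norm S f)\<^sup>2)) S"
    unfolding has_sum_of_real_iff ell2_norm_square
    by (rule has_sum_infsum) (use assms in \<open>simp add: ell2_def\<close>)
  moreover have "of_real ((cmod (f x))\<^sup>2) = f x * cnj (f x)" for x
    by (rule complex_norm_square)
  ultimately show ?thesis
    unfolding ell2_inner_def by (simp only: infsumI)
qed

lemma inner_delta_right:
  assumes "x \<in> S"
  shows "ell2_inner S f (delta x) = f x"
proof -
  have "ell2_inner S f (delta x) = (\<Sum>\<^sub>\<infinity>y\<in>{x}. f y * cnj (delta x y))"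
    unfolding ell2_inner_def by (rule infsum_cong_neutral) (use assms in \<open>auto simp: delta_def\<close>)
  then show ?thesis by (simp add: delta_def)
qed

lemma inner_delta_left: "x \<in> S \<Longrightarrow> ell2_inner S (delta x) f = cnj (f x)"
  using inner_delta_right[of x S f] inner_cnj by metis

lemma cauchy_schwarz:
  assumes "f \<in> ell2 S" "g \<in> ell2 S"
  shows "cmod (ell2_inner S f g) \<le> ell2_norm S f * ell2_norm S g"
proof -
  have "cmod (ell2_inner S f g) \<le> (\<Sum>\<^sub>\<infinity>x\<in>S. norm (f x * cnj (g x)))"
    unfolding ell2_inner_def by (rule norm_infsum_bound[OF inner_abs_summable[OF assms]])
  also have "\<dots> \<le> ell2_norm S f * ell2_norm S g"
  proof (rule infsum_le_finite_sums[OF inner_abs_summable[OF assms]])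
    fix F assume F: "finite F" "F \<subseteq> S"
    have "(\<Sum>x\<in>F. norm (f x * cnj (g x))) = (\<Sum>x\<in>F. \<bar>cmod (f x)\<bar> * \<bar>cmod (g x)\<bar>)"
      by (simp add: norm_mult)
    also have "\<dots> \<le> L2_set (\<lambda>x. cmod (f x)) F * L2_set (\<lambda>x. cmod (g x)) F"
      by (rule L2_set_mult_ineq)
    also have "\<dots> \<le> ell2_norm S f * ell2_norm S g"
      using ell2_finite_sum_le[OF assms(1) F] ell2_finite_sum_le[OF assms(2) F]
      by (intro mult_mono) (auto simp: L2_set_def real_le_lsqrt sum_nonneg)
    finally show "(\<Sum>x\<in>F. norm (f x * cnj (g x))) \<le> ell2_norm S f * ell2_norm S g" .
  qed
  finally show ?thesis .
qed

lemma ell2_ext: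
  assumes "f \<in> ell2 S" "g \<in> ell2 S" "\<And>x. x \<in> S \<Longrightarrow> f x = g x"
  shows "f = g"
  using assms by (metis ell2_D ext)

lemma ell2_norm_eq_0:
  assumes "f \<in> ell2 S" "ell2_norm S f = 0"
  shows "f = (\<lambda>x. 0)"
proof (rule ell2_ext[OF assms(1) ell2_zero])
  fix x assume "x \<in> S"
  then have "(\<Sum>x\<in>{x}. (cmod (f x))\<^sup>2) \<le> (ell2_norm S f)\<^sup>2"
    by (intro ell2_finite_sum_le assms(1)) auto
  then show "f x = 0" using assms(2) by simp
qed

section \<open>Finitely supported approximation and the Riesz representation\<close>

definition cut :: "'a set \<Rightarrow> ('a \<Rightarrow> complex) \<Rightarrow> 'a \<Rightarrow> complex" where
  "cut F f = (\<lambda>x. if x \<in> F then f x else 0)"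

lemma cut_ell2:
  assumes "f \<in> ell2 S"
  shows "cut F f \<in> ell2 S"
proof (rule ell2_boundedI(1)[where K = "ell2_norm S f"])
  fix A assume A: "finite A" "A \<subseteq> S"
  have "(\<Sum>x\<in>A. (cmod (cut F f x))\<^sup>2) \<le> (\<Sum>x\<in>A. (cmod (f x))\<^sup>2)"
    by (rule sum_mono) (simp add: cut_def)
  also have "\<dots> \<le> (ell2_norm S f)\<^sup>2" by (rule ell2_finite_sum_le[OF assms A])
  finally show "(\<Sum>x\<in>A. (cmod (cut F f x))\<^sup>2) \<le> (ell2_norm S f)\<^sup>2" .
qed (use assms in \<open>auto simp: cut_def ell2_D\<close>)

lemma cut_as_sum:
  assumes "finite F"
  shows "cut F f = (\<lambda>y. \<Sum>x\<in>F. f x * delta x y)"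
  using assms by (auto simp: cut_def delta_def if_distrib fun_eq_iff cong: if_cong)

lemma cut_approximates:
  assumes "f \<in> ell2 S" "e > 0"
  obtains F where "finite F" "F \<subseteq> S" "ell2_norm S (\<lambda>x. f x - cut F f x) < e"
proof -
  have s: "(\<lambda>x. (cmod (f x))\<^sup>2) summable_on S" using assms(1) by (simp add: ell2_def)
  obtain F where F: "finite F" "F \<subseteq> S"
      "dist (\<Sum>x\<in>F. (cmod (f x))\<^sup>2) (\<Sum>\<^sub>\<infinity>x\<in>S. (cmod (f x))\<^sup>2) \<le> (e/2)\<^sup>2"
    using infsum_finite_approximation[OF s, of "(e/2)\<^sup>2"] assms(2) by auto
  have "(ell2_norm S (\<lambda>x. f x - cut F f x))\<^sup>2 = (\<Sum>\<^sub>\<infinity>x\<in>S-F. (cmod (f x))\<^sup>2)"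
    unfolding ell2_norm_square by (rule infsum_cong_neutral) (auto simp: cut_def)
  also have "\<dots> = (\<Sum>\<^sub>\<infinity>x\<in>S. (cmod (f x))\<^sup>2) - (\<Sum>x\<in>F. (cmod (f x))\<^sup>2)"
    using infsum_Diff[OF s summable_on_finite[OF F(1)] F(2)] F(1) by simp
  also have "\<dots> \<le> (e/2)\<^sup>2" using F(3) by (simp add: dist_real_def)
  finally have "ell2_norm S (\<lambda>x. f x - cut F f x) \<le> e/2"
    by (rule power2_le_imp_le) (use assms(2) in simp)
  then show ?thesis using that[OF F(1,2)] assms(2) by simp
qed

lemma functional_on_cut:
  assumes add: "\<And>f g. f \<in> ell2 S \<Longrightarrow> g \<in> ell2 S \<Longrightarrow> L (\<lambda>x. f x + g x) = L f + L g"
    and scale: "\<And>c f. f \<in> ell2 S \<Longrightarrow> L (\<lambda>x. c * f x) = c * L f"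
    and F: "finite F" "F \<subseteq> S"
  shows "L (cut F f) = (\<Sum>x\<in>F. f x * (L (delta x) :: complex))"
  unfolding cut_as_sum[OF F(1)] using F
proof (induction F)
  case empty
  then show ?case using scale[of "\<lambda>x. 0" 0] by simp
next
  case (insert x F)
  have "L (\<lambda>y. \<Sum>x\<in>insert x F. f x * delta x y)
      = L (\<lambda>y. f x * delta x y + (\<Sum>x\<in>F. f x * delta x y))"
    using insert by simp
  also have "\<dots> = L (\<lambda>y. f x * delta x y) + L (\<lambda>y. \<Sum>x\<in>F. f x * delta x y)"
    by (rule add) (use insert in \<open>auto intro!: ell2_scale ell2_sum\<close>)
  finally show ?case using insert by (simp add: scale)
qed

text \<open>Finitely supported vectors are dense: \<open>L\<close> vanishes on
  \<open>cut F f\<close> by linearity, and on the remainder it is at most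
  \<open>\<bar>K\<bar> * e\<close>, with \<open>e\<close> chosen so small that this stays below
  \<open>cmod (L f)\<close>.\<close>

lemma functional_eq_0:
  assumes add: "\<And>f g. f \<in> ell2 S \<Longrightarrow> g \<in> ell2 S \<Longrightarrow> L (\<lambda>x. f x + g x) = L f + L g"
    and scale: "\<And>c f. f \<in> ell2 S \<Longrightarrow> L (\<lambda>x. c * f x) = c * L f"
    and bounded: "\<And>f. f \<in> ell2 S \<Longrightarrow> cmod (L f) \<le> K * ell2_norm S f"
    and delta: "\<And>x. x \<in> S \<Longrightarrow> L (delta x) = 0"
    and f: "f \<in> ell2 S"
  shows "L f = (0 :: complex)"
proof (rule ccontr)
  assume nz: "L f \<noteq> 0"
  define e where "e = cmod (L f) / (\<bar>K\<bar> + 1)"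
  have "e > 0" using nz by (simp add: e_def)
  then obtain F where F: "finite F" "F \<subseteq> S" "ell2_norm S (\<lambda>x. f x - cut F f x) < e"
    using cut_approximates[OF f] by blast
  have d: "(\<lambda>x. f x - cut F f x) \<in> ell2 S" by (simp add: f cut_ell2)
  have "L f = L (\<lambda>x. (f x - cut F f x) + cut F f x)" by simp
  also have "\<dots> = L (\<lambda>x. f x - cut F f x) + L (cut F f)"
    by (rule add[OF d cut_ell2[OF f]])
  also have "L (cut F f) = (\<Sum>x\<in>F. f x * L (delta x))"
    by (rule functional_on_cut) (use add scale F in auto)
  also have "\<dots> = 0" using F delta by (intro sum.neutral) auto
  finally have "cmod (L f) = cmod (L (\<lambda>x. f x - cut F f x))" by simp
  also have "\<dots> \<le> \<bar>K\<bar> * ell2_norm S (\<lambda>x. f x - cut F f x)"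
    by (rule order_trans[OF bounded[OF d]]) (simp add: mult_right_mono)
  also have "\<dots> \<le> \<bar>K\<bar> * e" using F(3) by (intro mult_left_mono) auto
  also have "\<dots> < cmod (L f)"
    using nz by (simp add: e_def field_simps)
  finally show False by simp
qed

text \<open>The vector \<open>G\<close> is dictated by the values of \<open>L\<close> on the basis;
  the point is that it is square summable. Testing \<open>L\<close> on the truncation
  \<open>cut F G\<close> gives the partial sum of squares \<open>s\<close>, and boundedness turns
  this into s <= K sqrt s, hence s <= K^2. The representation formula then only has to be checked on
  the vectors \<open>delta x\<close>.\<close>

lemma riesz:
  assumes add: "\<And>f g. f \<in> ell2 S \<Longrightarrow> g \<in> ell2 S \<Longrightarrow> L (\<lambda>x. f x + g x) = L f + L g"
    and scale: "\<And>c f. f \<in> ell2 S \<Longrightarrow> L (\<lambda>x. c * f x) = c * L f"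
    and bounded: "\<And>f. f \<in> ell2 S \<Longrightarrow> cmod (L f) \<le> K * ell2_norm S f"
    and K: "0 \<le> K"
  defines "G \<equiv> \<lambda>x. if x \<in> S then cnj (L (delta x)) else (0 :: complex)"
  shows "G \<in> ell2 S" "ell2_norm S G \<le> K" "\<And>f. f \<in> ell2 S \<Longrightarrow> L f = ell2_inner S f G"
proof -
  have fin: "(\<Sum>x\<in>F. (cmod (G x))\<^sup>2) \<le> K\<^sup>2" if F: "finite F" "F \<subseteq> S" for F
  proof -
    define s where "s = (\<Sum>x\<in>F. (cmod (G x))\<^sup>2)"
    have s0: "0 \<le> s" unfolding s_def by (simp add: sum_nonneg)
    have le: "(\<Sum>x\<in>F'. (cmod (cut F G x))\<^sup>2) \<le> (sqrt s)\<^sup>2" if "finite F'" for F'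
    proof -
      have "(\<Sum>x\<in>F'. (cmod (cut F G x))\<^sup>2) = (\<Sum>x\<in>F' \<inter> F. (cmod (G x))\<^sup>2)"
        using that by (auto simp: cut_def sum.inter_restrict intro!: sum.cong)
      also have "\<dots> \<le> s" unfolding s_def by (rule sum_mono2) (use F in auto)
      finally show ?thesis using s0 by simp
    qed
    have c: "cut F G \<in> ell2 S" "ell2_norm S (cut F G) \<le> sqrt s"
      by (rule ell2_boundedI[where K = "sqrt s"]; use le s0 F in \<open>force simp: cut_def G_def\<close>)+
    have "L (cut F G) = (\<Sum>x\<in>F. G x * L (delta x))"
      by (rule functional_on_cut) (use add scale F in auto)
    also have "\<dots> = (\<Sum>x\<in>F. of_real ((cmod (G x))\<^sup>2))"
    proof (rule sum.cong)
      fix x assume "x \<in> F"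
      then have "L (delta x) = cnj (G x)" using F by (auto simp: G_def)
      then show "G x * L (delta x) = of_real ((cmod (G x))\<^sup>2)"
        by (metis complex_norm_square)
    qed simp
    finally have "L (cut F G) = of_real s" by (simp add: s_def)
    then have "s \<le> K * ell2_norm S (cut F G)" using bounded[OF c(1)] s0 by simp
    also have "\<dots> \<le> K * sqrt s" by (intro mult_left_mono c(2) K)
    finally have "sqrt s * sqrt s \<le> K * sqrt s" using s0 by simp
    then have "sqrt s \<le> K"
      using K s0 mult_right_le_imp_le[of "sqrt s" "sqrt s" K] by (cases "s = 0") auto
    then have "(sqrt s)\<^sup>2 \<le> K\<^sup>2" using s0 by (intro power_mono) auto
    then show ?thesis using s0 by (simp add: s_def)
  qed
  show G: "G \<in> ell2 S" "ell2_norm S G \<le> K"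
    by (rule ell2_boundedI[where K = K]; use fin K in \<open>auto simp: G_def\<close>)+
  fix f assume f: "f \<in> ell2 S"
  have "L f - ell2_inner S f G = 0"
  proof (rule functional_eq_0[where L = "\<lambda>f. L f - ell2_inner S f G" and K = "K + ell2_norm S G"])
    fix f assume f: "f \<in> ell2 S"
    show "cmod (L f - ell2_inner S f G) \<le> (K + ell2_norm S G) * ell2_norm S f"
      using bounded[OF f] cauchy_schwarz[OF f G(1)] norm_triangle_ineq4[of "L f" "ell2_inner S f G"]
      by (simp add: algebra_simps)
  next
    fix f g assume "f \<in> ell2 S" "g \<in> ell2 S"
    then show "L (\<lambda>x. f x + g x) - ell2_inner S (\<lambda>x. f x + g x) G
        = (L f - ell2_inner S f G) + (L g - ell2_inner S g G)"
      by (simp add: add inner_add_left G(1))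
  next
    fix c f assume "f \<in> ell2 S"
    then show "L (\<lambda>x. c * f x) - ell2_inner S (\<lambda>x. c * f x) G = c * (L f - ell2_inner S f G)"
      by (simp add: scale inner_scale_left right_diff_distrib)
  next
    fix x assume "x \<in> S"
    then show "L (delta x) - ell2_inner S (delta x) G = 0"
      by (simp add: inner_delta_left G_def)
  qed (rule f)
  then show "L f = ell2_inner S f G" by simp
qed

section \<open>Bounded operators between two spaces and their adjoints\<close>

text \<open>The working notion of an operator: it allows two different spaces and asks nothing
  outside \<open>ell2 S\<close>, so compositions written as plain lambda terms qualify.
  \<open>bdd_restrict\<close> leads back to \<open>bounded_operators\<close>.\<close>

definition bdd :: "'a set \<Rightarrow> 'b set \<Rightarrow> (('a \<Rightarrow> complex) \<Rightarrow> ('b \<Rightarrow> complex)) \<Rightarrow> bool" where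
  "bdd S S' T \<longleftrightarrow> (\<forall>f\<in>ell2 S. T f \<in> ell2 S') \<and>
     (\<forall>f\<in>ell2 S. \<forall>g\<in>ell2 S. T (\<lambda>x. f x + g x) = (\<lambda>x. T f x + T g x)) \<and>
     (\<forall>c. \<forall>f\<in>ell2 S. T (\<lambda>x. c * f x) = (\<lambda>x. c * T f x)) \<and>
     (\<exists>K. \<forall>f\<in>ell2 S. ell2_norm S' (T f) \<le> K * ell2_norm S f)"

lemma bounded_operators_iff: "T \<in> bounded_operators S \<longleftrightarrow> T \<in> extensional (ell2 S) \<and> bdd S S T"
  by (auto simp: bounded_operators_def bdd_def PiE_iff)

lemma bounded_operators_bdd: "T \<in> bounded_operators S \<Longrightarrow> bdd S S T"
  by (simp add: bounded_operators_iff)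

lemma bdd_closed [simp]: "bdd S S' T \<Longrightarrow> f \<in> ell2 S \<Longrightarrow> T f \<in> ell2 S'"
  by (simp add: bdd_def)

lemma bounded_operators_closed: "T \<in> bounded_operators S \<Longrightarrow> f \<in> ell2 S \<Longrightarrow> T f \<in> ell2 S"
  by (auto simp: bounded_operators_def)

lemma bdd_add: "bdd S S' T \<Longrightarrow> f \<in> ell2 S \<Longrightarrow> g \<in> ell2 S \<Longrightarrow> T (\<lambda>x. f x + g x) = (\<lambda>x. T f x + T g x)"
  by (simp add: bdd_def)

lemma bdd_scale: "bdd S S' T \<Longrightarrow> f \<in> ell2 S \<Longrightarrow> T (\<lambda>x. c * f x) = (\<lambda>x. c * T f x)"
  by (simp add: bdd_def)

lemma bdd_bound:
  assumes "bdd S S' T"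
  obtains K where "0 \<le> K" "\<And>f. f \<in> ell2 S \<Longrightarrow> ell2_norm S' (T f) \<le> K * ell2_norm S f"
proof -
  obtain K where K: "\<And>f. f \<in> ell2 S \<Longrightarrow> ell2_norm S' (T f) \<le> K * ell2_norm S f"
    using assms unfolding bdd_def by blast
  show ?thesis
  proof (rule that[of "\<bar>K\<bar>"])
    fix f assume "f \<in> ell2 S"
    then show "ell2_norm S' (T f) \<le> \<bar>K\<bar> * ell2_norm S f"
      by (rule order_trans[OF K]) (simp add: mult_right_mono)
  qed simp
qed

lemma bdd_diff:
  assumes "bdd S S' T" "f \<in> ell2 S" "g \<in> ell2 S"
  shows "T (\<lambda>x. f x - g x) = (\<lambda>x. T f x - T g x)"
  using bdd_add[OF assms(1,2) ell2_scale[OF assms(3), of "-1"]] bdd_scale[OF assms(1,3), of "-1"]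
  by simp

lemma bdd_zero: "bdd S S' T \<Longrightarrow> T (\<lambda>x. 0) = (\<lambda>x. 0)"
  using bdd_scale[of S S' T "\<lambda>x. 0" 0] by simp

lemma bdd_compose:
  assumes "bdd S S' T" "bdd S' S'' U"
  shows "bdd S S'' (\<lambda>f. U (T f))"
proof -
  obtain K L where K: "0 \<le> K" "\<And>f. f \<in> ell2 S \<Longrightarrow> ell2_norm S' (T f) \<le> K * ell2_norm S f"
    and L: "0 \<le> L" "\<And>f. f \<in> ell2 S' \<Longrightarrow> ell2_norm S'' (U f) \<le> L * ell2_norm S' f"
    using bdd_bound assms by metis
  have "ell2_norm S'' (U (T f)) \<le> (L * K) * ell2_norm S f" if "f \<in> ell2 S" for f
    using L(2)[OF bdd_closed[OF assms(1) that]] mult_left_mono[OF K(2)[OF that] L(1)] by simp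
  then have "\<exists>M. \<forall>f\<in>ell2 S. ell2_norm S'' (U (T f)) \<le> M * ell2_norm S f" by blast
  then show ?thesis
    by (simp add: bdd_def[of S S''] bdd_add[OF assms(1)] bdd_add[OF assms(2)] bdd_scale[OF assms(1)]
        bdd_scale[OF assms(2)] bdd_closed[OF assms(1)] bdd_closed[OF assms(2)])
qed

lemma bdd_restrict: "bdd S S T \<Longrightarrow> (\<lambda>f\<in>ell2 S. T f) \<in> bounded_operators S"
  by (auto simp: bounded_operators_iff bdd_def)

lemma cmod_le_ell2_norm:
  assumes "f \<in> ell2 S"
  shows "cmod (f x) \<le> ell2_norm S f"
proof (cases "x \<in> S")
  case True
  then have "(\<Sum>y\<in>{x}. (cmod (f y))\<^sup>2) \<le> (ell2_norm S f)\<^sup>2"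
    by (intro ell2_finite_sum_le assms) auto
  then show ?thesis by (simp add: abs_le_square_iff[symmetric])
qed (simp add: ell2_D[OF assms])

text \<open>For each coordinate \<open>y\<close>, the functional \<open>T f y - U f y\<close> is
  bounded and vanishes on the basis.\<close>

lemma bdd_ext:
  assumes T: "bdd S S' T" and U: "bdd S S' U"
    and delta: "\<And>x. x \<in> S \<Longrightarrow> T (delta x) = U (delta x)"
    and f: "f \<in> ell2 S"
  shows "T f = U f"
proof
  fix y
  obtain K where K: "\<And>f. f \<in> ell2 S \<Longrightarrow> ell2_norm S' (T f) \<le> K * ell2_norm S f"
    using bdd_bound[OF T] by metis
  obtain L where L: "\<And>f. f \<in> ell2 S \<Longrightarrow> ell2_norm S' (U f) \<le> L * ell2_norm S f"
    using bdd_bound[OF U] by metis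
  have "T f y - U f y = 0"
  proof (rule functional_eq_0[where L = "\<lambda>f. T f y - U f y" and K = "K + L"])
    fix f assume f: "f \<in> ell2 S"
    have "cmod (T f y - U f y) \<le> cmod (T f y) + cmod (U f y)" by (rule norm_triangle_ineq4)
    also have "\<dots> \<le> ell2_norm S' (T f) + ell2_norm S' (U f)"
      by (intro add_mono cmod_le_ell2_norm bdd_closed[OF T f] bdd_closed[OF U f])
    also have "\<dots> \<le> (K + L) * ell2_norm S f" using K[OF f] L[OF f] by (simp add: distrib_right)
    finally show "cmod (T f y - U f y) \<le> (K + L) * ell2_norm S f" .
  qed (simp_all add: bdd_add[OF T] bdd_add[OF U] bdd_scale[OF T] bdd_scale[OF U] delta f algebra_simps)
  then show "T f y = U f y" by simp
qed

text \<open>The Riesz vector of the functional \<open>f \<mapsto> \<langle>T f, g\<rangle>\<close>,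
  written out in coordinates, so that \<open>riesz\<close> supplies membership, the norm bound and
  the defining identity.\<close>

definition adj :: "'a set \<Rightarrow> 'b set \<Rightarrow> (('a \<Rightarrow> complex) \<Rightarrow> ('b \<Rightarrow> complex)) \<Rightarrow> ('b \<Rightarrow> complex) \<Rightarrow> ('a \<Rightarrow> complex)" where
  "adj S S' T g = (\<lambda>x. if x \<in> S then cnj (ell2_inner S' (T (delta x)) g) else 0)"

lemma
  assumes T: "bdd S S' T"
  shows adj_bdd: "bdd S' S (adj S S' T)"
    and adj_inner: "\<And>f g. f \<in> ell2 S \<Longrightarrow> g \<in> ell2 S' \<Longrightarrow>
          ell2_inner S' (T f) g = ell2_inner S f (adj S S' T g)"
proof -
  obtain K where K: "0 \<le> K" "\<And>f. f \<in> ell2 S \<Longrightarrow> ell2_norm S' (T f) \<le> K * ell2_norm S f"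
    using bdd_bound[OF T] by metis
  have R: "adj S S' T g \<in> ell2 S \<and> ell2_norm S (adj S S' T g) \<le> K * ell2_norm S' g \<and>
      (\<forall>f\<in>ell2 S. ell2_inner S' (T f) g = ell2_inner S f (adj S S' T g))"
    if g: "g \<in> ell2 S'" for g
  proof -
    have "cmod (ell2_inner S' (T f) g) \<le> K * ell2_norm S' g * ell2_norm S f" if "f \<in> ell2 S" for f
    proof -
      have "cmod (ell2_inner S' (T f) g) \<le> ell2_norm S' (T f) * ell2_norm S' g"
        using that g T by (intro cauchy_schwarz) auto
      also have "\<dots> \<le> (K * ell2_norm S f) * ell2_norm S' g"
        by (intro mult_right_mono K(2) that) simp
      finally show ?thesis by (simp add: algebra_simps)
    qed
    note r = riesz[of S "\<lambda>f. ell2_inner S' (T f) g" "K * ell2_norm S' g",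
        OF _ _ this, folded adj_def]
    show ?thesis
      by (intro conjI ballI r)
        (auto simp: bdd_add[OF T] bdd_scale[OF T] inner_add_left inner_scale_left g bdd_closed[OF T] K(1))
  qed
  then show "\<And>f g. f \<in> ell2 S \<Longrightarrow> g \<in> ell2 S' \<Longrightarrow>
          ell2_inner S' (T f) g = ell2_inner S f (adj S S' T g)" by blast
  have "adj S S' T (\<lambda>x. f x + g x) = (\<lambda>x. adj S S' T f x + adj S S' T g x)"
    if "f \<in> ell2 S'" "g \<in> ell2 S'" for f g
    using that by (auto simp: adj_def inner_add_right bdd_closed[OF T] fun_eq_iff)
  moreover have "adj S S' T (\<lambda>x. c * f x) = (\<lambda>x. c * adj S S' T f x)" for c f
    by (auto simp: adj_def inner_scale_right fun_eq_iff)
  ultimately show "bdd S' S (adj S S' T)"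
    unfolding bdd_def using R by blast
qed

lemma ell2_eqI_inner:
  assumes "f \<in> ell2 S" "g \<in> ell2 S" "\<And>h. h \<in> ell2 S \<Longrightarrow> ell2_inner S h f = ell2_inner S h g"
  shows "f = g"
  by (rule ell2_ext[OF assms(1,2)])
     (metis assms(3) complex_cnj_cancel_iff delta_ell2 inner_delta_left)

text \<open>Uniqueness of adjoints resolves the definite description in
  \<open>op_adjoint\<close>.\<close>

lemma op_adjoint_eqI:
  assumes U: "U \<in> bounded_operators S"
    and adj: "\<And>f g. f \<in> ell2 S \<Longrightarrow> g \<in> ell2 S \<Longrightarrow> ell2_inner S (T f) g = ell2_inner S f (U g)"
  shows "op_adjoint S T = U"
  unfolding op_adjoint_def
proof (rule the_equality)
  fix W assume W: "W \<in> bounded_operators S \<and>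
     (\<forall>f\<in>ell2 S. \<forall>g\<in>ell2 S. ell2_inner S (T f) g = ell2_inner S f (W g))"
  show "W = U"
  proof (rule extensionalityI[of _ "ell2 S"])
    fix g assume g: "g \<in> ell2 S"
    show "W g = U g"
      using W U g adj by (intro ell2_eqI_inner) (auto simp: bounded_operators_iff)
  qed (use U W in \<open>auto simp: bounded_operators_iff\<close>)
qed (use assms in auto)

lemma op_adjoint_exists:
  assumes "T \<in> bounded_operators S"
  shows "op_adjoint S T \<in> bounded_operators S"
    "\<And>f g. f \<in> ell2 S \<Longrightarrow> g \<in> ell2 S \<Longrightarrow> ell2_inner S (T f) g = ell2_inner S f (op_adjoint S T g)"
proof -
  let ?U = "\<lambda>f\<in>ell2 S. adj S S T f"
  have b: "bdd S S T" using assms by (simp add: bounded_operators_iff)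
  have "op_adjoint S T = ?U"
    by (rule op_adjoint_eqI) (auto simp: bdd_restrict adj_bdd b adj_inner)
  then show "op_adjoint S T \<in> bounded_operators S"
    "\<And>f g. f \<in> ell2 S \<Longrightarrow> g \<in> ell2 S \<Longrightarrow> ell2_inner S (T f) g = ell2_inner S f (op_adjoint S T g)"
    by (auto simp: bdd_restrict adj_bdd b adj_inner)
qed

section \<open>Commutants and spatial isomorphisms\<close>

lemma commutant_iff:
  assumes "A \<subseteq> bounded_operators S"
  shows "X \<in> commutant S A \<longleftrightarrow>
    X \<in> bounded_operators S \<and> (\<forall>U\<in>A. \<forall>f\<in>ell2 S. X (U f) = U (X f))"
proof -
  have "op_mult S X U = op_mult S U X \<longleftrightarrow> (\<forall>f\<in>ell2 S. X (U f) = U (X f))" for U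
    by (auto simp: op_mult_def compose_def restrict_def fun_eq_iff)
  then show ?thesis by (auto simp: commutant_def)
qed

lemma commutant_subset: "commutant S A \<subseteq> bounded_operators S"
  by (auto simp: commutant_def)

text \<open>Conjugation by the unitary \<open>U\<close> with inverse \<open>V\<close> carries
  commutants to commutants, hence double commutants to double commutants. The hypothesis compares
  first commutants and not generators, because in the applications the generating sets
  \<open>X\<close> and \<open>Y\<close> do not correspond under conjugation.\<close>

lemma spatial_star_isomorphic:
  fixes S :: "'a set" and S' :: "'b set"
  assumes U: "bdd S S' U" and V: "bdd S' S V"
    and VU: "\<And>f. f \<in> ell2 S \<Longrightarrow> V (U f) = f" and UV: "\<And>f. f \<in> ell2 S' \<Longrightarrow> U (V f) = f"
    and inner: "\<And>f g. f \<in> ell2 S \<Longrightarrow> g \<in> ell2 S \<Longrightarrow> ell2_inner S' (U f) (U g) = ell2_inner S f g"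
    and comm: "\<And>Z. Z \<in> bounded_operators S' \<Longrightarrow>
       Z \<in> commutant S' Y \<longleftrightarrow> (\<lambda>f\<in>ell2 S. V (Z (U f))) \<in> commutant S X"
  shows "star_isomorphic S (commutant S (commutant S X)) S' (commutant S' (commutant S' Y))"
    (is "star_isomorphic S ?M S' ?N")
proof -
  define \<Phi> where "\<Phi> T = (\<lambda>g\<in>ell2 S'. U (T (V g)))" for T
  define \<Psi> where "\<Psi> Z = (\<lambda>f\<in>ell2 S. V (Z (U f)))" for Z
  have \<Phi>_bdd: "\<Phi> T \<in> bounded_operators S'" if "T \<in> bounded_operators S" for T
    unfolding \<Phi>_def by (intro bdd_restrict bdd_compose[OF _ U] bdd_compose[OF V])
      (use that in \<open>simp add: bounded_operators_iff\<close>)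
  have \<Psi>_bdd: "\<Psi> Z \<in> bounded_operators S" if "Z \<in> bounded_operators S'" for Z
    unfolding \<Psi>_def by (intro bdd_restrict bdd_compose[OF _ V] bdd_compose[OF U])
      (use that in \<open>simp add: bounded_operators_iff\<close>)
  note cl = bounded_operators_closed
  have \<Psi>\<Phi>: "\<Psi> (\<Phi> T) = T" if T: "T \<in> bounded_operators S" for T
  proof (rule extensionalityI[of _ "ell2 S"])
    show "T \<in> extensional (ell2 S)" using T by (simp add: bounded_operators_iff)
    show "\<Psi> (\<Phi> T) f = T f" if "f \<in> ell2 S" for f
      using that cl[OF T that] U by (simp add: \<Psi>_def \<Phi>_def VU)
  qed (simp add: \<Psi>_def)
  have \<Phi>\<Psi>: "\<Phi> (\<Psi> Z) = Z" if Z: "Z \<in> bounded_operators S'" for Z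
  proof (rule extensionalityI[of _ "ell2 S'"])
    show "Z \<in> extensional (ell2 S')" using Z by (simp add: bounded_operators_iff)
    show "\<Phi> (\<Psi> Z) f = Z f" if "f \<in> ell2 S'" for f
      using that cl[OF Z that] V by (simp add: \<Psi>_def \<Phi>_def UV)
  qed (simp add: \<Phi>_def)
  have comm': "Z \<in> commutant S' Y \<longleftrightarrow> \<Psi> Z \<in> commutant S X" if "Z \<in> bounded_operators S'" for Z
    using comm[OF that] by (simp add: \<Psi>_def)
  have \<Phi>M: "\<Phi> T \<in> ?N" if T: "T \<in> ?M" for T
    unfolding commutant_iff[OF commutant_subset]
  proof (intro conjI ballI)
    have Tb: "T \<in> bounded_operators S" using T commutant_subset by blast
    then show "\<Phi> T \<in> bounded_operators S'" by (rule \<Phi>_bdd)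
    fix Z f assume Z: "Z \<in> commutant S' Y" and f: "f \<in> ell2 S'"
    have Zb: "Z \<in> bounded_operators S'" using Z commutant_subset by blast
    have "\<Psi> Z \<in> commutant S X" using Z comm' Zb by simp
    then have "T (\<Psi> Z (V f)) = \<Psi> Z (T (V f))"
      using T f V unfolding commutant_iff[OF commutant_subset] by simp
    then have "T (V (Z f)) = V (Z (U (T (V f))))"
      using f V cl[OF Tb] by (simp add: \<Psi>_def UV)
    then show "\<Phi> T (Z f) = Z (\<Phi> T f)"
      using f V cl[OF Tb] cl[OF Zb] U by (simp add: \<Phi>_def UV)
  qed
  have \<Psi>N: "\<Psi> Z \<in> ?M" if Z: "Z \<in> ?N" for Z
    unfolding commutant_iff[OF commutant_subset]
  proof (intro conjI ballI)
    have Zb: "Z \<in> bounded_operators S'" using Z commutant_subset by blast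
    then show "\<Psi> Z \<in> bounded_operators S" by (rule \<Psi>_bdd)
    fix T f assume T: "T \<in> commutant S X" and f: "f \<in> ell2 S"
    have Tb: "T \<in> bounded_operators S" using T commutant_subset by blast
    have "\<Phi> T \<in> commutant S' Y" using T comm' \<Phi>_bdd[OF Tb] \<Psi>\<Phi>[OF Tb] by simp
    then have "Z (\<Phi> T (U f)) = \<Phi> T (Z (U f))"
      using Z f U unfolding commutant_iff[OF commutant_subset] by simp
    then have "Z (U (T f)) = U (T (V (Z (U f))))"
      using f U cl[OF Zb] by (simp add: \<Phi>_def VU)
    then show "\<Psi> Z (T f) = T (\<Psi> Z f)"
      using f U cl[OF Tb] cl[OF Zb] V by (simp add: \<Psi>_def VU)
  qed
  have inner': "ell2_inner S (V f) g = ell2_inner S' f (U g)" if "f \<in> ell2 S'" "g \<in> ell2 S" for f g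
    using inner[of "V f" g] that V UV by simp
  show ?thesis
    unfolding star_isomorphic_def
  proof (intro exI[of _ \<Phi>] conjI ballI allI)
    have Mb: "?M \<subseteq> bounded_operators S" and Nb: "?N \<subseteq> bounded_operators S'"
      by (rule commutant_subset)+
    show "bij_betw \<Phi> ?M ?N"
      by (rule bij_betw_byWitness[where f' = \<Psi>])
        (use \<Phi>M \<Psi>N Mb Nb in \<open>auto intro: \<Phi>\<Psi> \<Psi>\<Phi>\<close>)
    fix T assume "T \<in> ?M"
    then have T: "T \<in> bounded_operators S" using Mb by blast
    {
      fix T' assume "T' \<in> ?M"
      then have T': "T' \<in> bounded_operators S" using Mb by blast
      show "\<Phi> (op_add S T T') = op_add S' (\<Phi> T) (\<Phi> T')"
        using V by (auto simp: \<Phi>_def op_add_def fun_eq_iff restrict_def cl[OF T] cl[OF T'] bdd_add[OF U])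
      show "\<Phi> (op_mult S T T') = op_mult S' (\<Phi> T) (\<Phi> T')"
        using V U by (auto simp: \<Phi>_def op_mult_def compose_def fun_eq_iff restrict_def cl[OF T] cl[OF T'] VU)
    }
    show "\<Phi> (op_scale S c T) = op_scale S' c (\<Phi> T)" for c
      using V by (auto simp: \<Phi>_def op_scale_def fun_eq_iff restrict_def cl[OF T] bdd_scale[OF U])
    have T': "op_adjoint S T \<in> bounded_operators S" by (rule op_adjoint_exists(1)[OF T])
    show "\<Phi> (op_adjoint S T) = op_adjoint S' (\<Phi> T)"
    proof (rule op_adjoint_eqI[symmetric])
      show "\<Phi> (op_adjoint S T) \<in> bounded_operators S'" by (rule \<Phi>_bdd[OF T'])
      fix f g assume fg: "f \<in> ell2 S'" "g \<in> ell2 S'"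
      have "ell2_inner S' (\<Phi> T f) g = ell2_inner S' (U (T (V f))) (U (V g))"
        using fg by (simp add: \<Phi>_def UV)
      also have "\<dots> = ell2_inner S (T (V f)) (V g)"
        using fg V cl[OF T] by (intro inner) auto
      also have "\<dots> = ell2_inner S (V f) (op_adjoint S T (V g))"
        using fg V by (intro op_adjoint_exists(2)[OF T]) auto
      also have "\<dots> = ell2_inner S' f (U (op_adjoint S T (V g)))"
        using fg V cl[OF T'] by (intro inner') auto
      finally show "ell2_inner S' (\<Phi> T f) g = ell2_inner S' f (\<Phi> (op_adjoint S T) g)"
        using fg by (simp add: \<Phi>_def)
    qed
  qed
qed

section \<open>Expansions in orthonormal families\<close>

text \<open>The analysis map of the family \<open>b\<close>. Its adjoint sends
  \<open>delta x\<close> to \<open>b x\<close>, so the pair takes the place of infinite linear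
  combinations of the vectors \<open>b x\<close>.\<close>

definition coef :: "'b set \<Rightarrow> 'a set \<Rightarrow> ('b \<Rightarrow> 'a \<Rightarrow> complex) \<Rightarrow> ('a \<Rightarrow> complex) \<Rightarrow> 'b \<Rightarrow> complex" where
  "coef X S b h = (\<lambda>x. if x \<in> X then ell2_inner S h (b x) else 0)"

context
  fixes X :: "'b set" and S :: "'a set" and b :: "'b \<Rightarrow> 'a \<Rightarrow> complex"
  assumes b: "\<And>x. x \<in> X \<Longrightarrow> b x \<in> ell2 S"
    and on: "\<And>x y. x \<in> X \<Longrightarrow> y \<in> X \<Longrightarrow> ell2_inner S (b x) (b y) = (if x = y then 1 else 0)"
begin

text \<open>Cauchy-Schwarz for \<open>h\<close> and its partial expansion \<open>p\<close>: both the
  inner product of \<open>h\<close> with \<open>p\<close> and the squared norm of \<open>p\<close>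
  equal \<open>s\<close>, so the norm of \<open>p\<close> is at most that of
  \<open>h\<close>.\<close>

lemma bessel:
  assumes h: "h \<in> ell2 S" and F: "finite F" "F \<subseteq> X"
  shows "(\<Sum>x\<in>F. (cmod (ell2_inner S h (b x)))\<^sup>2) \<le> (ell2_norm S h)\<^sup>2"
proof -
  define p where "p = (\<lambda>y. \<Sum>x\<in>F. ell2_inner S h (b x) * b x y)"
  define s where "s = (\<Sum>x\<in>F. (cmod (ell2_inner S h (b x)))\<^sup>2)"
  have s0: "0 \<le> s" by (simp add: s_def sum_nonneg)
  have p: "p \<in> ell2 S" unfolding p_def using F b by (auto intro!: ell2_sum ell2_scale)
  have hp: "ell2_inner S g p = (\<Sum>x\<in>F. cnj (ell2_inner S h (b x)) * ell2_inner S g (b x))"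
    if "g \<in> ell2 S" for g
    unfolding p_def using F b that
    by (subst inner_sum_right) (auto simp: inner_scale_right intro!: ell2_scale)
  have sq: "cnj z * z = of_real ((cmod z)\<^sup>2)" for z
    by (metis complex_norm_square mult.commute)
  have 1: "ell2_inner S h p = of_real s" by (simp add: hp[OF h] s_def sq del: of_real_power)
  have "ell2_inner S p (b x) = ell2_inner S h (b x)" if "x \<in> F" for x
  proof -
    have "ell2_inner S p (b x) = (\<Sum>y\<in>F. ell2_inner S h (b y) * ell2_inner S (b y) (b x))"
      unfolding p_def using F b that
      by (subst inner_sum_left) (auto simp: inner_scale_left intro!: ell2_scale)
    also have "\<dots> = (\<Sum>y\<in>F. if y = x then ell2_inner S h (b y) else 0)"
      using F that by (intro sum.cong) (auto simp: on subset_iff)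
    finally show ?thesis using that F by simp
  qed
  then have "ell2_inner S p p = of_real s"
    by (simp add: hp[OF p] s_def sq del: of_real_power)
  then have n: "(ell2_norm S p)\<^sup>2 = s" using inner_self[OF p] by (metis of_real_eq_iff)
  have "s \<le> ell2_norm S h * ell2_norm S p" using cauchy_schwarz[OF h p] s0 by (simp add: 1)
  then have "ell2_norm S p * ell2_norm S p \<le> ell2_norm S h * ell2_norm S p"
    using n by (simp add: power2_eq_square)
  then have "ell2_norm S p \<le> ell2_norm S h"
    using mult_right_le_imp_le[of "ell2_norm S p" "ell2_norm S p" "ell2_norm S h"]
    by (cases "ell2_norm S p = 0") (auto simp: less_le)
  then have "(ell2_norm S p)\<^sup>2 \<le> (ell2_norm S h)\<^sup>2" by (intro power_mono) auto
  then show ?thesis using n by (simp add: s_def)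
qed

lemma coef_bdd: "bdd S X (coef X S b)"
proof -
  have n: "coef X S b h \<in> ell2 X \<and> ell2_norm X (coef X S b h) \<le> ell2_norm S h" if "h \<in> ell2 S" for h
  proof (intro conjI ell2_boundedI[where K = "ell2_norm S h"])
    fix F assume F: "finite F" "F \<subseteq> X"
    have "(\<Sum>x\<in>F. (cmod (coef X S b h x))\<^sup>2) = (\<Sum>x\<in>F. (cmod (ell2_inner S h (b x)))\<^sup>2)"
      using F by (intro sum.cong) (auto simp: coef_def)
    then show "(\<Sum>x\<in>F. (cmod (coef X S b h x))\<^sup>2) \<le> (ell2_norm S h)\<^sup>2"
      using bessel[OF that F] by simp
    then show "(\<Sum>x\<in>F. (cmod (coef X S b h x))\<^sup>2) \<le> (ell2_norm S h)\<^sup>2" .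
  qed (auto simp: coef_def)
  have "coef X S b (\<lambda>x. f x + g x) = (\<lambda>x. coef X S b f x + coef X S b g x)"
    if "f \<in> ell2 S" "g \<in> ell2 S" for f g
    using that b by (auto simp: coef_def inner_add_left)
  moreover have "coef X S b (\<lambda>x. c * f x) = (\<lambda>x. c * coef X S b f x)" for c f
    by (auto simp: coef_def inner_scale_left)
  moreover have "\<forall>f\<in>ell2 S. ell2_norm X (coef X S b f) \<le> 1 * ell2_norm S f" using n by simp
  ultimately show ?thesis unfolding bdd_def using n by blast
qed

lemma coef_basis: "x \<in> X \<Longrightarrow> coef X S b (b x) = delta x"
  by (auto simp: coef_def delta_def on fun_eq_iff)

lemma adj_coef_delta:
  assumes "x \<in> X"
  shows "adj S X (coef X S b) (delta x) = b x"
proof (rule ell2_ext)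
  show "adj S X (coef X S b) (delta x) \<in> ell2 S"
    by (rule bdd_closed[OF adj_bdd[OF coef_bdd]]) (simp add: assms)
  fix y assume "y \<in> S"
  then show "adj S X (coef X S b) (delta x) y = b x y"
    using assms by (simp add: adj_def inner_delta_right coef_def inner_delta_left)
qed (simp add: b assms)

text \<open>The coefficients of a synthesised vector are the given ones. The opposite composition is
  the projection onto the closed span, which is the identity only for a complete family.\<close>

lemma coef_adj:
  assumes "g \<in> ell2 X"
  shows "coef X S b (adj S X (coef X S b) g) = g"
proof -
  have "bdd X X (\<lambda>g. g)" by (auto simp: bdd_def intro: exI[of _ 1])
  from bdd_ext[OF bdd_compose[OF adj_bdd[OF coef_bdd] coef_bdd] this _ assms]
  show ?thesis by (simp add: adj_coef_delta coef_basis)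
qed

end

section \<open>Unitaries in generated von Neumann algebras\<close>

text \<open>Unitarity is expressed by surjectivity and preservation of the inner product, which
  avoids \<open>op_adjoint\<close>; inverses are obtained from \<open>adj\<close> when the group
  axioms are proved.\<close>

definition unitary_group :: "'a set \<Rightarrow> 'a operator monoid" where
  "unitary_group S = \<lparr>carrier = {T \<in> bounded_operators S. T ` ell2 S = ell2 S \<and>
      (\<forall>f\<in>ell2 S. \<forall>g\<in>ell2 S. ell2_inner S (T f) (T g) = ell2_inner S f g)},
    monoid.mult = op_mult S, one = (\<lambda>f\<in>ell2 S. f)\<rparr>"

lemma unitary_bounded: "T \<in> carrier (unitary_group S) \<Longrightarrow> T \<in> bounded_operators S"
  by (simp add: unitary_group_def)

lemma unitary_closed: "T \<in> carrier (unitary_group S) \<Longrightarrow> f \<in> ell2 S \<Longrightarrow> T f \<in> ell2 S"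
  by (simp add: unitary_bounded bounded_operators_closed)

lemma unitary_inner:
  "T \<in> carrier (unitary_group S) \<Longrightarrow> f \<in> ell2 S \<Longrightarrow> g \<in> ell2 S \<Longrightarrow>
    ell2_inner S (T f) (T g) = ell2_inner S f g"
  by (simp add: unitary_group_def)

lemma unitary_groupI:
  assumes "T \<in> bounded_operators S"
    and "\<And>f. f \<in> ell2 S \<Longrightarrow> \<exists>g\<in>ell2 S. T g = f"
    and "\<And>f g. f \<in> ell2 S \<Longrightarrow> g \<in> ell2 S \<Longrightarrow> ell2_inner S (T f) (T g) = ell2_inner S f g"
  shows "T \<in> carrier (unitary_group S)"
  using assms bounded_operators_closed[OF assms(1)] by (auto simp: unitary_group_def image_iff)

lemma unitary_surj: "T \<in> carrier (unitary_group S) \<Longrightarrow> f \<in> ell2 S \<Longrightarrow> \<exists>g\<in>ell2 S. T g = f"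
  unfolding unitary_group_def by force

lemma unitary_mult_apply:
  "f \<in> ell2 S \<Longrightarrow> (T \<otimes>\<^bsub>unitary_group S\<^esub> U) f = T (U f)"
  by (simp add: unitary_group_def op_mult_def compose_eq)

lemma unitary_one_apply: "f \<in> ell2 S \<Longrightarrow> \<one>\<^bsub>unitary_group S\<^esub> f = f"
  by (simp add: unitary_group_def)

lemma bounded_operators_ext:
  assumes "T \<in> bounded_operators S" "U \<in> bounded_operators S"
    "\<And>f. f \<in> ell2 S \<Longrightarrow> T f = U f"
  shows "T = U"
  by (rule extensionalityI[of _ "ell2 S"]) (use assms in \<open>auto simp: bounded_operators_iff\<close>)

lemma unitary_ext:
  assumes "T \<in> carrier (unitary_group S)" "U \<in> carrier (unitary_group S)"
    "\<And>f. f \<in> ell2 S \<Longrightarrow> T f = U f"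
  shows "T = U"
  using assms by (intro bounded_operators_ext[of T S U]) (auto simp: unitary_bounded)

lemma group_unitary_group: "group (unitary_group S)"
proof (rule groupI)
  fix T U assume T: "T \<in> carrier (unitary_group S)" and U: "U \<in> carrier (unitary_group S)"
  have eq: "T \<otimes>\<^bsub>unitary_group S\<^esub> U = (\<lambda>f\<in>ell2 S. T (U f))"
    by (simp add: unitary_group_def op_mult_def compose_def)
  show TU: "T \<otimes>\<^bsub>unitary_group S\<^esub> U \<in> carrier (unitary_group S)"
  proof (rule unitary_groupI)
    show "T \<otimes>\<^bsub>unitary_group S\<^esub> U \<in> bounded_operators S"
      unfolding eq
      using bdd_restrict[OF bdd_compose[OF bounded_operators_bdd[OF unitary_bounded[OF U]]
            bounded_operators_bdd[OF unitary_bounded[OF T]]]] .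
    fix f assume "f \<in> ell2 S"
    then obtain h where h: "h \<in> ell2 S" "T h = f" using unitary_surj[OF T] by blast
    then obtain g where "g \<in> ell2 S" "U g = h" using unitary_surj[OF U] by blast
    then show "\<exists>g\<in>ell2 S. (T \<otimes>\<^bsub>unitary_group S\<^esub> U) g = f"
      using h by (auto simp: unitary_mult_apply)
  qed (simp add: unitary_mult_apply unitary_closed[OF U] unitary_inner[OF T] unitary_inner[OF U])
next
  show "\<one>\<^bsub>unitary_group S\<^esub> \<in> carrier (unitary_group S)"
  proof (rule unitary_groupI)
    have "bdd S S (\<lambda>f. f)" by (auto simp: bdd_def intro: exI[of _ 1])
    then show "\<one>\<^bsub>unitary_group S\<^esub> \<in> bounded_operators S"
      using bdd_restrict by (auto simp: unitary_group_def)
  qed (auto simp: unitary_one_apply)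
next
  fix T U W assume T: "T \<in> carrier (unitary_group S)" and U: "U \<in> carrier (unitary_group S)"
    and W: "W \<in> carrier (unitary_group S)"
  show "T \<otimes>\<^bsub>unitary_group S\<^esub> U \<otimes>\<^bsub>unitary_group S\<^esub> W
      = T \<otimes>\<^bsub>unitary_group S\<^esub> (U \<otimes>\<^bsub>unitary_group S\<^esub> W)"
    using unitary_closed[OF W] unitary_closed[OF U]
    by (auto simp: unitary_group_def op_mult_def compose_def restrict_def fun_eq_iff)
next
  fix T assume T: "T \<in> carrier (unitary_group S)"
  then have ext: "T \<in> extensional (ell2 S)"
    by (simp add: unitary_group_def bounded_operators_iff)
  then show "\<one>\<^bsub>unitary_group S\<^esub> \<otimes>\<^bsub>unitary_group S\<^esub> T = T"
    using unitary_closed[OF T]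
    by (auto simp: unitary_group_def op_mult_def compose_def restrict_def fun_eq_iff extensional_def)
  have b: "bdd S S T" using T by (simp add: unitary_bounded bounded_operators_bdd)
  define U where "U = (\<lambda>f\<in>ell2 S. adj S S T f)"
  have Ub: "U \<in> bounded_operators S" unfolding U_def by (intro bdd_restrict adj_bdd b)
  have Uc: "U f \<in> ell2 S" if "f \<in> ell2 S" for f by (rule bounded_operators_closed[OF Ub that])
  have Ua: "ell2_inner S (T f) g = ell2_inner S f (U g)" if "f \<in> ell2 S" "g \<in> ell2 S" for f g
    using adj_inner[OF b that] that by (simp add: U_def)
  have UT: "U (T f) = f" if f: "f \<in> ell2 S" for f
    using f Uc unitary_closed[OF T]
    by (intro ell2_eqI_inner) (auto simp: Ua[symmetric] unitary_inner[OF T])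
  have TU: "T (U f) = f" if f: "f \<in> ell2 S" for f
  proof -
    obtain g where "g \<in> ell2 S" "T g = f" using unitary_surj[OF T f] by blast
    then show ?thesis using UT by auto
  qed
  show "\<exists>U\<in>carrier (unitary_group S). U \<otimes>\<^bsub>unitary_group S\<^esub> T = \<one>\<^bsub>unitary_group S\<^esub>"
  proof (rule bexI[of _ U])
    show "U \<otimes>\<^bsub>unitary_group S\<^esub> T = \<one>\<^bsub>unitary_group S\<^esub>"
      using UT by (auto simp: unitary_group_def op_mult_def compose_def restrict_def fun_eq_iff)
    show "U \<in> carrier (unitary_group S)"
    proof (rule unitary_groupI[OF Ub])
      show "\<exists>g\<in>ell2 S. U g = f" if "f \<in> ell2 S" for f
        using UT[OF that] unitary_closed[OF T that] by blast
      show "ell2_inner S (U f) (U g) = ell2_inner S f g" if "f \<in> ell2 S" "g \<in> ell2 S" for f g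
        using unitary_inner[OF T Uc[OF that(1)] Uc[OF that(2)]] TU that by simp
    qed
  qed
qed

lemma unitary_inv_apply:
  assumes "T \<in> carrier (unitary_group S)" "f \<in> ell2 S"
  shows "(inv\<^bsub>unitary_group S\<^esub> T) (T f) = f" "T ((inv\<^bsub>unitary_group S\<^esub> T) f) = f"
proof -
  interpret U: group "unitary_group S" by (rule group_unitary_group)
  show "(inv\<^bsub>unitary_group S\<^esub> T) (T f) = f"
    using U.l_inv[OF assms(1)] unitary_mult_apply[OF assms(2), of "inv\<^bsub>unitary_group S\<^esub> T" T]
    by (simp add: unitary_one_apply assms)
  show "T ((inv\<^bsub>unitary_group S\<^esub> T) f) = f"
    using U.r_inv[OF assms(1)] unitary_mult_apply[OF assms(2), of T "inv\<^bsub>unitary_group S\<^esub> T"]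
    by (simp add: unitary_one_apply assms)
qed

section \<open>Unitaries in commutants and double commutants\<close>

text \<open>The unitaries in the commutant of a single operator. For bounded \<open>X\<close> they
  form a subgroup, so that products, inverses and integer powers can be handled by group
  theory.\<close>

definition cent :: "'a set \<Rightarrow> 'a operator \<Rightarrow> 'a operator set" where
  "cent S X = {v \<in> carrier (unitary_group S). \<forall>f\<in>ell2 S. X (v f) = v (X f)}"

lemma subgroup_cent:
  assumes X: "X \<in> bounded_operators S"
  shows "subgroup (cent S X) (unitary_group S)"
proof -
  interpret U: group "unitary_group S" by (rule group_unitary_group)
  have Xc: "X f \<in> ell2 S" if "f \<in> ell2 S" for f
    by (rule bounded_operators_closed[OF X that])
  show ?thesis
  proof (rule U.subgroupI)
    have "\<one>\<^bsub>unitary_group S\<^esub> \<in> cent S X" by (simp add: cent_def unitary_one_apply Xc)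
    then show "cent S X \<noteq> {}" by blast
    fix v assume v: "v \<in> cent S X"
    then have vU: "v \<in> carrier (unitary_group S)" by (simp add: cent_def)
    show "inv\<^bsub>unitary_group S\<^esub> v \<in> cent S X"
      unfolding cent_def
    proof (intro CollectI conjI ballI)
      fix f assume f: "f \<in> ell2 S"
      let ?w = "inv\<^bsub>unitary_group S\<^esub> v"
      have wf: "?w f \<in> ell2 S" using f vU by (simp add: unitary_closed)
      have "v (X (?w f)) = X (v (?w f))" using v wf by (simp add: cent_def)
      also have "\<dots> = X f" using f vU by (simp add: unitary_inv_apply)
      finally show "X (?w f) = ?w (X f)"
        using unitary_inv_apply(1)[OF vU Xc[OF wf]] by simp
    qed (use vU in simp)
    fix w assume w: "w \<in> cent S X"
    then show "v \<otimes>\<^bsub>unitary_group S\<^esub> w \<in> cent S X"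
      using v by (auto simp: cent_def unitary_mult_apply unitary_closed Xc)
  qed (auto simp: cent_def)
qed

text \<open>For a set \<open>A\<close> of unitaries this is the unitary group of the double
  commutant of \<open>A\<close>, that is, of the von Neumann algebra which \<open>A\<close>
  generates.\<close>

definition vgen :: "'a set \<Rightarrow> 'a operator set \<Rightarrow> 'a operator set" where
  "vgen S A = {v \<in> carrier (unitary_group S).
     \<forall>X\<in>bounded_operators S. A \<subseteq> cent S X \<longrightarrow> v \<in> cent S X}"

lemma vgenD: "v \<in> vgen S A \<Longrightarrow> X \<in> bounded_operators S \<Longrightarrow> A \<subseteq> cent S X \<Longrightarrow> v \<in> cent S X"
  by (simp add: vgen_def)

lemma vgen_unitary: "v \<in> vgen S A \<Longrightarrow> v \<in> carrier (unitary_group S)"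
  by (simp add: vgen_def)

lemma vgen_incl: "A \<subseteq> carrier (unitary_group S) \<Longrightarrow> A \<subseteq> vgen S A"
  by (auto simp: vgen_def)

lemma vgen_least: "A \<subseteq> vgen S B \<Longrightarrow> vgen S A \<subseteq> vgen S B"
  by (fastforce simp: vgen_def)

lemma vgen_mono: "A \<subseteq> B \<Longrightarrow> vgen S A \<subseteq> vgen S B"
  by (auto simp: vgen_def)

lemma subgroup_vgen: "subgroup (vgen S A) (unitary_group S)"
proof -
  interpret U: group "unitary_group S" by (rule group_unitary_group)
  note sg = subgroup_cent
  show ?thesis
  proof (rule U.subgroupI)
    have "\<one>\<^bsub>unitary_group S\<^esub> \<in> vgen S A"
      by (auto simp: vgen_def intro: subgroup.one_closed[OF sg])
    then show "vgen S A \<noteq> {}" by blast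
  qed (auto simp: vgen_def intro: subgroup.m_inv_closed[OF sg] subgroup.m_closed[OF sg])
qed

lemma cent_commute:
  assumes "v \<in> carrier (unitary_group S)" "w \<in> carrier (unitary_group S)"
  shows "v \<in> cent S w \<longleftrightarrow> v \<otimes>\<^bsub>unitary_group S\<^esub> w = w \<otimes>\<^bsub>unitary_group S\<^esub> v"
proof -
  interpret U: group "unitary_group S" by (rule group_unitary_group)
  have "v \<otimes>\<^bsub>unitary_group S\<^esub> w = w \<otimes>\<^bsub>unitary_group S\<^esub> v
      \<longleftrightarrow> (\<forall>f\<in>ell2 S. v (w f) = w (v f))"
  proof
    assume "\<forall>f\<in>ell2 S. v (w f) = w (v f)"
    then show "v \<otimes>\<^bsub>unitary_group S\<^esub> w = w \<otimes>\<^bsub>unitary_group S\<^esub> v"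
      by (intro unitary_ext[of _ S]) (use assms in \<open>auto simp: unitary_mult_apply\<close>)
  qed (metis unitary_mult_apply)
  then show ?thesis using assms by (auto simp: cent_def)
qed

lemma cent_sym:
  "v \<in> carrier (unitary_group S) \<Longrightarrow> w \<in> carrier (unitary_group S) \<Longrightarrow>
    v \<in> cent S w \<longleftrightarrow> w \<in> cent S v"
  by (auto simp: cent_def)

text \<open>The double commutant property is used twice: every \<open>b\<close> commutes with
  \<open>A\<close>, hence with \<open>v\<close>; so \<open>v\<close> commutes with \<open>B\<close>,
  hence with \<open>w\<close>.\<close>

lemma vgen_commute:
  assumes A: "A \<subseteq> carrier (unitary_group S)" "B \<subseteq> carrier (unitary_group S)"
    and comm: "\<And>a b. a \<in> A \<Longrightarrow> b \<in> B \<Longrightarrow>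
        a \<otimes>\<^bsub>unitary_group S\<^esub> b = b \<otimes>\<^bsub>unitary_group S\<^esub> a"
    and v: "v \<in> vgen S A" and w: "w \<in> vgen S B"
  shows "v \<otimes>\<^bsub>unitary_group S\<^esub> w = w \<otimes>\<^bsub>unitary_group S\<^esub> v"
proof -
  note vU = vgen_unitary[OF v] and wU = vgen_unitary[OF w]
  have "v \<in> cent S b" if "b \<in> B" for b
    by (rule vgenD[OF v]) (use A that comm in \<open>auto simp: unitary_bounded cent_commute subset_iff\<close>)
  then have "B \<subseteq> cent S v" using A vU by (auto simp: cent_sym subset_iff)
  then have "w \<in> cent S v" by (intro vgenD[OF w]) (auto simp: unitary_bounded vU)
  then show ?thesis using vU wU by (simp add: cent_commute)
qed

lemma commutant_eq_cent:
  assumes "A \<subseteq> carrier (unitary_group S)"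
  shows "X \<in> commutant S A \<longleftrightarrow> X \<in> bounded_operators S \<and> A \<subseteq> cent S X"
proof -
  have "A \<subseteq> bounded_operators S" using assms unitary_bounded by blast
  from commutant_iff[OF this] show ?thesis using assms by (auto simp: cent_def)
qed

section \<open>The left regular representation\<close>

context group
begin

lemma left_regular_apply:
  "f \<in> ell2 (carrier G) \<Longrightarrow> left_regular G g f = (\<lambda>x. if x \<in> carrier G then f (inv g \<otimes> x) else 0)"
  by (simp add: left_regular_def)

lemma bij_left_mult:
  assumes "g \<in> carrier G"
  shows "bij_betw (\<lambda>x. inv g \<otimes> x) (carrier G) (carrier G)"
  by (rule bij_betw_byWitness[where f' = "\<lambda>x. g \<otimes> x"])
     (use assms in \<open>auto simp: m_assoc[symmetric]\<close>)

lemma left_regular_ell2: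
  assumes g: "g \<in> carrier G" and f: "f \<in> ell2 (carrier G)"
  shows "left_regular G g f \<in> ell2 (carrier G)"
proof -
  have "(\<lambda>x. (cmod (f x))\<^sup>2) summable_on carrier G" using f by (simp add: ell2_def)
  then have "(\<lambda>x. (cmod (f (inv g \<otimes> x)))\<^sup>2) summable_on carrier G"
    using summable_on_reindex_bij_betw[OF bij_left_mult[OF g], of "\<lambda>x. (cmod (f x))\<^sup>2"] by simp
  then show ?thesis
    unfolding ell2_def left_regular_apply[OF f] by (simp cong: summable_on_cong)
qed

lemma left_regular_inner:
  assumes g: "g \<in> carrier G" and f: "f \<in> ell2 (carrier G)" "h \<in> ell2 (carrier G)"
  shows "ell2_inner (carrier G) (left_regular G g f) (left_regular G g h) = ell2_inner (carrier G) f h"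
proof -
  have "ell2_inner (carrier G) (left_regular G g f) (left_regular G g h)
      = (\<Sum>\<^sub>\<infinity>x\<in>carrier G. f (inv g \<otimes> x) * cnj (h (inv g \<otimes> x)))"
    unfolding ell2_inner_def by (rule infsum_cong) (simp add: left_regular_apply f)
  also have "\<dots> = ell2_inner (carrier G) f h"
    unfolding ell2_inner_def
    using infsum_reindex_bij_betw[OF bij_left_mult[OF g], of "\<lambda>x. f x * cnj (h x)"] .
  finally show ?thesis .
qed

lemma left_regular_mult_apply:
  assumes "g \<in> carrier G" "h \<in> carrier G" "f \<in> ell2 (carrier G)"
  shows "left_regular G g (left_regular G h f) = left_regular G (g \<otimes> h) f"
  by (subst left_regular_apply[OF left_regular_ell2[OF assms(2,3)]])
     (use assms in \<open>auto simp: left_regular_apply inv_mult_group m_assoc\<close>)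

lemma left_regular_one: "f \<in> ell2 (carrier G) \<Longrightarrow> left_regular G \<one> f = f"
  by (auto simp: left_regular_apply ell2_D fun_eq_iff)

lemma left_regular_delta:
  assumes "g \<in> carrier G" "x \<in> carrier G"
  shows "left_regular G g (delta x) = delta (g \<otimes> x)"
proof -
  have "inv g \<otimes> y = x \<longleftrightarrow> y = g \<otimes> x" if "y \<in> carrier G" for y
    using assms that by (metis inv_solve_left')
  then show ?thesis
    unfolding left_regular_apply[OF delta_ell2[OF assms(2)]]
    using assms by (auto simp: delta_def fun_eq_iff)
qed

lemma left_regular_hom: "left_regular G \<in> hom G (unitary_group (carrier G))"
proof (rule homI)
  fix g assume g: "g \<in> carrier G"
  have "bdd (carrier G) (carrier G) (left_regular G g)"
  proof -
    have "ell2_norm (carrier G) (left_regular G g f) = ell2_norm (carrier G) f"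
      if "f \<in> ell2 (carrier G)" for f
      using left_regular_inner[OF g that that] left_regular_ell2[OF g that] that
      by (simp add: inner_self del: of_real_power)
    moreover have "left_regular G g (\<lambda>x. f x + h x) = (\<lambda>x. left_regular G g f x + left_regular G g h x)"
      if "f \<in> ell2 (carrier G)" "h \<in> ell2 (carrier G)" for f h
      using that by (auto simp: left_regular_apply)
    moreover have "left_regular G g (\<lambda>x. c * f x) = (\<lambda>x. c * left_regular G g f x)"
      if "f \<in> ell2 (carrier G)" for f c
      using that by (auto simp: left_regular_apply)
    ultimately show ?thesis
      unfolding bdd_def using left_regular_ell2[OF g] by (auto intro!: exI[of _ 1])
  qed
  then have b: "left_regular G g \<in> bounded_operators (carrier G)"
    by (auto simp: bounded_operators_iff left_regular_def)
  show "left_regular G g \<in> carrier (unitary_group (carrier G))"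
  proof (rule unitary_groupI[OF b])
    fix f assume f: "f \<in> ell2 (carrier G)"
    then have "left_regular G g (left_regular G (inv g) f) = f"
      using g by (simp add: left_regular_mult_apply left_regular_one)
    then show "\<exists>h\<in>ell2 (carrier G). left_regular G g h = f"
      using left_regular_ell2[of "inv g" f] f g by auto
  qed (rule left_regular_inner[OF g])
  fix h assume "h \<in> carrier G"
  then show "left_regular G (g \<otimes> h) =
      left_regular G g \<otimes>\<^bsub>unitary_group (carrier G)\<^esub> left_regular G h"
    using left_regular_mult_apply[OF g]
    by (simp add: unitary_group_def op_mult_def compose_def left_regular_def[of G "g \<otimes> h"]
        left_regular_apply cong: restrict_cong)
qed

lemma left_regular_unitary: "g \<in> carrier G \<Longrightarrow> left_regular G g \<in> carrier (unitary_group (carrier G))"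
  using left_regular_hom by (auto simp: hom_def)

end

section \<open>Comparing group von Neumann algebras\<close>

lemma delta_apply: "delta x y = (if y = x then 1 else 0)"
  by (simp add: delta_def)

lemma commutant_hom_image:
  assumes "\<rho> \<in> hom L (unitary_group S)"
  shows "X \<in> commutant S (\<rho> ` carrier L) \<longleftrightarrow>
    X \<in> bounded_operators S \<and> (\<forall>x\<in>carrier L. \<rho> x \<in> cent S X)"
  using assms by (subst commutant_eq_cent) (auto simp: hom_def)

text \<open>If a unitary representation \<open>\<rho>\<close> of \<open>L\<close> on $\ell^2(E)$ generates the same von Neumann algebra
  as the left regular representation of \<open>E\<close> and has the trace of the regular representation, then
  the vectors \<open>\<rho> x (delta \<one>)\<close> form an orthonormal basis: the projection onto their span commutes
  with \<open>\<rho>\<close>, hence with the left regular representation, and fixes \<open>delta \<one>\<close>.\<close>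

lemma (in group) vN_equivalent_by_representation:
  assumes L: "group L"
    and hom: "\<rho> \<in> hom L (unitary_group (carrier G))"
    and trace: "\<And>x. x \<in> carrier L \<Longrightarrow> x \<noteq> \<one>\<^bsub>L\<^esub> \<Longrightarrow> \<rho> x (delta \<one>) \<one> = 0"
    and comm: "\<And>X. X \<in> bounded_operators (carrier G) \<Longrightarrow>
       (\<forall>x\<in>carrier L. \<rho> x \<in> cent (carrier G) X) \<longleftrightarrow>
       (\<forall>g\<in>carrier G. left_regular G g \<in> cent (carrier G) X)"
  shows "vN_equivalent G L" "vN_equivalent L G"
proof -
  interpret L: group L by (rule L)
  interpret U: group "unitary_group (carrier G)" by (rule group_unitary_group)
  interpret \<rho>: group_hom L "unitary_group (carrier G)" \<rho>
    by unfold_locales (rule hom)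
  let ?S = "carrier G" and ?X = "carrier L"
  define b where "b x = \<rho> x (delta \<one>)" for x
  have bb: "b x \<in> ell2 ?S" if "x \<in> ?X" for x
    unfolding b_def using that by (simp add: unitary_closed)
  have \<rho>\<rho>: "\<rho> x (\<rho> y f) = \<rho> (x \<otimes>\<^bsub>L\<^esub> y) f" if "x \<in> ?X" "y \<in> ?X" "f \<in> ell2 ?S" for x y f
    using that by (simp add: unitary_mult_apply)
  have \<rho>1: "\<rho> \<one>\<^bsub>L\<^esub> f = f" if "f \<in> ell2 ?S" for f
    using that by (simp add: unitary_one_apply)
  have \<rho>_inner: "ell2_inner ?S (\<rho> x f) g = ell2_inner ?S f (\<rho> (inv\<^bsub>L\<^esub> x) g)"
    if "x \<in> ?X" "f \<in> ell2 ?S" "g \<in> ell2 ?S" for x f g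
    using unitary_inner[of "\<rho> x" ?S f "\<rho> (inv\<^bsub>L\<^esub> x) g"] that \<rho>\<rho>[of x "inv\<^bsub>L\<^esub> x" g] \<rho>1
    by (simp add: unitary_closed del: \<rho>.hom_inv)
  have \<rho>b: "\<rho> x (b y) = b (x \<otimes>\<^bsub>L\<^esub> y)" if "x \<in> ?X" "y \<in> ?X" for x y
    using that by (simp add: b_def \<rho>\<rho> del: \<rho>.hom_mult)
  have on: "ell2_inner ?S (b x) (b y) = (if x = y then 1 else 0)" if xy: "x \<in> ?X" "y \<in> ?X" for x y
  proof -
    have "ell2_inner ?S (b x) (b y) = cnj (ell2_inner ?S (\<rho> y (delta \<one>)) (b x))"
      by (simp add: inner_cnj b_def)
    also have "\<dots> = cnj (ell2_inner ?S (delta \<one>) (b (inv\<^bsub>L\<^esub> y \<otimes>\<^bsub>L\<^esub> x)))"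
      using xy by (simp add: \<rho>_inner bb \<rho>b del: \<rho>.hom_inv)
    also have "\<dots> = b (inv\<^bsub>L\<^esub> y \<otimes>\<^bsub>L\<^esub> x) \<one>" by (simp add: inner_delta_left)
    also have "\<dots> = (if x = y then 1 else 0)"
    proof (cases "x = y")
      case True
      then show ?thesis using xy \<rho>1[of "delta \<one>"] by (simp add: b_def delta_apply)
    next
      case False
      then have "inv\<^bsub>L\<^esub> y \<otimes>\<^bsub>L\<^esub> x \<noteq> \<one>\<^bsub>L\<^esub>"
        using xy by (metis L.inv_equality L.inv_inv L.inv_closed)
      then show ?thesis
        using False trace[of "inv\<^bsub>L\<^esub> y \<otimes>\<^bsub>L\<^esub> x"] xy
        by (simp add: b_def del: \<rho>.hom_mult)
    qed
    finally show ?thesis .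
  qed
  define A where "A = coef ?X ?S b"
  define V where "V = adj ?S ?X A"
  have A: "bdd ?S ?X A" unfolding A_def by (rule coef_bdd) (auto simp: bb on)
  have V: "bdd ?X ?S V" unfolding V_def by (rule adj_bdd[OF A])
  have Vd: "V (delta x) = b x" if "x \<in> ?X" for x
    unfolding V_def A_def by (rule adj_coef_delta) (use that in \<open>auto simp: bb on\<close>)
  have AV: "A (V g) = g" if "g \<in> ell2 ?X" for g
    unfolding V_def A_def by (rule coef_adj) (use that in \<open>auto simp: bb on\<close>)
  have Ab: "A (b x) = delta x" if "x \<in> ?X" for x
    unfolding A_def by (rule coef_basis) (use that in \<open>auto simp: bb on\<close>)
  have A\<rho>: "A (\<rho> x h) = left_regular L x (A h)" if x: "x \<in> ?X" and h: "h \<in> ell2 ?S" for x h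
  proof
    fix y
    have Ah: "A h \<in> ell2 ?X" by (rule bdd_closed[OF A h])
    show "A (\<rho> x h) y = left_regular L x (A h) y"
      unfolding L.left_regular_apply[OF Ah]
      using x h by (simp add: A_def coef_def \<rho>_inner bb \<rho>b del: \<rho>.hom_inv)
  qed
  have V\<rho>: "V (left_regular L x g) = \<rho> x (V g)" if x: "x \<in> ?X" and g: "g \<in> ell2 ?X" for x g
  proof (rule bdd_ext[OF _ _ _ g])
    note lb = bounded_operators_bdd[OF unitary_bounded]
    show "bdd ?X ?S (\<lambda>g. V (left_regular L x g))"
      by (rule bdd_compose[OF lb[OF L.left_regular_unitary[OF x]] V])
    show "bdd ?X ?S (\<lambda>g. \<rho> x (V g))"
      by (rule bdd_compose[OF V lb]) (use x in simp)
    show "V (left_regular L x (delta y)) = \<rho> x (V (delta y))" if "y \<in> ?X" for y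
      using x that by (simp add: L.left_regular_delta Vd \<rho>b)
  qed
  \<comment> \<open>The projection onto the closed span of the vectors \<open>b x\<close>. It
    commutes with every \<open>\<rho> x\<close> because \<open>A\<close> and \<open>V\<close>
    intertwine \<open>\<rho>\<close> with the left regular representation of
    \<open>L\<close>.\<close>
  define Q where "Q = (\<lambda>f\<in>ell2 ?S. V (A f))"
  have Qb: "Q \<in> bounded_operators ?S"
    unfolding Q_def by (rule bdd_restrict[OF bdd_compose[OF A V]])
  have "\<forall>x\<in>?X. \<rho> x \<in> cent ?S Q"
    by (auto simp: cent_def Q_def unitary_closed A\<rho> V\<rho> bdd_closed[OF A])
  then have Ql: "left_regular G g \<in> cent ?S Q" if "g \<in> ?S" for g using comm[OF Qb] that by blast
  have Q1: "Q (delta \<one>) = delta \<one>"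
  proof -
    have "delta \<one> = b \<one>\<^bsub>L\<^esub>" using \<rho>1[of "delta \<one>"] by (simp add: b_def)
    then show ?thesis by (simp add: Q_def Ab Vd bb)
  qed
  have VA: "V (A f) = f" if f: "f \<in> ell2 ?S" for f
  proof -
    have "V (A f) = Q f" using f by (simp add: Q_def)
    also have "\<dots> = f"
    proof (rule bdd_ext[OF bounded_operators_bdd[OF Qb] _ _ f])
      show "bdd ?S ?S (\<lambda>g. g)" by (auto simp: bdd_def intro: exI[of _ 1])
      fix g assume g: "g \<in> ?S"
      have "Q (left_regular G g (delta \<one>)) = left_regular G g (Q (delta \<one>))"
        using Ql[OF g] by (simp add: cent_def)
      then show "Q (delta g) = delta g" using g by (simp add: Q1 left_regular_delta)
    qed
    finally show ?thesis .
  qed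
  have Vinner: "ell2_inner ?S (V f) (V g) = ell2_inner ?X f g"
    if "f \<in> ell2 ?X" "g \<in> ell2 ?X" for f g
    using adj_inner[OF A, of "V f" g] that by (simp add: V_def[symmetric] AV bdd_closed[OF V])
  have Ainner: "ell2_inner ?X (A f) (A g) = ell2_inner ?S f g"
    if "f \<in> ell2 ?S" "g \<in> ell2 ?S" for f g
    using Vinner[of "A f" "A g"] that by (simp add: VA bdd_closed[OF A])
  have lrL: "Z \<in> commutant ?X (left_regular L ` ?X) \<longleftrightarrow>
      Z \<in> bounded_operators ?X \<and> (\<forall>x\<in>?X. left_regular L x \<in> cent ?X Z)" for Z
    by (rule commutant_hom_image[OF L.left_regular_hom])
  \<comment> \<open>The hypothesis \<open>comm\<close> enters a second time: membership in the
    commutant of the translations of \<open>G\<close> may be tested on the operators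
    \<open>\<rho> x\<close>, which conjugation does carry to the translations of
    \<open>L\<close>.\<close>
  have lrG: "Z \<in> commutant ?S (left_regular G ` ?S) \<longleftrightarrow>
      Z \<in> bounded_operators ?S \<and> (\<forall>x\<in>?X. \<rho> x \<in> cent ?S Z)" for Z
    using commutant_hom_image[OF left_regular_hom] comm by blast
  have LG: "(\<lambda>f\<in>ell2 ?S. V (Z (A f))) \<in> commutant ?S (left_regular G ` ?S) \<longleftrightarrow>
      Z \<in> commutant ?X (left_regular L ` ?X)" if Z: "Z \<in> bounded_operators ?X" for Z
  proof -
    note cl = bounded_operators_closed[OF Z] bdd_closed[OF A] bdd_closed[OF V]
    have b: "(\<lambda>f\<in>ell2 ?S. V (Z (A f))) \<in> bounded_operators ?S"
      by (rule bdd_restrict[OF bdd_compose[OF A bdd_compose[OF bounded_operators_bdd[OF Z] V]]])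
    have "\<rho> x \<in> cent ?S (\<lambda>f\<in>ell2 ?S. V (Z (A f))) \<longleftrightarrow> left_regular L x \<in> cent ?X Z"
      if x: "x \<in> ?X" for x
    proof -
      have lc: "left_regular L x f \<in> ell2 ?X" if "f \<in> ell2 ?X" for f
        by (rule L.left_regular_ell2[OF x that])
      have "\<rho> x \<in> cent ?S (\<lambda>f\<in>ell2 ?S. V (Z (A f))) \<longleftrightarrow>
          (\<forall>f\<in>ell2 ?S. V (Z (left_regular L x (A f))) = V (left_regular L x (Z (A f))))"
        using x by (simp add: cent_def unitary_closed A\<rho> V\<rho> cl)
      also have "\<dots> \<longleftrightarrow> (\<forall>g\<in>ell2 ?X. Z (left_regular L x g) = left_regular L x (Z g))"
      proof safe
        fix g assume "\<forall>f\<in>ell2 ?S. V (Z (left_regular L x (A f))) = V (left_regular L x (Z (A f)))"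
          and g: "g \<in> ell2 ?X"
        then have "V (Z (left_regular L x g)) = V (left_regular L x (Z g))"
          using AV[OF g] cl(3)[OF g] by metis
        then show "Z (left_regular L x g) = left_regular L x (Z g)"
          using AV lc cl(1) g by metis
      qed (simp add: cl(2))
      finally show ?thesis using x by (simp add: cent_def L.left_regular_unitary)
    qed
    then show ?thesis unfolding lrG lrL using b Z by auto
  qed
  show "vN_equivalent G L"
    unfolding vN_equivalent_def group_vN_def
    by (rule spatial_star_isomorphic[OF A V VA AV Ainner LG[symmetric]])
  show "vN_equivalent L G"
    unfolding vN_equivalent_def group_vN_def
  proof (rule spatial_star_isomorphic[OF V A AV VA Vinner])
    fix Z assume Z: "Z \<in> bounded_operators ?S"
    let ?W = "\<lambda>g\<in>ell2 ?X. A (Z (V g))"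
    have W: "?W \<in> bounded_operators ?X"
      by (rule bdd_restrict[OF bdd_compose[OF V bdd_compose[OF bounded_operators_bdd[OF Z] A]]])
    have "(\<lambda>f\<in>ell2 ?S. V (?W (A f))) = Z"
    proof (rule bounded_operators_ext[of _ ?S])
      show "(\<lambda>f\<in>ell2 ?S. V (?W (A f))) \<in> bounded_operators ?S"
        by (rule bdd_restrict[OF bdd_compose[OF A bdd_compose[OF bounded_operators_bdd[OF W] V]]])
    qed (simp_all add: Z VA bdd_closed[OF A] bounded_operators_closed[OF Z])
    then show "Z \<in> commutant ?S (left_regular G ` ?S) \<longleftrightarrow>
        ?W \<in> commutant ?X (left_regular L ` ?X)" using LG[OF W] by simp
  qed
qed

lemma vN_equivalent_trans:
  assumes "vN_equivalent G H" "vN_equivalent H K"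
  shows "vN_equivalent G K"
proof -
  obtain \<Phi> where \<Phi>: "bij_betw \<Phi> (group_vN G) (group_vN H)"
    "\<forall>T\<in>group_vN G. \<forall>U\<in>group_vN G. \<Phi> (op_add (carrier G) T U) = op_add (carrier H) (\<Phi> T) (\<Phi> U)"
    "\<forall>c. \<forall>T\<in>group_vN G. \<Phi> (op_scale (carrier G) c T) = op_scale (carrier H) c (\<Phi> T)"
    "\<forall>T\<in>group_vN G. \<forall>U\<in>group_vN G. \<Phi> (op_mult (carrier G) T U) = op_mult (carrier H) (\<Phi> T) (\<Phi> U)"
    "\<forall>T\<in>group_vN G. \<Phi> (op_adjoint (carrier G) T) = op_adjoint (carrier H) (\<Phi> T)"
    using assms(1) unfolding vN_equivalent_def star_isomorphic_def by blast
  obtain \<Psi> where \<Psi>: "bij_betw \<Psi> (group_vN H) (group_vN K)"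
    "\<forall>T\<in>group_vN H. \<forall>U\<in>group_vN H. \<Psi> (op_add (carrier H) T U) = op_add (carrier K) (\<Psi> T) (\<Psi> U)"
    "\<forall>c. \<forall>T\<in>group_vN H. \<Psi> (op_scale (carrier H) c T) = op_scale (carrier K) c (\<Psi> T)"
    "\<forall>T\<in>group_vN H. \<forall>U\<in>group_vN H. \<Psi> (op_mult (carrier H) T U) = op_mult (carrier K) (\<Psi> T) (\<Psi> U)"
    "\<forall>T\<in>group_vN H. \<Psi> (op_adjoint (carrier H) T) = op_adjoint (carrier K) (\<Psi> T)"
    using assms(2) unfolding vN_equivalent_def star_isomorphic_def by blast
  have im: "\<Phi> T \<in> group_vN H" if "T \<in> group_vN G" for T
    using \<Phi>(1) that by (auto simp: bij_betw_def)
  show ?thesis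
    unfolding vN_equivalent_def star_isomorphic_def
    by (rule exI[of _ "\<Psi> \<circ> \<Phi>"]) (use \<Phi> \<Psi> im bij_betw_trans[OF \<Phi>(1) \<Psi>(1)] in auto)
qed

text \<open>The representation to compare with is the left regular representation of
  \<open>H\<close>, pulled back along \<open>\<theta>\<close>.\<close>

lemma iso_vN_equivalent:
  assumes G: "group G" and H: "group H" and iso: "G \<cong> H"
  shows "vN_equivalent G H"
proof -
  interpret G: group G by (rule G)
  interpret H: group H by (rule H)
  obtain \<theta> where \<theta>: "\<theta> \<in> iso G H" using iso by (auto simp: is_iso_def)
  then have hom: "\<theta> \<in> hom G H" and bij: "bij_betw \<theta> (carrier G) (carrier H)"
    by (auto simp: iso_def)
  interpret \<theta>: group_hom G H \<theta> by unfold_locales (rule hom)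
  show ?thesis
  proof (rule H.vN_equivalent_by_representation(2)[OF G, where \<rho> = "left_regular H \<circ> \<theta>"])
    show "left_regular H \<circ> \<theta> \<in> hom G (unitary_group (carrier H))"
      by (rule hom_compose[OF hom H.left_regular_hom])
    fix x assume x: "x \<in> carrier G" "x \<noteq> \<one>\<^bsub>G\<^esub>"
    then have "\<theta> x \<noteq> \<one>\<^bsub>H\<^esub>" using bij
      by (metis G.one_closed \<theta>.hom_one bij_betw_imp_inj_on inj_on_def)
    then show "(left_regular H \<circ> \<theta>) x (delta \<one>\<^bsub>H\<^esub>) \<one>\<^bsub>H\<^esub> = 0"
      using x by (simp add: H.left_regular_delta delta_apply)
  next
    fix X
    have "\<theta> ` carrier G = carrier H" using bij by (simp add: bij_betw_def)
    then show "(\<forall>x\<in>carrier G. (left_regular H \<circ> \<theta>) x \<in> cent (carrier H) X) \<longleftrightarrow>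
        (\<forall>g\<in>carrier H. left_regular H g \<in> cent (carrier H) X)"
      by (metis comp_apply image_iff)
  qed
qed

text \<open>Multiplication by the indicator function of a subgroup commutes with its translations, so
  operators generated by these preserve supports in its cosets.\<close>

lemma (in group) vgen_delta_one:
  assumes B: "subgroup B G" and v: "v \<in> vgen (carrier G) (left_regular G ` B)"
    and x: "x \<in> carrier G" "x \<notin> B"
  shows "v (delta x) \<one> = 0"
proof -
  interpret B: subgroup B G by (rule B)
  let ?S = "carrier G"
  define P where "P = (\<lambda>f\<in>ell2 ?S. cut B f)"
  have "bdd ?S ?S (cut B)"
  proof -
    have "ell2_norm ?S (cut B f) \<le> 1 * ell2_norm ?S f" if "f \<in> ell2 ?S" for f
    proof -
      have "(ell2_norm ?S (cut B f))\<^sup>2 \<le> (ell2_norm ?S f)\<^sup>2"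
        unfolding ell2_norm_square using cut_ell2[OF that, of B] that
        by (intro infsum_mono) (auto simp: ell2_def cut_def)
      then show ?thesis by (simp add: abs_le_square_iff[symmetric])
    qed
    then have "\<exists>K. \<forall>f\<in>ell2 ?S. ell2_norm ?S (cut B f) \<le> K * ell2_norm ?S f" by blast
    then show ?thesis
      by (auto simp: bdd_def cut_ell2) (auto simp: cut_def)
  qed
  then have Pb: "P \<in> bounded_operators ?S" unfolding P_def by (rule bdd_restrict)
  have "left_regular G b \<in> cent ?S P" if b: "b \<in> B" for b
  proof -
    have "cut B (left_regular G b f) = left_regular G b (cut B f)" if f: "f \<in> ell2 ?S" for f
    proof -
      have "inv b \<otimes> y \<in> B \<longleftrightarrow> y \<in> B" if "y \<in> ?S" for y
        using b that by (metis B.m_closed B.m_inv_closed B.mem_carrier inv_solve_left')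
      then show ?thesis
        unfolding left_regular_apply[OF f] left_regular_apply[OF cut_ell2[OF f]]
        by (auto simp: cut_def)
    qed
    then show ?thesis using b by (auto simp: cent_def left_regular_unitary left_regular_ell2 P_def)
  qed
  then have "v \<in> cent ?S P" by (intro vgenD[OF v Pb]) auto
  then have "P (v (delta x)) = v (P (delta x))" using x by (simp add: cent_def)
  moreover have "P (delta x) = (\<lambda>_. 0)" using x by (auto simp: P_def cut_def delta_apply)
  moreover have "v (\<lambda>_. 0) = (\<lambda>_. 0)"
    using bdd_zero[OF bounded_operators_bdd[OF unitary_bounded[OF vgen_unitary[OF v]]]] .
  moreover have "P (v (delta x)) \<one> = v (delta x) \<one>"
    using unitary_closed[OF vgen_unitary[OF v] delta_ell2[OF x(1)]] by (simp add: P_def cut_def)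
  ultimately show ?thesis by metis
qed

section \<open>Roots of translations\<close>

lemma unitary_pow_apply:
  assumes "v \<in> carrier (unitary_group S)" "f \<in> ell2 S"
  shows "(v [^]\<^bsub>unitary_group S\<^esub> (q::nat)) f = (v ^^ q) f"
proof -
  interpret U: group "unitary_group S" by (rule group_unitary_group)
  show ?thesis using assms(2)
  proof (induction q arbitrary: f)
    case 0
    then show ?case by (simp add: unitary_one_apply)
  next
    case (Suc q)
    then show ?case
      using unitary_closed[OF assms(1)]
      by (simp add: unitary_mult_apply funpow_swap1)
  qed
qed

lemma bdd_funpow: "bdd S S T \<Longrightarrow> bdd S S (T ^^ q)"
proof (induction q)
  case 0
  show ?case by (auto simp: bdd_def intro: exI[of _ 1])
next
  case (Suc q)
  then show ?case using bdd_compose[of S S "T ^^ q" S T] by (simp add: comp_def)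
qed

lemma bdd_scaleI:
  assumes "bdd S S' T"
  shows "bdd S S' (\<lambda>f x. c * T f x)"
proof -
  have "bdd S' S' (\<lambda>f x. c * f x)"
  proof -
    have "ell2_norm S' (\<lambda>x. c * f x) = cmod c * ell2_norm S' f" if "f \<in> ell2 S'" for f
    proof -
      have "(ell2_norm S' (\<lambda>x. c * f x))\<^sup>2 = (cmod c * ell2_norm S' f)\<^sup>2"
        unfolding power_mult_distrib ell2_norm_square
        by (simp add: norm_mult power_mult_distrib infsum_cmult_right')
      then show ?thesis by simp
    qed
    then have "\<exists>K. \<forall>f\<in>ell2 S'. ell2_norm S' (\<lambda>x. c * f x) \<le> K * ell2_norm S' f"
      by (intro exI[of _ "cmod c"]) simp
    then show ?thesis by (auto simp: bdd_def algebra_simps)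
  qed
  from bdd_compose[OF assms this] show ?thesis .
qed

context group
begin

lemma mult_inv_cancel:
  assumes "x \<in> carrier G" "a \<in> carrier G"
  shows "x \<otimes> (inv x \<otimes> a) = a" "inv x \<otimes> (x \<otimes> a) = a"
  using assms by (simp_all add: m_assoc[symmetric])

lemma bij_right_mult: "y \<in> carrier G \<Longrightarrow> bij_betw (\<lambda>t. t \<otimes> y) (carrier G) (carrier G)"
  by (rule bij_betw_byWitness[where f' = "\<lambda>x. x \<otimes> inv y"]) (auto simp: m_assoc)

lemma bij_inv_mult: "x \<in> carrier G \<Longrightarrow> bij_betw (\<lambda>t. inv t \<otimes> x) (carrier G) (carrier G)"
  by (rule bij_betw_byWitness[where f' = "\<lambda>w. x \<otimes> inv w"])
     (auto simp: inv_mult_group m_assoc mult_inv_cancel)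

lemma bij_mult_inv: "x \<in> carrier G \<Longrightarrow> bij_betw (\<lambda>t. x \<otimes> inv t) (carrier G) (carrier G)"
  by (rule bij_betw_byWitness[where f' = "\<lambda>w. inv w \<otimes> x"])
     (auto simp: inv_mult_group m_assoc mult_inv_cancel)

text \<open>\<open>\<kappa> q\<close> plays the role of the convolution kernel of the \<open>q\<close>-th power of the root, up to
  scalars; these are removed at the end.\<close>

lemma root_from_kernel:
  fixes \<kappa> :: "nat \<Rightarrow> 'a \<Rightarrow> complex"
  assumes c: "c \<in> carrier G" and n: "n \<ge> 1"
    and supp: "\<And>x. x \<in> carrier G \<Longrightarrow> \<kappa> 1 x \<noteq> 0 \<Longrightarrow> \<exists>j::int. x = c [^] j"
    and sq: "(\<lambda>x. (cmod (\<kappa> 1 x))\<^sup>2) summable_on carrier G"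
    and on: "\<And>g. g \<in> carrier G \<Longrightarrow>
       (\<Sum>\<^sub>\<infinity>t\<in>carrier G. \<kappa> 1 (g \<otimes> t) * cnj (\<kappa> 1 t)) = (if g = \<one> then 1 else 0)"
    and conv: "\<And>q. 1 \<le> q \<Longrightarrow> q < n \<Longrightarrow>
       \<exists>\<tau>. \<forall>g\<in>carrier G. (\<Sum>\<^sub>\<infinity>t\<in>carrier G. \<kappa> 1 t * \<kappa> q (inv t \<otimes> g)) = \<tau> * \<kappa> (Suc q) g"
    and \<kappa>n: "\<And>x. x \<in> carrier G \<Longrightarrow> \<kappa> n x = (if x = c then 1 else 0)"
  shows "\<exists>v \<in> vgen (carrier G) {left_regular G c}.
    v [^]\<^bsub>unitary_group (carrier G)\<^esub> n = left_regular G c"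
proof -
  interpret U: group "unitary_group (carrier G)" by (rule group_unitary_group)
  let ?S = "carrier G"
  \<comment> \<open>The conjugated rows of the convolution matrix, chosen so that their coefficient
    map is convolution by \<open>\<kappa> 1\<close>. The hypothesis \<open>on\<close> says that they
    are orthonormal.\<close>
  define b where "b x = (\<lambda>y. if y \<in> ?S then cnj (\<kappa> 1 (x \<otimes> inv y)) else 0)" for x
  have bb: "b x \<in> ell2 ?S" if "x \<in> ?S" for x
    using summable_on_reindex_bij_betw[OF bij_mult_inv[OF that], of "\<lambda>x. (cmod (\<kappa> 1 x))\<^sup>2"] sq
    by (simp add: ell2_def b_def cong: summable_on_cong)
  have bon: "ell2_inner ?S (b x) (b y) = (if x = y then 1 else 0)" if xy: "x \<in> ?S" "y \<in> ?S" for x y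
  proof -
    have "ell2_inner ?S (b x) (b y)
        = (\<Sum>\<^sub>\<infinity>w\<in>?S. \<kappa> 1 ((y \<otimes> inv x) \<otimes> (x \<otimes> inv w)) * cnj (\<kappa> 1 (x \<otimes> inv w)))"
      unfolding ell2_inner_def
      by (rule infsum_cong) (use xy in \<open>simp add: b_def m_assoc mult_inv_cancel\<close>)
    also have "\<dots> = (\<Sum>\<^sub>\<infinity>t\<in>?S. \<kappa> 1 ((y \<otimes> inv x) \<otimes> t) * cnj (\<kappa> 1 t))"
      by (rule infsum_reindex_bij_betw[OF bij_mult_inv[OF xy(1)]])
    also have "\<dots> = (if y \<otimes> inv x = \<one> then 1 else 0)"
      by (rule on) (use xy in simp)
    also have "y \<otimes> inv x = \<one> \<longleftrightarrow> x = y" using xy by (metis inv_solve_right' l_one one_closed)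
    finally show ?thesis .
  qed
  define A where "A = coef ?S ?S b"
  have Ab: "bdd ?S ?S A" unfolding A_def by (rule coef_bdd) (auto simp: bb bon)
  have A_apply: "A f x = (\<Sum>\<^sub>\<infinity>t\<in>?S. \<kappa> 1 t * f (inv t \<otimes> x))" if "x \<in> ?S" for f x
  proof -
    have "A f x = (\<Sum>\<^sub>\<infinity>w\<in>?S. f w * \<kappa> 1 (x \<otimes> inv w))"
      unfolding A_def coef_def ell2_inner_def using that by (simp add: b_def cong: infsum_cong)
    also have "\<dots> = (\<Sum>\<^sub>\<infinity>t\<in>?S. f (inv t \<otimes> x) * \<kappa> 1 (x \<otimes> inv (inv t \<otimes> x)))"
      by (rule infsum_reindex_bij_betw[OF bij_inv_mult[OF that], symmetric])
    also have "\<dots> = (\<Sum>\<^sub>\<infinity>t\<in>?S. \<kappa> 1 t * f (inv t \<otimes> x))"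
      by (rule infsum_cong) (use that in \<open>simp add: inv_mult_group m_assoc[symmetric]\<close>)
    finally show ?thesis .
  qed
  have A_delta: "A (delta y) x = \<kappa> 1 (x \<otimes> inv y)" if "x \<in> ?S" "y \<in> ?S" for x y
    using that by (simp add: A_def coef_def inner_delta_left bb b_def)
  \<comment> \<open>If \<open>X\<close> commutes with the translation by \<open>c\<close>, its
    matrix entries do not change when both indices are multiplied from the left by the same power of
    \<open>c\<close>; and \<open>\<kappa> 1\<close> is supported on these powers.\<close>
  have A_comm: "X (A f) = A (X f)"
    if X: "X \<in> bounded_operators ?S" and cX: "left_regular G c \<in> cent ?S X" and f: "f \<in> ell2 ?S" for X f
  proof (rule bdd_ext[OF _ _ _ f])
    note Xb = bounded_operators_bdd[OF X]
    show "bdd ?S ?S (\<lambda>f. X (A f))" "bdd ?S ?S (\<lambda>f. A (X f))"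
      by (rule bdd_compose[OF Ab Xb], rule bdd_compose[OF Xb Ab])
    fix y assume y: "y \<in> ?S"
    have Ad: "A (delta y) \<in> ell2 ?S" and Xd: "X (delta y) \<in> ell2 ?S"
      using y by (auto intro: bdd_closed[OF Ab] bdd_closed[OF Xb])
    show "X (A (delta y)) = A (X (delta y))"
    proof (rule ell2_ext)
      fix x assume x: "x \<in> ?S"
      have Xa: "adj ?S ?S X (delta x) \<in> ell2 ?S" by (rule bdd_closed[OF adj_bdd[OF Xb]]) (simp add: x)
      have "X (A (delta y)) x = ell2_inner ?S (A (delta y)) (adj ?S ?S X (delta x))"
        using adj_inner[OF Xb Ad delta_ell2[OF x]] inner_delta_right[OF x] by metis
      also have "\<dots> = (\<Sum>\<^sub>\<infinity>w\<in>?S. \<kappa> 1 (w \<otimes> inv y) * X (delta w) x)"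
        unfolding ell2_inner_def
        by (rule infsum_cong) (use x y in \<open>simp add: A_delta adj_def inner_delta_right\<close>)
      also have "\<dots> = (\<Sum>\<^sub>\<infinity>t\<in>?S. \<kappa> 1 (t \<otimes> y \<otimes> inv y) * X (delta (t \<otimes> y)) x)"
        by (rule infsum_reindex_bij_betw[OF bij_right_mult[OF y], symmetric])
      also have "\<dots> = (\<Sum>\<^sub>\<infinity>t\<in>?S. \<kappa> 1 t * X (delta y) (inv t \<otimes> x))"
      proof (rule infsum_cong)
        fix t assume t: "t \<in> ?S"
        have "X (delta (t \<otimes> y)) x = X (delta y) (inv t \<otimes> x)" if nz: "\<kappa> 1 t \<noteq> 0"
        proof -
          obtain j :: int where j: "t = c [^] j" using supp[OF t nz] by blast
          interpret L: group_hom G "unitary_group ?S" "left_regular G"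
            by unfold_locales (rule left_regular_hom)
          have "left_regular G t = left_regular G c [^]\<^bsub>unitary_group ?S\<^esub> j"
            unfolding j by (rule L.hom_int_pow[OF c])
          then have "left_regular G t \<in> cent ?S X"
            using U.subgroup_int_pow_closed[OF subgroup_cent[OF X] cX] by simp
          then have "X (left_regular G t (delta y)) = left_regular G t (X (delta y))"
            using y by (simp add: cent_def)
          then show ?thesis
            using t y x by (simp add: left_regular_delta left_regular_apply[OF Xd])
        qed
        then show "\<kappa> 1 (t \<otimes> y \<otimes> inv y) * X (delta (t \<otimes> y)) x = \<kappa> 1 t * X (delta y) (inv t \<otimes> x)"
          using t y by (cases "\<kappa> 1 t = 0") (auto simp: m_assoc)
      qed
      also have "\<dots> = A (X (delta y)) x" by (rule A_apply[OF x, symmetric])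
      finally show "X (A (delta y)) x = A (X (delta y)) x" .
    qed (use y in \<open>auto intro!: bdd_closed[OF Ab] bdd_closed[OF Xb]\<close>)
  qed
  have pow: "\<exists>\<tau>. \<forall>x\<in>?S. \<forall>y\<in>?S. (A ^^ q) (delta y) x = \<tau> * \<kappa> q (x \<otimes> inv y)"
    if "1 \<le> q" "q \<le> n" for q
    using that
  proof (induction q rule: nat_induct_at_least)
    case base
    show ?case by (rule exI[of _ 1]) (simp add: A_delta)
  next
    case (Suc q)
    then obtain \<tau> where \<tau>: "\<And>x y. x \<in> ?S \<Longrightarrow> y \<in> ?S \<Longrightarrow> (A ^^ q) (delta y) x = \<tau> * \<kappa> q (x \<otimes> inv y)"
      by auto
    obtain \<tau>' where \<tau>': "\<And>g. g \<in> ?S \<Longrightarrow> (\<Sum>\<^sub>\<infinity>t\<in>?S. \<kappa> 1 t * \<kappa> q (inv t \<otimes> g)) = \<tau>' * \<kappa> (Suc q) g"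
      using conv[of q] Suc by auto
    have "(A ^^ Suc q) (delta y) x = (\<tau> * \<tau>') * \<kappa> (Suc q) (x \<otimes> inv y)"
      if x: "x \<in> ?S" and y: "y \<in> ?S" for x y
    proof -
      have "(A ^^ Suc q) (delta y) x = (\<Sum>\<^sub>\<infinity>t\<in>?S. \<kappa> 1 t * (A ^^ q) (delta y) (inv t \<otimes> x))"
        by (simp add: A_apply[OF x])
      also have "\<dots> = (\<Sum>\<^sub>\<infinity>t\<in>?S. \<tau> * (\<kappa> 1 t * \<kappa> q (inv t \<otimes> (x \<otimes> inv y))))"
        by (rule infsum_cong) (use x y in \<open>simp add: \<tau> m_assoc\<close>)
      also have "\<dots> = \<tau> * (\<tau>' * \<kappa> (Suc q) (x \<otimes> inv y))"
        using x y by (simp add: infsum_cmult_right' \<tau>' del: One_nat_def)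
      finally show ?thesis by simp
    qed
    then show ?case by blast
  qed
  from pow[of n] n obtain \<tau> where
    \<tau>: "\<And>x y. x \<in> ?S \<Longrightarrow> y \<in> ?S \<Longrightarrow> (A ^^ n) (delta y) x = \<tau> * \<kappa> n (x \<otimes> inv y)" by auto
  let ?L = "left_regular G c"
  have LU: "?L \<in> carrier (unitary_group ?S)" by (rule left_regular_unitary[OF c])
  have An: "(A ^^ n) f = (\<lambda>x. \<tau> * ?L f x)" if "f \<in> ell2 ?S" for f
  proof (rule bdd_ext[OF bdd_funpow[OF Ab] _ _ that])
    show Lb: "bdd ?S ?S (\<lambda>f x. \<tau> * ?L f x)"
      by (rule bdd_scaleI[OF bounded_operators_bdd[OF unitary_bounded[OF LU]]])
    fix y assume y: "y \<in> ?S"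
    show "(A ^^ n) (delta y) = (\<lambda>x. \<tau> * ?L (delta y) x)"
    proof (rule ell2_ext)
      show "(A ^^ n) (delta y) \<in> ell2 ?S" "(\<lambda>x. \<tau> * ?L (delta y) x) \<in> ell2 ?S"
        using y bdd_closed[OF bdd_funpow[OF Ab]] bdd_closed[OF Lb] by auto
      fix x assume x: "x \<in> ?S"
      have "x \<otimes> inv y = c \<longleftrightarrow> x = c \<otimes> y" using x y c by (metis inv_solve_right')
      then show "(A ^^ n) (delta y) x = \<tau> * ?L (delta y) x"
        using x y c by (simp add: \<tau> \<kappa>n left_regular_delta delta_apply)
    qed
  qed
  have AA: "A (adj ?S ?S A g) = g" if "g \<in> ell2 ?S" for g
    unfolding A_def by (rule coef_adj) (use that in \<open>auto simp: bb bon\<close>)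
  have adjb: "bdd ?S ?S (adj ?S ?S A)" by (rule adj_bdd[OF Ab])
  \<comment> \<open>Powers of \<open>A\<close> have right inverses and cannot vanish; this excludes
    \<open>\<tau> = 0\<close>.\<close>
  have "(A ^^ q) ((adj ?S ?S A ^^ q) g) = g" if "g \<in> ell2 ?S" for g q
    using that
  proof (induction q arbitrary: g)
    case (Suc q)
    have "(A ^^ Suc q) ((adj ?S ?S A ^^ Suc q) g) = A ((A ^^ q) ((adj ?S ?S A ^^ q) (adj ?S ?S A g)))"
      by (simp add: funpow_swap1)
    then show ?case using Suc bdd_closed[OF adjb] by (simp add: AA)
  qed simp
  from this[of "delta \<one>" n] have "(A ^^ n) ((adj ?S ?S A ^^ n) (delta \<one>)) \<one> = 1"
    by (simp add: delta_apply)
  then have \<tau>0: "\<tau> \<noteq> 0" using An[OF bdd_closed[OF bdd_funpow[OF adjb] delta_ell2[OF one_closed]]] by auto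
  \<comment> \<open>Orthonormal rows only make \<open>A\<close> a coisometry. Injectivity, and with
    it unitarity, comes from \<open>A ^^ n\<close> being a nonzero multiple of a
    translation.\<close>
  have inj: "f = (\<lambda>x. 0)" if f: "f \<in> ell2 ?S" and z: "A f = (\<lambda>x. 0)" for f
  proof -
    obtain m where m: "n = Suc m" using n by (cases n) auto
    have "(A ^^ n) f = (A ^^ m) (A f)" by (simp add: m funpow_swap1)
    also have "\<dots> = (\<lambda>x. 0)" using bdd_zero[OF bdd_funpow[OF Ab]] by (simp add: z)
    finally have "?L f = (\<lambda>x. 0)" using An[OF f] \<tau>0 by (auto simp: fun_eq_iff)
    then have "ell2_inner ?S f f = 0" using unitary_inner[OF LU f f] by simp
    then show ?thesis using ell2_norm_eq_0[OF f] by (simp add: inner_self[OF f])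
  qed
  have adjA: "adj ?S ?S A (A f) = f" if f: "f \<in> ell2 ?S" for f
  proof -
    have g: "adj ?S ?S A (A f) \<in> ell2 ?S" by (intro bdd_closed[OF adjb] bdd_closed[OF Ab] f)
    have "A (\<lambda>x. adj ?S ?S A (A f) x - f x) = (\<lambda>x. 0)"
      using bdd_diff[OF Ab g f] by (simp add: AA bdd_closed[OF Ab f])
    then have "(\<lambda>x. adj ?S ?S A (A f) x - f x) = (\<lambda>x. 0)" by (rule inj[rotated]) (simp add: f g)
    then show ?thesis by (auto simp: fun_eq_iff)
  qed
  have A_inner: "ell2_inner ?S (A f) (A g) = ell2_inner ?S f g" if "f \<in> ell2 ?S" "g \<in> ell2 ?S" for f g
    using adj_inner[OF Ab that(1) bdd_closed[OF Ab that(2)]] that by (simp add: adjA)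
  have "ell2_inner ?S ((A ^^ q) f) ((A ^^ q) f) = ell2_inner ?S f f" if "f \<in> ell2 ?S" for f q
    by (induction q) (simp_all add: A_inner bdd_closed[OF bdd_funpow[OF Ab] that])
  from this[of "delta \<one>" n] have "\<tau> * cnj \<tau> = 1"
    using An[of "delta \<one>"] unitary_inner[OF LU delta_ell2 delta_ell2, of \<one> \<one>]
    by (simp add: inner_scale_left inner_scale_right inner_delta_left delta_apply)
  then have \<tau>1: "cmod \<tau> = 1"
    by (metis complex_norm_square norm_ge_zero of_real_eq_1_iff power2_eq_1_iff power2_eq_iff_nonneg zero_le_one one_power2)
  \<comment> \<open>An n-th root of the inverse of \<open>\<tau>\<close>, of modulus 1 like
    \<open>\<tau>\<close> itself; it rescales \<open>A\<close> to an exact root of the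
    translation.\<close>
  define \<mu> where "\<mu> = cis (- Arg \<tau> / real n)"
  have "\<mu> ^ n = cis (- Arg \<tau>)" using n by (simp add: \<mu>_def DeMoivre)
  then have \<mu>: "\<mu> ^ n = inverse \<tau>"
    using cis_Arg[OF \<tau>0] \<tau>1 by (simp add: sgn_eq flip: cis_inverse)
  have \<mu>1: "cmod \<mu> = 1" by (simp add: \<mu>_def)
  then have \<mu>\<mu>: "\<mu> * cnj \<mu> = 1" using complex_norm_square[of \<mu>] by simp
  have \<mu>0: "\<mu> \<noteq> 0" using \<mu>1 by auto
  define v where "v = (\<lambda>f\<in>ell2 ?S. \<lambda>x. \<mu> * A f x)"
  have v_apply: "v f = (\<lambda>x. \<mu> * A f x)" if "f \<in> ell2 ?S" for f using that by (simp add: v_def)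
  have vb: "v \<in> bounded_operators ?S" unfolding v_def by (intro bdd_restrict bdd_scaleI Ab)
  have vU: "v \<in> carrier (unitary_group ?S)"
  proof (rule unitary_groupI[OF vb])
    fix f assume f: "f \<in> ell2 ?S"
    let ?g = "\<lambda>x. inverse \<mu> * adj ?S ?S A f x"
    have "?g \<in> ell2 ?S" using f by (intro ell2_scale bdd_closed[OF adjb])
    moreover have "v ?g = f"
      using f \<mu>0 by (simp add: v_apply bdd_closed[OF adjb] bdd_scale[OF Ab] AA flip: mult.assoc)
    ultimately show "\<exists>g\<in>ell2 ?S. v g = f" by blast
  next
    fix f g assume "f \<in> ell2 ?S" "g \<in> ell2 ?S"
    then show "ell2_inner ?S (v f) (v g) = ell2_inner ?S f g"
      using \<mu>\<mu> by (simp add: v_apply inner_scale_left inner_scale_right A_inner)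
  qed
  have vq: "(v ^^ q) f = (\<lambda>x. \<mu> ^ q * (A ^^ q) f x)" if f: "f \<in> ell2 ?S" for f q
  proof (induction q)
    case (Suc q)
    have "(A ^^ q) f \<in> ell2 ?S" by (rule bdd_closed[OF bdd_funpow[OF Ab] f])
    then show ?case by (simp add: Suc v_apply bdd_scale[OF Ab] mult.assoc)
  qed simp
  have "v [^]\<^bsub>unitary_group ?S\<^esub> n = ?L"
    by (rule unitary_ext[of _ ?S])
      (use vU LU \<mu> \<tau>0 in \<open>auto simp: unitary_pow_apply vq An\<close>)
  moreover have "v \<in> vgen ?S {?L}"
    unfolding vgen_def
  proof (intro CollectI conjI ballI impI vU)
    fix X assume X: "X \<in> bounded_operators ?S" and "{?L} \<subseteq> cent ?S X"
    then show "v \<in> cent ?S X"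
      using A_comm[OF X] bdd_closed[OF Ab] bounded_operators_closed[OF X]
      by (simp add: cent_def vU v_apply bdd_scale[OF bounded_operators_bdd[OF X]])
  qed
  ultimately show ?thesis by blast
qed

end

context group
begin

text \<open>A kernel supported on the cyclic group of \<open>c\<close> is a function of the
  exponent. The set \<open>J\<close> represents each power of \<open>c\<close> exactly once: all
  integers for infinite order, one period for finite order. In the second case \<open>compat\<close>
  asks for periodicity.\<close>

lemma root_from_integer_kernel:
  fixes k :: "nat \<Rightarrow> int \<Rightarrow> complex" and J :: "int set"
  assumes c: "c \<in> carrier G" and n: "n \<ge> 1"
    and inj: "inj_on (\<lambda>j. c [^] j) J" and cover: "\<And>i::int. \<exists>j\<in>J. c [^] i = c [^] j"
    and compat: "\<And>q i j. c [^] i = c [^] j \<Longrightarrow> k q i = k q j"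
    and sq: "(\<lambda>j. (cmod (k 1 j))\<^sup>2) summable_on J"
    and on: "\<And>l. (\<Sum>\<^sub>\<infinity>j\<in>J. k 1 (l + j) * cnj (k 1 j)) = (if c [^] l = \<one> then 1 else 0)"
    and conv: "\<And>q. 1 \<le> q \<Longrightarrow> q < n \<Longrightarrow>
       \<exists>\<tau>. \<forall>l. (\<Sum>\<^sub>\<infinity>j\<in>J. k 1 j * k q (l - j)) = \<tau> * k (Suc q) l"
    and kn: "\<And>l. k n l = (if c [^] l = c then 1 else 0)"
  shows "\<exists>v \<in> vgen (carrier G) {left_regular G c}.
    v [^]\<^bsub>unitary_group (carrier G)\<^esub> n = left_regular G c"
proof -
  let ?D = "range (\<lambda>j::int. c [^] j)"
  \<comment> \<open>The choice of the exponent is harmless by \<open>compat\<close>.\<close>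
  define \<kappa> where "\<kappa> q x = (if x \<in> ?D then k q (SOME j. x = c [^] j) else 0)" for q x
  have \<kappa>_pow: "\<kappa> q (c [^] j) = k q j" for q j
  proof -
    have "\<exists>i::int. c [^] j = c [^] i" by blast
    from someI_ex[OF this] have "k q (SOME i. c [^] j = c [^] i) = k q j"
      by (intro compat) (rule sym)
    then show ?thesis by (simp add: \<kappa>_def)
  qed
  have \<kappa>_0: "x \<notin> ?D \<Longrightarrow> \<kappa> q x = 0" for q x by (simp add: \<kappa>_def)
  have D: "(\<lambda>j. c [^] j) ` J = ?D" using cover by (auto simp: image_iff)
  have DS: "?D \<subseteq> carrier G" using c by auto
  have sum_D: "(\<Sum>\<^sub>\<infinity>x\<in>carrier G. F x) = (\<Sum>\<^sub>\<infinity>j\<in>J. F (c [^] j))"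
    if "\<And>x. x \<in> carrier G \<Longrightarrow> x \<notin> ?D \<Longrightarrow> F x = 0" for F :: "'a \<Rightarrow> complex"
  proof -
    have "(\<Sum>\<^sub>\<infinity>x\<in>carrier G. F x) = (\<Sum>\<^sub>\<infinity>x\<in>(\<lambda>j. c [^] j) ` J. F x)"
      unfolding D by (rule infsum_cong_neutral) (use that DS in auto)
    also have "\<dots> = (\<Sum>\<^sub>\<infinity>j\<in>J. F (c [^] j))"
      by (subst infsum_reindex[OF inj]) (simp add: comp_def)
    finally show ?thesis .
  qed
  have mem: "c [^] j \<otimes> x \<in> ?D \<longleftrightarrow> x \<in> ?D" if x: "x \<in> carrier G" for j :: int and x
  proof
    assume "c [^] j \<otimes> x \<in> ?D"
    then obtain i :: int where "c [^] j \<otimes> x = c [^] i" by blast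
    then have "x = inv (c [^] j) \<otimes> c [^] i" using c x by (metis inv_solve_left int_pow_closed)
    then have "x = c [^] (i - j)"
      using c by (metis add_diff_cancel_left' int_pow_mult int_pow_neg add.commute uminus_add_conv_diff)
    then show "x \<in> ?D" by blast
  next
    assume "x \<in> ?D"
    then obtain i :: int where "x = c [^] i" by blast
    then have "c [^] j \<otimes> x = c [^] (j + i)" using c by (simp add: int_pow_mult)
    then show "c [^] j \<otimes> x \<in> ?D" by blast
  qed
  show ?thesis
  proof (rule root_from_kernel[OF c n, where \<kappa> = \<kappa>])
    show "\<exists>j::int. x = c [^] j" if "\<kappa> 1 x \<noteq> 0" for x using that by (auto simp: \<kappa>_def split: if_splits)
    have "(\<lambda>x. (cmod (\<kappa> 1 x))\<^sup>2) summable_on (\<lambda>j. c [^] j) ` J"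
      unfolding summable_on_reindex[OF inj] using sq by (simp add: comp_def \<kappa>_pow)
    moreover have "(\<lambda>x. (cmod (\<kappa> 1 x))\<^sup>2) summable_on (\<lambda>j. c [^] j) ` J \<longleftrightarrow>
        (\<lambda>x. (cmod (\<kappa> 1 x))\<^sup>2) summable_on carrier G"
      unfolding D by (rule summable_on_cong_neutral) (use c in \<open>auto simp: \<kappa>_0\<close>)
    ultimately show "(\<lambda>x. (cmod (\<kappa> 1 x))\<^sup>2) summable_on carrier G" by simp
    show "(\<Sum>\<^sub>\<infinity>t\<in>carrier G. \<kappa> 1 (g \<otimes> t) * cnj (\<kappa> 1 t)) = (if g = \<one> then 1 else 0)"
      if g: "g \<in> carrier G" for g
    proof (cases "g \<in> ?D")
      case True
      then obtain l :: int where l: "g = c [^] l" by blast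
      have "(\<Sum>\<^sub>\<infinity>t\<in>carrier G. \<kappa> 1 (g \<otimes> t) * cnj (\<kappa> 1 t))
          = (\<Sum>\<^sub>\<infinity>j\<in>J. \<kappa> 1 (c [^] (l + j)) * cnj (\<kappa> 1 (c [^] j)))"
        by (subst sum_D) (use c in \<open>auto simp: \<kappa>_0 l int_pow_mult simp del: One_nat_def\<close>)
      then show ?thesis by (simp add: \<kappa>_pow on l del: One_nat_def)
    next
      case False
      have "\<kappa> 1 (g \<otimes> t) * cnj (\<kappa> 1 t) = 0" if t: "t \<in> carrier G" for t
      proof (cases "t \<in> ?D")
        case True
        then obtain j :: int where j: "t = c [^] j" by blast
        have "g \<otimes> t \<notin> ?D"
        proof
          assume "g \<otimes> t \<in> ?D"
          then obtain i :: int where "g \<otimes> t = c [^] i" by blast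
          then have "g = c [^] i \<otimes> inv t" using g t c by (metis inv_solve_right int_pow_closed)
          then have "g = c [^] (i - j)" using c j by (simp add: int_pow_diff)
          then show False using False by blast
        qed
        then show ?thesis by (simp add: \<kappa>_0)
      qed (simp add: \<kappa>_0)
      moreover have "g \<noteq> \<one>" using False c by (metis int_pow_0 rangeI)
      ultimately show ?thesis by (simp add: infsum_0)
    qed
    show "\<exists>\<tau>. \<forall>g\<in>carrier G. (\<Sum>\<^sub>\<infinity>t\<in>carrier G. \<kappa> 1 t * \<kappa> q (inv t \<otimes> g)) = \<tau> * \<kappa> (Suc q) g"
      if q: "1 \<le> q" "q < n" for q
    proof -
      obtain \<tau> where \<tau>: "\<And>l. (\<Sum>\<^sub>\<infinity>j\<in>J. k 1 j * k q (l - j)) = \<tau> * k (Suc q) l"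
        using conv[OF q] by blast
      have inv_pow: "inv (c [^] j) = c [^] (- j)" for j :: int using c by (simp add: int_pow_neg)
      have "(\<Sum>\<^sub>\<infinity>t\<in>carrier G. \<kappa> 1 t * \<kappa> q (inv t \<otimes> g)) = \<tau> * \<kappa> (Suc q) g" if g: "g \<in> carrier G" for g
      proof -
        have "(\<Sum>\<^sub>\<infinity>t\<in>carrier G. \<kappa> 1 t * \<kappa> q (inv t \<otimes> g)) = (\<Sum>\<^sub>\<infinity>j\<in>J. k 1 j * \<kappa> q (c [^] (- j) \<otimes> g))"
          by (subst sum_D) (auto simp: \<kappa>_0 \<kappa>_pow inv_pow simp del: One_nat_def)
        also have "\<dots> = \<tau> * \<kappa> (Suc q) g"
        proof (cases "g \<in> ?D")
          case True
          then obtain l :: int where l: "g = c [^] l" by blast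
          have "c [^] (- j) \<otimes> g = c [^] (l - j)" for j
            using c by (simp add: l int_pow_mult[symmetric])
          then show ?thesis by (simp add: \<kappa>_pow \<tau> l del: One_nat_def)
        next
          case False
          then show ?thesis by (simp add: \<kappa>_0 mem g)
        qed
        finally show ?thesis .
      qed
      then show ?thesis by blast
    qed
    show "\<kappa> n x = (if x = c then 1 else 0)" for x
    proof (cases "x \<in> ?D")
      case True
      then obtain j :: int where "x = c [^] j" by blast
      then show ?thesis by (simp add: \<kappa>_pow kn)
    next
      case False
      moreover have "x \<noteq> c" using False c by (metis int_pow_1 rangeI)
      ultimately show ?thesis by (simp add: \<kappa>_0)
    qed
  qed
qed

end

section \<open>Cauchy kernels on the integers\<close>

text \<open>Telescoping needs an order of summation. The symmetric intervals eventually contain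
  every finite set of integers, so they compute the unordered sum.\<close>

lemma sums_on_int:
  fixes f :: "int \<Rightarrow> 'a::banach"
  assumes "f abs_summable_on UNIV"
  shows "(\<lambda>N. \<Sum>j\<in>{- int N..int N}. f j) \<longlonglongrightarrow> infsum f UNIV"
proof -
  have "((\<lambda>F. sum f F) \<longlongrightarrow> infsum f UNIV) (finite_subsets_at_top UNIV)"
    by (rule infsum_tendsto[OF abs_summable_summable[OF assms]])
  moreover have "filterlim (\<lambda>N. {- int N..int N}) (finite_subsets_at_top UNIV) sequentially"
    unfolding filterlim_finite_subsets_at_top
  proof (intro allI impI)
    fix X :: "int set" assume X: "finite X \<and> X \<subseteq> UNIV"
    define M where "M = (\<Sum>x\<in>X. nat \<bar>x\<bar>)"
    have "nat \<bar>x\<bar> \<le> M" if "x \<in> X" for x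
      unfolding M_def using X that by (intro member_le_sum) auto
    then have "X \<subseteq> {- int N..int N}" if "N \<ge> M" for N
      using that by fastforce
    then show "\<forall>\<^sub>F N in sequentially. finite {- int N..int N} \<and> X \<subseteq> {- int N..int N} \<and> {- int N..int N} \<subseteq> UNIV"
      by (auto simp: eventually_sequentially)
  qed
  ultimately show ?thesis by (rule filterlim_compose)
qed

context
  fixes \<beta> :: real
  assumes \<beta>: "\<beta> \<notin> \<int>"
begin

lemma frac_nz: "\<beta> + real_of_int i \<noteq> 0"
  using \<beta> by (metis Ints_minus Ints_of_int add_eq_0_iff2 minus_minus)

text \<open>On each half-line the terms are at most 4 / i^2 as soon as i >= 2 |\<beta>|.\<close>

lemma summable_cauchy_kernel: "(\<lambda>i::int. (1 / (\<beta> + of_int i))\<^sup>2) summable_on UNIV"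
proof -
  define M where "M = \<bar>\<beta>\<bar> + 1"
  have pos: "(\<lambda>i::nat. (1 / (\<beta> + s * real i))\<^sup>2) summable_on UNIV" if s: "s = 1 \<or> s = -1" for s
  proof (rule summable_nonneg_imp_summable_on)
    have "summable (\<lambda>i. 4 / (real i)\<^sup>2)"
      using summable_mult[OF inverse_power_summable[of 2], of 4] by (simp add: field_simps)
    then show "summable (\<lambda>i. (1 / (\<beta> + s * real i))\<^sup>2)"
    proof (rule summable_comparison_test_ev[rotated])
      show "\<forall>\<^sub>F i in sequentially. norm ((1 / (\<beta> + s * real i))\<^sup>2) \<le> 4 / (real i)\<^sup>2"
        unfolding eventually_sequentially
      proof (intro exI allI impI)
        fix i assume "nat \<lceil>2 * \<bar>\<beta>\<bar>\<rceil> + 1 \<le> i"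
        then have i: "2 * \<bar>\<beta>\<bar> \<le> real i" "0 < real i" by linarith+
        then have "real i / 2 \<le> \<bar>\<beta> + s * real i\<bar>" using s by auto
        then have "(real i / 2)\<^sup>2 \<le> (\<beta> + s * real i)\<^sup>2"
          using i by (simp add: abs_le_square_iff[symmetric])
        then have "1 / (\<beta> + s * real i)\<^sup>2 \<le> 1 / (real i / 2)\<^sup>2"
          using i by (intro divide_left_mono) (auto intro!: mult_pos_pos)
        then show "norm ((1 / (\<beta> + s * real i))\<^sup>2) \<le> 4 / (real i)\<^sup>2"
          by (simp add: power_divide)
      qed
    qed
  qed simp
  have 1: "(\<lambda>i::int. (1 / (\<beta> + of_int i))\<^sup>2) summable_on range int"
    using pos[of 1] by (subst summable_on_reindex) (auto simp: comp_def inj_on_def)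
  have 2: "(\<lambda>i::int. (1 / (\<beta> + of_int i))\<^sup>2) summable_on range (\<lambda>n. - int n)"
    using pos[of "-1"] by (subst summable_on_reindex) (auto simp: comp_def inj_on_def)
  have "(\<lambda>i::int. (1 / (\<beta> + of_int i))\<^sup>2) summable_on (range int \<union> range (\<lambda>n. - int n))"
    by (rule summable_on_union[OF 1 2])
  moreover have "range int \<union> range (\<lambda>n. - int n) = UNIV"
    by (auto simp: image_iff) (metis int_cases2)
  ultimately show ?thesis by simp
qed

lemma shifted_difference_eq:
  "1 / (\<beta> + of_int (i + m)) - 1 / (\<beta> + of_int i)
    = - of_int m * ((1 / (\<beta> + of_int (i + m))) * (1 / (\<beta> + of_int i)))"
  using frac_nz[of "i + m"] frac_nz[of i] by (simp add: field_simps)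

lemma abs_summable_cauchy_product:
  "(\<lambda>i::int. (1 / (\<beta> + of_int (i + m))) * (1 / (\<beta> + of_int i))) abs_summable_on UNIV"
proof (rule abs_summable_product)
  have "bij (\<lambda>i. i + m)" by (rule bij_betw_byWitness[where f' = "\<lambda>i. i - m"]) auto
  then show "(\<lambda>i. 1 / (\<beta> + of_int (i + m)) * (1 / (\<beta> + of_int (i + m)))) abs_summable_on UNIV"
    using summable_on_reindex_bij_betw[of "\<lambda>i. i + m" UNIV UNIV "\<lambda>i. (1 / (\<beta> + of_int i))\<^sup>2"]
      summable_cauchy_kernel by (simp add: power2_eq_square abs_mult[symmetric])
  show "(\<lambda>i::int. 1 / (\<beta> + of_int i) * (1 / (\<beta> + of_int i))) abs_summable_on UNIV"
    using summable_cauchy_kernel by (simp add: power2_eq_square abs_mult[symmetric])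
qed

lemma abs_summable_shifted_difference:
  "(\<lambda>i::int. 1 / (\<beta> + of_int (i + m)) - 1 / (\<beta> + of_int i)) abs_summable_on UNIV"
  unfolding shifted_difference_eq norm_mult
  using abs_summable_cauchy_product[of m] by (intro summable_on_cmult_right) (simp only: norm_mult)

text \<open>The terms 1 / (\<beta> + i) alone are not summable, so the difference cannot be split.
  Over a symmetric interval it telescopes to 1 / (\<beta> + N + 1) - 1 / (\<beta> - N), which tends
  to 0.\<close>

lemma infsum_shift_1: "(\<Sum>\<^sub>\<infinity>i::int. 1 / (\<beta> + of_int (i + 1)) - 1 / (\<beta> + of_int i)) = 0"
proof (rule LIMSEQ_unique[OF sums_on_int[OF abs_summable_shifted_difference]])
  have "(\<Sum>j\<in>{- int N..int N}. 1 / (\<beta> + of_int (j + 1)) - 1 / (\<beta> + of_int j))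
      = 1 / (\<beta> + real N + 1) - 1 / (\<beta> - real N)" for N
  proof (induction N)
    case (Suc N)
    have "{- int (Suc N)..int (Suc N)} = insert (- int (Suc N)) (insert (int (Suc N)) {- int N..int N})"
      by auto
    then show ?case using Suc by (simp add: algebra_simps)
  qed simp
  moreover have "(\<lambda>N. 1 / (\<beta> + real N + 1) - 1 / (\<beta> - real N)) \<longlonglongrightarrow> 0"
    by real_asymp
  ultimately show "(\<lambda>N. \<Sum>j\<in>{- int N..int N}. 1 / (\<beta> + of_int (j + 1)) - 1 / (\<beta> + of_int j)) \<longlonglongrightarrow> 0"
    by simp
qed

lemma infsum_int_shift:
  fixes f :: "int \<Rightarrow> 'a::{comm_monoid_add,t2_space}"
  shows "(\<Sum>\<^sub>\<infinity>i. f (i + m)) = (\<Sum>\<^sub>\<infinity>i. f i)"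
  by (rule infsum_reindex_bij_betw, rule bij_betw_byWitness[where f' = "\<lambda>i. i - m"]) auto

lemma infsum_shift_nat: "(\<Sum>\<^sub>\<infinity>i::int. 1 / (\<beta> + of_int (i + int m)) - 1 / (\<beta> + of_int i)) = 0"
proof (induction m)
  case (Suc m)
  let ?g = "\<lambda>i::int. 1 / (\<beta> + of_int i)"
  have "(\<Sum>\<^sub>\<infinity>i::int. ?g (i + int (Suc m)) - ?g i)
      = (\<Sum>\<^sub>\<infinity>i::int. (?g (i + int m + 1) - ?g (i + int m)) + (?g (i + int m) - ?g i))"
    by (simp add: add.assoc add.commute[of 1])
  also have "\<dots> = (\<Sum>\<^sub>\<infinity>i::int. ?g (i + int m + 1) - ?g (i + int m)) + (\<Sum>\<^sub>\<infinity>i::int. ?g (i + int m) - ?g i)"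
  proof (rule infsum_add)
    have "(\<lambda>i. ?g (i + 1) - ?g i) summable_on UNIV"
      by (rule abs_summable_summable[OF abs_summable_shifted_difference])
    moreover have "bij_betw (\<lambda>i. i + int m) UNIV UNIV"
      by (rule bij_betw_byWitness[where f' = "\<lambda>i. i - int m"]) auto
    ultimately show "(\<lambda>i. ?g (i + int m + 1) - ?g (i + int m)) summable_on UNIV"
      using summable_on_reindex_bij_betw[of "\<lambda>i. i + int m" UNIV UNIV "\<lambda>i. ?g (i + 1) - ?g i"] by simp
    show "(\<lambda>i. ?g (i + int m) - ?g i) summable_on UNIV"
      by (rule abs_summable_summable[OF abs_summable_shifted_difference])
  qed
  also have "(\<Sum>\<^sub>\<infinity>i::int. ?g (i + int m + 1) - ?g (i + int m)) = 0"
    using infsum_int_shift[of "\<lambda>i. ?g (i + 1) - ?g i" "int m"] infsum_shift_1 by simp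
  finally show ?case using Suc by simp
qed simp

lemma infsum_shift: "(\<Sum>\<^sub>\<infinity>i::int. 1 / (\<beta> + of_int (i + m)) - 1 / (\<beta> + of_int i)) = 0"
proof (cases "0 \<le> m")
  case True
  then show ?thesis using infsum_shift_nat[of "nat m"] by simp
next
  case False
  let ?g = "\<lambda>i::int. 1 / (\<beta> + of_int i)"
  have "(\<Sum>\<^sub>\<infinity>i::int. ?g (i + m) - ?g i) = (\<Sum>\<^sub>\<infinity>i::int. ?g i - ?g (i + - m))"
    using infsum_int_shift[of "\<lambda>i. ?g (i + m) - ?g i" "- m"] by simp
  also have "\<dots> = - (\<Sum>\<^sub>\<infinity>i::int. ?g (i + - m) - ?g i)"
    by (subst infsum_uminus[symmetric]) simp
  also have "\<dots> = 0" using infsum_shift_nat[of "nat (- m)"] False by simp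
  finally show ?thesis .
qed

text \<open>By partial fractions, -m times the product is a shifted difference, whose sum is 0. This
  yields the orthogonality of distinct translates of the kernel.\<close>

lemma infsum_cauchy_product:
  assumes "m \<noteq> 0"
  shows "(\<Sum>\<^sub>\<infinity>i::int. (1 / (\<beta> + of_int (i + m))) * (1 / (\<beta> + of_int i))) = 0"
proof -
  have "(\<Sum>\<^sub>\<infinity>i::int. - of_int m * ((1 / (\<beta> + of_int (i + m))) * (1 / (\<beta> + of_int i)))) = 0"
    using infsum_shift[of m] by (simp only: shifted_difference_eq)
  then show ?thesis using assms by (subst (asm) infsum_cmult_right') simp
qed

end

lemma infsum_complex_of_real:
  "f summable_on A \<Longrightarrow> (\<Sum>\<^sub>\<infinity>x\<in>A. complex_of_real (f x)) = complex_of_real (\<Sum>\<^sub>\<infinity>x\<in>A. f x)"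
  by (rule infsumI[OF has_sum_of_real[OF has_sum_infsum]])

lemma infsum_difference:
  fixes f g :: "'a \<Rightarrow> real"
  assumes "f summable_on A" "g summable_on A"
  shows "(\<Sum>\<^sub>\<infinity>x\<in>A. f x - g x) = infsum f A - infsum g A"
  using infsum_add[OF assms(1) summable_on_uminus[THEN iffD2, OF assms(2)]]
  by (simp add: infsum_uminus)

lemma infsum_int_uminus:
  fixes f :: "int \<Rightarrow> 'a::{comm_monoid_add,t2_space}"
  shows "(\<Sum>\<^sub>\<infinity>i. f (- i)) = (\<Sum>\<^sub>\<infinity>i. f i)"
  by (rule infsum_reindex_bij_betw, rule bij_betw_byWitness[where f' = uminus]) auto

text \<open>Partial fractions turn each term into 1 / (\<alpha> + i) - 1 / (- \<gamma> + i + l),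
  divided by \<alpha> + \<gamma> - l. Replacing i + l by i in the second fraction costs a shifted
  difference of sum 0, so the remaining numerator does not depend on \<open>l\<close>. Its value, a
  sum of cotangents, can stay unevaluated.\<close>

lemma cauchy_kernel_convolution:
  fixes \<alpha> \<gamma> :: real
  assumes \<alpha>: "\<alpha> \<notin> \<int>" and \<gamma>: "\<gamma> \<notin> \<int>" and nz: "\<alpha> + \<gamma> \<noteq> of_int l"
  shows "(\<Sum>\<^sub>\<infinity>i::int. (1 / (\<alpha> + of_int i)) * (1 / (\<gamma> - of_int l - of_int i)))
    = (\<Sum>\<^sub>\<infinity>i::int. 1 / (\<alpha> + of_int i) - 1 / (- \<gamma> + of_int i)) / (\<alpha> + \<gamma> - of_int l)"
    (is "?lhs = infsum ?f UNIV / ?d")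
    and "(\<lambda>i::int. (1 / (\<alpha> + of_int i)) * (1 / (\<gamma> - of_int l - of_int i))) abs_summable_on UNIV"
proof -
  have \<delta>: "- \<gamma> \<notin> \<int>" using \<gamma> by simp
  note sq = summable_cauchy_kernel[OF \<alpha>] summable_cauchy_kernel[OF \<delta>]
  let ?g = "\<lambda>i::int. 1 / (- \<gamma> + of_int (i + l)) - 1 / (- \<gamma> + of_int i)"
  have prod: "(\<lambda>i::int. (1 / (\<alpha> + of_int i)) * (1 / (- \<gamma> + of_int i))) abs_summable_on UNIV"
    by (rule abs_summable_product)
       (use sq in \<open>simp_all add: power2_eq_square abs_mult[symmetric]\<close>)
  have f_eq: "?f i = (- \<gamma> - \<alpha>) * ((1 / (\<alpha> + of_int i)) * (1 / (- \<gamma> + of_int i)))" for i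
    using frac_nz[OF \<alpha>, of i] frac_nz[OF \<delta>, of i] by (simp add: field_simps)
  have fs: "?f abs_summable_on UNIV"
    unfolding f_eq norm_mult using prod by (intro summable_on_cmult_right) (simp only: norm_mult)
  have gs: "?g abs_summable_on UNIV" by (rule abs_summable_shifted_difference[OF \<delta>])
  have e: "(1 / (\<alpha> + of_int i)) * (1 / (\<gamma> - of_int l - of_int i)) = (?f i - ?g i) * (1 / ?d)" for i :: int
  proof -
    have "\<alpha> + of_int i \<noteq> 0" "\<gamma> - of_int l - of_int i \<noteq> 0" "?d \<noteq> 0"
      using frac_nz[OF \<alpha>, of i] frac_nz[OF \<delta>, of "i + l"] nz by auto
    moreover have "?f i - ?g i = 1 / (\<alpha> + of_int i) - 1 / (- \<gamma> + of_int (i + l))" by simp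
    moreover have "1 / (- \<gamma> + of_int (i + l)) = - (1 / (\<gamma> - of_int l - of_int i))"
      by (subst minus_divide_right) (simp add: algebra_simps)
    ultimately show ?thesis by (simp add: divide_simps) (simp add: algebra_simps)
  qed
  have "?lhs = (\<Sum>\<^sub>\<infinity>i. (?f i - ?g i) * (1 / ?d))" by (simp only: e)
  also have "\<dots> = (\<Sum>\<^sub>\<infinity>i. ?f i - ?g i) * (1 / ?d)" by (rule infsum_cmult_left')
  also have "(\<Sum>\<^sub>\<infinity>i. ?f i - ?g i) = infsum ?f UNIV - infsum ?g UNIV"
    by (rule infsum_difference[OF abs_summable_summable[OF fs] abs_summable_summable[OF gs]])
  also have "infsum ?g UNIV = 0" by (rule infsum_shift[OF \<delta>])
  finally show "?lhs = infsum ?f UNIV / ?d" by simp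
  have bij: "bij_betw (\<lambda>i. i + l) UNIV UNIV" by (rule bij_betw_byWitness[where f' = "\<lambda>i. i - l"]) auto
  have sh: "(\<lambda>i::int. (1 / (- \<gamma> + of_int (i + l)))\<^sup>2) summable_on UNIV"
    using sq(2) summable_on_reindex_bij_betw[OF bij, of "\<lambda>i. (1 / (- \<gamma> + of_int i))\<^sup>2"] by simp
  have m: "\<gamma> - of_int l - of_int i = - (- \<gamma> + of_int (i + l))" for i :: int by simp
  show "(\<lambda>i::int. (1 / (\<alpha> + of_int i)) * (1 / (\<gamma> - of_int l - of_int i))) abs_summable_on UNIV"
    by (rule abs_summable_product)
       (use sq sh in \<open>simp_all only: m power2_eq_square divide_minus_right minus_mult_minus
          real_norm_def abs_of_nonneg zero_le_square\<close>)
qed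

section \<open>Roots of translations of infinite and of finite order\<close>

context group
begin

text \<open>Up to scalars, 1 / (q/n - j) is the j-th Fourier coefficient of exp(2 pi i t q / n), and
  dividing by \<open>sqrt S\<close> gives the first kernel norm 1. For q = n the function is exp(2
  pi i t), whose coefficients are concentrated at j = 1; hence the case distinction in
  \<open>r\<close>. The bound on \<open>n\<close> keeps 1/n away from the integers.\<close>

lemma root_infinite_order:
  fixes n :: nat
  assumes c: "c \<in> carrier G" and ord: "ord c = 0" and n: "n \<ge> 2"
  shows "\<exists>v \<in> vgen (carrier G) {left_regular G c}.
    v [^]\<^bsub>unitary_group (carrier G)\<^esub> n = left_regular G c"
proof -
  define \<beta> where "\<beta> q = real q / real n" for q :: nat
  have \<beta>: "\<beta> q \<notin> \<int>" if "1 \<le> q" "q < n" for q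
  proof
    assume "\<beta> q \<in> \<int>"
    then obtain z :: int where z: "\<beta> q = of_int z" by (auto elim: Ints_cases)
    have "0 < \<beta> q" "\<beta> q < 1" using that by (auto simp: \<beta>_def)
    then have "0 < z" "z < 1" unfolding z by linarith+
    then show False by simp
  qed
  have \<beta>1: "\<beta> 1 \<notin> \<int>" using n by (intro \<beta>) auto
  define S where "S = (\<Sum>\<^sub>\<infinity>i::int. (1 / (\<beta> 1 + of_int i))\<^sup>2)"
  note sqs = summable_cauchy_kernel[OF \<beta>1]
  have S0: "S > 0"
  proof -
    have "(\<Sum>i\<in>{0::int}. (1 / (\<beta> 1 + of_int i))\<^sup>2) \<le> S"
      unfolding S_def by (rule finite_sum_le_infsum[OF sqs]) auto
    moreover have "\<beta> 1 \<noteq> 0" using n by (simp add: \<beta>_def)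
    ultimately show ?thesis by (simp add: power_divide) (smt (verit) zero_less_divide_1_iff zero_less_power2)
  qed
  define r where "r q j = (if q < n then 1 / (sqrt S * (\<beta> q - of_int j)) else if j = 1 then 1 else 0)"
    for q and j :: int
  define k where "k q j = complex_of_real (r q j)" for q j
  have r1: "r 1 j = 1 / sqrt S * (1 / (\<beta> 1 + of_int (- j)))" for j using n by (simp add: r_def)
  have SS: "1 / sqrt S * x * (1 / sqrt S * y) = 1 / S * (x * y)" for x y
  proof -
    have "sqrt S * sqrt S = S" using S0 by simp
    then show ?thesis by (simp add: times_divide_times_eq)
  qed
  have pow_eq: "c [^] i = c [^] j \<longleftrightarrow> i = j" for i j :: int
    using int_pow_eq[OF c, of i j] by (auto simp: ord)
  have mm: "bij_betw uminus UNIV (UNIV :: int set)"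
    by (rule bij_betw_byWitness[where f' = uminus]) auto
  show ?thesis
  proof (rule root_from_integer_kernel[OF c, where J = UNIV and k = k])
    show "1 \<le> n" using n by simp
    show "inj_on (\<lambda>j::int. c [^] j) UNIV" by (auto simp: inj_on_def pow_eq)
    show "\<exists>j\<in>(UNIV :: int set). c [^] i = c [^] j" for i :: int by blast
    show "k q i = k q j" if "c [^] i = c [^] j" for q i j using that by (simp add: pow_eq)
    have "(\<lambda>j::int. 1 / S * (1 / (\<beta> 1 + of_int (- j)))\<^sup>2) summable_on UNIV"
      using summable_on_reindex_bij_betw[OF mm, of "\<lambda>i. (1 / (\<beta> 1 + of_int i))\<^sup>2"] sqs
      by (intro summable_on_cmult_right) simp
    moreover have "(cmod (k 1 j))\<^sup>2 = 1 / S * (1 / (\<beta> 1 + of_int (- j)))\<^sup>2" for j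
      unfolding k_def norm_of_real power2_abs r1 using S0 by (simp add: power_mult_distrib power_divide)
    ultimately show "(\<lambda>j. (cmod (k 1 j))\<^sup>2) summable_on UNIV" by (simp only:)
    show "(\<Sum>\<^sub>\<infinity>j\<in>UNIV. k 1 (l + j) * cnj (k 1 j)) = (if c [^] l = \<one> then 1 else 0)" for l :: int
    proof -
      let ?h = "\<lambda>i::int. (1 / (\<beta> 1 + of_int (i + - l))) * (1 / (\<beta> 1 + of_int i))"
      have "(\<Sum>\<^sub>\<infinity>j\<in>UNIV. k 1 (l + j) * cnj (k 1 j)) = (\<Sum>\<^sub>\<infinity>j. complex_of_real (1 / S * ?h (- j)))"
      proof (rule infsum_cong)
        fix j
        have "- (l + j) = - j + - l" by simp
        then have "r 1 (l + j) * r 1 j = 1 / S * ?h (- j)" by (simp only: r1 SS)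
        moreover have "k 1 (l + j) * cnj (k 1 j) = complex_of_real (r 1 (l + j) * r 1 j)"
          by (simp add: k_def)
        ultimately show "k 1 (l + j) * cnj (k 1 j) = complex_of_real (1 / S * ?h (- j))" by (simp only:)
      qed
      also have "\<dots> = (\<Sum>\<^sub>\<infinity>j. complex_of_real (1 / S * ?h j))" by (rule infsum_int_uminus)
      also have "\<dots> = complex_of_real (\<Sum>\<^sub>\<infinity>j. 1 / S * ?h j)"
        by (intro infsum_complex_of_real summable_on_cmult_right
              abs_summable_summable[OF abs_summable_cauchy_product[OF \<beta>1]])
      also have "\<dots> = complex_of_real (1 / S * (\<Sum>\<^sub>\<infinity>j. ?h j))" by (simp only: infsum_cmult_right')
      also have "\<dots> = (if l = 0 then 1 else 0)"
      proof (cases "l = 0")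
        case True
        then have "(\<Sum>\<^sub>\<infinity>j. ?h j) = S" by (simp add: S_def power2_eq_square)
        then show ?thesis using S0 True by simp
      next
        case False
        then have "- l \<noteq> 0" by simp
        show ?thesis unfolding infsum_cauchy_product[OF \<beta>1 \<open>- l \<noteq> 0\<close>] using False by simp
      qed
      also have "l = 0 \<longleftrightarrow> c [^] l = \<one>" using pow_eq[of l 0] c by simp
      finally show ?thesis .
    qed
    show "\<exists>\<tau>. \<forall>l. (\<Sum>\<^sub>\<infinity>j\<in>UNIV. k 1 j * k q (l - j)) = \<tau> * k (Suc q) l" if q: "1 \<le> q" "q < n" for q
    proof -
      define h where "h l = (\<lambda>i::int. (1 / (\<beta> 1 + of_int i)) * (1 / (\<beta> q - of_int l - of_int i)))" for l :: int
      define T where "T = (\<Sum>\<^sub>\<infinity>i::int. 1 / (\<beta> 1 + of_int i) - 1 / (- \<beta> q + of_int i))"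
      have conv: "(\<Sum>\<^sub>\<infinity>j\<in>UNIV. k 1 j * k q (l - j)) = complex_of_real (1 / S * infsum (h l) UNIV)"
        if "h l abs_summable_on UNIV" for l
      proof -
        have "(\<Sum>\<^sub>\<infinity>j\<in>UNIV. k 1 j * k q (l - j)) = (\<Sum>\<^sub>\<infinity>j. complex_of_real (1 / S * h l (- j)))"
        proof (rule infsum_cong)
          fix j
          have "r q (l - j) = 1 / sqrt S * (1 / (\<beta> q - of_int l - of_int (- j)))"
            using q by (simp add: r_def)
          then have "r 1 j * r q (l - j) = 1 / S * h l (- j)" by (simp only: r1 h_def SS)
          moreover have "k 1 j * k q (l - j) = complex_of_real (r 1 j * r q (l - j))"
            by (simp add: k_def)
          ultimately show "k 1 j * k q (l - j) = complex_of_real (1 / S * h l (- j))" by (simp only:)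
        qed
        also have "\<dots> = (\<Sum>\<^sub>\<infinity>j. complex_of_real (1 / S * h l j))" by (rule infsum_int_uminus)
        also have "\<dots> = complex_of_real (\<Sum>\<^sub>\<infinity>j. 1 / S * h l j)"
          by (intro infsum_complex_of_real summable_on_cmult_right abs_summable_summable[OF that])
        finally show ?thesis by (simp only: infsum_cmult_right')
      qed
      have add: "\<beta> 1 + \<beta> q = \<beta> (Suc q)" by (simp add: \<beta>_def add_divide_distrib)
      have cc: "infsum (h l) UNIV = T / (\<beta> (Suc q) - of_int l)" "h l abs_summable_on UNIV"
        if "\<beta> (Suc q) \<noteq> of_int l" for l
        using cauchy_kernel_convolution[OF \<beta>1 \<beta>[OF q], unfolded add, OF that]
        by (simp_all only: h_def T_def)
      show ?thesis
      proof (cases "Suc q < n")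
        case True
        then have ne: "\<beta> (Suc q) \<noteq> of_int l" for l :: int using \<beta>[of "Suc q"] by auto
        have "(\<Sum>\<^sub>\<infinity>j\<in>UNIV. k 1 j * k q (l - j)) = complex_of_real (T / sqrt S) * k (Suc q) l" for l
          unfolding conv[OF cc(2)[OF ne]] cc(1)[OF ne] using True S0
          by (simp add: k_def r_def flip: of_real_mult)
        then show ?thesis by blast
      next
        case False
        then have qn: "Suc q = n" using q by simp
        then have \<beta>n: "\<beta> (Suc q) = 1" using n by (simp add: \<beta>_def)
        have \<beta>q: "- \<beta> q = \<beta> 1 - 1" using add \<beta>n by simp
        \<comment> \<open>For q = n - 1 the numbers \<open>- \<beta> q\<close> and
          \<open>\<beta> 1\<close> differ by 1, so \<open>T\<close> is a sum of shifted differences.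
          The convolution formula then gives 0 for every l other than 1. At l = 1 its denominator
          vanishes, and the sum is computed directly as \<open>- S\<close>, which explains the
          scalar -1 below.\<close>
        have T: "T = 0"
        proof -
          have "- \<beta> q \<notin> \<int>" using \<beta>[OF q] by simp
          from infsum_shift[OF this, of 1] show ?thesis by (simp add: T_def \<beta>q del: One_nat_def)
        qed
        have h1: "h 1 = (\<lambda>i. - ((1 / (\<beta> 1 + of_int i))\<^sup>2))"
        proof
          fix i :: int
          have "\<beta> q - of_int 1 - of_int i = - (\<beta> 1 + of_int i)" using \<beta>q by simp
          then show "h 1 i = - ((1 / (\<beta> 1 + of_int i))\<^sup>2)"
            by (simp only: h_def power2_eq_square divide_minus_right mult_minus_right)
        qed
        have "(\<Sum>\<^sub>\<infinity>j\<in>UNIV. k 1 j * k q (l - j)) = - 1 * k (Suc q) l" for l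
        proof (cases "l = 1")
          case True
          have "h 1 abs_summable_on UNIV" unfolding h1 using sqs by simp
          from conv[OF this] have "(\<Sum>\<^sub>\<infinity>j\<in>UNIV. k 1 j * k q (1 - j)) = complex_of_real (1 / S * - S)"
            unfolding h1 infsum_uminus S_def[symmetric] .
          then show ?thesis using S0 True by (simp add: k_def r_def qn)
        next
          case False
          then have ne: "\<beta> (Suc q) \<noteq> of_int l" by (simp add: \<beta>n)
          show ?thesis unfolding conv[OF cc(2)[OF ne]] cc(1)[OF ne] T
            using False by (simp add: k_def r_def qn)
        qed
        then show ?thesis by blast
      qed
    qed
    show "k n l = (if c [^] l = c then 1 else 0)" for l :: int
      using pow_eq[of l 1] c by (simp add: k_def r_def)
  qed
qed

text \<open>On its cyclic group the translation by \<open>c\<close> is diagonalised by characters: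
  \<open>e a\<close> is an eigenvalue, \<open>w a\<close> an n-th root of it, and \<open>k q\<close>
  the inverse discrete Fourier transform of the q-th powers of \<open>w\<close>.\<close>

lemma root_finite_order:
  fixes n :: nat
  assumes c: "c \<in> carrier G" and ord: "ord c > 0" and n: "n \<ge> 1"
  shows "\<exists>v \<in> vgen (carrier G) {left_regular G c}.
    v [^]\<^bsub>unitary_group (carrier G)\<^esub> n = left_regular G c"
proof -
  define m where "m = int (ord c)"
  have m: "m > 0" using ord by (simp add: m_def)
  let ?J = "{0..<m}"
  define e where "e x = cis (2 * pi * of_int x / of_int m)" for x :: int
  define w where "w a = cis (2 * pi * of_int a / (of_int m * real n))" for a :: int
  define k where "k q j = (\<Sum>a\<in>?J. w a ^ q * e (- a * j)) / of_int m" for q and j :: int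
  have e_add: "e (x + y) = e x * e y" for x y
    by (simp add: e_def cis_mult add_divide_distrib algebra_simps)
  have e_cnj: "cnj (e x) = e (- x)" for x by (simp add: e_def cis_cnj)
  have w_cnj: "w a * cnj (w a) = 1" for a by (simp add: w_def cis_cnj cis_mult)
  have w_n: "w a ^ n = e a" for a using n by (simp add: w_def e_def DeMoivre)
  have e_1: "e x = 1 \<longleftrightarrow> m dvd x" for x
  proof
    assume "e x = 1"
    then have "cos (2 * pi * of_int x / of_int m) = 1" by (simp add: e_def complex_eq_iff)
    then obtain z :: int where "2 * pi * of_int x / of_int m = of_int z * (2 * pi)"
      by (auto simp: cos_one_2pi_int)
    then have "real_of_int x = of_int (z * m)" using m by (simp add: field_simps)
    then have "x = z * m" by linarith
    then show "m dvd x" by simp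
  next
    assume "m dvd x"
    then obtain z where "x = m * z" by blast
    then have "2 * pi * of_int x / of_int m = 2 * pi * of_int z" using m by simp
    then show "e x = 1" by (simp add: e_def)
  qed
  have e_mult: "e (d * int j) = e d ^ j" for d j
    by (simp add: e_def DeMoivre algebra_simps)
  have sum_e: "(\<Sum>j\<in>?J. e (d * j)) = (if m dvd d then of_int m else 0)" for d
  proof -
    have "(\<Sum>j\<in>?J. e (d * j)) = (\<Sum>j<nat m. e (d * int j))"
      by (rule sum.reindex_bij_witness[of _ int nat]) (use m in auto)
    also have "\<dots> = (\<Sum>j<nat m. e d ^ j)" by (simp only: e_mult)
    also have "\<dots> = (if m dvd d then of_int m else 0)"
    proof (cases "m dvd d")
      case True
      then have "e d = 1" by (simp add: e_1)
      then show ?thesis using True m by simp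
    next
      case False
      have "e d ^ nat m = e (d * m)" using e_mult[of d "nat m"] m by simp
      also have "\<dots> = 1" by (simp add: e_1)
      finally show ?thesis using False e_1[of d] by (simp add: sum_gp_strict)
    qed
    finally show ?thesis .
  qed
  \<comment> \<open>Parseval's identity: summing over \<open>j\<close> leaves only equal frequencies
    \<open>a = b\<close>. The two offsets let one formula serve both the inner products of
    translates and the convolutions.\<close>
  have k_conv: "(\<Sum>j\<in>?J. (\<Sum>a\<in>?J. f a * e (- a * (l1 + j))) * (\<Sum>b\<in>?J. g b * e (b * (j + l2))))
      = of_int m * (\<Sum>a\<in>?J. f a * g a * e (a * (l2 - l1)))" for f g l1 l2
  proof -
    have "(\<Sum>j\<in>?J. (\<Sum>a\<in>?J. f a * e (- a * (l1 + j))) * (\<Sum>b\<in>?J. g b * e (b * (j + l2))))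
        = (\<Sum>j\<in>?J. \<Sum>a\<in>?J. \<Sum>b\<in>?J. f a * g b * e (- a * l1 + b * l2) * e ((b - a) * j))"
    proof (intro sum.cong refl)
      fix j
      have "e (- a * (l1 + j)) * e (b * (j + l2)) = e (- a * l1 + b * l2) * e ((b - a) * j)" for a b
        by (simp only: e_add[symmetric]) (simp add: algebra_simps)
      then show "(\<Sum>a\<in>?J. f a * e (- a * (l1 + j))) * (\<Sum>b\<in>?J. g b * e (b * (j + l2)))
          = (\<Sum>a\<in>?J. \<Sum>b\<in>?J. f a * g b * e (- a * l1 + b * l2) * e ((b - a) * j))"
        unfolding sum_product by (intro sum.cong refl) (metis mult.assoc mult.left_commute)
    qed
    also have "\<dots> = (\<Sum>a\<in>?J. \<Sum>j\<in>?J. \<Sum>b\<in>?J. f a * g b * e (- a * l1 + b * l2) * e ((b - a) * j))"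
      by (rule sum.swap)
    also have "\<dots> = (\<Sum>a\<in>?J. \<Sum>b\<in>?J. \<Sum>j\<in>?J. f a * g b * e (- a * l1 + b * l2) * e ((b - a) * j))"
      by (intro sum.cong refl sum.swap)
    also have "\<dots> = (\<Sum>a\<in>?J. \<Sum>b\<in>?J. if b = a then f a * g a * e (a * (l2 - l1)) * of_int m else 0)"
    proof (intro sum.cong refl)
      fix a b assume ab: "a \<in> ?J" "b \<in> ?J"
      have "m dvd b - a \<longleftrightarrow> b = a"
        using ab by (auto dest: zdvd_imp_le simp: mod_eq_dvd_iff[symmetric])
      moreover have "(\<Sum>j\<in>?J. f a * g b * e (- a * l1 + b * l2) * e ((b - a) * j))
          = f a * g b * e (- a * l1 + b * l2) * (if m dvd b - a then of_int m else 0)"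
        by (simp only: sum_distrib_left[symmetric] sum_e)
      moreover have "- a * l1 + a * l2 = a * (l2 - l1)" by (simp add: algebra_simps)
      ultimately show "(\<Sum>j\<in>?J. f a * g b * e (- a * l1 + b * l2) * e ((b - a) * j))
          = (if b = a then f a * g a * e (a * (l2 - l1)) * of_int m else 0)"
        by simp
    qed
    also have "\<dots> = (\<Sum>a\<in>?J. f a * g a * e (a * (l2 - l1)) * of_int m)"
      by (intro sum.cong refl) simp
    finally show ?thesis by (simp add: sum_distrib_left mult.commute)
  qed
  have pow_eq: "c [^] i = c [^] j \<longleftrightarrow> m dvd (j - i)" for i j :: int
    using int_pow_eq[OF c] by (simp add: m_def)
  have m0: "complex_of_int m \<noteq> 0" using m by simp
  show ?thesis
  proof (rule root_from_integer_kernel[OF c n, where J = ?J and k = k])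
    show "inj_on (\<lambda>j::int. c [^] j) ?J"
    proof (rule inj_onI)
      fix i j assume ij: "i \<in> ?J" "j \<in> ?J" "c [^] i = c [^] j"
      then have "j mod m = i mod m" by (simp only: pow_eq mod_eq_dvd_iff)
      then show "i = j" using ij(1,2) by (metis atLeastLessThan_iff mod_pos_pos_trivial)
    qed
    show "\<exists>j\<in>?J. c [^] i = c [^] j" for i :: int
      by (rule bexI[of _ "i mod m"]) (use m in \<open>auto simp: pow_eq mod_eq_dvd_iff[symmetric]\<close>)
    show "k q i = k q j" if "c [^] i = c [^] j" for q i j
    proof -
      have "e (- a * i) = e (- a * j)" for a
      proof -
        have "m dvd - a * (i - j)"
          using that by (metis dvd_minus_iff dvd_mult minus_diff_eq pow_eq)
        then have "e (- a * (i - j)) = 1" by (simp only: e_1)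
        then show ?thesis using e_add[of "- a * (i - j)" "- a * j"] by (simp add: algebra_simps)
      qed
      then show ?thesis by (simp add: k_def)
    qed
    show "(\<lambda>j. (cmod (k 1 j))\<^sup>2) summable_on ?J" by simp
    show "(\<Sum>\<^sub>\<infinity>j\<in>?J. k 1 (l + j) * cnj (k 1 j)) = (if c [^] l = \<one> then 1 else 0)" for l :: int
    proof -
      have "(\<Sum>\<^sub>\<infinity>j\<in>?J. k 1 (l + j) * cnj (k 1 j))
          = (\<Sum>j\<in>?J. (\<Sum>a\<in>?J. w a * e (- a * (l + j))) * (\<Sum>b\<in>?J. cnj (w b) * e (b * (j + 0))))
            / (of_int m * of_int m)"
        by (subst sum_divide_distrib) (simp add: k_def e_cnj)
      also have "\<dots> = (\<Sum>a\<in>?J. e (- l * a)) / of_int m"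
        unfolding k_conv using m0 by (simp add: w_cnj mult.commute)
      also have "\<dots> = (if m dvd - l then 1 else 0)" unfolding sum_e using m0 by simp
      also have "m dvd - l \<longleftrightarrow> c [^] l = \<one>" using pow_eq[of l 0] by simp
      finally show ?thesis .
    qed
    show "\<exists>\<tau>. \<forall>l. (\<Sum>\<^sub>\<infinity>j\<in>?J. k 1 j * k q (l - j)) = \<tau> * k (Suc q) l" if "1 \<le> q" "q < n" for q
    proof (intro exI[of _ 1] allI)
      fix l
      have "(\<Sum>\<^sub>\<infinity>j\<in>?J. k 1 j * k q (l - j))
          = (\<Sum>j\<in>?J. (\<Sum>a\<in>?J. w a * e (- a * (0 + j))) * (\<Sum>b\<in>?J. w b ^ q * e (b * (j + - l))))
            / (of_int m * of_int m)"
        by (subst sum_divide_distrib) (simp add: k_def right_diff_distrib)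
      also have "\<dots> = 1 * k (Suc q) l"
        unfolding k_conv using m0 by (simp add: k_def)
      finally show "(\<Sum>\<^sub>\<infinity>j\<in>?J. k 1 j * k q (l - j)) = 1 * k (Suc q) l" .
    qed
    show "k n l = (if c [^] l = c then 1 else 0)" for l :: int
    proof -
      have "k n l = (\<Sum>a\<in>?J. e ((1 - l) * a)) / of_int m"
        by (simp add: k_def w_n e_add[symmetric] algebra_simps)
      also have "\<dots> = (if m dvd 1 - l then 1 else 0)" unfolding sum_e using m0 by simp
      also have "m dvd 1 - l \<longleftrightarrow> c [^] l = c" using pow_eq[of l 1] c by simp
      finally show ?thesis .
    qed
  qed
qed

text \<open>The Cauchy kernel requires n >= 2; for n = 1 the translation is its own root.\<close>

lemma left_regular_root:
  fixes n :: nat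
  assumes c: "c \<in> carrier G" and n: "n \<ge> 1"
  shows "\<exists>v \<in> vgen (carrier G) {left_regular G c}.
    v [^]\<^bsub>unitary_group (carrier G)\<^esub> n = left_regular G c"
proof -
  interpret U: group "unitary_group (carrier G)" by (rule group_unitary_group)
  consider "ord c > 0" | "n = 1" | "ord c = 0" "n \<ge> 2" using n by linarith
  then show ?thesis
  proof cases
    case 2
    have "left_regular G c \<in> vgen (carrier G) {left_regular G c}"
      using vgen_incl[of "{left_regular G c}"] c by (simp add: left_regular_unitary)
    then show ?thesis
      by (rule bexI[rotated]) (simp add: 2 left_regular_unitary c)
  qed (use root_finite_order[OF c _ n] root_infinite_order[OF c] in auto)
qed

end

section \<open>Twisting by a carry cocycle\<close>

text \<open>The carry \<open>(s x + s y) div n\<close> is the cocycle describing the extension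
  \<open>n\<int> \<rightarrow> \<int> \<rightarrow> \<int>/n\<int>\<close>, pulled back along \<open>s\<close>.\<close>

definition twist :: "('a, 'm) monoid_scheme \<Rightarrow> nat \<Rightarrow> ('a \<Rightarrow> int) \<Rightarrow> 'a \<Rightarrow> 'a monoid" where
  "twist G n s z = \<lparr>carrier = carrier G,
     monoid.mult = (\<lambda>x y. x \<otimes>\<^bsub>G\<^esub> y \<otimes>\<^bsub>G\<^esub> z [^]\<^bsub>G\<^esub> ((s x + s y) div int n)), one = \<one>\<^bsub>G\<^esub>\<rparr>"

text \<open>Carrying at once and reducing the intermediate sum does not change the total carry. This
  is the cocycle identity behind the associativity of \<open>twist\<close>.\<close>

lemma carry_assoc:
  fixes a b m :: int
  assumes "m > 0"
  shows "a div m + (a mod m + b) div m = (a + b) div m"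
proof -
  have "a + b = (a mod m + b) + m * (a div m)" by simp
  then show ?thesis using assms by (simp only: div_mult_self2)
qed

text \<open>The condition \<open>s_z\<close> makes \<open>s\<close> blind to the powers of
  \<open>z\<close> that the twisted product inserts.\<close>

locale central_twist = group G for G :: "('a, 'm) monoid_scheme" (structure) +
  fixes n :: nat and s :: "'a \<Rightarrow> int" and z :: 'a
  assumes n_pos: "n \<ge> 1"
    and s_hom: "s \<in> hom G (integer_mod_group n)"
    and z_closed [simp]: "z \<in> carrier G"
    and z_central: "x \<in> carrier G \<Longrightarrow> z \<otimes> x = x \<otimes> z"
    and s_z: "s z = 0"
begin

lemma s_range: "x \<in> carrier G \<Longrightarrow> 0 \<le> s x \<and> s x < int n"
  using s_hom n_pos by (auto simp: hom_def carrier_integer_mod_group split: if_splits)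

lemma s_mult: "x \<in> carrier G \<Longrightarrow> y \<in> carrier G \<Longrightarrow> s (x \<otimes> y) = (s x + s y) mod int n"
  using s_hom by (simp add: hom_def)

lemma s_one: "s \<one> = 0"
  using group_hom.hom_one[of G "integer_mod_group n" s] s_hom
  by (simp add: group_hom_def group_hom_axioms_def is_group)

lemma s_z_pow: "s (z [^] (k::int)) = 0"
  using group_hom.hom_int_pow[of G "integer_mod_group n" s z k] s_hom
  by (simp add: group_hom_def group_hom_axioms_def is_group int_pow_integer_mod_group s_z)

lemma z_pow_central:
  assumes "x \<in> carrier G"
  shows "z [^] (k::int) \<otimes> x = x \<otimes> z [^] k"
proof -
  have nat: "z [^] (k::nat) \<otimes> x = x \<otimes> z [^] k" for k
  proof (induction k)
    case (Suc k)
    have "z [^] Suc k \<otimes> x = z [^] k \<otimes> (z \<otimes> x)" using assms by (simp add: m_assoc)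
    also have "\<dots> = (z [^] k \<otimes> x) \<otimes> z" using assms by (simp add: z_central m_assoc)
    also have "\<dots> = x \<otimes> z [^] Suc k" using assms by (simp add: Suc m_assoc)
    finally show ?case .
  qed (use assms in simp)
  show ?thesis
  proof (cases k rule: int_cases2)
    case (nonneg m)
    then show ?thesis using nat[of m] by (simp add: int_pow_int)
  next
    case (nonpos m)
    have "inv (z [^] m) \<otimes> x = inv (z [^] m) \<otimes> (x \<otimes> z [^] m) \<otimes> inv (z [^] m)"
      using assms by (simp add: m_assoc)
    also have "\<dots> = inv (z [^] m) \<otimes> (z [^] m \<otimes> x) \<otimes> inv (z [^] m)" by (simp only: nat)
    also have "\<dots> = x \<otimes> inv (z [^] m)" using assms by (simp add: mult_inv_cancel)
    finally have "inv (z [^] m) \<otimes> x = x \<otimes> inv (z [^] m)" .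
    then show ?thesis using nonpos by (simp add: int_pow_neg_int)
  qed
qed

lemma s_mult_z: "x \<in> carrier G \<Longrightarrow> s (x \<otimes> z [^] (k::int)) = s x"
  using s_range[of x] by (simp add: s_mult s_z_pow)

lemma twist_simps [simp]:
  "carrier (twist G n s z) = carrier G" "\<one>\<^bsub>twist G n s z\<^esub> = \<one>"
  "x \<otimes>\<^bsub>twist G n s z\<^esub> y = x \<otimes> y \<otimes> z [^] ((s x + s y) div int n)"
  by (simp_all add: twist_def)

lemma group_twist: "group (twist G n s z)"
proof (rule groupI)
  fix x y w assume *: "x \<in> carrier (twist G n s z)" "y \<in> carrier (twist G n s z)"
    "w \<in> carrier (twist G n s z)"
  then have c: "x \<in> carrier G" "y \<in> carrier G" "w \<in> carrier G" by auto
  have e: "a div int n + (a mod int n + b) div int n = (a + b) div int n"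
    "a div int n + (b + a mod int n) div int n = (b + a) div int n" for a b
    using carry_assoc[of "int n" a b] n_pos by (simp_all add: add.commute)
  have "x \<otimes>\<^bsub>twist G n s z\<^esub> y \<otimes>\<^bsub>twist G n s z\<^esub> w
      = x \<otimes> y \<otimes> w \<otimes> (z [^] ((s x + s y) div int n) \<otimes> z [^] (((s x + s y) mod int n + s w) div int n))"
    using c by (simp add: s_mult s_z_pow z_pow_central[of w] m_assoc mod_simps)
  also have "\<dots> = x \<otimes> y \<otimes> w \<otimes> z [^] ((s x + s y + s w) div int n)"
    by (simp add: int_pow_mult[symmetric] e)
  also have "\<dots> = x \<otimes> y \<otimes> w \<otimes> (z [^] ((s y + s w) div int n) \<otimes> z [^] ((s x + (s y + s w) mod int n) div int n))"
    by (simp add: int_pow_mult[symmetric] e add.assoc)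
  also have "\<dots> = x \<otimes>\<^bsub>twist G n s z\<^esub> (y \<otimes>\<^bsub>twist G n s z\<^esub> w)"
    using c by (simp add: s_mult s_z_pow m_assoc mod_simps)
  finally show "x \<otimes>\<^bsub>twist G n s z\<^esub> y \<otimes>\<^bsub>twist G n s z\<^esub> w
      = x \<otimes>\<^bsub>twist G n s z\<^esub> (y \<otimes>\<^bsub>twist G n s z\<^esub> w)" .
next
  fix x assume "x \<in> carrier (twist G n s z)"
  then have x: "x \<in> carrier G" by simp
  then show "\<one>\<^bsub>twist G n s z\<^esub> \<otimes>\<^bsub>twist G n s z\<^esub> x = x" using s_range[OF x] by (simp add: s_one)
  let ?k = "(s (inv x) + s x) div int n"
  have "(inv x \<otimes> z [^] (- ?k)) \<otimes> x \<otimes> z [^] ?k = (inv x \<otimes> x) \<otimes> (z [^] (- ?k) \<otimes> z [^] ?k)"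
    using x by (simp add: m_assoc z_pow_central[of x] mult_inv_cancel)
  also have "\<dots> = \<one>" using x by (simp flip: int_pow_mult)
  finally show "\<exists>y\<in>carrier (twist G n s z). y \<otimes>\<^bsub>twist G n s z\<^esub> x = \<one>\<^bsub>twist G n s z\<^esub>"
    using x by (intro bexI[of _ "inv x \<otimes> z [^] (- ?k)"]) (simp_all add: s_mult_z)
qed simp_all

text \<open>The carries that arise while \<open>s x\<close> is added up \<open>k\<close> times sum
  to the integer part of k s(x) / n.\<close>

lemma twist_pow:
  assumes x: "x \<in> carrier G"
  shows "x [^]\<^bsub>twist G n s z\<^esub> (k::nat) = x [^] k \<otimes> z [^] ((int k * s x) div int n)"
proof (induction k)
  case (Suc k)
  have sp: "s (x [^] k) = (int k * s x) mod int n"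
    using group_hom.hom_nat_pow[of G "integer_mod_group n" s x k] s_hom x
    by (simp add: group_hom_def group_hom_axioms_def is_group pow_integer_mod_group s_range carrier_integer_mod_group)
  have e: "a div int n + (a mod int n + b) div int n = (a + b) div int n" for a b
    using n_pos by (simp add: carry_assoc)
  have "x [^]\<^bsub>twist G n s z\<^esub> Suc k
      = x [^] k \<otimes> x \<otimes> (z [^] ((int k * s x) div int n) \<otimes> z [^] (((int k * s x) mod int n + s x) div int n))"
    using x by (simp add: Suc s_mult_z sp z_pow_central[of x] m_assoc)
  also have "\<dots> = x [^] Suc k \<otimes> z [^] ((int k * s x + s x) div int n)"
    by (simp add: int_pow_mult[symmetric] e)
  finally show ?case by (simp add: distrib_right add.commute)
qed simp

text \<open>With an \<open>n\<close>-th root \<open>v\<close> of the translation by \<open>z\<close>, the elements \<open>v\<^bsup>s x\<^esup> \<lambda>\<^sub>x\<close> multiply as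
  the twisted group.\<close>

lemma twist_vN_equivalent: "vN_equivalent G (twist G n s z)"
proof -
  let ?S = "carrier G" and ?U = "unitary_group (carrier G)" and ?L = "left_regular G"
  interpret U: group ?U by (rule group_unitary_group)
  interpret L: group_hom G ?U ?L by unfold_locales (rule left_regular_hom)
  obtain v where v: "v \<in> vgen ?S {?L z}" and vn: "v [^]\<^bsub>?U\<^esub> n = ?L z"
    using left_regular_root[OF z_closed n_pos] by blast
  have vU: "v \<in> carrier ?U" by (rule vgen_unitary[OF v])
  have vL: "v [^]\<^bsub>?U\<^esub> (k::int) \<in> vgen ?S {?L z}" for k
    by (rule U.subgroup_int_pow_closed[OF subgroup_vgen v])
  have comm: "v [^]\<^bsub>?U\<^esub> (k::int) \<otimes>\<^bsub>?U\<^esub> ?L x = ?L x \<otimes>\<^bsub>?U\<^esub> v [^]\<^bsub>?U\<^esub> k" if x: "x \<in> ?S" for k x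
  proof (rule vgen_commute[OF _ _ _ vL])
    show "{?L z} \<subseteq> carrier ?U" "{?L x} \<subseteq> carrier ?U" using x by auto
    then show "?L x \<in> vgen ?S {?L x}" using vgen_incl by blast
    show "a \<otimes>\<^bsub>?U\<^esub> b = b \<otimes>\<^bsub>?U\<^esub> a" if "a \<in> {?L z}" "b \<in> {?L x}" for a b
      using that x z_central[OF x] by (simp flip: L.hom_mult)
  qed
  define \<rho> where "\<rho> x = v [^]\<^bsub>?U\<^esub> s x \<otimes>\<^bsub>?U\<^esub> ?L x" for x
  have \<rho>U: "\<rho> x \<in> carrier ?U" if "x \<in> ?S" for x using that vU by (simp add: \<rho>_def)
  have cent: "(\<forall>x\<in>?S. \<rho> x \<in> cent ?S X) \<longleftrightarrow> (\<forall>x\<in>?S. ?L x \<in> cent ?S X)"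
    if X: "X \<in> bounded_operators ?S" for X
  proof -
    interpret C: subgroup "cent ?S X" ?U by (rule subgroup_cent[OF X])
    \<comment> \<open>Since \<open>s z = 0\<close>, the operators \<open>\<rho> x\<close> include
      the translation by \<open>z\<close>. It generates \<open>v\<close>, and removing the power of
      \<open>v\<close> recovers every translation.\<close>
    have \<rho>z: "\<rho> z = ?L z" using vU by (simp add: \<rho>_def s_z)
    have vC: "v [^]\<^bsub>?U\<^esub> (k::int) \<in> cent ?S X" if "?L z \<in> cent ?S X" for k
      using vgenD[OF vL X] that by simp
    show ?thesis
    proof safe
      fix x assume "\<forall>x\<in>?S. \<rho> x \<in> cent ?S X" and x: "x \<in> ?S"
      then have "?L z \<in> cent ?S X" and \<rho>x: "\<rho> x \<in> cent ?S X" using \<rho>z z_closed by metis+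
      then have "inv\<^bsub>?U\<^esub> (v [^]\<^bsub>?U\<^esub> s x) \<otimes>\<^bsub>?U\<^esub> \<rho> x \<in> cent ?S X" using vC by simp
      moreover have "inv\<^bsub>?U\<^esub> (v [^]\<^bsub>?U\<^esub> s x) \<otimes>\<^bsub>?U\<^esub> \<rho> x = ?L x"
        using x vU by (simp add: \<rho>_def U.mult_inv_cancel)
      ultimately show "?L x \<in> cent ?S X" by simp
    next
      fix x assume "\<forall>x\<in>?S. ?L x \<in> cent ?S X" and "x \<in> ?S"
      then show "\<rho> x \<in> cent ?S X" using vC by (simp add: \<rho>_def)
    qed
  qed
  show ?thesis
  proof (rule vN_equivalent_by_representation(1)[OF group_twist, where \<rho> = \<rho>])
    show "\<rho> \<in> hom (twist G n s z) ?U"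
    proof (rule homI)
      fix x y assume "x \<in> carrier (twist G n s z)" "y \<in> carrier (twist G n s z)"
      then have x: "x \<in> ?S" and y: "y \<in> ?S" by auto
      let ?k = "(s x + s y) div int n"
      \<comment> \<open>The carry contributes the power of \<open>v\<close> with exponent
        \<open>int n * ?k\<close>, which restores the full exponent \<open>s x + s y\<close> after
        its reduction modulo \<open>n\<close>.\<close>
      have Lz: "?L (z [^] ?k) = v [^]\<^bsub>?U\<^esub> (int n * ?k)"
        using vU vn by (simp add: L.hom_int_pow U.int_pow_pow[symmetric] int_pow_int)
      have "\<rho> (x \<otimes>\<^bsub>twist G n s z\<^esub> y)
          = v [^]\<^bsub>?U\<^esub> ((s x + s y) mod int n) \<otimes>\<^bsub>?U\<^esub> (?L (z [^] ?k) \<otimes>\<^bsub>?U\<^esub> (?L x \<otimes>\<^bsub>?U\<^esub> ?L y))"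
        using x y by (simp add: \<rho>_def s_mult_z s_mult s_z_pow z_pow_central[symmetric] del: L.hom_int_pow)
      also have "\<dots> = v [^]\<^bsub>?U\<^esub> ((s x + s y) mod int n) \<otimes>\<^bsub>?U\<^esub> v [^]\<^bsub>?U\<^esub> (int n * ?k)
          \<otimes>\<^bsub>?U\<^esub> (?L x \<otimes>\<^bsub>?U\<^esub> ?L y)"
        unfolding Lz using x y vU by (simp add: U.m_assoc)
      also have "\<dots> = v [^]\<^bsub>?U\<^esub> (s x + s y) \<otimes>\<^bsub>?U\<^esub> (?L x \<otimes>\<^bsub>?U\<^esub> ?L y)"
        using vU by (simp flip: U.int_pow_mult)
      also have "\<dots> = v [^]\<^bsub>?U\<^esub> s x \<otimes>\<^bsub>?U\<^esub> (v [^]\<^bsub>?U\<^esub> s y \<otimes>\<^bsub>?U\<^esub> ?L x) \<otimes>\<^bsub>?U\<^esub> ?L y"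
        using x y vU by (simp add: U.int_pow_mult U.m_assoc)
      also have "\<dots> = \<rho> x \<otimes>\<^bsub>?U\<^esub> \<rho> y"
        unfolding comm[OF x] using x y vU by (simp add: \<rho>_def U.m_assoc)
      finally show "\<rho> (x \<otimes>\<^bsub>twist G n s z\<^esub> y) = \<rho> x \<otimes>\<^bsub>?U\<^esub> \<rho> y" .
    qed (simp add: \<rho>U)
    fix x assume "x \<in> carrier (twist G n s z)" "x \<noteq> \<one>\<^bsub>twist G n s z\<^esub>"
    then have x: "x \<in> ?S" "x \<noteq> \<one>" by auto
    have \<rho>x: "\<rho> x (delta \<one>) = (v [^]\<^bsub>?U\<^esub> s x) (delta x)"
      using x vU by (simp add: \<rho>_def unitary_mult_apply left_regular_delta)
    \<comment> \<open>Inside this subgroup \<open>s x = 0\<close> and the trace is that of a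
      translation. Outside it, the power of \<open>v\<close> lies in the algebra of the subgroup and
      cannot move mass from \<open>x\<close> to the identity.\<close>
    let ?B = "range (\<lambda>k::int. z [^] k)"
    show "\<rho> x (delta \<one>) \<one> = 0"
    proof (cases "x \<in> ?B")
      case True
      then have "s x = 0" by (auto simp: s_z_pow)
      then show ?thesis using x by (simp add: \<rho>x unitary_one_apply delta_apply)
    next
      case False
      have B: "subgroup ?B G"
      proof (rule subgroupI)
        fix a b assume "a \<in> ?B" "b \<in> ?B"
        then obtain i j :: int where "a = z [^] i" "b = z [^] j" by blast
        then have "a \<otimes> b = z [^] (i + j)" "inv a = z [^] (- i)"
          by (simp_all add: int_pow_mult int_pow_neg)
        then show "a \<otimes> b \<in> ?B" "inv a \<in> ?B" by blast+
      qed auto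
      have "z \<in> ?B" by (metis int_pow_1 rangeI z_closed)
      then have "v [^]\<^bsub>?U\<^esub> s x \<in> vgen ?S (?L ` ?B)" using vL vgen_mono[of "{?L z}" "?L ` ?B"] by blast
      then show ?thesis unfolding \<rho>x by (rule vgen_delta_one[OF B _ x(1) False])
    qed
  qed (use cent in simp)
qed

end

section \<open>Abelian groups without elements of order $p^2$\<close>

text \<open>For a group this excludes elements of order q^2. The set \<open>R\<close> is a separate
  argument so that powers may be computed in a larger group.\<close>

definition prime_torsion_elementary :: "('a, 'm) monoid_scheme \<Rightarrow> 'a set \<Rightarrow> bool" where
  "prime_torsion_elementary G R \<longleftrightarrow>
     (\<forall>x\<in>R. \<forall>q::nat. prime q \<longrightarrow> x [^]\<^bsub>G\<^esub> (q * q) = \<one>\<^bsub>G\<^esub> \<longrightarrow> x [^]\<^bsub>G\<^esub> q = \<one>\<^bsub>G\<^esub>)"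

text \<open>If some positive power of \<open>e0\<close> lies in \<open>B\<close>, the least such
  exponent m exceeds 1. For a prime p dividing m, the power of \<open>e0\<close> with exponent m/p
  is outside \<open>B\<close>, while its p-th power is inside. In the other case negative exponents
  are excluded by taking inverses.\<close>

lemma (in group) minimal_extension_step:
  assumes B: "subgroup B G" and e0: "e0 \<in> carrier G" "e0 \<notin> B"
  shows "(\<exists>e\<in>carrier G. \<exists>p::nat. e \<notin> B \<and> prime p \<and> e [^] p \<in> B) \<or>
    (\<forall>j::int. j \<noteq> 0 \<longrightarrow> e0 [^] j \<notin> B)"
proof (cases "\<exists>m::nat. m > 0 \<and> e0 [^] m \<in> B")
  case True
  define m where "m = (LEAST m::nat. m > 0 \<and> e0 [^] m \<in> B)"
  have m: "m > 0" "e0 [^] m \<in> B" unfolding m_def using LeastI_ex[OF True] by auto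
  have "m \<noteq> 1" using m e0 by auto
  then obtain p where p: "prime p" "p dvd m" using prime_factor_nat by blast
  have "m div p < m" "m div p > 0" using p m prime_gt_1_nat[OF p(1)]
    by (auto simp: div_greater_zero_iff dvd_imp_le)
  then have "e0 [^] (m div p) \<notin> B" using not_less_Least unfolding m_def by blast
  moreover have "(e0 [^] (m div p)) [^] p \<in> B" using m p e0 by (simp add: nat_pow_pow)
  ultimately show ?thesis
    using e0 p by (intro disjI1 bexI[of _ "e0 [^] (m div p)"] exI[of _ p]) simp_all
next
  case False
  interpret B: subgroup B G by (rule B)
  have "e0 [^] j \<notin> B" if j: "j \<noteq> 0" for j :: int
  proof
    assume jB: "e0 [^] j \<in> B"
    have "e0 [^] nat \<bar>j\<bar> \<in> B"
    proof (cases "0 \<le> j")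
      case True
      then show ?thesis using jB by (simp add: int_pow_int[symmetric])
    next
      case False
      then have "e0 [^] nat \<bar>j\<bar> = inv (e0 [^] j)"
        using e0 by (simp add: int_pow_int[symmetric] int_pow_neg)
      then show ?thesis using jB by simp
    qed
    moreover have "nat \<bar>j\<bar> > 0" using j by simp
    ultimately show False using False by blast
  qed
  then show ?thesis by blast
qed

section \<open>Regular families of unitaries and their maximal members\<close>

context comm_group
begin

text \<open>A regular family \<open>R\<close> has the trace of a regular representation and generates the same
  von Neumann algebra as the subgroup \<open>vbase R\<close>; a maximal one satisfies \<open>vbase R = carrier G\<close>.\<close>

definition vbase :: "'a operator set \<Rightarrow> 'a set" where
  "vbase R = {b \<in> carrier G. left_regular G b \<in> vgen (carrier G) R}"

definition regular_family :: "'a operator set \<Rightarrow> bool" where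
  "regular_family R \<longleftrightarrow> subgroup R (unitary_group (carrier G)) \<and>
     R \<subseteq> vgen (carrier G) (left_regular G ` vbase R) \<and>
     (\<forall>r\<in>R. r \<noteq> \<one>\<^bsub>unitary_group (carrier G)\<^esub> \<longrightarrow> r (delta \<one>) \<one> = 0) \<and>
     prime_torsion_elementary (unitary_group (carrier G)) R"

lemma subgroup_vbase: "subgroup (vbase R) G"
proof -
  interpret U: group "unitary_group (carrier G)" by (rule group_unitary_group)
  interpret L: group_hom G "unitary_group (carrier G)" "left_regular G"
    by unfold_locales (rule left_regular_hom)
  interpret V: subgroup "vgen (carrier G) R" "unitary_group (carrier G)" by (rule subgroup_vgen)
  show ?thesis
    by (rule subgroupI) (auto simp: vbase_def intro!: exI[of _ \<one>])
qed

lemma vbaseD: "b \<in> vbase R \<Longrightarrow> left_regular G b \<in> vgen (carrier G) R"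
  by (simp add: vbase_def)

lemma vbase_mono: "R \<subseteq> R' \<Longrightarrow> vbase R \<subseteq> vbase R'"
  using vgen_mono[of R R' "carrier G"] by (auto simp: vbase_def)

lemma vgen_comm:
  assumes "v \<in> vgen (carrier G) (left_regular G ` carrier G)"
    "w \<in> vgen (carrier G) (left_regular G ` carrier G)"
  shows "v \<otimes>\<^bsub>unitary_group (carrier G)\<^esub> w = w \<otimes>\<^bsub>unitary_group (carrier G)\<^esub> v"
proof (rule vgen_commute[OF _ _ _ assms])
  interpret L: group_hom G "unitary_group (carrier G)" "left_regular G"
    by (simp add: group_hom_def group_hom_axioms_def is_group group_unitary_group left_regular_hom)
  show "left_regular G ` carrier G \<subseteq> carrier (unitary_group (carrier G))"
    "left_regular G ` carrier G \<subseteq> carrier (unitary_group (carrier G))" by auto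
  show "a \<otimes>\<^bsub>unitary_group (carrier G)\<^esub> b = b \<otimes>\<^bsub>unitary_group (carrier G)\<^esub> a"
    if "a \<in> left_regular G ` carrier G" "b \<in> left_regular G ` carrier G" for a b
    using that m_comm by (auto simp flip: L.hom_mult)
qed

lemma regular_family_one: "regular_family {\<one>\<^bsub>unitary_group (carrier G)\<^esub>}"
proof -
  interpret U: group "unitary_group (carrier G)" by (rule group_unitary_group)
  show ?thesis
    using subgroup.one_closed[OF subgroup_vgen]
    by (auto simp: regular_family_def prime_torsion_elementary_def U.triv_subgroup)
qed

text \<open>Each condition concerns at most two members of the family at a time or is monotone in
  the family, so it survives unions of chains, as Zorn's lemma requires.\<close>

lemma regular_family_Union:
  assumes ne: "C \<noteq> {}" and chain: "subset.chain (Collect regular_family) C"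
  shows "regular_family (\<Union>C)"
proof -
  interpret U: group "unitary_group (carrier G)" by (rule group_unitary_group)
  have R: "regular_family R" if "R \<in> C" for R using chain that by (auto simp: subset.chain_def)
  have sub: "subgroup R (unitary_group (carrier G))" if "R \<in> C" for R
    using R[OF that] by (simp add: regular_family_def)
  have two: "\<exists>R\<in>C. x \<in> R \<and> y \<in> R" if xy: "x \<in> \<Union>C" "y \<in> \<Union>C" for x y
  proof -
    obtain X Y where XY: "X \<in> C" "x \<in> X" "Y \<in> C" "y \<in> Y" using xy by blast
    then have "X \<subseteq> Y \<or> Y \<subseteq> X" using chain unfolding subset_chain_def by blast
    then show ?thesis using XY by blast
  qed
  have "subgroup (\<Union>C) (unitary_group (carrier G))"
  proof (rule U.subgroupI)
    show "\<Union>C \<subseteq> carrier (unitary_group (carrier G))" using sub subgroup.subset by blast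
    show "\<Union>C \<noteq> {}" using ne sub subgroup.one_closed by blast
    show "inv\<^bsub>unitary_group (carrier G)\<^esub> a \<in> \<Union>C" if a: "a \<in> \<Union>C" for a
    proof -
      obtain R where R: "R \<in> C" "a \<in> R" using a by blast
      from subgroup.m_inv_closed[OF sub[OF R(1)] R(2)] R(1) show ?thesis by (rule UnionI[rotated])
    qed
    show "a \<otimes>\<^bsub>unitary_group (carrier G)\<^esub> b \<in> \<Union>C" if ab: "a \<in> \<Union>C" "b \<in> \<Union>C" for a b
    proof -
      obtain R where R: "R \<in> C" "a \<in> R" "b \<in> R" using two[OF ab] by blast
      from subgroup.m_closed[OF sub[OF R(1)] R(2,3)] R(1) show ?thesis by (rule UnionI[rotated])
    qed
  qed
  moreover have "r \<in> vgen (carrier G) (left_regular G ` vbase (\<Union>C))" if "r \<in> R" "R \<in> C" for r R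
  proof -
    have "r \<in> vgen (carrier G) (left_regular G ` vbase R)"
      using R[OF that(2)] that(1) by (auto simp: regular_family_def)
    moreover have "vbase R \<subseteq> vbase (\<Union>C)" by (rule vbase_mono) (use that in blast)
    ultimately show ?thesis using vgen_mono[OF image_mono] by blast
  qed
  ultimately show ?thesis
    using R unfolding regular_family_def prime_torsion_elementary_def by (intro conjI) auto
qed

text \<open>Let \<open>e\<close> lie outside \<open>vbase R\<close> with e^p inside, p prime.
  Adjoining the translation by \<open>e\<close> could create elements of order p^2. The new
  generator is instead \<open>\<rho>\<close>, the translation by \<open>e\<close> divided by a p-th
  root \<open>r\<close> of the translation by e^p; this root exists in the algebra already
  generated. Thus \<rho>^p = 1, while \<open>r\<close> and \<open>\<rho>\<close> together recover
  the translation by \<open>e\<close>. If no nontrivial power of \<open>e\<close> falls into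
  \<open>vbase R\<close>, then r = 1 and \<open>\<rho>\<close> has infinite order.\<close>

lemma regular_family_extend:
  assumes R: "regular_family R" and ne: "vbase R \<noteq> carrier G"
  shows "\<exists>R'. regular_family R' \<and> R \<subset> R'"
proof -
  let ?S = "carrier G" and ?U = "unitary_group (carrier G)" and ?L = "left_regular G"
  let ?B = "vbase R"
  interpret U: group ?U by (rule group_unitary_group)
  interpret L: group_hom G ?U ?L by unfold_locales (rule left_regular_hom)
  interpret B: subgroup ?B G by (rule subgroup_vbase)
  interpret R: subgroup R ?U using R by (simp add: regular_family_def)
  let ?V = "vgen ?S (?L ` ?B)"
  interpret V: subgroup ?V ?U by (rule subgroup_vgen)
  have LB: "?L b \<in> ?V" if "b \<in> ?B" for b
  proof -
    have "?L ` ?B \<subseteq> carrier ?U" using B.mem_carrier by (intro image_subsetI L.hom_closed)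
    from vgen_incl[OF this] that show ?thesis by blast
  qed
  have RV: "R \<subseteq> ?V" using R by (simp add: regular_family_def)
  have VR: "?V \<subseteq> vgen ?S R" by (rule vgen_least[OF image_subsetI[OF vbaseD]])
  have VW: "?V \<subseteq> vgen ?S (?L ` ?S)" by (rule vgen_mono[OF image_mono[OF B.subset]])
  have LW: "?L x \<in> vgen ?S (?L ` ?S)" if "x \<in> ?S" for x
  proof -
    have "?L ` ?S \<subseteq> carrier ?U" by (intro image_subsetI L.hom_closed)
    from vgen_incl[OF this] that show ?thesis by blast
  qed
  obtain e0 where e0: "e0 \<in> ?S" "e0 \<notin> ?B" using ne B.subset by blast
  \<comment> \<open>Both cases are packed into two conditions on exponents. Those j for which the
    j-th power of \<open>e\<close> lies in the base are the multiples of p, or only 0; in either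
    case \<open>\<rho>\<close> to the power j is trivial, and j q^2 belongs to them only if j q
    does.\<close>
  have "\<exists>e r. e \<in> ?S \<and> e \<notin> ?B \<and> r \<in> ?V \<and>
      (\<forall>j::int. e [^] j \<in> ?B \<longrightarrow> (inv\<^bsub>?U\<^esub> r \<otimes>\<^bsub>?U\<^esub> ?L e) [^]\<^bsub>?U\<^esub> j = \<one>\<^bsub>?U\<^esub>) \<and>
      (\<forall>j::int. \<forall>q::nat. prime q \<longrightarrow> e [^] (j * int (q * q)) \<in> ?B \<longrightarrow> e [^] (j * int q) \<in> ?B)"
  proof -
    consider (1) e p where "e \<in> ?S" "e \<notin> ?B" "prime (p::nat)" "e [^] p \<in> ?B"
      | (2) "\<And>j::int. j \<noteq> 0 \<Longrightarrow> e0 [^] j \<notin> ?B"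
      using minimal_extension_step[OF subgroup_vbase e0] by blast
    then show ?thesis
    proof cases
      case (1 e p)
      obtain r where r: "r \<in> vgen ?S {?L (e [^] p)}" "r [^]\<^bsub>?U\<^esub> p = ?L (e [^] p)"
        using left_regular_root[of "e [^] p" p] 1 prime_ge_1_nat by auto
      have rV: "r \<in> ?V" using r(1) vgen_mono[of "{?L (e [^] p)}" "?L ` ?B"] 1 by blast
      let ?\<rho> = "inv\<^bsub>?U\<^esub> r \<otimes>\<^bsub>?U\<^esub> ?L e"
      have \<rho>c: "?\<rho> \<in> carrier ?U" using rV 1 by simp
      have "inv\<^bsub>?U\<^esub> r \<otimes>\<^bsub>?U\<^esub> ?L e = ?L e \<otimes>\<^bsub>?U\<^esub> inv\<^bsub>?U\<^esub> r"
        using VW rV LW[OF 1(1)] by (intro vgen_comm) auto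
      then have "?\<rho> [^]\<^bsub>?U\<^esub> p = (inv\<^bsub>?U\<^esub> r) [^]\<^bsub>?U\<^esub> p \<otimes>\<^bsub>?U\<^esub> ?L e [^]\<^bsub>?U\<^esub> p"
        using rV 1 by (intro U.pow_mult_distrib) auto
      also have "\<dots> = \<one>\<^bsub>?U\<^esub>"
        using rV 1 r(2) by (simp add: U.nat_pow_inv L.hom_nat_pow)
      finally have \<rho>p: "?\<rho> [^]\<^bsub>?U\<^esub> p = \<one>\<^bsub>?U\<^esub>" .
      have dvd: "e [^] j \<in> ?B \<longleftrightarrow> int p dvd j" for j :: int
      proof
        assume jB: "e [^] j \<in> ?B"
        show "int p dvd j"
        proof (rule ccontr)
          assume "\<not> int p dvd j"
          then have "coprime (int p) j" using 1(3) by (intro prime_imp_coprime) auto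
          then have "gcd (int p) j = 1" by simp
          then obtain a b where ab: "a * int p + b * j = 1" using bezout_int[of "int p" j] by auto
          have "(e [^] int p) [^] a \<otimes> (e [^] j) [^] b = e [^] (a * int p + b * j)"
            using 1(1) by (simp add: int_pow_pow int_pow_mult mult.commute)
          then have "(e [^] p) [^] a \<otimes> (e [^] j) [^] b = e" using 1(1) by (simp add: ab int_pow_int)
          moreover have "(e [^] p) [^] a \<otimes> (e [^] j) [^] b \<in> ?B"
            by (intro B.m_closed subgroup_int_pow_closed[OF subgroup_vbase] 1(4) jB)
          ultimately show False using 1(2) by simp
        qed
      next
        assume "int p dvd j"
        then obtain k where "j = int p * k" by (elim dvdE)
        then have "e [^] j = (e [^] p) [^] k" using 1(1) by (simp add: int_pow_pow[symmetric] int_pow_int)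
        then show "e [^] j \<in> ?B" using subgroup_int_pow_closed[OF subgroup_vbase 1(4)] by simp
      qed
      show ?thesis
      proof (intro exI conjI allI impI)
        show "e \<in> ?S" "e \<notin> ?B" "r \<in> ?V" by (fact 1 rV)+
        fix j :: int
        show "?\<rho> [^]\<^bsub>?U\<^esub> j = \<one>\<^bsub>?U\<^esub>" if "e [^] j \<in> ?B"
        proof -
          have "int p dvd j" using that by (simp only: dvd)
          then obtain k where "j = int p * k" by (elim dvdE)
          then show ?thesis using \<rho>c \<rho>p by (simp add: U.int_pow_pow[symmetric] int_pow_int)
        qed
        fix q :: nat assume q: "prime q" and "e [^] (j * int (q * q)) \<in> ?B"
        then have "int p dvd j * int q * int q" by (simp add: dvd mult.assoc)
        then have "int p dvd j * int q"
          using 1(3) by (metis dvd_mult prime_dvd_mult_iff prime_nat_int_transfer)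
        then show "e [^] (j * int q) \<in> ?B" by (simp add: dvd)
      qed
    next
      case 2
      then have z: "e0 [^] j \<in> ?B \<longleftrightarrow> j = 0" for j :: int by auto
      show ?thesis
        by (rule exI[of _ e0], rule exI[of _ "\<one>\<^bsub>?U\<^esub>"]) (use e0 in \<open>auto simp: z\<close>)
    qed
  qed
  then obtain e r where e: "e \<in> ?S" "e \<notin> ?B" and r: "r \<in> ?V"
    and \<rho>1: "\<And>j::int. e [^] j \<in> ?B \<Longrightarrow> (inv\<^bsub>?U\<^esub> r \<otimes>\<^bsub>?U\<^esub> ?L e) [^]\<^bsub>?U\<^esub> j = \<one>\<^bsub>?U\<^esub>"
    and sq: "\<And>(j::int) (q::nat). prime q \<Longrightarrow> e [^] (j * int (q * q)) \<in> ?B \<Longrightarrow> e [^] (j * int q) \<in> ?B"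
    by blast
  define \<rho> where "\<rho> = inv\<^bsub>?U\<^esub> r \<otimes>\<^bsub>?U\<^esub> ?L e"
  have \<rho>W: "\<rho> \<in> vgen ?S (?L ` ?S)"
    unfolding \<rho>_def using r VW LW[OF e(1)] subgroup_vgen[of ?S "?L ` ?S"]
    by (meson subgroup.m_closed subgroup.m_inv_closed subsetD)
  have \<rho>c: "\<rho> \<in> carrier ?U" by (rule vgen_unitary[OF \<rho>W])
  have RW: "x \<in> vgen ?S (?L ` ?S)" if "x \<in> R" for x using that RV VW by blast
  have \<rho>jW: "\<rho> [^]\<^bsub>?U\<^esub> (j::int) \<in> vgen ?S (?L ` ?S)" for j
    by (rule U.subgroup_int_pow_closed[OF subgroup_vgen \<rho>W])
  have comm: "x \<otimes>\<^bsub>?U\<^esub> \<rho> [^]\<^bsub>?U\<^esub> (j::int) = \<rho> [^]\<^bsub>?U\<^esub> j \<otimes>\<^bsub>?U\<^esub> x" if "x \<in> R" for x j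
    by (rule vgen_comm[OF RW[OF that] \<rho>jW])
  \<comment> \<open>By commutativity, \<open>x\<close> times the j-th power of \<open>\<rho>\<close>
    is an operator from the algebra of the base times the translation by the j-th power of
    \<open>e\<close>. If the latter element is outside the base, the coset argument gives trace
    0.\<close>
  have trace: "(x \<otimes>\<^bsub>?U\<^esub> \<rho> [^]\<^bsub>?U\<^esub> j) (delta \<one>) \<one> = 0" if x: "x \<in> R" and j: "e [^] j \<notin> ?B" for x and j :: int
  proof -
    have "inv\<^bsub>?U\<^esub> r \<otimes>\<^bsub>?U\<^esub> ?L e = ?L e \<otimes>\<^bsub>?U\<^esub> inv\<^bsub>?U\<^esub> r"
      using VW r LW[OF e(1)] by (intro vgen_comm) auto
    from U.int_pow_mult_distrib[OF this]
    have \<rho>j: "\<rho> [^]\<^bsub>?U\<^esub> j = (inv\<^bsub>?U\<^esub> r) [^]\<^bsub>?U\<^esub> j \<otimes>\<^bsub>?U\<^esub> ?L (e [^] j)"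
      unfolding \<rho>_def using r e by (simp add: L.hom_int_pow)
    define y where "y = x \<otimes>\<^bsub>?U\<^esub> (inv\<^bsub>?U\<^esub> r) [^]\<^bsub>?U\<^esub> j"
    have y: "y \<in> ?V"
      unfolding y_def using x RV r by (intro V.m_closed U.subgroup_int_pow_closed[OF subgroup_vgen]) auto
    have "x \<otimes>\<^bsub>?U\<^esub> \<rho> [^]\<^bsub>?U\<^esub> j = y \<otimes>\<^bsub>?U\<^esub> ?L (e [^] j)"
      unfolding \<rho>j y_def using x r e by (simp add: U.m_assoc)
    then have "(x \<otimes>\<^bsub>?U\<^esub> \<rho> [^]\<^bsub>?U\<^esub> j) (delta \<one>) = y (delta (e [^] j))"
      using e by (simp add: unitary_mult_apply left_regular_delta del: L.hom_int_pow)
    then show ?thesis using vgen_delta_one[OF subgroup_vbase y _ j] e by simp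
  qed
  define R' where "R' = {x \<otimes>\<^bsub>?U\<^esub> \<rho> [^]\<^bsub>?U\<^esub> j | x j::int. x \<in> R}"
  have RR': "R \<subseteq> R'"
  proof
    fix x assume "x \<in> R"
    moreover from this have "x = x \<otimes>\<^bsub>?U\<^esub> \<rho> [^]\<^bsub>?U\<^esub> (0::int)" by simp
    ultimately show "x \<in> R'" unfolding R'_def by blast
  qed
  have \<rho>R': "\<rho> \<in> R'"
  proof -
    have "\<rho> = \<one>\<^bsub>?U\<^esub> \<otimes>\<^bsub>?U\<^esub> \<rho> [^]\<^bsub>?U\<^esub> (1::int)" using \<rho>c by simp
    then show ?thesis unfolding R'_def using R.one_closed by blast
  qed
  have sub: "subgroup R' ?U"
  proof (rule U.subgroupI)
    show "R' \<subseteq> carrier ?U" using \<rho>c by (auto simp: R'_def)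
    show "R' \<noteq> {}" using \<rho>R' by blast
    fix a assume "a \<in> R'"
    then obtain x and i :: int where a: "a = x \<otimes>\<^bsub>?U\<^esub> \<rho> [^]\<^bsub>?U\<^esub> i" "x \<in> R" by (auto simp: R'_def)
    have "inv\<^bsub>?U\<^esub> a = inv\<^bsub>?U\<^esub> x \<otimes>\<^bsub>?U\<^esub> \<rho> [^]\<^bsub>?U\<^esub> (- i)"
      using a \<rho>c by (simp add: comm U.inv_mult_group U.int_pow_neg)
    then show "inv\<^bsub>?U\<^esub> a \<in> R'" unfolding R'_def using a(2) by blast
    fix b assume "b \<in> R'"
    then obtain y and j :: int where b: "b = y \<otimes>\<^bsub>?U\<^esub> \<rho> [^]\<^bsub>?U\<^esub> j" "y \<in> R" by (auto simp: R'_def)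
    have "a \<otimes>\<^bsub>?U\<^esub> b = x \<otimes>\<^bsub>?U\<^esub> (\<rho> [^]\<^bsub>?U\<^esub> i \<otimes>\<^bsub>?U\<^esub> y) \<otimes>\<^bsub>?U\<^esub> \<rho> [^]\<^bsub>?U\<^esub> j"
      using a b \<rho>c by (simp add: U.m_assoc)
    also have "\<dots> = (x \<otimes>\<^bsub>?U\<^esub> y) \<otimes>\<^bsub>?U\<^esub> \<rho> [^]\<^bsub>?U\<^esub> (i + j)"
      unfolding comm[OF b(2), symmetric] using a b \<rho>c by (simp add: U.m_assoc U.int_pow_mult)
    finally show "a \<otimes>\<^bsub>?U\<^esub> b \<in> R'" unfolding R'_def using a(2) b(2) by blast
  qed
  have Le: "?L e = r \<otimes>\<^bsub>?U\<^esub> \<rho>" unfolding \<rho>_def using r e by (simp add: U.mult_inv_cancel)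
  have eB: "e \<in> vbase R'"
  proof -
    have "r \<in> vgen ?S R'" using r VR vgen_mono[OF RR'] by blast
    moreover have "\<rho> \<in> vgen ?S R'" using \<rho>R' vgen_incl[OF subgroup.subset[OF sub]] by blast
    ultimately show ?thesis
      unfolding vbase_def using e Le subgroup.m_closed[OF subgroup_vgen] by auto
  qed
  have BB: "?B \<subseteq> vbase R'" by (rule vbase_mono[OF RR'])
  have "R' \<subseteq> vgen ?S (?L ` vbase R')"
  proof -
    interpret V': subgroup "vgen ?S (?L ` vbase R')" ?U by (rule subgroup_vgen)
    have VV': "?V \<subseteq> vgen ?S (?L ` vbase R')" by (intro vgen_mono image_mono BB)
    have "?L ` vbase R' \<subseteq> carrier ?U"
      using subgroup.mem_carrier[OF subgroup_vbase] by (intro image_subsetI L.hom_closed)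
    from vgen_incl[OF this] have "?L e \<in> vgen ?S (?L ` vbase R')" using eB by blast
    then have "\<rho> \<in> vgen ?S (?L ` vbase R')"
      unfolding \<rho>_def using subsetD[OF VV' r] by (intro V'.m_closed V'.m_inv_closed)
    then have \<rho>V': "\<rho> [^]\<^bsub>?U\<^esub> j \<in> vgen ?S (?L ` vbase R')" for j :: int
      by (rule U.subgroup_int_pow_closed[OF subgroup_vgen])
    show ?thesis
    proof
      fix x assume "x \<in> R'"
      then obtain y and j :: int where y: "x = y \<otimes>\<^bsub>?U\<^esub> \<rho> [^]\<^bsub>?U\<^esub> j" "y \<in> R" by (auto simp: R'_def)
      from V'.m_closed[OF subsetD[OF VV' subsetD[OF RV y(2)]] \<rho>V'] y(1)
      show "x \<in> vgen ?S (?L ` vbase R')" by simp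
    qed
  qed
  moreover have "x (delta \<one>) \<one> = 0" if "x \<in> R'" "x \<noteq> \<one>\<^bsub>?U\<^esub>" for x
  proof -
    obtain y and j :: int where y: "x = y \<otimes>\<^bsub>?U\<^esub> \<rho> [^]\<^bsub>?U\<^esub> j" "y \<in> R"
      using \<open>x \<in> R'\<close> by (auto simp: R'_def)
    show ?thesis
    proof (cases "e [^] j \<in> ?B")
      case True
      then have "x = y" using y \<rho>1 by (simp add: \<rho>_def)
      then show ?thesis using R y that(2) by (simp add: regular_family_def)
    next
      case False
      then show ?thesis using trace y by simp
    qed
  qed
  moreover have "prime_torsion_elementary ?U R'"
    unfolding prime_torsion_elementary_def
  proof (intro ballI allI impI)
    fix x and q :: nat assume x: "x \<in> R'" and q: "prime q" and xq: "x [^]\<^bsub>?U\<^esub> (q * q) = \<one>\<^bsub>?U\<^esub>"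
    obtain y and j :: int where y: "x = y \<otimes>\<^bsub>?U\<^esub> \<rho> [^]\<^bsub>?U\<^esub> j" "y \<in> R" using x by (auto simp: R'_def)
    have pow: "x [^]\<^bsub>?U\<^esub> (k::nat) = y [^]\<^bsub>?U\<^esub> k \<otimes>\<^bsub>?U\<^esub> \<rho> [^]\<^bsub>?U\<^esub> (j * int k)" for k
      using U.pow_mult_distrib[OF comm[OF y(2)], of j k] y \<rho>c
      by (simp add: U.int_pow_pow[symmetric] int_pow_int)
    have ycl: "y [^]\<^bsub>?U\<^esub> (k::nat) \<in> R" for k by (induction k) (use y in auto)
    \<comment> \<open>Otherwise the power of \<open>x\<close> with exponent q^2 would have trace 0,
      but it is the identity. Hence \<open>\<rho>\<close> drops out of both powers, and the claim is
      inherited from \<open>y\<close> in \<open>R\<close>.\<close>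
    have "e [^] (j * int (q * q)) \<in> ?B"
    proof (rule ccontr)
      assume "e [^] (j * int (q * q)) \<notin> ?B"
      from trace[OF ycl this, of "q * q"] show False
        using xq unfolding pow by (simp add: unitary_one_apply delta_apply)
    qed
    then have 1: "\<rho> [^]\<^bsub>?U\<^esub> (j * int (q * q)) = \<one>\<^bsub>?U\<^esub>" "\<rho> [^]\<^bsub>?U\<^esub> (j * int q) = \<one>\<^bsub>?U\<^esub>"
      using \<rho>1 sq[OF q] unfolding \<rho>_def by blast+
    then have "y [^]\<^bsub>?U\<^esub> (q * q) = \<one>\<^bsub>?U\<^esub>" using xq ycl unfolding pow by simp
    then have "y [^]\<^bsub>?U\<^esub> q = \<one>\<^bsub>?U\<^esub>"
      using R y(2) q by (simp add: regular_family_def prime_torsion_elementary_def)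
    then show "x [^]\<^bsub>?U\<^esub> q = \<one>\<^bsub>?U\<^esub>" unfolding pow using 1 by simp
  qed
  ultimately have "regular_family R'" using sub by (simp add: regular_family_def)
  moreover have "R \<noteq> R'" using e eB by auto
  ultimately show ?thesis using RR' by blast
qed

text \<open>A maximal regular family generates all translations and is the required group. Its
  countability is what allows a copy on natural numbers later on. It follows from Bessel's
  inequality: the vectors \<open>x (delta \<one>)\<close> are orthonormal, so each coordinate is
  nonzero for only countably many \<open>x\<close>, and there are countably many
  coordinates.\<close>

lemma exists_elementary_vN_equivalent:
  "\<exists>R. group (unitary_group (carrier G)\<lparr>carrier := R\<rparr>) \<and>
     prime_torsion_elementary (unitary_group (carrier G)) R \<and>
     (countable (carrier G) \<longrightarrow> countable R) \<and>
     vN_equivalent G (unitary_group (carrier G)\<lparr>carrier := R\<rparr>)"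
proof -
  let ?S = "carrier G" and ?U = "unitary_group (carrier G)" and ?L = "left_regular G"
  interpret U: group ?U by (rule group_unitary_group)
  interpret L: group_hom G ?U ?L by unfold_locales (rule left_regular_hom)
  obtain R where R: "regular_family R" and max: "\<And>R'. regular_family R' \<Longrightarrow> R \<subseteq> R' \<Longrightarrow> R' = R"
    using subset_Zorn_nonempty[of "Collect regular_family"] regular_family_one regular_family_Union
    by auto
  have base: "vbase R = ?S" using regular_family_extend[OF R] max by blast
  have sub: "subgroup R ?U" and RV: "R \<subseteq> vgen ?S (?L ` ?S)"
    and trace: "\<And>r. r \<in> R \<Longrightarrow> r \<noteq> \<one>\<^bsub>?U\<^esub> \<Longrightarrow> r (delta \<one>) \<one> = 0"
    and elem: "prime_torsion_elementary ?U R"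
    using R base by (auto simp: regular_family_def)
  interpret R: subgroup R ?U by (rule sub)
  let ?H = "?U\<lparr>carrier := R\<rparr>"
  have H: "group ?H" by (rule R.subgroup_is_group[OF U.is_group])
  have vN: "vN_equivalent G ?H"
  proof (rule vN_equivalent_by_representation(1)[OF H, where \<rho> = "\<lambda>r. r"])
    show "(\<lambda>r. r) \<in> hom ?H ?U" by (auto simp: hom_def)
    show "r (delta \<one>) \<one> = 0" if "r \<in> carrier ?H" "r \<noteq> \<one>\<^bsub>?H\<^esub>" for r using that trace by simp
    fix X assume X: "X \<in> bounded_operators ?S"
    show "(\<forall>x\<in>carrier ?H. x \<in> cent ?S X) \<longleftrightarrow> (\<forall>g\<in>?S. ?L g \<in> cent ?S X)"
    proof safe
      fix x assume "\<forall>g\<in>?S. ?L g \<in> cent ?S X" "x \<in> carrier ?H"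
      then show "x \<in> cent ?S X" using vgenD[OF _ X, of x "?L ` ?S"] RV by auto
    next
      fix g assume *: "\<forall>x\<in>carrier ?H. x \<in> cent ?S X" and "g \<in> ?S"
      then have "?L g \<in> vgen ?S R" using base by (auto simp: vbase_def)
      then show "?L g \<in> cent ?S X" by (rule vgenD[OF _ X]) (use * in auto)
    qed
  qed
  have on: "ell2_inner ?S (x (delta \<one>)) (y (delta \<one>)) = (if x = y then 1 else 0)"
    if x: "x \<in> R" and y: "y \<in> R" for x y
  proof -
    let ?w = "inv\<^bsub>?U\<^esub> y \<otimes>\<^bsub>?U\<^esub> x"
    have "y \<otimes>\<^bsub>?U\<^esub> ?w = x" using x y by (simp add: U.mult_inv_cancel)
    then have "x (delta \<one>) = y (?w (delta \<one>))"
      using unitary_mult_apply[of "delta \<one>" ?S y ?w] by simp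
    then have "ell2_inner ?S (x (delta \<one>)) (y (delta \<one>)) = ell2_inner ?S (?w (delta \<one>)) (delta \<one>)"
      using x y by (simp add: unitary_inner unitary_closed)
    also have "\<dots> = ?w (delta \<one>) \<one>" by (simp add: inner_delta_right)
    also have "\<dots> = (if x = y then 1 else 0)"
    proof (cases "x = y")
      case True
      then show ?thesis using x by (simp add: unitary_one_apply delta_apply)
    next
      case False
      then have "?w \<noteq> \<one>\<^bsub>?U\<^esub>" using x y by (metis R.mem_carrier U.inv_closed U.inv_equality U.inv_inv)
      then show ?thesis using False trace[of ?w] x y by simp
    qed
    finally show ?thesis .
  qed
  have "countable R" if "countable ?S"
  proof -
    have b: "x (delta \<one>) \<in> ell2 ?S" if "x \<in> R" for x using that by (simp add: unitary_closed)
    have "countable {x \<in> R. (cmod (x (delta \<one>) s))\<^sup>2 \<noteq> 0}" if s: "s \<in> ?S" for s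
    proof (rule summable_countable_real, rule nonneg_bdd_above_summable_on)
      show "bdd_above (sum (\<lambda>x. (cmod (x (delta \<one>) s))\<^sup>2) ` {F. F \<subseteq> R \<and> finite F})"
      proof (rule bdd_aboveI2)
        fix F assume "F \<in> {F. F \<subseteq> R \<and> finite F}"
        then have F: "finite F" "F \<subseteq> R" by auto
        have "(\<Sum>x\<in>F. (cmod (x (delta \<one>) s))\<^sup>2) = (\<Sum>x\<in>F. (cmod (ell2_inner ?S (delta s) (x (delta \<one>))))\<^sup>2)"
          using s by (simp add: inner_delta_left)
        also have "\<dots> \<le> (ell2_norm ?S (delta s))\<^sup>2"
          by (rule bessel[where X = R and b = "\<lambda>x. x (delta \<one>)"]) (use b on s F in auto)
        finally show "(\<Sum>x\<in>F. (cmod (x (delta \<one>) s))\<^sup>2) \<le> (ell2_norm ?S (delta s))\<^sup>2" .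
      qed
    qed simp
    then have "countable (\<Union>s\<in>?S. {x \<in> R. (cmod (x (delta \<one>) s))\<^sup>2 \<noteq> 0})" using that by blast
    moreover have "R \<subseteq> (\<Union>s\<in>?S. {x \<in> R. (cmod (x (delta \<one>) s))\<^sup>2 \<noteq> 0})"
    proof
      fix x assume x: "x \<in> R"
      have "x (delta \<one>) \<noteq> (\<lambda>_. 0)" using on[OF x x] by auto
      then obtain s where "x (delta \<one>) s \<noteq> 0" by auto
      then show "x \<in> (\<Union>s\<in>?S. {x \<in> R. (cmod (x (delta \<one>) s))\<^sup>2 \<noteq> 0})"
        using x ell2_D[OF b[OF x], of s] by auto
    qed
    ultimately show ?thesis by (rule countable_subset[rotated])
  qed
  then show ?thesis using H elem vN by blast
qed

end

section \<open>Wreath products\<close>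

text \<open>The elements whose normal closure is abelian. In the wreath products with infinite
  stabilizer orbits they are exactly the base, which is thereby described without reference to
  coordinates.\<close>

definition commuting_conj :: "('a, 'm) monoid_scheme \<Rightarrow> 'a set" where
  "commuting_conj G = {a \<in> carrier G. \<forall>t\<in>carrier G.
     a \<otimes>\<^bsub>G\<^esub> (t \<otimes>\<^bsub>G\<^esub> a \<otimes>\<^bsub>G\<^esub> inv\<^bsub>G\<^esub> t) = (t \<otimes>\<^bsub>G\<^esub> a \<otimes>\<^bsub>G\<^esub> inv\<^bsub>G\<^esub> t) \<otimes>\<^bsub>G\<^esub> a}"

text \<open>An isomorphism-invariant substitute for the generators \<open>u i\<close>: among the
  elements with abelian normal closure, only powers of \<open>a\<close> have a finite orbit under
  the centralizer of \<open>a\<close>. In the wreath products below each \<open>u i\<close> is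
  isolated, and each isolated element has some \<open>u j\<close> among its powers.\<close>

definition isolated :: "('a, 'm) monoid_scheme \<Rightarrow> 'a set" where
  "isolated G = {a \<in> commuting_conj G. a \<noteq> \<one>\<^bsub>G\<^esub> \<and>
     (\<forall>b\<in>commuting_conj G.
        finite {t \<otimes>\<^bsub>G\<^esub> b \<otimes>\<^bsub>G\<^esub> inv\<^bsub>G\<^esub> t | t. t \<in> carrier G \<and> t \<otimes>\<^bsub>G\<^esub> a = a \<otimes>\<^bsub>G\<^esub> t} \<longrightarrow>
        (\<exists>k::int. b = a [^]\<^bsub>G\<^esub> k))}"

context
  fixes G :: "('a, 'm) monoid_scheme" and H :: "('b, 'k) monoid_scheme" and \<theta>
  assumes G: "group G" and H: "group H" and iso: "\<theta> \<in> iso G H"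
begin

interpretation G: group G by (rule G)
interpretation H: group H by (rule H)
interpretation \<theta>: group_hom G H \<theta>
  using iso by unfold_locales (auto simp: iso_def)

lemma iso_surj: "y \<in> carrier H \<Longrightarrow> \<exists>x\<in>carrier G. y = \<theta> x"
  using iso by (auto simp: iso_def bij_betw_def)

lemma iso_eq_iff: "x \<in> carrier G \<Longrightarrow> y \<in> carrier G \<Longrightarrow> \<theta> x = \<theta> y \<longleftrightarrow> x = y"
  using iso by (auto simp: iso_def bij_betw_def inj_on_def)

lemma commuting_conj_iso_iff:
  assumes a: "a \<in> carrier G"
  shows "\<theta> a \<in> commuting_conj H \<longleftrightarrow> a \<in> commuting_conj G"
proof -
  have "(\<theta> a \<otimes>\<^bsub>H\<^esub> (\<theta> t \<otimes>\<^bsub>H\<^esub> \<theta> a \<otimes>\<^bsub>H\<^esub> inv\<^bsub>H\<^esub> \<theta> t) = (\<theta> t \<otimes>\<^bsub>H\<^esub> \<theta> a \<otimes>\<^bsub>H\<^esub> inv\<^bsub>H\<^esub> \<theta> t) \<otimes>\<^bsub>H\<^esub> \<theta> a)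
      \<longleftrightarrow> (a \<otimes>\<^bsub>G\<^esub> (t \<otimes>\<^bsub>G\<^esub> a \<otimes>\<^bsub>G\<^esub> inv\<^bsub>G\<^esub> t) = (t \<otimes>\<^bsub>G\<^esub> a \<otimes>\<^bsub>G\<^esub> inv\<^bsub>G\<^esub> t) \<otimes>\<^bsub>G\<^esub> a)"
    if t: "t \<in> carrier G" for t
    using a t iso_eq_iff[of "a \<otimes>\<^bsub>G\<^esub> (t \<otimes>\<^bsub>G\<^esub> a \<otimes>\<^bsub>G\<^esub> inv\<^bsub>G\<^esub> t)" "(t \<otimes>\<^bsub>G\<^esub> a \<otimes>\<^bsub>G\<^esub> inv\<^bsub>G\<^esub> t) \<otimes>\<^bsub>G\<^esub> a"]
    by simp
  moreover have "(\<forall>t\<in>carrier H. Q t) \<longleftrightarrow> (\<forall>t\<in>carrier G. Q (\<theta> t))" for Q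
    using iso_surj by (metis \<theta>.hom_closed)
  ultimately show ?thesis using a by (simp add: commuting_conj_def)
qed

lemma isolated_iso:
  assumes a: "a \<in> isolated G"
  shows "\<theta> a \<in> isolated H"
proof -
  have ac: "a \<in> carrier G" "a \<in> commuting_conj G" "a \<noteq> \<one>\<^bsub>G\<^esub>"
    using a by (auto simp: isolated_def commuting_conj_def)
  have "\<exists>k::int. \<theta> b = \<theta> a [^]\<^bsub>H\<^esub> k"
    if b: "b \<in> commuting_conj G" and
      fin: "finite {t \<otimes>\<^bsub>H\<^esub> \<theta> b \<otimes>\<^bsub>H\<^esub> inv\<^bsub>H\<^esub> t | t. t \<in> carrier H \<and> t \<otimes>\<^bsub>H\<^esub> \<theta> a = \<theta> a \<otimes>\<^bsub>H\<^esub> t}" for b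
  proof -
    have bc: "b \<in> carrier G" using b by (simp add: commuting_conj_def)
    let ?O = "{t \<otimes>\<^bsub>G\<^esub> b \<otimes>\<^bsub>G\<^esub> inv\<^bsub>G\<^esub> t | t. t \<in> carrier G \<and> t \<otimes>\<^bsub>G\<^esub> a = a \<otimes>\<^bsub>G\<^esub> t}"
    have "\<theta> ` ?O \<subseteq> {t \<otimes>\<^bsub>H\<^esub> \<theta> b \<otimes>\<^bsub>H\<^esub> inv\<^bsub>H\<^esub> t | t. t \<in> carrier H \<and> t \<otimes>\<^bsub>H\<^esub> \<theta> a = \<theta> a \<otimes>\<^bsub>H\<^esub> t}"
    proof clarify
      fix t assume t: "t \<in> carrier G" "t \<otimes>\<^bsub>G\<^esub> a = a \<otimes>\<^bsub>G\<^esub> t"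
      have "\<theta> t \<otimes>\<^bsub>H\<^esub> \<theta> a = \<theta> a \<otimes>\<^bsub>H\<^esub> \<theta> t" using t ac by (simp flip: \<theta>.hom_mult)
      then show "\<exists>u. \<theta> (t \<otimes>\<^bsub>G\<^esub> b \<otimes>\<^bsub>G\<^esub> inv\<^bsub>G\<^esub> t) = u \<otimes>\<^bsub>H\<^esub> \<theta> b \<otimes>\<^bsub>H\<^esub> inv\<^bsub>H\<^esub> u \<and>
          u \<in> carrier H \<and> u \<otimes>\<^bsub>H\<^esub> \<theta> a = \<theta> a \<otimes>\<^bsub>H\<^esub> u"
        using t bc by (intro exI[of _ "\<theta> t"]) simp
    qed
    then have "finite (\<theta> ` ?O)" using fin by (rule finite_subset)
    moreover have "inj_on \<theta> ?O"
      by (rule inj_on_subset[of _ "carrier G"]) (use iso bc in \<open>auto simp: iso_def bij_betw_def\<close>)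
    ultimately have "finite ?O" by (rule finite_imageD)
    then obtain k :: int where "b = a [^]\<^bsub>G\<^esub> k" using a b unfolding isolated_def by blast
    then show ?thesis using ac by (auto simp: \<theta>.hom_int_pow)
  qed
  moreover have "\<exists>b\<in>commuting_conj G. y = \<theta> b" if "y \<in> commuting_conj H" for y
  proof -
    obtain b where "b \<in> carrier G" "y = \<theta> b" using iso_surj \<open>y \<in> commuting_conj H\<close>
      by (auto simp: commuting_conj_def)
    then show ?thesis using that commuting_conj_iso_iff by blast
  qed
  moreover have "\<theta> a \<noteq> \<one>\<^bsub>H\<^esub>" using ac iso_eq_iff[of a "\<one>\<^bsub>G\<^esub>"] by simp
  ultimately show ?thesis
    unfolding isolated_def using ac commuting_conj_iso_iff[of a] by blast
qed

end

section \<open>The wreath product in coordinates\<close>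

locale wreath = group \<Gamma> for \<Gamma> :: "'g monoid" (structure) +
  fixes I :: "'i set" and \<phi> :: "'g \<Rightarrow> 'i \<Rightarrow> 'i" and n :: nat
  assumes faithful: "faithful_action \<Gamma> I \<phi>" and transitive: "transitive_action \<Gamma> I \<phi>"
    and I_ne: "I \<noteq> {}" and n2: "n \<ge> 2"
begin

sublocale act: faithful_action \<Gamma> I \<phi> by (rule faithful)

lemma act_closed [simp]: "g \<in> carrier \<Gamma> \<Longrightarrow> i \<in> I \<Longrightarrow> \<phi> g i \<in> I"
  using act.element_image by blast

lemma act_mult: "g \<in> carrier \<Gamma> \<Longrightarrow> h \<in> carrier \<Gamma> \<Longrightarrow> i \<in> I \<Longrightarrow> \<phi> (g \<otimes> h) i = \<phi> g (\<phi> h i)"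
  by (rule act.composition_rule)

lemma act_one [simp]: "i \<in> I \<Longrightarrow> \<phi> \<one> i = i"
  using act.id_eq_one by (metis restrict_apply')

lemma act_inv [simp]:
  "g \<in> carrier \<Gamma> \<Longrightarrow> i \<in> I \<Longrightarrow> \<phi> (inv g) (\<phi> g i) = i"
  "g \<in> carrier \<Gamma> \<Longrightarrow> i \<in> I \<Longrightarrow> \<phi> g (\<phi> (inv g) i) = i"
  by (simp_all flip: act_mult)

lemma act_eq_iff: "g \<in> carrier \<Gamma> \<Longrightarrow> i \<in> I \<Longrightarrow> j \<in> I \<Longrightarrow> \<phi> (inv g) j = i \<longleftrightarrow> j = \<phi> g i"
  by auto

lemma act_faithful:
  assumes "g \<in> carrier \<Gamma>" "g \<noteq> \<one>"
  shows "\<exists>i\<in>I. \<phi> g i \<noteq> i"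
proof (rule ccontr)
  assume *: "\<not> ?thesis"
  have "\<phi> g \<in> extensional I" using act.bij_prop0[OF assms(1)] by (simp add: Bij_def)
  then have "\<phi> g = (\<lambda>i\<in>I. i)" using * by (auto simp: extensional_def fun_eq_iff)
  then have "\<phi> g = \<phi> \<one>" using act.id_eq_one by simp
  then show False using act.faithful assms by (auto simp: inj_on_def)
qed

definition base :: "('i \<Rightarrow> int) set" where
  "base = {x \<in> extensional I. (\<forall>i\<in>I. 0 \<le> x i \<and> x i < int n) \<and> finite {i \<in> I. x i \<noteq> 0}}"

definition add :: "('i \<Rightarrow> int) \<Rightarrow> ('i \<Rightarrow> int) \<Rightarrow> 'i \<Rightarrow> int" where
  "add x y = (\<lambda>i\<in>I. (x i + y i) mod int n)"

definition shift :: "'g \<Rightarrow> ('i \<Rightarrow> int) \<Rightarrow> 'i \<Rightarrow> int" where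
  "shift g x = (\<lambda>i\<in>I. x (\<phi> (inv g) i))"

definition zero :: "'i \<Rightarrow> int" where "zero = (\<lambda>i\<in>I. 0)"

definition unit :: "'i \<Rightarrow> 'i \<Rightarrow> int" where "unit j = (\<lambda>i\<in>I. if i = j then 1 else 0)"

abbreviation W :: "(('i \<Rightarrow> int) \<times> 'g) monoid" where "W \<equiv> generalized_wreath n I \<Gamma> \<phi>"

lemma carrier_W: "carrier W = base \<times> carrier \<Gamma>"
proof -
  have "carrier (sum_group I (\<lambda>_. integer_mod_group n)) = base"
    using n2 by (subst carrier_sum_group) (auto simp: base_def PiE_iff carrier_integer_mod_group)
  then show ?thesis by (simp add: generalized_wreath_def Let_def)
qed

lemma one_W: "\<one>\<^bsub>W\<^esub> = (zero, \<one>)"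
  by (simp add: generalized_wreath_def Let_def zero_def)

lemma mult_W: "(x, g) \<otimes>\<^bsub>W\<^esub> (y, h) = (add x (shift g y), g \<otimes> h)"
  by (auto simp: generalized_wreath_def Let_def add_def shift_def fun_eq_iff)

lemma baseD:
  assumes "x \<in> base"
  shows "x \<in> extensional I" "\<And>i. i \<in> I \<Longrightarrow> 0 \<le> x i" "\<And>i. i \<in> I \<Longrightarrow> x i < int n"
    "finite {i \<in> I. x i \<noteq> 0}"
  using assms by (auto simp: base_def)

lemma base_ext: "x \<in> base \<Longrightarrow> y \<in> base \<Longrightarrow> (\<And>i. i \<in> I \<Longrightarrow> x i = y i) \<Longrightarrow> x = y"
  by (rule extensionalityI[of _ I]) (auto simp: base_def)

lemma zero_base [simp]: "zero \<in> base"
  using n2 by (simp add: base_def zero_def)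

lemma unit_base [simp]: "unit j \<in> base"
proof -
  have "finite {i \<in> I. unit j i \<noteq> 0}"
    by (rule finite_subset[of _ "{j}"]) (auto simp: unit_def)
  then show ?thesis using n2 by (simp add: base_def unit_def)
qed

lemma add_base [simp]:
  assumes "x \<in> base" "y \<in> base"
  shows "add x y \<in> base"
proof -
  have "finite {i \<in> I. add x y i \<noteq> 0}"
    by (rule finite_subset[of _ "{i \<in> I. x i \<noteq> 0} \<union> {i \<in> I. y i \<noteq> 0}"])
      (use assms in \<open>auto simp: add_def base_def\<close>)
  then show ?thesis using n2 by (simp add: base_def add_def)
qed

lemma shift_base [simp]:
  assumes "g \<in> carrier \<Gamma>" "x \<in> base"
  shows "shift g x \<in> base"
proof -
  have "finite {i \<in> I. shift g x i \<noteq> 0}"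
  proof (rule finite_subset[of _ "\<phi> g ` {i \<in> I. x i \<noteq> 0}"])
    show "{i \<in> I. shift g x i \<noteq> 0} \<subseteq> \<phi> g ` {i \<in> I. x i \<noteq> 0}"
      using assms by (auto simp: shift_def intro!: image_eqI[of _ _ "\<phi> (inv g) _"])
  qed (use assms in \<open>simp add: base_def\<close>)
  then show ?thesis using assms by (simp add: base_def shift_def)
qed

lemma add_comm: "add x y = add y x"
  by (simp add: add_def add.commute)

lemma add_assoc: "add (add x y) w = add x (add y w)"
  by (auto simp: add_def fun_eq_iff mod_simps add.assoc)

lemma add_zero [simp]: "x \<in> base \<Longrightarrow> add zero x = x" "x \<in> base \<Longrightarrow> add x zero = x"
  by (auto simp: add_def zero_def base_def extensional_def fun_eq_iff)

lemma shift_add: "g \<in> carrier \<Gamma> \<Longrightarrow> shift g (add x y) = add (shift g x) (shift g y)"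
  by (auto simp: shift_def add_def fun_eq_iff)

lemma shift_mult: "g \<in> carrier \<Gamma> \<Longrightarrow> h \<in> carrier \<Gamma> \<Longrightarrow> shift (g \<otimes> h) x = shift g (shift h x)"
  by (auto simp: shift_def fun_eq_iff inv_mult_group act_mult)

lemma shift_one [simp]: "x \<in> base \<Longrightarrow> shift \<one> x = x"
  by (auto simp: shift_def base_def extensional_def fun_eq_iff)

lemma shift_zero [simp]: "g \<in> carrier \<Gamma> \<Longrightarrow> shift g zero = zero"
  by (auto simp: shift_def zero_def fun_eq_iff)

lemma shift_unit: "g \<in> carrier \<Gamma> \<Longrightarrow> j \<in> I \<Longrightarrow> shift g (unit j) = unit (\<phi> g j)"
  by (auto simp: shift_def unit_def fun_eq_iff act_eq_iff)

lemma shift_apply: "g \<in> carrier \<Gamma> \<Longrightarrow> i \<in> I \<Longrightarrow> shift g x (\<phi> g i) = x i"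
  by (simp add: shift_def)

definition neg :: "('i \<Rightarrow> int) \<Rightarrow> 'i \<Rightarrow> int" where "neg x = (\<lambda>i\<in>I. (- x i) mod int n)"

lemma neg_base [simp]:
  assumes "x \<in> base"
  shows "neg x \<in> base"
proof -
  have "finite {i \<in> I. neg x i \<noteq> 0}"
    by (rule finite_subset[of _ "{i \<in> I. x i \<noteq> 0}"]) (use assms in \<open>auto simp: neg_def base_def\<close>)
  then show ?thesis using n2 by (simp add: base_def neg_def)
qed

lemma add_neg [simp]: "add (neg x) x = zero" "add x (neg x) = zero"
  by (auto simp: add_def neg_def zero_def fun_eq_iff mod_simps)

lemma group_W: "group W"
proof (rule groupI)
  fix a assume "a \<in> carrier W"
  then obtain x g where a: "a = (x, g)" "x \<in> base" "g \<in> carrier \<Gamma>" by (auto simp: carrier_W)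
  let ?b = "(shift (inv g) (neg x), inv g)"
  have "?b \<otimes>\<^bsub>W\<^esub> a = \<one>\<^bsub>W\<^esub>" using a by (simp add: mult_W one_W flip: shift_add)
  moreover have "?b \<in> carrier W" using a by (simp add: carrier_W)
  ultimately show "\<exists>b\<in>carrier W. b \<otimes>\<^bsub>W\<^esub> a = \<one>\<^bsub>W\<^esub>" by blast
qed (auto simp: carrier_W mult_W one_W shift_add shift_mult add_assoc m_assoc)

sublocale W: group W by (rule group_W)

abbreviation u :: "'i \<Rightarrow> ('i \<Rightarrow> int) \<times> 'g" where "u i \<equiv> (unit i, \<one>)"

lemma u_carrier [simp]: "u i \<in> carrier W"
  by (simp add: carrier_W)

lemma u_pow: "u i [^]\<^bsub>W\<^esub> (k::nat) = ((\<lambda>j\<in>I. if j = i then int k mod int n else 0), \<one>)"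
proof (induction k)
  case 0
  then show ?case by (auto simp: one_W zero_def fun_eq_iff)
next
  case (Suc k)
  have "u i [^]\<^bsub>W\<^esub> Suc k = (add (\<lambda>j\<in>I. if j = i then int k mod int n else 0) (unit i), \<one>)"
    by (simp add: Suc mult_W restrict_def)
  also have "add (\<lambda>j\<in>I. if j = i then int k mod int n else 0) (unit i)
      = (\<lambda>j\<in>I. if j = i then int (Suc k) mod int n else 0)"
    by (auto simp: add_def fun_eq_iff unit_def mod_simps add.commute)
  finally show ?case .
qed

lemma u_pow_n: "u i [^]\<^bsub>W\<^esub> n = \<one>\<^bsub>W\<^esub>"
  by (auto simp: u_pow one_W zero_def fun_eq_iff)

lemma conj_u:
  assumes "t \<in> carrier W" "i \<in> I"
  shows "t \<otimes>\<^bsub>W\<^esub> u i \<otimes>\<^bsub>W\<^esub> inv\<^bsub>W\<^esub> t = u (\<phi> (snd t) i)"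
proof -
  obtain y g where t: "t = (y, g)" "y \<in> base" "g \<in> carrier \<Gamma>" using assms by (auto simp: carrier_W)
  have "t \<otimes>\<^bsub>W\<^esub> u i = u (\<phi> g i) \<otimes>\<^bsub>W\<^esub> t"
    using t assms by (simp add: mult_W shift_unit add_comm)
  then have "t \<otimes>\<^bsub>W\<^esub> u i \<otimes>\<^bsub>W\<^esub> inv\<^bsub>W\<^esub> t = u (\<phi> g i) \<otimes>\<^bsub>W\<^esub> t \<otimes>\<^bsub>W\<^esub> inv\<^bsub>W\<^esub> t" by simp
  then show ?thesis using assms t(1) by (simp add: W.m_assoc)
qed

definition total :: "('i \<Rightarrow> int) \<Rightarrow> int" where "total x = (\<Sum>i\<in>{i \<in> I. x i \<noteq> 0}. x i)"

lemma total_superset: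
  assumes "finite F" "{i \<in> I. x i \<noteq> 0} \<subseteq> F" "F \<subseteq> I"
  shows "total x = (\<Sum>i\<in>F. x i)"
  unfolding total_def by (rule sum.mono_neutral_left) (use assms in auto)

lemma total_add:
  assumes "x \<in> base" "y \<in> base"
  shows "total (add x y) mod int n = (total x + total y) mod int n"
proof -
  let ?F = "{i \<in> I. x i \<noteq> 0} \<union> {i \<in> I. y i \<noteq> 0}"
  have F: "finite ?F" "?F \<subseteq> I" using assms by (auto simp: base_def)
  have "total (add x y) = (\<Sum>i\<in>?F. add x y i)"
    by (rule total_superset[OF F(1) _ F(2)]) (auto simp: add_def)
  also have "\<dots> = (\<Sum>i\<in>?F. (x i + y i) mod int n)"
    by (rule sum.cong) (auto simp: add_def)
  finally have "total (add x y) mod int n = (\<Sum>i\<in>?F. x i + y i) mod int n"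
    by (simp add: mod_sum_eq)
  also have "(\<Sum>i\<in>?F. x i + y i) = total x + total y"
    using total_superset[OF F(1) _ F(2), of x] total_superset[OF F(1) _ F(2), of y]
    by (simp add: sum.distrib)
  finally show ?thesis .
qed

lemma total_shift:
  assumes g: "g \<in> carrier \<Gamma>" and x: "x \<in> base"
  shows "total (shift g x) = total x"
  unfolding total_def
  by (rule sum.reindex_bij_witness[of _ "\<phi> g" "\<phi> (inv g)"]) (use g in \<open>auto simp: shift_def\<close>)

text \<open>The integer coordinate sum is additive only modulo \<open>n\<close>, hence the
  reduction; the representatives 0, ..., n - 1 are the digits whose carries define the
  twist.\<close>

definition sigma :: "('i \<Rightarrow> int) \<times> 'g \<Rightarrow> int" where "sigma a = total (fst a) mod int n"

lemma sigma_hom: "sigma \<in> hom W (integer_mod_group n)"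
  using n2
  by (auto simp: hom_def carrier_integer_mod_group sigma_def carrier_W mult_W total_add total_shift mod_simps)

lemma sigma_one: "sigma \<one>\<^bsub>W\<^esub> = 0"
  by (simp add: one_W sigma_def total_def zero_def)

lemma sigma_range: "0 \<le> sigma a" "sigma a < int n"
  using n2 by (simp_all add: sigma_def)

lemma sigma_mult: "g \<in> carrier W \<Longrightarrow> h \<in> carrier W \<Longrightarrow> sigma (g \<otimes>\<^bsub>W\<^esub> h) = (sigma g + sigma h) mod int n"
  using sigma_hom by (simp add: hom_def)

lemma sigma_u:
  assumes "i \<in> I"
  shows "sigma (u i) = 1"
proof -
  have "{j \<in> I. unit i j \<noteq> 0} = {i}" using assms by (auto simp: unit_def)
  then show ?thesis using assms n2 by (simp add: sigma_def total_def) (simp add: unit_def)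
qed

text \<open>A conjugate of a base element has trivial \<Gamma>-component again, and the base is
  abelian.\<close>

lemma base_commuting_conj:
  assumes "x \<in> base"
  shows "(x, \<one>) \<in> commuting_conj W"
  unfolding commuting_conj_def
proof (intro CollectI conjI ballI)
  show xc: "(x, \<one>) \<in> carrier W" using assms by (simp add: carrier_W)
  fix t assume t: "t \<in> carrier W"
  have sm: "snd (a \<otimes>\<^bsub>W\<^esub> b) = snd a \<otimes> snd b" for a b by (cases a; cases b) (simp add: mult_W)
  have tc: "t \<otimes>\<^bsub>W\<^esub> (x, \<one>) \<otimes>\<^bsub>W\<^esub> inv\<^bsub>W\<^esub> t \<in> carrier W" using t xc by simp
  have sc: "snd t \<in> carrier \<Gamma>" "snd (inv\<^bsub>W\<^esub> t) \<in> carrier \<Gamma>"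
    using t W.inv_closed[OF t] by (auto simp: carrier_W mem_Times_iff)
  have "snd t \<otimes> snd (inv\<^bsub>W\<^esub> t) = \<one>"
    using arg_cong[OF W.r_inv[OF t], of snd] by (simp add: sm one_W)
  then have "snd (t \<otimes>\<^bsub>W\<^esub> (x, \<one>) \<otimes>\<^bsub>W\<^esub> inv\<^bsub>W\<^esub> t) = \<one>" using sc by (simp add: sm)
  then obtain y where y: "t \<otimes>\<^bsub>W\<^esub> (x, \<one>) \<otimes>\<^bsub>W\<^esub> inv\<^bsub>W\<^esub> t = (y, \<one>)" "y \<in> base"
    using tc by (cases "t \<otimes>\<^bsub>W\<^esub> (x, \<one>) \<otimes>\<^bsub>W\<^esub> inv\<^bsub>W\<^esub> t") (auto simp: carrier_W)
  show "(x, \<one>) \<otimes>\<^bsub>W\<^esub> (t \<otimes>\<^bsub>W\<^esub> (x, \<one>) \<otimes>\<^bsub>W\<^esub> inv\<^bsub>W\<^esub> t)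
      = (t \<otimes>\<^bsub>W\<^esub> (x, \<one>) \<otimes>\<^bsub>W\<^esub> inv\<^bsub>W\<^esub> t) \<otimes>\<^bsub>W\<^esub> (x, \<one>)"
    unfolding y(1) using assms y(2) by (simp add: mult_W add_comm)
qed

end

section \<open>Consequences of infinite stabilizer orbits\<close>

locale wreath_infinite = wreath +
  assumes infinite_orbits: "i \<in> I \<Longrightarrow> j \<in> I \<Longrightarrow> i \<noteq> j \<Longrightarrow> infinite ((\<lambda>g. \<phi> g j) ` stabilizer \<Gamma> \<phi> i)"
begin

text \<open>If \<open>a = (x, g)\<close> commutes with its conjugates and \<open>g i \<noteq> i\<close>, then conjugates of \<open>a\<close> fix
  \<open>[unit i, a] = unit i - unit (g i)\<close>, so their \<open>\<Gamma>\<close>-components, which include \<open>s g s\<^sup>-\<^sup>1\<close> for \<open>s\<close> fixing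
  \<open>i\<close>, map \<open>i\<close> to \<open>i\<close> or \<open>g i\<close>; hence the stabilizer of \<open>i\<close> has a finite orbit at \<open>g i\<close>.\<close>

lemma commuting_conj_W: "commuting_conj W = base \<times> {\<one>}"
proof safe
  fix x g assume a: "(x, g) \<in> commuting_conj W"
  let ?a = "(x, g)"
  have ac: "?a \<in> carrier W" using a by (simp add: commuting_conj_def)
  then have x: "x \<in> base" and g: "g \<in> carrier \<Gamma>" by (auto simp: carrier_W)
  show "x \<in> base" by (rule x)
  show "g = \<one>"
  proof (rule ccontr)
    assume "g \<noteq> \<one>"
    then obtain i where i: "i \<in> I" "\<phi> g i \<noteq> i" using act_faithful[OF g] by blast
    have "\<phi> s (\<phi> g i) \<in> {i, \<phi> g i}" if s: "s \<in> stabilizer \<Gamma> \<phi> i" for s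
    proof -
      have sc: "s \<in> carrier \<Gamma>" and si: "\<phi> s i = i" using s by (auto simp: stabilizer_def)
      let ?t = "(zero, s)" and ?d = "add (unit i) (neg (unit (\<phi> g i)))"
      have tc: "?t \<in> carrier W" using sc by (simp add: carrier_W)
      have dc: "?d \<in> base" by simp
      let ?b = "?t \<otimes>\<^bsub>W\<^esub> ?a \<otimes>\<^bsub>W\<^esub> inv\<^bsub>W\<^esub> ?t"
      have bc: "?b \<in> carrier W" using tc ac by simp
      \<comment> \<open>The definition compares only \<open>?a\<close> with its conjugates;
        conjugating that relation shows that any two conjugates of \<open>?a\<close>
        commute.\<close>
      have conj: "(w \<otimes>\<^bsub>W\<^esub> ?a \<otimes>\<^bsub>W\<^esub> inv\<^bsub>W\<^esub> w) \<otimes>\<^bsub>W\<^esub> ?b = ?b \<otimes>\<^bsub>W\<^esub> (w \<otimes>\<^bsub>W\<^esub> ?a \<otimes>\<^bsub>W\<^esub> inv\<^bsub>W\<^esub> w)"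
        if w: "w \<in> carrier W" for w
      proof -
        let ?w = "inv\<^bsub>W\<^esub> w \<otimes>\<^bsub>W\<^esub> ?t"
        have "?a \<otimes>\<^bsub>W\<^esub> (?w \<otimes>\<^bsub>W\<^esub> ?a \<otimes>\<^bsub>W\<^esub> inv\<^bsub>W\<^esub> ?w) = (?w \<otimes>\<^bsub>W\<^esub> ?a \<otimes>\<^bsub>W\<^esub> inv\<^bsub>W\<^esub> ?w) \<otimes>\<^bsub>W\<^esub> ?a"
          using a w tc by (simp add: commuting_conj_def)
        then have "w \<otimes>\<^bsub>W\<^esub> (?a \<otimes>\<^bsub>W\<^esub> (?w \<otimes>\<^bsub>W\<^esub> ?a \<otimes>\<^bsub>W\<^esub> inv\<^bsub>W\<^esub> ?w)) \<otimes>\<^bsub>W\<^esub> inv\<^bsub>W\<^esub> w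
            = w \<otimes>\<^bsub>W\<^esub> ((?w \<otimes>\<^bsub>W\<^esub> ?a \<otimes>\<^bsub>W\<^esub> inv\<^bsub>W\<^esub> ?w) \<otimes>\<^bsub>W\<^esub> ?a) \<otimes>\<^bsub>W\<^esub> inv\<^bsub>W\<^esub> w" by simp
        then show ?thesis
          using w tc ac by (simp add: W.m_assoc W.inv_mult_group W.mult_inv_cancel)
      qed
      have c1: "?b \<otimes>\<^bsub>W\<^esub> ?a = ?a \<otimes>\<^bsub>W\<^esub> ?b" using a tc by (simp add: commuting_conj_def)
      have c2: "(u i \<otimes>\<^bsub>W\<^esub> ?a \<otimes>\<^bsub>W\<^esub> inv\<^bsub>W\<^esub> u i) \<otimes>\<^bsub>W\<^esub> ?b = ?b \<otimes>\<^bsub>W\<^esub> (u i \<otimes>\<^bsub>W\<^esub> ?a \<otimes>\<^bsub>W\<^esub> inv\<^bsub>W\<^esub> u i)"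
        by (rule conj) simp
      have dW: "(?d, \<one>) \<in> carrier W" by (simp add: carrier_W)
      \<comment> \<open>Conjugation by \<open>u i\<close> multiplies \<open>?a\<close> by
        \<open>?d\<close>. As \<open>?b\<close> commutes with \<open>?a\<close> and with this
        product, it commutes with \<open>?d\<close>.\<close>
      have da: "u i \<otimes>\<^bsub>W\<^esub> ?a \<otimes>\<^bsub>W\<^esub> inv\<^bsub>W\<^esub> u i = (?d, \<one>) \<otimes>\<^bsub>W\<^esub> ?a"
      proof -
        have "add x (shift g (unit i)) = add x (unit (\<phi> g i))" using g i by (simp add: shift_unit)
        then have "(?d, \<one>) \<otimes>\<^bsub>W\<^esub> ?a \<otimes>\<^bsub>W\<^esub> u i = u i \<otimes>\<^bsub>W\<^esub> ?a"
          using x g i by (simp add: mult_W add_assoc add_comm[of x] )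
            (simp flip: add_assoc)
        then have "u i \<otimes>\<^bsub>W\<^esub> ?a \<otimes>\<^bsub>W\<^esub> inv\<^bsub>W\<^esub> u i
            = (?d, \<one>) \<otimes>\<^bsub>W\<^esub> ?a \<otimes>\<^bsub>W\<^esub> u i \<otimes>\<^bsub>W\<^esub> inv\<^bsub>W\<^esub> u i" by (simp only:)
        also have "\<dots> = (?d, \<one>) \<otimes>\<^bsub>W\<^esub> ?a"
          using ac dW u_carrier by (simp only: W.m_assoc W.m_closed W.inv_closed W.r_inv W.r_one)
        finally show ?thesis .
      qed
      have "(?d, \<one>) \<otimes>\<^bsub>W\<^esub> ?b \<otimes>\<^bsub>W\<^esub> ?a = ?b \<otimes>\<^bsub>W\<^esub> (?d, \<one>) \<otimes>\<^bsub>W\<^esub> ?a"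
        using c2 unfolding da using c1 dW ac bc by (simp only: W.m_assoc)
      then have db: "(?d, \<one>) \<otimes>\<^bsub>W\<^esub> ?b = ?b \<otimes>\<^bsub>W\<^esub> (?d, \<one>)"
        using dW ac bc by (simp only: W.right_cancel W.m_closed)
      have it: "inv\<^bsub>W\<^esub> ?t = (zero, inv s)"
        by (rule W.inv_equality) (use sc in \<open>simp_all add: mult_W one_W carrier_W\<close>)
      let ?h = "s \<otimes> g \<otimes> inv s"
      have b: "?b = (shift s x, ?h)" using sc x g by (simp add: it mult_W)
      have h: "?h \<in> carrier \<Gamma>" using sc g by simp
      have "add ?d (shift s x) = add (shift s x) (shift ?h ?d)"
        using db x sc unfolding b by (simp add: mult_W)
      then have "add (neg (shift s x)) (add (shift s x) ?d) = add (neg (shift s x)) (add (shift s x) (shift ?h ?d))"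
        by (simp add: add_comm)
      then have "?d = shift ?h ?d" using dc h sc x by (simp flip: add_assoc)
      \<comment> \<open>\<open>?d\<close> takes the value 1 at \<open>i\<close> and vanishes off
        \<open>i\<close> and \<open>\<phi> g i\<close>. For n = 2 its value at
        \<open>\<phi> g i\<close> is 1 as well, so only membership in the pair can be
        concluded.\<close>
      then have "?d (\<phi> ?h i) = ?d i" using shift_apply[OF h i(1), of ?d] by simp
      moreover have "?d i = 1" using i n2 by (simp add: add_def neg_def unit_def)
      moreover have "?d j = 0" if "j \<in> I" "j \<noteq> i" "j \<noteq> \<phi> g i" for j
        using that by (simp add: add_def neg_def unit_def)
      ultimately have "\<phi> ?h i \<in> {i, \<phi> g i}" using act_closed[OF h i(1)] by force
      moreover have "\<phi> ?h i = \<phi> s (\<phi> g i)"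
      proof -
        have "\<phi> (inv s) i = i" using act_eq_iff[OF sc i(1) i(1)] si by simp
        then show ?thesis using sc g i by (simp add: act_mult)
      qed
      ultimately show ?thesis by simp
    qed
    then have "(\<lambda>s. \<phi> s (\<phi> g i)) ` stabilizer \<Gamma> \<phi> i \<subseteq> {i, \<phi> g i}" by blast
    then have "finite ((\<lambda>s. \<phi> s (\<phi> g i)) ` stabilizer \<Gamma> \<phi> i)" by (rule finite_subset) simp
    then show False using infinite_orbits[of i "\<phi> g i"] i g by simp
  qed
next
  fix x assume "x \<in> base"
  then show "(x, \<one>) \<in> commuting_conj W" by (rule base_commuting_conj)
qed

text \<open>The supports of the shifts cover the orbit of \<open>j\<close> under the stabilizer of
  \<open>i\<close>, which is infinite, and each single support is finite.\<close>

lemma shifted_supports_infinite: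
  assumes y: "y \<in> base" and j: "j \<in> I" "y j \<noteq> 0" and i: "i \<in> I" "i \<noteq> j"
  shows "infinite {shift s y | s. s \<in> stabilizer \<Gamma> \<phi> i}" (is "infinite ?Y")
proof
  assume fin: "finite ?Y"
  have "(\<lambda>s. \<phi> s j) ` stabilizer \<Gamma> \<phi> i \<subseteq> (\<Union>w\<in>?Y. {k \<in> I. w k \<noteq> 0})"
  proof clarify
    fix s assume s: "s \<in> stabilizer \<Gamma> \<phi> i"
    then have "s \<in> carrier \<Gamma>" by (simp add: stabilizer_def)
    then have "shift s y (\<phi> s j) \<noteq> 0" "\<phi> s j \<in> I" using j by (simp_all add: shift_apply)
    then show "\<phi> s j \<in> (\<Union>w\<in>?Y. {k \<in> I. w k \<noteq> 0})" using s by blast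
  qed
  moreover have "finite (\<Union>w\<in>?Y. {k \<in> I. w k \<noteq> 0})"
    using fin y by (auto simp: stabilizer_def intro!: baseD(4) shift_base)
  ultimately show False using infinite_orbits[OF i(1) j(1) i(2)] finite_subset by blast
qed

lemma conj_base:
  assumes s: "s \<in> carrier \<Gamma>" and y: "y \<in> base"
  shows "(zero, s) \<otimes>\<^bsub>W\<^esub> (y, \<one>) \<otimes>\<^bsub>W\<^esub> inv\<^bsub>W\<^esub> (zero, s) = (shift s y, \<one>)"
proof -
  have it: "inv\<^bsub>W\<^esub> (zero, s) = (zero, inv s)"
    by (rule W.inv_equality) (use s in \<open>simp_all add: mult_W one_W carrier_W\<close>)
  show ?thesis using s y by (simp add: it mult_W)
qed

text \<open>The stabilizer of \<open>i\<close> centralizes \<open>u i\<close>. A base element with a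
  nonzero coordinate off \<open>i\<close> has infinitely many shifts under it, so finiteness of the
  orbit leaves only elements supported at \<open>i\<close>, and these are the powers of
  \<open>u i\<close>.\<close>

lemma u_isolated:
  assumes i: "i \<in> I"
  shows "u i \<in> isolated W"
  unfolding isolated_def
proof (intro CollectI conjI ballI impI)
  show "u i \<in> commuting_conj W" by (simp add: base_commuting_conj)
  have "unit i i \<noteq> zero i" using i by (simp add: unit_def zero_def)
  then show "u i \<noteq> \<one>\<^bsub>W\<^esub>" by (auto simp: one_W)
  fix b assume "b \<in> commuting_conj W"
  then obtain y where b: "b = (y, \<one>)" "y \<in> base" by (auto simp: commuting_conj_W)
  assume fin: "finite {t \<otimes>\<^bsub>W\<^esub> b \<otimes>\<^bsub>W\<^esub> inv\<^bsub>W\<^esub> t | t. t \<in> carrier W \<and> t \<otimes>\<^bsub>W\<^esub> u i = u i \<otimes>\<^bsub>W\<^esub> t}"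
  have "y j = 0" if j: "j \<in> I" "j \<noteq> i" for j
  proof (rule ccontr)
    assume "y j \<noteq> 0"
    have "(\<lambda>w. (w, \<one>)) ` {shift s y | s. s \<in> stabilizer \<Gamma> \<phi> i} \<subseteq>
        {t \<otimes>\<^bsub>W\<^esub> b \<otimes>\<^bsub>W\<^esub> inv\<^bsub>W\<^esub> t | t. t \<in> carrier W \<and> t \<otimes>\<^bsub>W\<^esub> u i = u i \<otimes>\<^bsub>W\<^esub> t}"
    proof clarify
      fix s assume "s \<in> stabilizer \<Gamma> \<phi> i"
      then have s: "s \<in> carrier \<Gamma>" "\<phi> s i = i" by (auto simp: stabilizer_def)
      show "\<exists>t. (shift s y, \<one>) = t \<otimes>\<^bsub>W\<^esub> b \<otimes>\<^bsub>W\<^esub> inv\<^bsub>W\<^esub> t \<and> t \<in> carrier W \<and> t \<otimes>\<^bsub>W\<^esub> u i = u i \<otimes>\<^bsub>W\<^esub> t"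
      proof (intro exI conjI)
        show "(shift s y, \<one>) = (zero, s) \<otimes>\<^bsub>W\<^esub> b \<otimes>\<^bsub>W\<^esub> inv\<^bsub>W\<^esub> (zero, s)"
          using s b by (simp only: conj_base)
        show "(zero, s) \<in> carrier W" "(zero, s) \<otimes>\<^bsub>W\<^esub> u i = u i \<otimes>\<^bsub>W\<^esub> (zero, s)"
          using s i by (simp_all add: carrier_W mult_W shift_unit)
      qed
    qed
    then have "finite ((\<lambda>w. (w, \<one>)) ` {shift s y | s. s \<in> stabilizer \<Gamma> \<phi> i})"
      using fin by (rule finite_subset)
    then have "finite {shift s y | s. s \<in> stabilizer \<Gamma> \<phi> i}"
      by (rule finite_imageD) (auto simp: inj_on_def)
    then show False using shifted_supports_infinite[OF b(2) j(1) \<open>y j \<noteq> 0\<close> i] j by auto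
  qed
  then have "y = (\<lambda>j\<in>I. if j = i then int (nat (y i)) mod int n else 0)"
    using b(2) i by (auto simp: base_def extensional_def fun_eq_iff)
  then have "b = u i [^]\<^bsub>W\<^esub> int (nat (y i))" using b by (simp only: int_pow_int u_pow)
  then show "\<exists>k::int. b = u i [^]\<^bsub>W\<^esub> k" by blast
qed

text \<open>Let \<open>j\<close> be in the support of the base element \<open>a\<close>. The
  centralizer of \<open>a\<close> permutes this finite support, so \<open>u j\<close> has a finite
  orbit under it and must be a power of \<open>a\<close>.\<close>

lemma isolated_generates_u:
  assumes a: "a \<in> isolated W"
  shows "\<exists>j\<in>I. \<exists>k::int. u j = a [^]\<^bsub>W\<^esub> k"
proof -
  obtain x where x: "a = (x, \<one>)" "x \<in> base"
    using a by (auto simp: isolated_def commuting_conj_W)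
  have "a \<noteq> \<one>\<^bsub>W\<^esub>" using a by (simp add: isolated_def)
  then have "x \<noteq> zero" using x by (simp add: one_W)
  then obtain j where j: "j \<in> I" "x j \<noteq> 0"
    using base_ext[OF x(2) zero_base] by (auto simp: zero_def)
  have "{t \<otimes>\<^bsub>W\<^esub> u j \<otimes>\<^bsub>W\<^esub> inv\<^bsub>W\<^esub> t | t. t \<in> carrier W \<and> t \<otimes>\<^bsub>W\<^esub> a = a \<otimes>\<^bsub>W\<^esub> t} \<subseteq> u ` {k \<in> I. x k \<noteq> 0}"
  proof
    fix w assume "w \<in> {t \<otimes>\<^bsub>W\<^esub> u j \<otimes>\<^bsub>W\<^esub> inv\<^bsub>W\<^esub> t | t. t \<in> carrier W \<and> t \<otimes>\<^bsub>W\<^esub> a = a \<otimes>\<^bsub>W\<^esub> t}"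
    then obtain y g where t: "(y, g) \<in> carrier W" "(y, g) \<otimes>\<^bsub>W\<^esub> a = a \<otimes>\<^bsub>W\<^esub> (y, g)"
      and w: "w = (y, g) \<otimes>\<^bsub>W\<^esub> u j \<otimes>\<^bsub>W\<^esub> inv\<^bsub>W\<^esub> (y, g)" by auto
    then have y: "y \<in> base" and g: "g \<in> carrier \<Gamma>" by (auto simp: carrier_W)
    have "add y (shift g x) = add x y" using t(2) y g x by (simp add: mult_W)
    then have "add (neg y) (add y (shift g x)) = add (neg y) (add y x)" by (simp add: add_comm)
    then have "shift g x = x" using x(2) y g by (simp flip: add_assoc)
    then have "x (\<phi> g j) \<noteq> 0" using shift_apply[OF g j(1), of x] j by simp
    then show "w \<in> u ` {k \<in> I. x k \<noteq> 0}"
      using conj_u[OF t(1) j(1)] g j w by auto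
  qed
  then have "finite {t \<otimes>\<^bsub>W\<^esub> u j \<otimes>\<^bsub>W\<^esub> inv\<^bsub>W\<^esub> t | t. t \<in> carrier W \<and> t \<otimes>\<^bsub>W\<^esub> a = a \<otimes>\<^bsub>W\<^esub> t}"
    by (rule finite_subset) (use baseD(4)[OF x(2)] in simp)
  moreover have "u j \<in> commuting_conj W" by (simp add: base_commuting_conj)
  ultimately show ?thesis using a j(1) unfolding isolated_def by blast
qed

text \<open>A central element lies in the base and is invariant under all shifts. A nonzero
  coordinate \<open>k\<close> is impossible, since the stabilizer of a second point \<open>l\<close>
  would produce infinitely many shifts.\<close>

lemma center_trivial:
  assumes two: "i \<in> I" "j \<in> I" "i \<noteq> j"
    and a: "a \<in> carrier W" and central: "\<And>t. t \<in> carrier W \<Longrightarrow> t \<otimes>\<^bsub>W\<^esub> a = a \<otimes>\<^bsub>W\<^esub> t"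
  shows "a = \<one>\<^bsub>W\<^esub>"
proof -
  have "a \<in> commuting_conj W" using a central by (simp add: commuting_conj_def)
  then obtain x where x: "a = (x, \<one>)" "x \<in> base" by (auto simp: commuting_conj_W)
  have sh: "shift s x = x" if s: "s \<in> carrier \<Gamma>" for s
    using central[of "(zero, s)"] x s by (simp add: carrier_W mult_W)
  have "x k = 0" if k: "k \<in> I" for k
  proof (rule ccontr)
    assume xk: "x k \<noteq> 0"
    obtain l where l: "l \<in> I" "l \<noteq> k" using two by blast
    have "{shift s x | s. s \<in> stabilizer \<Gamma> \<phi> l} \<subseteq> {x}" using sh by (auto simp: stabilizer_def)
    then show False using shifted_supports_infinite[OF x(2) k xk l] finite_subset by blast
  qed
  then have "x = zero" by (intro base_ext x(2) zero_base) (simp add: zero_def)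
  then show ?thesis by (simp add: x one_W)
qed

end

section \<open>Central extensions of wreath products\<close>

text \<open>Only the projection is given, and its kernel \<open>K\<close> plays the role of
  \<open>C\<close>. This covers abstract central extensions as well as those built from cocycles,
  and a twist is again an instance with the same projection and kernel.\<close>

locale central_ext = wreath \<Gamma> I \<phi> n
  for \<Gamma> :: "'g monoid" (structure) and I :: "'i set" and \<phi> n +
  fixes E :: "('e, 'm) monoid_scheme" and \<pi> :: "'e \<Rightarrow> ('i \<Rightarrow> int) \<times> 'g"
  assumes E: "group E" and epi: "\<pi> \<in> epi E W"
    and central: "k \<in> kernel E W \<pi> \<Longrightarrow> e \<in> carrier E \<Longrightarrow> k \<otimes>\<^bsub>E\<^esub> e = e \<otimes>\<^bsub>E\<^esub> k"
begin

sublocale E: group E by (rule E)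

sublocale \<pi>: group_hom E W \<pi>
  using epi by unfold_locales (auto simp: epi_def)

abbreviation K :: "'e set" where "K \<equiv> kernel E W \<pi>"

lemma K_iff: "k \<in> K \<longleftrightarrow> k \<in> carrier E \<and> \<pi> k = \<one>\<^bsub>W\<^esub>"
  by (auto simp: kernel_def)

lemma K_closed [simp]:
  "k \<in> K \<Longrightarrow> k \<in> carrier E" "\<one>\<^bsub>E\<^esub> \<in> K" "k \<in> K \<Longrightarrow> inv\<^bsub>E\<^esub> k \<in> K"
  "k \<in> K \<Longrightarrow> l \<in> K \<Longrightarrow> k \<otimes>\<^bsub>E\<^esub> l \<in> K"
  by (simp_all add: K_iff)

lemma \<pi>_surj:
  assumes "w \<in> carrier W"
  shows "\<exists>x\<in>carrier E. \<pi> x = w"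
proof -
  have "w \<in> \<pi> ` carrier E" using epi assms by (simp add: epi_def)
  then show ?thesis by blast
qed

lemma fibre:
  assumes "x \<in> carrier E" "y \<in> carrier E" "\<pi> x = \<pi> y"
  shows "\<exists>k\<in>K. y = x \<otimes>\<^bsub>E\<^esub> k"
proof (rule bexI[of _ "inv\<^bsub>E\<^esub> x \<otimes>\<^bsub>E\<^esub> y"])
  show "y = x \<otimes>\<^bsub>E\<^esub> (inv\<^bsub>E\<^esub> x \<otimes>\<^bsub>E\<^esub> y)" using assms by (simp add: E.mult_inv_cancel)
  show "inv\<^bsub>E\<^esub> x \<otimes>\<^bsub>E\<^esub> y \<in> K" using assms by (simp add: K_iff)
qed

lemma pow_mult_K:
  assumes "x \<in> carrier E" "k \<in> K"
  shows "(x \<otimes>\<^bsub>E\<^esub> k) [^]\<^bsub>E\<^esub> (m::nat) = x [^]\<^bsub>E\<^esub> m \<otimes>\<^bsub>E\<^esub> k [^]\<^bsub>E\<^esub> m"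
  by (rule E.pow_mult_distrib) (use assms central[of k x] in auto)

lemma K_pow: "k \<in> K \<Longrightarrow> k [^]\<^bsub>E\<^esub> (m::nat) \<in> K"
  by (induction m) auto

lemma lift_pow_K:
  assumes "x \<in> carrier E" "\<pi> x = u i"
  shows "x [^]\<^bsub>E\<^esub> n \<in> K"
  using assms by (simp add: K_iff \<pi>.hom_nat_pow u_pow_n)

definition carry_twist :: "'e \<Rightarrow> 'e monoid" where
  "carry_twist z = twist E n (sigma \<circ> \<pi>) z"

lemma central_twist:
  assumes z: "z \<in> K"
  shows "central_twist E n (sigma \<circ> \<pi>) z"
proof -
  have "sigma \<one>\<^bsub>W\<^esub> = 0" by (simp add: one_W sigma_def total_def zero_def)
  then show ?thesis
    using n2 z central[OF z] Group.hom_compose[OF \<pi>.homh sigma_hom]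
    by (simp add: central_twist_def central_twist_axioms_def E K_iff)
qed

lemma carry_twist_pow:
  assumes z: "z \<in> K" and x: "x \<in> carrier E"
  shows "x [^]\<^bsub>carry_twist z\<^esub> (k::nat)
    = x [^]\<^bsub>E\<^esub> k \<otimes>\<^bsub>E\<^esub> z [^]\<^bsub>E\<^esub> ((int k * sigma (\<pi> x)) div int n)"
  using central_twist.twist_pow[OF central_twist[OF z] x, of k] by (simp add: carry_twist_def)

lemma carry_twist_simps:
  assumes z: "z \<in> K"
  shows "carrier (carry_twist z) = carrier E" "\<one>\<^bsub>carry_twist z\<^esub> = \<one>\<^bsub>E\<^esub>"
    "x \<otimes>\<^bsub>carry_twist z\<^esub> y = x \<otimes>\<^bsub>E\<^esub> y \<otimes>\<^bsub>E\<^esub> z [^]\<^bsub>E\<^esub> ((sigma (\<pi> x) + sigma (\<pi> y)) div int n)"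
  by (simp_all add: carry_twist_def central_twist.twist_simps[OF central_twist[OF z]])

lemma carry_twist_K:
  assumes z: "z \<in> K" and k: "k \<in> K" and e: "e \<in> carrier E"
  shows "k \<otimes>\<^bsub>carry_twist z\<^esub> e = k \<otimes>\<^bsub>E\<^esub> e" "e \<otimes>\<^bsub>carry_twist z\<^esub> k = e \<otimes>\<^bsub>E\<^esub> k"
  using k e sigma_range[of "\<pi> e"] by (simp_all add: carry_twist_simps[OF z] K_iff sigma_one)

lemma carry_twist_pow_K:
  "z \<in> K \<Longrightarrow> k \<in> K \<Longrightarrow> k [^]\<^bsub>carry_twist z\<^esub> (m::nat) = k [^]\<^bsub>E\<^esub> m"
  by (simp add: carry_twist_pow K_iff sigma_one)

text \<open>\<open>sigma (u i) = 1\<close>, so adding it up \<open>n\<close> times produces exactly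
  one carry.\<close>

lemma carry_twist_lift_pow:
  assumes "z \<in> K" "x \<in> carrier E" "i \<in> I" "\<pi> x = u i"
  shows "x [^]\<^bsub>carry_twist z\<^esub> n = x [^]\<^bsub>E\<^esub> n \<otimes>\<^bsub>E\<^esub> z"
  using assms n2 by (simp add: carry_twist_pow sigma_u)

lemma central_ext_carry_twist:
  assumes z: "z \<in> K"
  shows "central_ext \<Gamma> I \<phi> n (carry_twist z) \<pi>" "kernel (carry_twist z) W \<pi> = K"
proof -
  interpret T: central_twist E n "sigma \<circ> \<pi>" z by (rule central_twist[OF z])
  have zW: "\<pi> (z [^]\<^bsub>E\<^esub> (k::int)) = \<one>\<^bsub>W\<^esub>" for k using z by (simp add: \<pi>.hom_int_pow K_iff)
  have "\<pi> \<in> hom (carry_twist z) W"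
    by (rule homI) (simp_all add: carry_twist_simps[OF z] zW)
  then have e: "\<pi> \<in> epi (carry_twist z) W"
    using epi by (simp add: epi_def carry_twist_simps[OF z])
  show k: "kernel (carry_twist z) W \<pi> = K" unfolding kernel_def carry_twist_simps(1)[OF z] ..
  show "central_ext \<Gamma> I \<phi> n (carry_twist z) \<pi>"
  proof (rule central_ext.intro[OF wreath_axioms central_ext_axioms.intro[OF _ e]])
    show "group (carry_twist z)" unfolding carry_twist_def by (rule T.group_twist)
    fix l x assume l: "l \<in> kernel (carry_twist z) W \<pi>" and x: "x \<in> carrier (carry_twist z)"
    have "l \<in> K" "x \<in> carrier E" using l x unfolding k carry_twist_simps(1)[OF z] by auto
    then show "l \<otimes>\<^bsub>carry_twist z\<^esub> x = x \<otimes>\<^bsub>carry_twist z\<^esub> l"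
      using central by (simp add: carry_twist_K[OF z])
  qed
qed

lemma vN_equivalent_carry_twist: "z \<in> K \<Longrightarrow> vN_equivalent E (carry_twist z)"
  unfolding carry_twist_def by (rule central_twist.twist_vN_equivalent[OF central_twist])

end

text \<open>A central element projects to a central element of the wreath product, whose center is
  trivial once \<open>I\<close> has two points.\<close>

lemma (in central_ext) kernel_eq_center:
  assumes W: "wreath_infinite \<Gamma> I \<phi> n" and two: "i0 \<in> I" "j0 \<in> I" "i0 \<noteq> j0"
    and c: "c \<in> carrier E"
  shows "\<pi> c = \<one>\<^bsub>W\<^esub> \<longleftrightarrow> (\<forall>e\<in>carrier E. c \<otimes>\<^bsub>E\<^esub> e = e \<otimes>\<^bsub>E\<^esub> c)"
proof
  assume "\<pi> c = \<one>\<^bsub>W\<^esub>"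
  then show "\<forall>e\<in>carrier E. c \<otimes>\<^bsub>E\<^esub> e = e \<otimes>\<^bsub>E\<^esub> c" using c central by (simp add: K_iff)
next
  assume *: "\<forall>e\<in>carrier E. c \<otimes>\<^bsub>E\<^esub> e = e \<otimes>\<^bsub>E\<^esub> c"
  show "\<pi> c = \<one>\<^bsub>W\<^esub>"
  proof (rule wreath_infinite.center_trivial[OF W two])
    fix t assume "t \<in> carrier W"
    then obtain e where e: "e \<in> carrier E" "\<pi> e = t" using \<pi>_surj by blast
    have "\<pi> (e \<otimes>\<^bsub>E\<^esub> c) = \<pi> (c \<otimes>\<^bsub>E\<^esub> e)" using * e by simp
    then show "t \<otimes>\<^bsub>W\<^esub> \<pi> c = \<pi> c \<otimes>\<^bsub>W\<^esub> t" using e c by simp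
  qed (use c in simp)
qed

text \<open>The kernels of \<open>\<pi>1\<close> and \<open>\<pi>2\<close> are the centers, so an isomorphism of \<open>E1\<close> and \<open>E2\<close> induces an
  automorphism \<open>\<alpha>\<close> of the wreath product.\<close>

lemma (in wreath_infinite) lifted_root_iso:
  fixes E1 :: "('e, 'm) monoid_scheme" and E2 :: "('f, 'k) monoid_scheme"
  assumes two: "i0 \<in> I" "j0 \<in> I" "i0 \<noteq> j0"
    and E1: "central_ext \<Gamma> I \<phi> n E1 \<pi>1" and E2: "central_ext \<Gamma> I \<phi> n E2 \<pi>2"
    and iso: "E1 \<cong> E2"
    and x: "x \<in> carrier E1" "i \<in> I" "\<pi>1 x = u i" "x [^]\<^bsub>E1\<^esub> n = \<one>\<^bsub>E1\<^esub>"
  shows "\<exists>j\<in>I. \<exists>y\<in>carrier E2. \<pi>2 y = u j \<and> y [^]\<^bsub>E2\<^esub> n = \<one>\<^bsub>E2\<^esub>"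
proof -
  interpret E1: central_ext \<Gamma> I \<phi> n E1 \<pi>1 by (rule E1)
  interpret E2: central_ext \<Gamma> I \<phi> n E2 \<pi>2 by (rule E2)
  obtain \<beta> where \<beta>: "\<beta> \<in> iso E1 E2" using iso by (auto simp: is_iso_def)
  interpret \<beta>: group_hom E1 E2 \<beta>
    using \<beta> by (simp add: group_hom_def group_hom_axioms_def iso_def E1.E E2.E)
  note surj = iso_surj[OF E1.E E2.E \<beta>] and eq = iso_eq_iff[OF E1.E E2.E \<beta>]
  note center1 = E1.kernel_eq_center[OF wreath_infinite_axioms two]
    and center2 = E2.kernel_eq_center[OF wreath_infinite_axioms two]
  have ker: "\<pi>2 (\<beta> c) = \<one>\<^bsub>W\<^esub> \<longleftrightarrow> \<pi>1 c = \<one>\<^bsub>W\<^esub>" if c: "c \<in> carrier E1" for c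
  proof -
    have "(\<forall>e\<in>carrier E2. \<beta> c \<otimes>\<^bsub>E2\<^esub> e = e \<otimes>\<^bsub>E2\<^esub> \<beta> c) \<longleftrightarrow>
        (\<forall>e\<in>carrier E1. \<beta> (c \<otimes>\<^bsub>E1\<^esub> e) = \<beta> (e \<otimes>\<^bsub>E1\<^esub> c))"
    proof
      assume *: "\<forall>e\<in>carrier E1. \<beta> (c \<otimes>\<^bsub>E1\<^esub> e) = \<beta> (e \<otimes>\<^bsub>E1\<^esub> c)"
      show "\<forall>e\<in>carrier E2. \<beta> c \<otimes>\<^bsub>E2\<^esub> e = e \<otimes>\<^bsub>E2\<^esub> \<beta> c"
      proof
        fix e assume "e \<in> carrier E2"
        then obtain d where "d \<in> carrier E1" "e = \<beta> d" using surj by blast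
        then show "\<beta> c \<otimes>\<^bsub>E2\<^esub> e = e \<otimes>\<^bsub>E2\<^esub> \<beta> c" using * c by simp
      qed
    qed (use c in simp)
    also have "\<dots> \<longleftrightarrow> (\<forall>e\<in>carrier E1. c \<otimes>\<^bsub>E1\<^esub> e = e \<otimes>\<^bsub>E1\<^esub> c)" using c by (simp add: eq del: \<beta>.hom_mult)
    finally show ?thesis using c by (simp add: center1 center2)
  qed
  have same: "\<pi>2 (\<beta> a) = \<pi>2 (\<beta> b) \<longleftrightarrow> \<pi>1 a = \<pi>1 b" if "a \<in> carrier E1" "b \<in> carrier E1" for a b
  proof -
    have "\<pi>2 (\<beta> a) = \<pi>2 (\<beta> b) \<longleftrightarrow> \<pi>2 (\<beta> (a \<otimes>\<^bsub>E1\<^esub> inv\<^bsub>E1\<^esub> b)) = \<one>\<^bsub>W\<^esub>"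
      using that W.inv_solve_right'[of "\<one>\<^bsub>W\<^esub>" "\<pi>2 (\<beta> a)" "\<pi>2 (\<beta> b)"] by auto
    also have "\<dots> \<longleftrightarrow> \<pi>1 a \<otimes>\<^bsub>W\<^esub> inv\<^bsub>W\<^esub> \<pi>1 b = \<one>\<^bsub>W\<^esub>" using that by (subst ker) simp_all
    also have "\<dots> \<longleftrightarrow> \<pi>1 a = \<pi>1 b"
      using that W.inv_solve_right'[of "\<one>\<^bsub>W\<^esub>" "\<pi>1 a" "\<pi>1 b"] by auto
    finally show ?thesis .
  qed
  \<comment> \<open>Any lift of \<open>w\<close> may be used, because \<open>same\<close> says that
    \<open>\<beta>\<close> respects the fibres of both projections.\<close>
  define \<alpha> where "\<alpha> w = \<pi>2 (\<beta> (SOME a. a \<in> carrier E1 \<and> \<pi>1 a = w))" for w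
  have \<alpha>: "\<alpha> (\<pi>1 a) = \<pi>2 (\<beta> a)" if a: "a \<in> carrier E1" for a
  proof -
    have "\<exists>b. b \<in> carrier E1 \<and> \<pi>1 b = \<pi>1 a" using a by blast
    from someI_ex[OF this] show ?thesis unfolding \<alpha>_def using a by (simp add: same)
  qed
  have lift: "\<exists>a\<in>carrier E1. w = \<pi>1 a" if "w \<in> carrier W" for w using E1.\<pi>_surj[OF that] by blast
  have \<alpha>_iso: "\<alpha> \<in> iso W W"
  proof (rule isoI)
    show "\<alpha> \<in> hom W W"
    proof (rule homI)
      fix v w assume "v \<in> carrier W" "w \<in> carrier W"
      then obtain a b where ab: "a \<in> carrier E1" "v = \<pi>1 a" "b \<in> carrier E1" "w = \<pi>1 b"
        using lift by metis
      then show "\<alpha> v \<in> carrier W" by (simp add: \<alpha>)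
      have "\<alpha> (v \<otimes>\<^bsub>W\<^esub> w) = \<alpha> (\<pi>1 (a \<otimes>\<^bsub>E1\<^esub> b))" using ab by simp
      also have "\<dots> = \<pi>2 (\<beta> (a \<otimes>\<^bsub>E1\<^esub> b))" using ab by (intro \<alpha>) simp
      finally show "\<alpha> (v \<otimes>\<^bsub>W\<^esub> w) = \<alpha> v \<otimes>\<^bsub>W\<^esub> \<alpha> w" using ab by (simp add: \<alpha>)
    qed
    show "bij_betw \<alpha> (carrier W) (carrier W)"
      unfolding bij_betw_def
    proof
      show "inj_on \<alpha> (carrier W)"
      proof (rule inj_onI)
        fix v w assume "v \<in> carrier W" "w \<in> carrier W" "\<alpha> v = \<alpha> w"
        then show "v = w" using lift by (metis \<alpha> same)
      qed
      show "\<alpha> ` carrier W = carrier W"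
      proof
        show "\<alpha> ` carrier W \<subseteq> carrier W"
        proof (rule image_subsetI)
          fix w assume "w \<in> carrier W"
          then obtain a where "a \<in> carrier E1" "w = \<pi>1 a" using lift by blast
          then show "\<alpha> w \<in> carrier W" by (simp add: \<alpha>)
        qed
        show "carrier W \<subseteq> \<alpha> ` carrier W"
        proof
          fix w assume "w \<in> carrier W"
          then obtain b where b: "b \<in> carrier E2" "\<pi>2 b = w" using E2.\<pi>_surj by blast
          then obtain a where a: "a \<in> carrier E1" "b = \<beta> a" using surj by blast
          then have "\<pi>1 a \<in> carrier W" "w = \<alpha> (\<pi>1 a)" using b by (simp_all add: \<alpha>)
          then show "w \<in> \<alpha> ` carrier W" by blast
        qed
      qed
    qed
  qed
  \<comment> \<open>Some power k of this element is a generator \<open>u j\<close>. The same power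
    of \<open>\<beta> x\<close> lifts \<open>u j\<close>, and its n-th power is still
    trivial.\<close>
  have "\<alpha> (u i) \<in> isolated W" by (rule isolated_iso[OF group_W group_W \<alpha>_iso u_isolated[OF x(2)]])
  then obtain j and k :: int where j: "j \<in> I" "u j = \<alpha> (u i) [^]\<^bsub>W\<^esub> k"
    using isolated_generates_u by blast
  have \<alpha>u: "\<alpha> (u i) = \<pi>2 (\<beta> x)" using \<alpha>[OF x(1)] x(3) by simp
  have \<beta>x: "\<beta> x \<in> carrier E2" using x by simp
  define y where "y = \<beta> x [^]\<^bsub>E2\<^esub> k"
  have "\<pi>2 y = u j" using j \<beta>x by (simp add: y_def \<alpha>u E2.\<pi>.hom_int_pow)
  moreover have "y [^]\<^bsub>E2\<^esub> n = \<one>\<^bsub>E2\<^esub>"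
  proof -
    have "y [^]\<^bsub>E2\<^esub> int n = (\<beta> x [^]\<^bsub>E2\<^esub> int n) [^]\<^bsub>E2\<^esub> k"
      using \<beta>x by (simp add: y_def E2.E.int_pow_pow mult.commute)
    also have "\<beta> x [^]\<^bsub>E2\<^esub> int n = \<beta> (x [^]\<^bsub>E1\<^esub> n)" using x(1) by (simp add: int_pow_int \<beta>.hom_nat_pow)
    finally show ?thesis using x(4) by (simp add: int_pow_int)
  qed
  moreover have "y \<in> carrier E2" using \<beta>x by (simp add: y_def)
  ultimately show ?thesis using j(1) by blast
qed

text \<open>If some generator has a lift with trivial n-th power, twisting by a \<open>z\<close>
  that is not an n-th power in \<open>K\<close> destroys all such lifts: one in the twist would give
  elements \<open>v\<close>, \<open>v k\<close> over the same generator with v^n = 1 and (v k)^n z =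
  1, hence k^n z = 1. If there is no such lift, twisting by the inverse of x^n, for any lift
  \<open>x\<close> of a generator, creates one.\<close>

lemma (in wreath_infinite) exists_noniso_carry_twist:
  assumes two: "i0 \<in> I" "j0 \<in> I" "i0 \<noteq> j0" and ext: "central_ext \<Gamma> I \<phi> n E \<pi>"
    and ne: "(\<lambda>c. c [^]\<^bsub>E\<^esub> n) ` kernel E W \<pi> \<noteq> kernel E W \<pi>"
  shows "\<exists>z\<in>kernel E W \<pi>. \<not> E \<cong> twist E n (sigma \<circ> \<pi>) z"
proof -
  interpret central_ext \<Gamma> I \<phi> n E \<pi> by (rule ext)
  show ?thesis
  proof (cases "\<exists>i\<in>I. \<exists>y\<in>carrier E. \<pi> y = u i \<and> y [^]\<^bsub>E\<^esub> n = \<one>\<^bsub>E\<^esub>")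
    case True
    then obtain i y where y: "i \<in> I" "y \<in> carrier E" "\<pi> y = u i" "y [^]\<^bsub>E\<^esub> n = \<one>\<^bsub>E\<^esub>" by blast
    obtain z where z: "z \<in> K" "\<And>c. c \<in> K \<Longrightarrow> c [^]\<^bsub>E\<^esub> n \<noteq> z"
    proof -
      have "(\<lambda>c. c [^]\<^bsub>E\<^esub> n) ` K \<subseteq> K" using K_pow by blast
      then obtain z where "z \<in> K" "z \<notin> (\<lambda>c. c [^]\<^bsub>E\<^esub> n) ` K" using ne by blast
      then show ?thesis using that by blast
    qed
    have "\<not> E \<cong> carry_twist z"
    proof
      assume iso: "E \<cong> carry_twist z"
      obtain j w where w: "j \<in> I" "w \<in> carrier (carry_twist z)" "\<pi> w = u j"
          "w [^]\<^bsub>carry_twist z\<^esub> n = \<one>\<^bsub>carry_twist z\<^esub>"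
        using lifted_root_iso[OF two ext central_ext_carry_twist(1)[OF z(1)] iso y(2,1,3,4)] by blast
      then have wE: "w \<in> carrier E" and wn: "w [^]\<^bsub>E\<^esub> n \<otimes>\<^bsub>E\<^esub> z = \<one>\<^bsub>E\<^esub>"
        using carry_twist_lift_pow[OF z(1), of w j] by (simp_all add: carry_twist_simps[OF z(1)])
      \<comment> \<open>The lifts \<open>y\<close> and \<open>w\<close> may lie over different
        generators. Transitivity provides a conjugate \<open>v\<close> of \<open>y\<close> over
        \<open>u j\<close>, which differs from \<open>w\<close> by an element of the kernel.\<close>
      obtain g where g: "g \<in> carrier \<Gamma>" "\<phi> g i = j"
        using transitive_action.unique_orbit[OF transitive y(1) w(1)] by blast
      have "(zero, g) \<in> carrier W" using g by (simp add: carrier_W)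
      then obtain t where t: "t \<in> carrier E" "\<pi> t = (zero, g)" using \<pi>_surj by blast
      define v where "v = t \<otimes>\<^bsub>E\<^esub> y \<otimes>\<^bsub>E\<^esub> inv\<^bsub>E\<^esub> t"
      have vE: "v \<in> carrier E" using t y by (simp add: v_def)
      have "\<pi> v = (zero, g) \<otimes>\<^bsub>W\<^esub> u i \<otimes>\<^bsub>W\<^esub> inv\<^bsub>W\<^esub> (zero, g)" using t y by (simp add: v_def)
      also have "\<dots> = u j" using conj_u[of "(zero, g)" i] g y(1) by (simp add: carrier_W)
      finally have \<pi>v: "\<pi> v = u j" .
      have "v [^]\<^bsub>E\<^esub> (m::nat) = t \<otimes>\<^bsub>E\<^esub> y [^]\<^bsub>E\<^esub> m \<otimes>\<^bsub>E\<^esub> inv\<^bsub>E\<^esub> t" for m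
      proof (induction m)
        case (Suc m)
        then show ?case using t y(2) by (simp add: v_def E.m_assoc E.mult_inv_cancel)
      qed (use t in simp)
      then have vn: "v [^]\<^bsub>E\<^esub> n = \<one>\<^bsub>E\<^esub>" using t by (simp add: y(4))
      obtain k where k: "k \<in> K" "w = v \<otimes>\<^bsub>E\<^esub> k" using fibre[OF vE wE] \<pi>v w(3) by auto
      then have "w [^]\<^bsub>E\<^esub> n = k [^]\<^bsub>E\<^esub> n" using pow_mult_K[OF vE k(1), of n] by (simp add: vn)
      then have "k [^]\<^bsub>E\<^esub> n \<otimes>\<^bsub>E\<^esub> z = \<one>\<^bsub>E\<^esub>" using wn by simp
      then have "inv\<^bsub>E\<^esub> z = k [^]\<^bsub>E\<^esub> n" using k(1) z(1) by (intro E.inv_equality) simp_all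
      then have "inv\<^bsub>E\<^esub> (k [^]\<^bsub>E\<^esub> n) = z" using E.inv_inv[OF K_closed(1)[OF z(1)]] by simp
      then have "(inv\<^bsub>E\<^esub> k) [^]\<^bsub>E\<^esub> n = z" using k(1) by (simp add: E.nat_pow_inv)
      then show False using z(2)[of "inv\<^bsub>E\<^esub> k"] k(1) by simp
    qed
    then show ?thesis using z(1) by (auto simp: carry_twist_def)
  next
    case False
    obtain i where i: "i \<in> I" using two by blast
    obtain x where x: "x \<in> carrier E" "\<pi> x = u i" using \<pi>_surj[OF u_carrier] by blast
    define z where "z = inv\<^bsub>E\<^esub> (x [^]\<^bsub>E\<^esub> n)"
    have z: "z \<in> K" unfolding z_def using lift_pow_K[OF x] by simp
    have "x [^]\<^bsub>carry_twist z\<^esub> n = \<one>\<^bsub>carry_twist z\<^esub>"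
    proof -
      have "x [^]\<^bsub>E\<^esub> n \<otimes>\<^bsub>E\<^esub> z = \<one>\<^bsub>E\<^esub>" using x by (simp add: z_def)
      then show ?thesis
        using carry_twist_lift_pow[OF z x(1) i x(2)] by (simp add: carry_twist_simps[OF z])
    qed
    moreover have "x \<in> carrier (carry_twist z)" using x by (simp add: carry_twist_simps[OF z])
    moreover have "carry_twist z \<cong> E" if "E \<cong> carry_twist z"
      by (rule group.iso_sym[OF E that])
    ultimately have "\<not> E \<cong> carry_twist z"
      using lifted_root_iso[OF two central_ext_carry_twist(1)[OF z] ext _ _ i x(2)] False by blast
    then show ?thesis using z by (auto simp: carry_twist_def)
  qed
qed

section \<open>Torsion under isomorphisms and copies on natural numbers\<close>

lemma prime_torsion_elementary_iso:
  assumes G: "group G" and H: "group H" and iso: "G \<cong> H"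
    and elem: "prime_torsion_elementary G (carrier G)"
  shows "prime_torsion_elementary H (carrier H)"
proof -
  obtain \<theta> where \<theta>: "\<theta> \<in> iso G H" using iso by (auto simp: is_iso_def)
  interpret G: group G by (rule G)
  interpret \<theta>: group_hom G H \<theta>
    using \<theta> by (simp add: group_hom_def group_hom_axioms_def iso_def G H)
  show ?thesis
    unfolding prime_torsion_elementary_def
  proof (intro ballI allI impI)
    fix y and q :: nat assume y: "y \<in> carrier H" and q: "prime q" and yq: "y [^]\<^bsub>H\<^esub> (q * q) = \<one>\<^bsub>H\<^esub>"
    obtain x where x: "x \<in> carrier G" "y = \<theta> x" using iso_surj[OF G H \<theta> y] by blast
    have "\<theta> (x [^]\<^bsub>G\<^esub> (q * q)) = \<theta> \<one>\<^bsub>G\<^esub>" using yq x by (simp add: \<theta>.hom_nat_pow)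
    then have "x [^]\<^bsub>G\<^esub> (q * q) = \<one>\<^bsub>G\<^esub>" using x by (simp add: iso_eq_iff[OF G H \<theta>] del: \<theta>.hom_one)
    then have "x [^]\<^bsub>G\<^esub> q = \<one>\<^bsub>G\<^esub>" using elem x q by (auto simp: prime_torsion_elementary_def)
    then show "y [^]\<^bsub>H\<^esub> q = \<one>\<^bsub>H\<^esub>" using x by (simp flip: \<theta>.hom_nat_pow)
  qed
qed

lemma torsion_element_iso:
  assumes G: "group G" and H: "group H" and iso: "G \<cong> H"
    and x: "x \<in> carrier G" "x \<noteq> \<one>\<^bsub>G\<^esub>" "x [^]\<^bsub>G\<^esub> (p::nat) = \<one>\<^bsub>G\<^esub>"
  shows "\<exists>y\<in>carrier H. y \<noteq> \<one>\<^bsub>H\<^esub> \<and> y [^]\<^bsub>H\<^esub> p = \<one>\<^bsub>H\<^esub>"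
proof -
  obtain \<theta> where \<theta>: "\<theta> \<in> iso G H" using iso by (auto simp: is_iso_def)
  interpret G: group G by (rule G)
  interpret \<theta>: group_hom G H \<theta>
    using \<theta> by (simp add: group_hom_def group_hom_axioms_def iso_def G H)
  have "\<theta> x \<noteq> \<one>\<^bsub>H\<^esub>" using iso_eq_iff[OF G H \<theta>, of x "\<one>\<^bsub>G\<^esub>"] x by simp
  moreover have "\<theta> x [^]\<^bsub>H\<^esub> p = \<one>\<^bsub>H\<^esub>" using x by (simp flip: \<theta>.hom_nat_pow)
  moreover have "\<theta> x \<in> carrier H" using x by simp
  ultimately show ?thesis by (intro bexI conjI)
qed

lemma nat_copy:
  assumes G: "group G" and c: "countable (carrier G)"
  shows "\<exists>H :: nat monoid. group H \<and> G \<cong> H"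
proof -
  interpret G: group G by (rule G)
  define f where "f = to_nat_on (carrier G)"
  define g where "g = from_nat_into (carrier G)"
  have gf: "g (f x) = x" if "x \<in> carrier G" for x using that c by (simp add: f_def g_def)
  define H :: "nat monoid" where
    "H = \<lparr>carrier = f ` carrier G, monoid.mult = (\<lambda>a b. f (g a \<otimes>\<^bsub>G\<^esub> g b)), one = f \<one>\<^bsub>G\<^esub>\<rparr>"
  have "inj_on f (carrier G)" unfolding f_def by (rule inj_on_to_nat_on[OF c])
  then have f: "f \<in> iso G H" by (auto simp: iso_def hom_def H_def gf bij_betw_def)
  have "group H"
  proof (rule groupI)
    fix a assume "a \<in> carrier H"
    then obtain x where x: "x \<in> carrier G" "a = f x" by (auto simp: H_def)
    then show "\<exists>b\<in>carrier H. b \<otimes>\<^bsub>H\<^esub> a = \<one>\<^bsub>H\<^esub>"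
      by (intro bexI[of _ "f (inv\<^bsub>G\<^esub> x)"]) (simp_all add: H_def gf)
  qed (auto simp: H_def gf G.m_assoc)
  then show ?thesis using f by (auto simp: is_iso_def)
qed

text \<open>If raising to the p-th power were onto \<open>K\<close> for each prime p dividing
  \<open>n\<close>, so would be the composite of these maps. This reduces the hypothesis on
  \<open>n\<close> to a single prime.\<close>

lemma power_image_composite:
  fixes K :: "'a set"
  assumes G: "group G" and K: "K \<subseteq> carrier G" and closed: "\<And>k m. k \<in> K \<Longrightarrow> k [^]\<^bsub>G\<^esub> (m::nat) \<in> K"
    and ne: "(\<lambda>c. c [^]\<^bsub>G\<^esub> n) ` K \<noteq> K" and n: "(n::nat) > 0"
  obtains p where "prime (p::nat)" "p dvd n" "(\<lambda>c. c [^]\<^bsub>G\<^esub> p) ` K \<noteq> K"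
proof -
  interpret G: group G by (rule G)
  have "\<exists>p::nat. prime p \<and> p dvd m \<and> (\<lambda>c. c [^]\<^bsub>G\<^esub> p) ` K \<noteq> K"
    if "(\<lambda>c. c [^]\<^bsub>G\<^esub> m) ` K \<noteq> K" "m > 0" for m :: nat
    using that
  proof (induction m rule: less_induct)
    case (less m)
    have "m \<noteq> 1"
    proof
      assume "m = 1"
      moreover have "(\<lambda>c. c [^]\<^bsub>G\<^esub> (1::nat)) ` K = (\<lambda>c. c) ` K" using K by (intro image_cong) auto
      ultimately show False using less.prems by simp
    qed
    then obtain p where p: "prime p" "p dvd m" using prime_factor_nat by blast
    show ?case
    proof (cases "(\<lambda>c. c [^]\<^bsub>G\<^esub> p) ` K = K")
      case True
      obtain d where d: "m = d * p" using p(2) by (metis dvd_def mult.commute)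
      have dm: "d < m" "d > 0" using d less.prems(2) prime_gt_1_nat[OF p(1)] by auto
      have "(\<lambda>c. c [^]\<^bsub>G\<^esub> m) ` K = (\<lambda>c. c [^]\<^bsub>G\<^esub> p) ` ((\<lambda>c. c [^]\<^bsub>G\<^esub> d) ` K)"
        unfolding image_image using K by (intro image_cong) (auto simp: d G.nat_pow_pow)
      then have "(\<lambda>c. c [^]\<^bsub>G\<^esub> d) ` K \<noteq> K" using True less.prems(1) by metis
      then obtain q where "prime q" "q dvd d" "(\<lambda>c. c [^]\<^bsub>G\<^esub> q) ` K \<noteq> K"
        using less.IH[OF dm(1) _ dm(2)] by blast
      moreover from this have "q dvd m" using d by simp
      ultimately show ?thesis by blast
    qed (use p in blast)
  qed
  then show ?thesis using ne n that by blast
qed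

context central_ext
begin

lemma countable_W:
  assumes "countable (carrier \<Gamma>)"
  shows "countable (carrier W)"
proof -
  obtain i where i: "i \<in> I" using I_ne by blast
  have "I \<subseteq> (\<lambda>g. \<phi> g i) ` carrier \<Gamma>"
    using transitive_action.unique_orbit[OF transitive i] by blast
  then have I: "countable I" using assms countable_subset by blast
  \<comment> \<open>The nonzero part of the graph of \<open>x\<close> determines \<open>x\<close>
    and is a finite subset of the countable set of pairs of a point of \<open>I\<close> and an
    integer.\<close>
  define G where "G x = {(j, x j) | j. j \<in> I \<and> x j \<noteq> 0}" for x :: "'i \<Rightarrow> int"
  have "inj_on G base"
  proof (rule inj_onI)
    fix x y assume x: "x \<in> base" and y: "y \<in> base" and eq: "G x = G y"
    show "x = y"
    proof (rule base_ext[OF x y])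
      fix j assume j: "j \<in> I"
      have "(j, v) \<in> G x \<longleftrightarrow> (j, v) \<in> G y" for v using eq by simp
      then have "v = x j \<and> v \<noteq> 0 \<longleftrightarrow> v = y j \<and> v \<noteq> 0" for v using j by (auto simp: G_def)
      then show "x j = y j" by metis
    qed
  qed
  moreover have "G ` base \<subseteq> {A. finite A \<and> A \<subseteq> I \<times> UNIV}"
  proof (rule image_subsetI)
    fix x assume "x \<in> base"
    then have "finite ((\<lambda>j. (j, x j)) ` {j \<in> I. x j \<noteq> 0})" by (simp add: base_def)
    moreover have "G x = (\<lambda>j. (j, x j)) ` {j \<in> I. x j \<noteq> 0}" by (auto simp: G_def)
    ultimately show "G x \<in> {A. finite A \<and> A \<subseteq> I \<times> UNIV}" by (auto simp: G_def)
  qed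
  moreover have "countable {A. finite A \<and> A \<subseteq> I \<times> (UNIV :: int set)}"
    using I by (intro countable_Collect_finite_subset) simp
  ultimately have "countable base" by (meson countable_image_inj_on countable_subset)
  then show ?thesis using assms by (simp add: carrier_W)
qed

lemma countable_E:
  assumes "countable (carrier \<Gamma>)" "countable K"
  shows "countable (carrier E)"
proof -
  define s where "s w = (SOME x. x \<in> carrier E \<and> \<pi> x = w)" for w
  have s: "s w \<in> carrier E \<and> \<pi> (s w) = w" if "w \<in> carrier W" for w
    unfolding s_def by (rule someI_ex) (use \<pi>_surj[OF that] in blast)
  have "carrier E \<subseteq> (\<lambda>(w, k). s w \<otimes>\<^bsub>E\<^esub> k) ` (carrier W \<times> K)"
  proof
    fix x assume x: "x \<in> carrier E"
    then have sx: "s (\<pi> x) \<in> carrier E" "\<pi> (s (\<pi> x)) = \<pi> x" using s by auto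
    obtain k where "k \<in> K" "x = s (\<pi> x) \<otimes>\<^bsub>E\<^esub> k" using fibre[OF sx(1) x sx(2)] by blast
    then show "x \<in> (\<lambda>(w, k). s w \<otimes>\<^bsub>E\<^esub> k) ` (carrier W \<times> K)" using x by force
  qed
  moreover have "countable ((\<lambda>(w, k). s w \<otimes>\<^bsub>E\<^esub> k) ` (carrier W \<times> K))"
    using countable_W[OF assms(1)] assms(2) by simp
  ultimately show ?thesis by (rule countable_subset)
qed

end

section \<open>The case of a single point\<close>

text \<open>Faithfulness on one point makes \<open>\<Gamma>\<close> trivial, so the quotient is
  cyclic of order \<open>n\<close>, generated by \<open>u i0\<close>, and every central extension of
  it is abelian.\<close>

locale central_ext_cyclic = central_ext +
  fixes i0 assumes I: "I = {i0}"
begin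

lemma i0: "i0 \<in> I"
  by (simp add: I)

lemma W_cyclic:
  assumes "w \<in> carrier W"
  shows "\<exists>m<n. w = u i0 [^]\<^bsub>W\<^esub> m"
proof -
  obtain x g where w: "w = (x, g)" "x \<in> base" "g \<in> carrier \<Gamma>" using assms by (auto simp: carrier_W)
  have eq: "j = i0" if "j \<in> I" for j using that by (simp add: I)
  have "g = \<one>" using act_faithful[OF w(3)] act_closed[OF w(3)] eq by metis
  moreover have xi: "0 \<le> x i0" "x i0 < int n" by (rule baseD(2,3)[OF w(2) i0])+
  moreover have "x = (\<lambda>j\<in>I. if j = i0 then int (nat (x i0)) mod int n else 0)"
  proof (rule extensionalityI[of _ I])
    show "x \<in> extensional I" by (rule baseD(1)[OF w(2)])
    fix j assume "j \<in> I"
    then show "x j = (\<lambda>j\<in>I. if j = i0 then int (nat (x i0)) mod int n else 0) j"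
      using eq[of j] xi by simp
  qed simp
  ultimately have "w = u i0 [^]\<^bsub>W\<^esub> nat (x i0)" using w by (simp only: u_pow)
  moreover have "nat (x i0) < n" using xi by linarith
  ultimately show ?thesis by blast
qed

lemma E_decompose:
  assumes x: "x \<in> carrier E" "\<pi> x = u i0" and w: "w \<in> carrier E"
  obtains m k where "m < n" "k \<in> K" "w = x [^]\<^bsub>E\<^esub> m \<otimes>\<^bsub>E\<^esub> k"
proof -
  obtain m where m: "m < n" "\<pi> w = u i0 [^]\<^bsub>W\<^esub> m" using W_cyclic[OF \<pi>.hom_closed[OF w]] by blast
  have "\<pi> (x [^]\<^bsub>E\<^esub> m) = \<pi> w" using x m by (simp add: \<pi>.hom_nat_pow)
  then obtain k where k: "k \<in> K" "w = x [^]\<^bsub>E\<^esub> m \<otimes>\<^bsub>E\<^esub> k"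
    using fibre[OF E.nat_pow_closed[OF x(1)] w] by blast
  show ?thesis by (rule that[OF m(1) k])
qed

lemma comm_group_E: "comm_group E"
proof (rule E.group_comm_groupI)
  fix v w assume v: "v \<in> carrier E" and w: "w \<in> carrier E"
  obtain x where x: "x \<in> carrier E" "\<pi> x = u i0" using \<pi>_surj[OF u_carrier[of i0]] by blast
  obtain a k where "a < n" and a: "k \<in> K" "v = x [^]\<^bsub>E\<^esub> a \<otimes>\<^bsub>E\<^esub> k" by (rule E_decompose[OF x v])
  obtain b l where "b < n" and b: "l \<in> K" "w = x [^]\<^bsub>E\<^esub> b \<otimes>\<^bsub>E\<^esub> l" by (rule E_decompose[OF x w])
  have kw: "k \<otimes>\<^bsub>E\<^esub> y = y \<otimes>\<^bsub>E\<^esub> k" if "y \<in> carrier E" for y using central[OF a(1) that] .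
  have lw: "l \<otimes>\<^bsub>E\<^esub> y = y \<otimes>\<^bsub>E\<^esub> l" if "y \<in> carrier E" for y using central[OF b(1) that] .
  have "v \<otimes>\<^bsub>E\<^esub> w = x [^]\<^bsub>E\<^esub> a \<otimes>\<^bsub>E\<^esub> w \<otimes>\<^bsub>E\<^esub> k"
    using a w x by (simp add: E.m_assoc kw)
  also have "x [^]\<^bsub>E\<^esub> a \<otimes>\<^bsub>E\<^esub> w = w \<otimes>\<^bsub>E\<^esub> x [^]\<^bsub>E\<^esub> a"
  proof -
    have "x [^]\<^bsub>E\<^esub> a \<otimes>\<^bsub>E\<^esub> w = (x [^]\<^bsub>E\<^esub> a \<otimes>\<^bsub>E\<^esub> x [^]\<^bsub>E\<^esub> b) \<otimes>\<^bsub>E\<^esub> l" using b x by (simp add: E.m_assoc)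
    also have "x [^]\<^bsub>E\<^esub> a \<otimes>\<^bsub>E\<^esub> x [^]\<^bsub>E\<^esub> b = x [^]\<^bsub>E\<^esub> b \<otimes>\<^bsub>E\<^esub> x [^]\<^bsub>E\<^esub> a"
      using x by (simp add: E.nat_pow_mult add.commute)
    also have "x [^]\<^bsub>E\<^esub> b \<otimes>\<^bsub>E\<^esub> x [^]\<^bsub>E\<^esub> a \<otimes>\<^bsub>E\<^esub> l = w \<otimes>\<^bsub>E\<^esub> x [^]\<^bsub>E\<^esub> a"
      using b x lw[of "x [^]\<^bsub>E\<^esub> a"] by (simp add: E.m_assoc)
    finally show ?thesis .
  qed
  finally show "v \<otimes>\<^bsub>E\<^esub> w = w \<otimes>\<^bsub>E\<^esub> v" using a w x by (simp add: E.m_assoc)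
qed

lemma u_pow_eq_one: "u i0 [^]\<^bsub>W\<^esub> (m::nat) = \<one>\<^bsub>W\<^esub> \<longleftrightarrow> n dvd m"
proof -
  have "(\<lambda>j\<in>I. if j = i0 then int m mod int n else 0) = zero \<longleftrightarrow> int m mod int n = 0"
    using i0 by (auto simp: zero_def fun_eq_iff)
  then have "u i0 [^]\<^bsub>W\<^esub> m = \<one>\<^bsub>W\<^esub> \<longleftrightarrow> int m mod int n = 0" by (simp add: u_pow one_W)
  also have "\<dots> \<longleftrightarrow> n dvd m" by (metis dvd_eq_mod_eq_0 int_dvd_int_iff)
  finally show ?thesis .
qed

text \<open>Write w = x^m k. From w^p = 1 it follows that m p = n r and c^r k^p = 1, with r < p. A
  nonzero r would be invertible modulo p, which makes \<open>c\<close> a p-th power in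
  \<open>K\<close>. So r = 0 and \<open>w\<close> lies in \<open>K\<close>, where there is no
  p-torsion.\<close>

lemma no_torsion:
  assumes p: "prime p" "p dvd n" and x: "x \<in> carrier E" "\<pi> x = u i0"
    and tf: "\<And>c. c \<in> K \<Longrightarrow> c [^]\<^bsub>E\<^esub> p = \<one>\<^bsub>E\<^esub> \<Longrightarrow> c = \<one>\<^bsub>E\<^esub>"
    and xn: "x [^]\<^bsub>E\<^esub> n = c" "\<And>d. d \<in> K \<Longrightarrow> d [^]\<^bsub>E\<^esub> p \<noteq> c"
    and w: "w \<in> carrier E" "w [^]\<^bsub>E\<^esub> (p::nat) = \<one>\<^bsub>E\<^esub>"
  shows "w = \<one>\<^bsub>E\<^esub>"
proof -
  obtain m k where m: "m < n" "k \<in> K" "w = x [^]\<^bsub>E\<^esub> m \<otimes>\<^bsub>E\<^esub> k" by (rule E_decompose[OF x w(1)])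
  have cK: "c \<in> K" using lift_pow_K[OF x] xn(1) by simp
  have "\<pi> w = u i0 [^]\<^bsub>W\<^esub> m" using m x by (simp add: \<pi>.hom_nat_pow K_iff)
  then have "u i0 [^]\<^bsub>W\<^esub> (m * p) = \<pi> (w [^]\<^bsub>E\<^esub> p)" using w(1) by (simp add: \<pi>.hom_nat_pow W.nat_pow_pow)
  then have "n dvd m * p" using w(2) by (simp add: u_pow_eq_one)
  then obtain r where r: "m * p = n * r" by (elim dvdE)
  have wp: "c [^]\<^bsub>E\<^esub> r \<otimes>\<^bsub>E\<^esub> k [^]\<^bsub>E\<^esub> p = \<one>\<^bsub>E\<^esub>"
    using w(2) pow_mult_K[of "x [^]\<^bsub>E\<^esub> m" k p] m x by (simp add: E.nat_pow_pow r flip: xn(1))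
  have rp: "r < p"
  proof (rule ccontr)
    assume "\<not> r < p"
    then have "n * p \<le> m * p" using r by simp
    then show False using m(1) p(1) prime_gt_0_nat by simp
  qed
  have "r = 0"
  proof (rule ccontr)
    assume "r \<noteq> 0"
    then have "\<not> p dvd r" using rp by (auto dest: dvd_imp_le)
    then have "coprime (int p) (int r)" using p(1) by (intro prime_imp_coprime) auto
    then have "gcd (int p) (int r) = 1" by simp
    then obtain a b where ab: "a * int p + b * int r = 1" using bezout_int[of "int p" "int r"] by auto
    have ck: "c [^]\<^bsub>E\<^esub> r = inv\<^bsub>E\<^esub> (k [^]\<^bsub>E\<^esub> p)" using E.inv_equality[OF wp] cK m by simp
    interpret C: comm_group E by (rule comm_group_E)
    \<comment> \<open>The p-th power of k^(-1) is c^r, so the p-th power of \<open>?d\<close> is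
      c^(a p + b r) = c.\<close>
    let ?d = "c [^]\<^bsub>E\<^esub> a \<otimes>\<^bsub>E\<^esub> (inv\<^bsub>E\<^esub> k) [^]\<^bsub>E\<^esub> b"
    have ip: "y [^]\<^bsub>E\<^esub> (j::int) \<in> K" if "y \<in> K" for y j
      by (rule E.subgroup_int_pow_closed[OF \<pi>.subgroup_kernel that])
    have dK: "?d \<in> K" using cK m(2) by (intro K_closed(4) ip K_closed(3))
    have "?d [^]\<^bsub>E\<^esub> int p = (c [^]\<^bsub>E\<^esub> a) [^]\<^bsub>E\<^esub> int p \<otimes>\<^bsub>E\<^esub> ((inv\<^bsub>E\<^esub> k) [^]\<^bsub>E\<^esub> b) [^]\<^bsub>E\<^esub> int p"
      using cK m(2) by (intro C.int_pow_distrib) auto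
    also have "((inv\<^bsub>E\<^esub> k) [^]\<^bsub>E\<^esub> b) [^]\<^bsub>E\<^esub> int p = ((inv\<^bsub>E\<^esub> k) [^]\<^bsub>E\<^esub> int p) [^]\<^bsub>E\<^esub> b"
      using m(2) by (simp add: E.int_pow_pow mult.commute)
    also have "(inv\<^bsub>E\<^esub> k) [^]\<^bsub>E\<^esub> int p = c [^]\<^bsub>E\<^esub> int r"
      using m(2) by (simp add: int_pow_int E.nat_pow_inv ck)
    also have "(c [^]\<^bsub>E\<^esub> a) [^]\<^bsub>E\<^esub> int p \<otimes>\<^bsub>E\<^esub> (c [^]\<^bsub>E\<^esub> int r) [^]\<^bsub>E\<^esub> b = c [^]\<^bsub>E\<^esub> (a * int p + b * int r)"
      using cK by (simp add: E.int_pow_pow E.int_pow_mult mult.commute)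
    finally have "?d [^]\<^bsub>E\<^esub> p = c" using cK by (simp add: ab int_pow_int)
    then show False using xn(2)[OF dK] by simp
  qed
  then have "m = 0" using r p(1) prime_gt_0_nat by auto
  then have "w = k" using m by simp
  then show ?thesis using tf m(2) w(2) by simp
qed

text \<open>Suppose that all twists are isomorphic to \<open>E\<close>, and let p be a prime divisor
  of \<open>n\<close> for which p-th powers do not exhaust \<open>K\<close>. A suitable twist gives
  the lift \<open>x\<close> any prescribed n-th power \<open>c\<close> in \<open>K\<close>, and then
  y = x^(n/p) satisfies y^p = c. If \<open>K\<close> has an element \<open>c\<close> of order p, y
  has order p^2, contrary to \<open>elem\<close>. Otherwise c = 1 yields a nontrivial y with y^p =
  1, whereas a \<open>c\<close> that is no p-th power yields a group without p-torsion;
  \<open>E\<close> cannot be isomorphic to both.\<close>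

lemma cyclic_dichotomy:
  assumes ne: "(\<lambda>c. c [^]\<^bsub>E\<^esub> n) ` K \<noteq> K"
    and elem: "prime_torsion_elementary E (carrier E)"
  shows "\<exists>z\<in>K. \<not> E \<cong> carry_twist z"
proof (rule ccontr)
  assume "\<not> ?thesis"
  then have iso: "E \<cong> carry_twist z" if "z \<in> K" for z using that by blast
  have T: "central_ext \<Gamma> I \<phi> n (carry_twist z) \<pi>" "kernel (carry_twist z) W \<pi> = K" if "z \<in> K" for z
    using central_ext_carry_twist[OF that] by auto
  have Tg: "group (carry_twist z)" if "z \<in> K" for z
    by (rule central_ext.E[OF T(1)[OF that]])
  have KE: "K \<subseteq> carrier E" by (rule subsetI) simp
  have n0: "n > 0" using n2 by simp
  obtain p where p: "prime p" "p dvd n" "(\<lambda>c. c [^]\<^bsub>E\<^esub> p) ` K \<noteq> K"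
    by (rule power_image_composite[OF E KE K_pow ne n0])
  obtain q where "n = p * q" using p(2) by (elim dvdE)
  then have q: "n = q * p" by simp
  have q0: "0 < q" using q n0 by (cases q) auto
  then have qn: "q < n" using q prime_gt_1_nat[OF p(1)] by simp
  obtain x where x: "x \<in> carrier E" "\<pi> x = u i0" using \<pi>_surj[OF u_carrier[of i0]] by blast
  \<comment> \<open>The twist by \<open>z0\<close> cancels the n-th power of \<open>x\<close>; a
    further factor \<open>c\<close> makes it equal to \<open>c\<close>.\<close>
  define z0 where "z0 = inv\<^bsub>E\<^esub> (x [^]\<^bsub>E\<^esub> n)"
  have z0: "z0 \<in> K" unfolding z0_def using lift_pow_K[OF x] by simp
  have xn: "x [^]\<^bsub>carry_twist (z0 \<otimes>\<^bsub>E\<^esub> c)\<^esub> n = c" if c: "c \<in> K" for c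
    using carry_twist_lift_pow[OF K_closed(4)[OF z0 c] x(1) i0 x(2)] x c
    by (simp add: z0_def E.mult_inv_cancel)
  have xq: "x [^]\<^bsub>carry_twist (z0 \<otimes>\<^bsub>E\<^esub> c)\<^esub> q \<in> carrier E"
    "(x [^]\<^bsub>carry_twist (z0 \<otimes>\<^bsub>E\<^esub> c)\<^esub> q) [^]\<^bsub>carry_twist (z0 \<otimes>\<^bsub>E\<^esub> c)\<^esub> p = c" if c: "c \<in> K" for c
  proof -
    interpret T: group "carry_twist (z0 \<otimes>\<^bsub>E\<^esub> c)" by (rule Tg[OF K_closed(4)[OF z0 c]])
    note cs = carry_twist_simps[OF K_closed(4)[OF z0 c]]
    have xT: "x \<in> carrier (carry_twist (z0 \<otimes>\<^bsub>E\<^esub> c))" using x by (simp add: cs)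
    show "x [^]\<^bsub>carry_twist (z0 \<otimes>\<^bsub>E\<^esub> c)\<^esub> q \<in> carrier E" using T.nat_pow_closed[OF xT] by (simp add: cs)
    show "(x [^]\<^bsub>carry_twist (z0 \<otimes>\<^bsub>E\<^esub> c)\<^esub> q) [^]\<^bsub>carry_twist (z0 \<otimes>\<^bsub>E\<^esub> c)\<^esub> p = c"
      using T.nat_pow_pow[OF xT, of q p] xn[OF c] by (simp flip: q)
  qed
  show False
  proof (cases "\<exists>c\<in>K. c \<noteq> \<one>\<^bsub>E\<^esub> \<and> c [^]\<^bsub>E\<^esub> p = \<one>\<^bsub>E\<^esub>")
    case True
    then obtain c where c: "c \<in> K" "c \<noteq> \<one>\<^bsub>E\<^esub>" "c [^]\<^bsub>E\<^esub> p = \<one>\<^bsub>E\<^esub>" by blast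
    let ?T = "carry_twist (z0 \<otimes>\<^bsub>E\<^esub> c)"
    have z: "z0 \<otimes>\<^bsub>E\<^esub> c \<in> K" using z0 c by simp
    interpret T: group ?T by (rule Tg[OF z])
    note cs = carry_twist_simps[OF z]
    let ?y = "x [^]\<^bsub>?T\<^esub> q"
    have y: "?y \<in> carrier ?T" using xq(1)[OF c(1)] by (simp add: cs)
    have "?y [^]\<^bsub>?T\<^esub> (p * p) = (?y [^]\<^bsub>?T\<^esub> p) [^]\<^bsub>?T\<^esub> p" by (rule T.nat_pow_pow[OF y, symmetric])
    also have "\<dots> = \<one>\<^bsub>?T\<^esub>" unfolding xq(2)[OF c(1)] using c by (simp add: carry_twist_pow_K[OF z] cs)
    finally have "?y [^]\<^bsub>?T\<^esub> p = \<one>\<^bsub>?T\<^esub>"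
      using prime_torsion_elementary_iso[OF E Tg[OF z] iso[OF z] elem] y p(1)
      unfolding prime_torsion_elementary_def by blast
    then show False using c(2) xq(2)[OF c(1)] by (simp add: cs)
  next
    case False
    then have tf: "c = \<one>\<^bsub>E\<^esub>" if "c \<in> K" "c [^]\<^bsub>E\<^esub> p = \<one>\<^bsub>E\<^esub>" for c using that by blast
    have "\<exists>w\<in>carrier E. w \<noteq> \<one>\<^bsub>E\<^esub> \<and> w [^]\<^bsub>E\<^esub> p = \<one>\<^bsub>E\<^esub>"
    proof -
      let ?T = "carry_twist (z0 \<otimes>\<^bsub>E\<^esub> \<one>\<^bsub>E\<^esub>)"
      have z: "z0 \<otimes>\<^bsub>E\<^esub> \<one>\<^bsub>E\<^esub> \<in> K" by (rule K_closed(4)[OF z0 K_closed(2)])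
      interpret T: central_ext \<Gamma> I \<phi> n ?T \<pi> by (rule T(1)[OF z])
      note cs = carry_twist_simps[OF z]
      let ?y = "x [^]\<^bsub>?T\<^esub> q"
      have y: "?y \<in> carrier ?T" using xq(1)[of "\<one>\<^bsub>E\<^esub>"] by (simp only: cs K_closed(2))
      have yp: "?y [^]\<^bsub>?T\<^esub> p = \<one>\<^bsub>?T\<^esub>" using xq(2)[of "\<one>\<^bsub>E\<^esub>"] by (simp only: cs K_closed(2))
      have "\<pi> ?y = u i0 [^]\<^bsub>W\<^esub> q" using T.\<pi>.hom_nat_pow[of x q] x by (simp only: cs)
      moreover have "\<not> n dvd q" using q0 qn by (auto dest: dvd_imp_le)
      ultimately have "?y \<noteq> \<one>\<^bsub>?T\<^esub>" using u_pow_eq_one[of q] T.\<pi>.hom_one by metis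
      then show ?thesis
        using torsion_element_iso[OF Tg[OF z] E group.iso_sym[OF E iso[OF z]] y _ yp] by blast
    qed
    then obtain w where w: "w \<in> carrier E" "w \<noteq> \<one>\<^bsub>E\<^esub>" "w [^]\<^bsub>E\<^esub> p = \<one>\<^bsub>E\<^esub>" by blast
    have "(\<lambda>c. c [^]\<^bsub>E\<^esub> p) ` K \<subseteq> K" using K_pow by blast
    then obtain c where c: "c \<in> K" "\<And>d. d \<in> K \<Longrightarrow> d [^]\<^bsub>E\<^esub> p \<noteq> c" using p(3) by blast
    let ?T = "carry_twist (z0 \<otimes>\<^bsub>E\<^esub> c)"
    have z: "z0 \<otimes>\<^bsub>E\<^esub> c \<in> K" using z0 c by simp
    note cs = carry_twist_simps[OF z]
    have T': "central_ext_cyclic \<Gamma> I \<phi> n ?T \<pi> i0"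
      using T(1)[OF z] I by (simp add: central_ext_cyclic_def central_ext_cyclic_axioms_def)
    obtain v where v: "v \<in> carrier ?T" "v \<noteq> \<one>\<^bsub>?T\<^esub>" "v [^]\<^bsub>?T\<^esub> p = \<one>\<^bsub>?T\<^esub>"
      using torsion_element_iso[OF E Tg[OF z] iso[OF z] w] by blast
    have "v = \<one>\<^bsub>?T\<^esub>"
    proof (rule central_ext_cyclic.no_torsion[OF T' p(1,2) _ x(2) _ xn[OF c(1)] _ v(1,3)])
      show "x \<in> carrier ?T" using x by (simp add: cs)
      show "d = \<one>\<^bsub>?T\<^esub>" if "d \<in> kernel ?T W \<pi>" "d [^]\<^bsub>?T\<^esub> p = \<one>\<^bsub>?T\<^esub>" for d
        using that tf by (simp add: T(2)[OF z] carry_twist_pow_K[OF z] cs)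
      show "d [^]\<^bsub>?T\<^esub> p \<noteq> c" if "d \<in> kernel ?T W \<pi>" for d
        using that c(2) by (simp add: T(2)[OF z] carry_twist_pow_K[OF z])
    qed
    then show False using v by simp
  qed
qed

end

lemma noniso_nat_copy:
  assumes E: "group E" and F: "group F" and c: "countable (carrier F)"
    and vN: "vN_equivalent E F" and ni: "\<not> E \<cong> F"
  shows "\<exists>H :: nat monoid. group H \<and> vN_equivalent E H \<and> \<not> E \<cong> H"
proof -
  obtain H :: "nat monoid" where H: "group H" "F \<cong> H" using nat_copy[OF F c] by blast
  have "vN_equivalent E H" by (rule vN_equivalent_trans[OF vN iso_vN_equivalent[OF F H]])
  moreover have "\<not> E \<cong> H"
  proof
    assume "E \<cong> H"
    then show False using ni iso_trans[OF _ group.iso_sym[OF F H(2)]] by blast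
  qed
  ultimately show ?thesis using H(1) by blast
qed

text \<open>For one point there are two sources of a competitor. If \<open>E\<close> has no element
  of order q^2 for any prime q, some twist is not isomorphic to it; if it has one, the group found
  by Zorn's lemma has none and differs from \<open>E\<close> for that reason.\<close>

lemma (in central_ext) exists_noniso_vN_equivalent:
  assumes W: "wreath_infinite \<Gamma> I \<phi> n"
    and ne: "(\<lambda>c. c [^]\<^bsub>E\<^esub> n) ` K \<noteq> K" and cnt: "countable (carrier E)"
  shows "\<exists>H :: nat monoid. group H \<and> vN_equivalent E H \<and> \<not> E \<cong> H"
proof -
  have twist: ?thesis if z: "z \<in> K" and ni: "\<not> E \<cong> carry_twist z" for z
  proof (rule noniso_nat_copy[OF E _ _ vN_equivalent_carry_twist[OF z] ni])
    show "group (carry_twist z)" by (rule central_ext.E[OF central_ext_carry_twist(1)[OF z]])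
    show "countable (carrier (carry_twist z))" using cnt by (simp add: carry_twist_simps[OF z])
  qed
  show ?thesis
  proof (cases "\<exists>i\<in>I. \<exists>j\<in>I. i \<noteq> j")
    case True
    then obtain i j where ij: "i \<in> I" "j \<in> I" "i \<noteq> j" by blast
    show ?thesis
      using wreath_infinite.exists_noniso_carry_twist[OF W ij central_ext_axioms ne] twist
      by (auto simp: carry_twist_def)
  next
    case False
    obtain i0 where "i0 \<in> I" using I_ne by blast
    then have I: "I = {i0}" using False by blast
    then have cyc: "central_ext_cyclic \<Gamma> I \<phi> n E \<pi> i0"
      using central_ext_axioms by (simp add: central_ext_cyclic_def central_ext_cyclic_axioms_def)
    show ?thesis
    proof (cases "prime_torsion_elementary E (carrier E)")
      case True
      then show ?thesis using central_ext_cyclic.cyclic_dichotomy[OF cyc ne True] twist by blast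
    next
      case False
      interpret C: comm_group E by (rule central_ext_cyclic.comm_group_E[OF cyc])
      let ?U = "unitary_group (carrier E)"
      obtain R where R: "group (?U\<lparr>carrier := R\<rparr>)" "prime_torsion_elementary ?U R"
        "countable R" "vN_equivalent E (?U\<lparr>carrier := R\<rparr>)"
        using C.exists_elementary_vN_equivalent cnt by blast
      have pow: "x [^]\<^bsub>?U\<lparr>carrier := R\<rparr>\<^esub> (k::nat) = x [^]\<^bsub>?U\<^esub> k" for x k
        by (simp add: nat_pow_def)
      have "prime_torsion_elementary (?U\<lparr>carrier := R\<rparr>) (carrier (?U\<lparr>carrier := R\<rparr>))"
        using R(2) by (simp add: prime_torsion_elementary_def pow)
      then have "\<not> E \<cong> ?U\<lparr>carrier := R\<rparr>"
        using prime_torsion_elementary_iso[OF R(1) E group.iso_sym[OF E]] False by blast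
      then show ?thesis using noniso_nat_copy[OF E R(1) _ R(4)] R(3) by simp
    qed
  qed
qed

section \<open>Second cohomology\<close>

locale cohomology = G: group G + C: comm_group C
  for G :: "('g, 'm) monoid_scheme" and C :: "('c, 'k) monoid_scheme"
begin

lemma Z2_iff:
  "\<xi> \<in> carrier (Z2 G C) \<longleftrightarrow> \<xi> \<in> extensional (carrier G \<times> carrier G) \<and>
     (\<forall>g\<in>carrier G. \<forall>h\<in>carrier G. \<xi> (g, h) \<in> carrier C) \<and>
     (\<forall>g\<in>carrier G. \<xi> (\<one>\<^bsub>G\<^esub>, g) = \<one>\<^bsub>C\<^esub> \<and> \<xi> (g, \<one>\<^bsub>G\<^esub>) = \<one>\<^bsub>C\<^esub>) \<and>
     (\<forall>g\<in>carrier G. \<forall>h\<in>carrier G. \<forall>k\<in>carrier G.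
        \<xi> (g, h) \<otimes>\<^bsub>C\<^esub> \<xi> (g \<otimes>\<^bsub>G\<^esub> h, k) = \<xi> (h, k) \<otimes>\<^bsub>C\<^esub> \<xi> (g, h \<otimes>\<^bsub>G\<^esub> k))"
  by (auto simp: Z2_def PiE_iff)

lemma Z2_mult: "\<xi> \<otimes>\<^bsub>Z2 G C\<^esub> \<eta> = (\<lambda>i\<in>carrier G \<times> carrier G. \<xi> i \<otimes>\<^bsub>C\<^esub> \<eta> i)"
  by (simp add: Z2_def)

lemma Z2_one: "\<one>\<^bsub>Z2 G C\<^esub> = (\<lambda>i\<in>carrier G \<times> carrier G. \<one>\<^bsub>C\<^esub>)"
  by (simp add: Z2_def)

lemma Z2_closed: "\<xi> \<in> carrier (Z2 G C) \<Longrightarrow> g \<in> carrier G \<Longrightarrow> h \<in> carrier G \<Longrightarrow> \<xi> (g, h) \<in> carrier C"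
  by (simp add: Z2_iff)

lemma Z2_normalized:
  "\<xi> \<in> carrier (Z2 G C) \<Longrightarrow> g \<in> carrier G \<Longrightarrow> \<xi> (\<one>\<^bsub>G\<^esub>, g) = \<one>\<^bsub>C\<^esub>"
  "\<xi> \<in> carrier (Z2 G C) \<Longrightarrow> g \<in> carrier G \<Longrightarrow> \<xi> (g, \<one>\<^bsub>G\<^esub>) = \<one>\<^bsub>C\<^esub>"
  by (simp_all add: Z2_iff)

lemma Z2_cocycle:
  "\<xi> \<in> carrier (Z2 G C) \<Longrightarrow> g \<in> carrier G \<Longrightarrow> h \<in> carrier G \<Longrightarrow> k \<in> carrier G \<Longrightarrow>
    \<xi> (g, h) \<otimes>\<^bsub>C\<^esub> \<xi> (g \<otimes>\<^bsub>G\<^esub> h, k) = \<xi> (h, k) \<otimes>\<^bsub>C\<^esub> \<xi> (g, h \<otimes>\<^bsub>G\<^esub> k)"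
  by (simp add: Z2_iff)

lemma Z2_ext:
  assumes "\<xi> \<in> carrier (Z2 G C)" "\<eta> \<in> carrier (Z2 G C)"
    "\<And>g h. g \<in> carrier G \<Longrightarrow> h \<in> carrier G \<Longrightarrow> \<xi> (g, h) = \<eta> (g, h)"
  shows "\<xi> = \<eta>"
  by (rule extensionalityI[of _ "carrier G \<times> carrier G"]) (use assms in \<open>auto simp: Z2_iff\<close>)

lemma interchange:
  assumes "a \<in> carrier C" "b \<in> carrier C" "c \<in> carrier C" "d \<in> carrier C"
  shows "(a \<otimes>\<^bsub>C\<^esub> b) \<otimes>\<^bsub>C\<^esub> (c \<otimes>\<^bsub>C\<^esub> d) = (a \<otimes>\<^bsub>C\<^esub> c) \<otimes>\<^bsub>C\<^esub> (b \<otimes>\<^bsub>C\<^esub> d)"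
  using assms by (simp add: C.m_ac)

lemma Z2_mult_closed:
  assumes "\<xi> \<in> carrier (Z2 G C)" "\<eta> \<in> carrier (Z2 G C)"
  shows "\<xi> \<otimes>\<^bsub>Z2 G C\<^esub> \<eta> \<in> carrier (Z2 G C)"
  unfolding Z2_iff
proof (intro conjI ballI)
  fix g h k assume *: "g \<in> carrier G" "h \<in> carrier G" "k \<in> carrier G"
  have "(\<xi> (g, h) \<otimes>\<^bsub>C\<^esub> \<eta> (g, h)) \<otimes>\<^bsub>C\<^esub> (\<xi> (g \<otimes>\<^bsub>G\<^esub> h, k) \<otimes>\<^bsub>C\<^esub> \<eta> (g \<otimes>\<^bsub>G\<^esub> h, k))
      = (\<xi> (g, h) \<otimes>\<^bsub>C\<^esub> \<xi> (g \<otimes>\<^bsub>G\<^esub> h, k)) \<otimes>\<^bsub>C\<^esub> (\<eta> (g, h) \<otimes>\<^bsub>C\<^esub> \<eta> (g \<otimes>\<^bsub>G\<^esub> h, k))"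
    using assms * by (intro interchange) (auto simp: Z2_closed)
  also have "\<dots> = (\<xi> (h, k) \<otimes>\<^bsub>C\<^esub> \<xi> (g, h \<otimes>\<^bsub>G\<^esub> k)) \<otimes>\<^bsub>C\<^esub> (\<eta> (h, k) \<otimes>\<^bsub>C\<^esub> \<eta> (g, h \<otimes>\<^bsub>G\<^esub> k))"
    using assms * by (simp add: Z2_cocycle)
  also have "\<dots> = (\<xi> (h, k) \<otimes>\<^bsub>C\<^esub> \<eta> (h, k)) \<otimes>\<^bsub>C\<^esub> (\<xi> (g, h \<otimes>\<^bsub>G\<^esub> k) \<otimes>\<^bsub>C\<^esub> \<eta> (g, h \<otimes>\<^bsub>G\<^esub> k))"
    using assms * by (intro interchange) (auto simp: Z2_closed)
  finally show "(\<xi> \<otimes>\<^bsub>Z2 G C\<^esub> \<eta>) (g, h) \<otimes>\<^bsub>C\<^esub> (\<xi> \<otimes>\<^bsub>Z2 G C\<^esub> \<eta>) (g \<otimes>\<^bsub>G\<^esub> h, k)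
      = (\<xi> \<otimes>\<^bsub>Z2 G C\<^esub> \<eta>) (h, k) \<otimes>\<^bsub>C\<^esub> (\<xi> \<otimes>\<^bsub>Z2 G C\<^esub> \<eta>) (g, h \<otimes>\<^bsub>G\<^esub> k)"
    using * by (simp add: Z2_mult)
qed (use assms in \<open>auto simp: Z2_mult Z2_closed Z2_normalized\<close>)

lemma group_Z2: "group (Z2 G C)"
proof (rule groupI)
  show one: "\<one>\<^bsub>Z2 G C\<^esub> \<in> carrier (Z2 G C)" by (auto simp: Z2_iff Z2_one)
  fix \<xi> assume \<xi>: "\<xi> \<in> carrier (Z2 G C)"
  show "\<one>\<^bsub>Z2 G C\<^esub> \<otimes>\<^bsub>Z2 G C\<^esub> \<xi> = \<xi>"
    by (rule Z2_ext) (use \<xi> one in \<open>auto simp: Z2_mult_closed\<close>, simp add: Z2_mult Z2_one Z2_closed)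
  let ?\<eta> = "\<lambda>i\<in>carrier G \<times> carrier G. inv\<^bsub>C\<^esub> \<xi> i"
  have \<eta>: "?\<eta> \<in> carrier (Z2 G C)"
    using \<xi> by (auto simp: Z2_iff C.inv_mult[symmetric])
  have "?\<eta> \<otimes>\<^bsub>Z2 G C\<^esub> \<xi> = \<one>\<^bsub>Z2 G C\<^esub>"
    using \<xi> by (auto simp: Z2_mult Z2_one Z2_closed fun_eq_iff)
  then show "\<exists>\<eta>\<in>carrier (Z2 G C). \<eta> \<otimes>\<^bsub>Z2 G C\<^esub> \<xi> = \<one>\<^bsub>Z2 G C\<^esub>" using \<eta> by blast
next
  fix \<xi> \<eta> \<zeta> assume *: "\<xi> \<in> carrier (Z2 G C)" "\<eta> \<in> carrier (Z2 G C)" "\<zeta> \<in> carrier (Z2 G C)"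
  show "\<xi> \<otimes>\<^bsub>Z2 G C\<^esub> \<eta> \<otimes>\<^bsub>Z2 G C\<^esub> \<zeta> = \<xi> \<otimes>\<^bsub>Z2 G C\<^esub> (\<eta> \<otimes>\<^bsub>Z2 G C\<^esub> \<zeta>)"
    by (rule Z2_ext) (use * in \<open>auto simp: Z2_mult_closed\<close>, use * in \<open>simp add: Z2_mult Z2_closed C.m_assoc\<close>)
qed (rule Z2_mult_closed)

definition cobd :: "('g \<Rightarrow> 'c) \<Rightarrow> 'g \<times> 'g \<Rightarrow> 'c" where
  "cobd f = (\<lambda>(g, h)\<in>carrier G \<times> carrier G. f g \<otimes>\<^bsub>C\<^esub> f h \<otimes>\<^bsub>C\<^esub> inv\<^bsub>C\<^esub> f (g \<otimes>\<^bsub>G\<^esub> h))"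

lemma cobd_apply:
  "g \<in> carrier G \<Longrightarrow> h \<in> carrier G \<Longrightarrow> cobd f (g, h) = f g \<otimes>\<^bsub>C\<^esub> f h \<otimes>\<^bsub>C\<^esub> inv\<^bsub>C\<^esub> f (g \<otimes>\<^bsub>G\<^esub> h)"
  by (simp add: cobd_def)

lemma B2_eq: "B2 G C = {cobd f | f. f \<in> carrier G \<rightarrow> carrier C \<and> f \<one>\<^bsub>G\<^esub> = \<one>\<^bsub>C\<^esub>}"
  by (simp add: B2_def cobd_def)

lemma cobd_Z2:
  assumes f: "f \<in> carrier G \<rightarrow> carrier C" "f \<one>\<^bsub>G\<^esub> = \<one>\<^bsub>C\<^esub>"
  shows "cobd f \<in> carrier (Z2 G C)"
  unfolding Z2_iff
proof (intro conjI ballI)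
  have fc: "f g \<in> carrier C" if "g \<in> carrier G" for g using f that by blast
  fix g assume g: "g \<in> carrier G"
  show "cobd f (\<one>\<^bsub>G\<^esub>, g) = \<one>\<^bsub>C\<^esub>" "cobd f (g, \<one>\<^bsub>G\<^esub>) = \<one>\<^bsub>C\<^esub>"
    using g by (simp_all add: cobd_apply f(2) fc)
  fix h assume h: "h \<in> carrier G"
  show "cobd f (g, h) \<in> carrier C" using g h by (simp add: cobd_apply fc)
  fix k assume k: "k \<in> carrier G"
  have cancel: "a \<otimes>\<^bsub>C\<^esub> b \<otimes>\<^bsub>C\<^esub> inv\<^bsub>C\<^esub> c \<otimes>\<^bsub>C\<^esub> (c \<otimes>\<^bsub>C\<^esub> d \<otimes>\<^bsub>C\<^esub> e) = a \<otimes>\<^bsub>C\<^esub> b \<otimes>\<^bsub>C\<^esub> d \<otimes>\<^bsub>C\<^esub> e"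
    if "a \<in> carrier C" "b \<in> carrier C" "c \<in> carrier C" "d \<in> carrier C" "e \<in> carrier C" for a b c d e
    using that by (simp add: C.m_assoc C.mult_inv_cancel)
  have "cobd f (g, h) \<otimes>\<^bsub>C\<^esub> cobd f (g \<otimes>\<^bsub>G\<^esub> h, k)
      = f g \<otimes>\<^bsub>C\<^esub> f h \<otimes>\<^bsub>C\<^esub> f k \<otimes>\<^bsub>C\<^esub> inv\<^bsub>C\<^esub> f (g \<otimes>\<^bsub>G\<^esub> h \<otimes>\<^bsub>G\<^esub> k)"
    using g h k by (simp add: cobd_apply fc cancel)
  also have "\<dots> = f h \<otimes>\<^bsub>C\<^esub> f k \<otimes>\<^bsub>C\<^esub> f g \<otimes>\<^bsub>C\<^esub> inv\<^bsub>C\<^esub> f (g \<otimes>\<^bsub>G\<^esub> (h \<otimes>\<^bsub>G\<^esub> k))"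
    using g h k by (simp add: fc C.m_ac G.m_assoc)
  also have "\<dots> = cobd f (h, k) \<otimes>\<^bsub>C\<^esub> (f (h \<otimes>\<^bsub>G\<^esub> k) \<otimes>\<^bsub>C\<^esub> f g \<otimes>\<^bsub>C\<^esub> inv\<^bsub>C\<^esub> f (g \<otimes>\<^bsub>G\<^esub> (h \<otimes>\<^bsub>G\<^esub> k)))"
    using g h k by (simp add: cobd_apply fc cancel)
  also have "f (h \<otimes>\<^bsub>G\<^esub> k) \<otimes>\<^bsub>C\<^esub> f g \<otimes>\<^bsub>C\<^esub> inv\<^bsub>C\<^esub> f (g \<otimes>\<^bsub>G\<^esub> (h \<otimes>\<^bsub>G\<^esub> k)) = cobd f (g, h \<otimes>\<^bsub>G\<^esub> k)"
    using g h k by (simp add: cobd_apply fc C.m_comm)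
  finally show "cobd f (g, h) \<otimes>\<^bsub>C\<^esub> cobd f (g \<otimes>\<^bsub>G\<^esub> h, k) = cobd f (h, k) \<otimes>\<^bsub>C\<^esub> cobd f (g, h \<otimes>\<^bsub>G\<^esub> k)" .
qed (simp add: cobd_def)

lemma subgroup_B2: "subgroup (B2 G C) (Z2 G C)"
proof (rule group.subgroupI[OF group_Z2])
  show sub: "B2 G C \<subseteq> carrier (Z2 G C)" by (auto simp: B2_eq cobd_Z2)
  have "cobd (\<lambda>_. \<one>\<^bsub>C\<^esub>) \<in> B2 G C" by (auto simp: B2_eq)
  then show "B2 G C \<noteq> {}" by blast
  fix b assume "b \<in> B2 G C"
  then obtain f where b: "b = cobd f" and f: "f \<in> carrier G \<rightarrow> carrier C" "f \<one>\<^bsub>G\<^esub> = \<one>\<^bsub>C\<^esub>"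
    by (auto simp: B2_eq)
  have fc: "f g \<in> carrier C" if "g \<in> carrier G" for g using f that by blast
  let ?f = "\<lambda>g. inv\<^bsub>C\<^esub> f g"
  have f': "?f \<in> carrier G \<rightarrow> carrier C" "?f \<one>\<^bsub>G\<^esub> = \<one>\<^bsub>C\<^esub>" using f by auto
  have "cobd ?f \<otimes>\<^bsub>Z2 G C\<^esub> b = \<one>\<^bsub>Z2 G C\<^esub>"
  proof (rule Z2_ext)
    show "cobd ?f \<otimes>\<^bsub>Z2 G C\<^esub> b \<in> carrier (Z2 G C)" unfolding b by (intro Z2_mult_closed cobd_Z2 f f')
    show "\<one>\<^bsub>Z2 G C\<^esub> \<in> carrier (Z2 G C)" using group.is_monoid[OF group_Z2] by simp
    fix g h assume gh: "g \<in> carrier G" "h \<in> carrier G"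
    have "inv\<^bsub>C\<^esub> f g \<otimes>\<^bsub>C\<^esub> inv\<^bsub>C\<^esub> f h \<otimes>\<^bsub>C\<^esub> f (g \<otimes>\<^bsub>G\<^esub> h) = inv\<^bsub>C\<^esub> (f g \<otimes>\<^bsub>C\<^esub> f h \<otimes>\<^bsub>C\<^esub> inv\<^bsub>C\<^esub> f (g \<otimes>\<^bsub>G\<^esub> h))"
      using gh by (simp add: fc C.inv_mult)
    then show "(cobd ?f \<otimes>\<^bsub>Z2 G C\<^esub> b) (g, h) = \<one>\<^bsub>Z2 G C\<^esub> (g, h)"
      using gh by (simp add: Z2_mult Z2_one cobd_apply b fc)
  qed
  then have "inv\<^bsub>Z2 G C\<^esub> b = cobd ?f"
    using group.inv_equality[OF group_Z2] cobd_Z2[OF f'] cobd_Z2[OF f] b by simp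
  then show "inv\<^bsub>Z2 G C\<^esub> b \<in> B2 G C" using f' by (auto simp: B2_eq)
  fix b' assume "b' \<in> B2 G C"
  then obtain f2 where b': "b' = cobd f2" and f2: "f2 \<in> carrier G \<rightarrow> carrier C" "f2 \<one>\<^bsub>G\<^esub> = \<one>\<^bsub>C\<^esub>"
    by (auto simp: B2_eq)
  have f2c: "f2 g \<in> carrier C" if "g \<in> carrier G" for g using f2 that by blast
  let ?h = "\<lambda>g. f g \<otimes>\<^bsub>C\<^esub> f2 g"
  have h: "?h \<in> carrier G \<rightarrow> carrier C" "?h \<one>\<^bsub>G\<^esub> = \<one>\<^bsub>C\<^esub>" using f f2 by auto
  have "b \<otimes>\<^bsub>Z2 G C\<^esub> b' = cobd ?h"
  proof (rule Z2_ext)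
    show "b \<otimes>\<^bsub>Z2 G C\<^esub> b' \<in> carrier (Z2 G C)" unfolding b b' by (intro Z2_mult_closed cobd_Z2 f f2)
    show "cobd ?h \<in> carrier (Z2 G C)" by (rule cobd_Z2[OF h])
    fix g k assume gk: "g \<in> carrier G" "k \<in> carrier G"
    then show "(b \<otimes>\<^bsub>Z2 G C\<^esub> b') (g, k) = cobd ?h (g, k)"
      by (simp add: Z2_mult b b' cobd_apply fc f2c C.inv_mult C.m_ac)
  qed
  then show "b \<otimes>\<^bsub>Z2 G C\<^esub> b' \<in> B2 G C" using h by (auto simp: B2_eq)
qed

lemma coset_absorb:
  assumes "b \<in> B2 G C" "\<xi> \<in> carrier (Z2 G C)"
  shows "B2 G C #>\<^bsub>Z2 G C\<^esub> (b \<otimes>\<^bsub>Z2 G C\<^esub> \<xi>) = B2 G C #>\<^bsub>Z2 G C\<^esub> \<xi>"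
proof -
  interpret Z: group "Z2 G C" by (rule group_Z2)
  have b: "b \<in> carrier (Z2 G C)" using subgroup.mem_carrier[OF subgroup_B2 assms(1)] .
  have "B2 G C #>\<^bsub>Z2 G C\<^esub> (b \<otimes>\<^bsub>Z2 G C\<^esub> \<xi>) = (B2 G C #>\<^bsub>Z2 G C\<^esub> b) #>\<^bsub>Z2 G C\<^esub> \<xi>"
    by (rule Z.coset_mult_assoc[OF subgroup.subset[OF subgroup_B2] b assms(2), symmetric])
  also have "B2 G C #>\<^bsub>Z2 G C\<^esub> b = B2 G C" by (rule Z.coset_join2[OF b subgroup_B2 assms(1)])
  finally show ?thesis .
qed

lemma H2_carrier: "carrier (H2 G C) = {B2 G C #>\<^bsub>Z2 G C\<^esub> \<xi> | \<xi>. \<xi> \<in> carrier (Z2 G C)}"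
  by (auto simp: H2_def FactGroup_def RCOSETS_def)

lemma coset_elements:
  assumes "\<eta> \<in> B2 G C #>\<^bsub>Z2 G C\<^esub> \<xi>"
  obtains f where "f \<in> carrier G \<rightarrow> carrier C" "f \<one>\<^bsub>G\<^esub> = \<one>\<^bsub>C\<^esub>" "\<eta> = cobd f \<otimes>\<^bsub>Z2 G C\<^esub> \<xi>"
  using assms by (auto simp: r_coset_def B2_eq)

lemma coset_nonempty: "B2 G C #>\<^bsub>Z2 G C\<^esub> \<xi> \<noteq> {}"
  using subgroup.one_closed[OF subgroup_B2] by (auto simp: r_coset_def)

lemma group_cocycle_extension:
  assumes \<xi>: "\<xi> \<in> carrier (Z2 G C)"
  shows "group (cocycle_extension G C \<xi>)"
proof (rule groupI)
  fix x y z
  assume "x \<in> carrier (cocycle_extension G C \<xi>)" "y \<in> carrier (cocycle_extension G C \<xi>)"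
    "z \<in> carrier (cocycle_extension G C \<xi>)"
  then obtain a g b h c k where x: "x = (a, g)" "a \<in> carrier C" "g \<in> carrier G"
    and y: "y = (b, h)" "b \<in> carrier C" "h \<in> carrier G" and z: "z = (c, k)" "c \<in> carrier C" "k \<in> carrier G"
    by (auto simp: cocycle_extension_def)
  have "a \<otimes>\<^bsub>C\<^esub> b \<otimes>\<^bsub>C\<^esub> \<xi> (g, h) \<otimes>\<^bsub>C\<^esub> c \<otimes>\<^bsub>C\<^esub> \<xi> (g \<otimes>\<^bsub>G\<^esub> h, k)
      = a \<otimes>\<^bsub>C\<^esub> b \<otimes>\<^bsub>C\<^esub> c \<otimes>\<^bsub>C\<^esub> (\<xi> (g, h) \<otimes>\<^bsub>C\<^esub> \<xi> (g \<otimes>\<^bsub>G\<^esub> h, k))"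
    using x y z by (simp add: Z2_closed[OF \<xi>] C.m_ac)
  also have "\<dots> = a \<otimes>\<^bsub>C\<^esub> (b \<otimes>\<^bsub>C\<^esub> c \<otimes>\<^bsub>C\<^esub> \<xi> (h, k)) \<otimes>\<^bsub>C\<^esub> \<xi> (g, h \<otimes>\<^bsub>G\<^esub> k)"
    using x y z by (simp add: Z2_cocycle[OF \<xi>]) (simp add: Z2_closed[OF \<xi>] C.m_assoc)
  finally show "x \<otimes>\<^bsub>cocycle_extension G C \<xi>\<^esub> y \<otimes>\<^bsub>cocycle_extension G C \<xi>\<^esub> z
      = x \<otimes>\<^bsub>cocycle_extension G C \<xi>\<^esub> (y \<otimes>\<^bsub>cocycle_extension G C \<xi>\<^esub> z)"
    using x y z by (simp add: cocycle_extension_def G.m_assoc)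
next
  fix x assume "x \<in> carrier (cocycle_extension G C \<xi>)"
  then obtain a g where x: "x = (a, g)" "a \<in> carrier C" "g \<in> carrier G"
    by (auto simp: cocycle_extension_def)
  then show "\<one>\<^bsub>cocycle_extension G C \<xi>\<^esub> \<otimes>\<^bsub>cocycle_extension G C \<xi>\<^esub> x = x"
    by (simp add: cocycle_extension_def Z2_normalized[OF \<xi>])
  let ?y = "(inv\<^bsub>C\<^esub> (a \<otimes>\<^bsub>C\<^esub> \<xi> (inv\<^bsub>G\<^esub> g, g)), inv\<^bsub>G\<^esub> g)"
  have "?y \<otimes>\<^bsub>cocycle_extension G C \<xi>\<^esub> x = \<one>\<^bsub>cocycle_extension G C \<xi>\<^esub>"
    using x by (simp add: cocycle_extension_def C.m_assoc Z2_closed[OF \<xi>])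
  moreover have "?y \<in> carrier (cocycle_extension G C \<xi>)"
    using x by (simp add: cocycle_extension_def Z2_closed[OF \<xi>])
  ultimately show "\<exists>y\<in>carrier (cocycle_extension G C \<xi>).
      y \<otimes>\<^bsub>cocycle_extension G C \<xi>\<^esub> x = \<one>\<^bsub>cocycle_extension G C \<xi>\<^esub>" by blast
qed (auto simp: cocycle_extension_def Z2_closed[OF \<xi>])

text \<open>The isomorphism multiplies the central component by the cochain \<open>f\<close> whose
  coboundary relates the two cocycles.\<close>

lemma cohomologous_extensions_iso:
  assumes \<xi>: "\<xi> \<in> carrier (Z2 G C)" and \<eta>: "\<eta> \<in> B2 G C #>\<^bsub>Z2 G C\<^esub> \<xi>"
  shows "cocycle_extension G C \<eta> \<cong> cocycle_extension G C \<xi>"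
proof -
  obtain f where f: "f \<in> carrier G \<rightarrow> carrier C" and \<eta>f: "\<eta> = cobd f \<otimes>\<^bsub>Z2 G C\<^esub> \<xi>"
    using coset_elements[OF \<eta>] by metis
  have fc: "f g \<in> carrier C" if "g \<in> carrier G" for g using f that by blast
  define \<theta> where "\<theta> = (\<lambda>(a, g). (a \<otimes>\<^bsub>C\<^esub> f g, g))"
  have "\<theta> \<in> hom (cocycle_extension G C \<eta>) (cocycle_extension G C \<xi>)"
  proof (rule homI)
    fix x y assume "x \<in> carrier (cocycle_extension G C \<eta>)" "y \<in> carrier (cocycle_extension G C \<eta>)"
    then obtain a g b h where x: "x = (a, g)" "a \<in> carrier C" "g \<in> carrier G"
      and y: "y = (b, h)" "b \<in> carrier C" "h \<in> carrier G" by (auto simp: cocycle_extension_def)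
    note cl = fc Z2_closed[OF \<xi>]
    have "a \<otimes>\<^bsub>C\<^esub> b \<otimes>\<^bsub>C\<^esub> (f g \<otimes>\<^bsub>C\<^esub> f h \<otimes>\<^bsub>C\<^esub> inv\<^bsub>C\<^esub> f (g \<otimes>\<^bsub>G\<^esub> h) \<otimes>\<^bsub>C\<^esub> \<xi> (g, h)) \<otimes>\<^bsub>C\<^esub> f (g \<otimes>\<^bsub>G\<^esub> h)
        = a \<otimes>\<^bsub>C\<^esub> b \<otimes>\<^bsub>C\<^esub> (f g \<otimes>\<^bsub>C\<^esub> f h) \<otimes>\<^bsub>C\<^esub> \<xi> (g, h) \<otimes>\<^bsub>C\<^esub> (inv\<^bsub>C\<^esub> f (g \<otimes>\<^bsub>G\<^esub> h) \<otimes>\<^bsub>C\<^esub> f (g \<otimes>\<^bsub>G\<^esub> h))"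
      using x y by (simp add: cl C.m_ac del: C.l_inv C.r_inv)
    also have "\<dots> = a \<otimes>\<^bsub>C\<^esub> f g \<otimes>\<^bsub>C\<^esub> (b \<otimes>\<^bsub>C\<^esub> f h) \<otimes>\<^bsub>C\<^esub> \<xi> (g, h)"
      using x y by (simp add: cl C.m_ac)
    finally show "\<theta> (x \<otimes>\<^bsub>cocycle_extension G C \<eta>\<^esub> y) = \<theta> x \<otimes>\<^bsub>cocycle_extension G C \<xi>\<^esub> \<theta> y"
      using x y by (simp add: \<theta>_def cocycle_extension_def \<eta>f Z2_mult cobd_apply)
  qed (auto simp: \<theta>_def cocycle_extension_def fc)
  moreover have "bij_betw \<theta> (carrier C \<times> carrier G) (carrier C \<times> carrier G)"
    by (rule bij_betw_byWitness[where f' = "\<lambda>(a, g). (a \<otimes>\<^bsub>C\<^esub> inv\<^bsub>C\<^esub> f g, g)"])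
      (auto simp: \<theta>_def fc C.m_assoc)
  ultimately have "\<theta> \<in> iso (cocycle_extension G C \<eta>) (cocycle_extension G C \<xi>)"
    by (simp add: iso_def cocycle_extension_def)
  then show ?thesis by (auto simp: is_iso_def)
qed

text \<open>Composing a coboundary with the homomorphism \<open>\<omega>\<close> gives a coboundary,
  so all terms of the union agree and one representative suffices.\<close>

lemma H2_map_coset:
  fixes D :: "('d, 'l) monoid_scheme"
  assumes D: "comm_group D" and \<omega>: "\<omega> \<in> hom C D" and \<xi>: "\<xi> \<in> carrier (Z2 G C)"
  shows "H2_map G D \<omega> (B2 G C #>\<^bsub>Z2 G C\<^esub> \<xi>)
    = B2 G D #>\<^bsub>Z2 G D\<^esub> compose (carrier G \<times> carrier G) \<omega> \<xi>"
    and "compose (carrier G \<times> carrier G) \<omega> \<xi> \<in> carrier (Z2 G D)"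
proof -
  interpret D: cohomology G D using D G.is_group by (simp add: cohomology_def)
  interpret \<omega>: group_hom C D \<omega>
    using \<omega> by (simp add: group_hom_def group_hom_axioms_def C.is_group D.C.is_group)
  let ?c = "compose (carrier G \<times> carrier G) \<omega>"
  show c: "?c \<xi> \<in> carrier (Z2 G D)"
    unfolding D.Z2_iff
  proof (intro conjI ballI)
    fix g h k assume *: "g \<in> carrier G" "h \<in> carrier G" "k \<in> carrier G"
    show "?c \<xi> (g, h) \<otimes>\<^bsub>D\<^esub> ?c \<xi> (g \<otimes>\<^bsub>G\<^esub> h, k) = ?c \<xi> (h, k) \<otimes>\<^bsub>D\<^esub> ?c \<xi> (g, h \<otimes>\<^bsub>G\<^esub> k)"
      using * arg_cong[OF Z2_cocycle[OF \<xi> *], of \<omega>] by (simp add: compose_eq Z2_closed[OF \<xi>])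
  qed (auto simp: compose_eq Z2_closed[OF \<xi>] Z2_normalized[OF \<xi>])
  have "B2 G D #>\<^bsub>Z2 G D\<^esub> ?c \<eta> = B2 G D #>\<^bsub>Z2 G D\<^esub> ?c \<xi>" if \<eta>: "\<eta> \<in> B2 G C #>\<^bsub>Z2 G C\<^esub> \<xi>" for \<eta>
  proof -
    obtain f where f: "f \<in> carrier G \<rightarrow> carrier C" "f \<one>\<^bsub>G\<^esub> = \<one>\<^bsub>C\<^esub>" and \<eta>f: "\<eta> = cobd f \<otimes>\<^bsub>Z2 G C\<^esub> \<xi>"
      using coset_elements[OF \<eta>] by metis
    have fc: "f g \<in> carrier C" if "g \<in> carrier G" for g using f that by blast
    have wf: "(\<lambda>g. \<omega> (f g)) \<in> carrier G \<rightarrow> carrier D" "\<omega> (f \<one>\<^bsub>G\<^esub>) = \<one>\<^bsub>D\<^esub>" using fc f by auto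
    have "?c \<eta> = D.cobd (\<lambda>g. \<omega> (f g)) \<otimes>\<^bsub>Z2 G D\<^esub> ?c \<xi>"
      by (auto simp: \<eta>f compose_def Z2_mult D.Z2_mult cobd_apply D.cobd_apply fc Z2_closed[OF \<xi>] fun_eq_iff)
    moreover have "D.cobd (\<lambda>g. \<omega> (f g)) \<in> B2 G D" using wf by (auto simp: D.B2_eq)
    ultimately show ?thesis using D.coset_absorb[OF _ c] by simp
  qed
  then show "H2_map G D \<omega> (B2 G C #>\<^bsub>Z2 G C\<^esub> \<xi>) = B2 G D #>\<^bsub>Z2 G D\<^esub> ?c \<xi>"
    unfolding H2_map_def using coset_nonempty by (simp cong: SUP_cong)
qed

end

section \<open>The carry cocycle as a cohomology class\<close>

lemma comm_group_circle: "comm_group circle_group"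
proof (rule comm_groupI)
  fix x assume "x \<in> carrier circle_group"
  moreover from this have "x \<noteq> 0" by (auto simp: circle_group_def)
  ultimately show "\<exists>y\<in>carrier circle_group. y \<otimes>\<^bsub>circle_group\<^esub> x = \<one>\<^bsub>circle_group\<^esub>"
    by (intro bexI[of _ "inverse x"]) (auto simp: circle_group_def norm_inverse)
qed (auto simp: circle_group_def norm_mult)

lemma circle_root:
  assumes "x \<in> carrier circle_group" "n > 0"
  shows "\<exists>r\<in>carrier circle_group. r [^]\<^bsub>circle_group\<^esub> (n::nat) = x"
proof
  have x: "cmod x = 1" using assms by (simp add: circle_group_def)
  let ?r = "cis (Arg x / real n)"
  have "?r [^]\<^bsub>circle_group\<^esub> (k::nat) = ?r ^ k" for k
    by (induction k) (auto simp: circle_group_def nat_pow_def)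
  moreover have "?r ^ n = x"
  proof -
    have "x \<noteq> 0" using x by auto
    then show ?thesis using assms(2) x cis_Arg[of x] by (simp add: DeMoivre sgn_eq)
  qed
  ultimately show "?r [^]\<^bsub>circle_group\<^esub> n = x" by simp
  show "?r \<in> carrier circle_group" by (simp add: circle_group_def)
qed

locale wreath_coefficients = wreath \<Gamma> I \<phi> n + C: comm_group C
  for \<Gamma> :: "'g monoid" (structure) and I :: "'i set" and \<phi> n and C :: "'c monoid"
begin

sublocale coh: cohomology W C
  by (simp add: cohomology_def group_W C.comm_group_axioms)

definition carry_cocycle :: "'c \<Rightarrow> (('i \<Rightarrow> int) \<times> 'g) \<times> (('i \<Rightarrow> int) \<times> 'g) \<Rightarrow> 'c" where
  "carry_cocycle c = (\<lambda>(g, h)\<in>carrier W \<times> carrier W. c [^]\<^bsub>C\<^esub> ((sigma g + sigma h) div int n))"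

lemma carry_cocycle_Z2:
  assumes c: "c \<in> carrier C"
  shows "carry_cocycle c \<in> carrier (Z2 W C)"
  unfolding coh.Z2_iff
proof (intro conjI ballI)
  fix g h k assume *: "g \<in> carrier W" "h \<in> carrier W" "k \<in> carrier W"
  have "(sigma g + sigma h) div int n + ((sigma g + sigma h) mod int n + sigma k) div int n
      = (sigma h + sigma k) div int n + (sigma g + (sigma h + sigma k) mod int n) div int n"
    using carry_assoc[of "int n" "sigma g + sigma h" "sigma k"]
      carry_assoc[of "int n" "sigma h + sigma k" "sigma g"] n2 by (simp add: ac_simps)
  then show "carry_cocycle c (g, h) \<otimes>\<^bsub>C\<^esub> carry_cocycle c (g \<otimes>\<^bsub>W\<^esub> h, k)
      = carry_cocycle c (h, k) \<otimes>\<^bsub>C\<^esub> carry_cocycle c (g, h \<otimes>\<^bsub>W\<^esub> k)"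
    using * c by (simp add: carry_cocycle_def sigma_mult C.int_pow_mult[symmetric])
qed (use c sigma_range in \<open>auto simp: carry_cocycle_def sigma_one\<close>)

text \<open>For r^n = \<omega> c and t = sigma g + sigma h, the exponent n (t div n) equals t - t
  mod n, so the image of the carry cocycle is the coboundary of g \<mapsto> r^sigma(g). The root is
  needed only in \<open>D\<close>; its absence in \<open>C\<close> is what leaves room for a
  different extension.\<close>

lemma carry_cocycle_coboundary:
  fixes D :: "('d, 'l) monoid_scheme"
  assumes D: "comm_group D" and \<omega>: "\<omega> \<in> hom C D" and c: "c \<in> carrier C"
    and r: "r \<in> carrier D" "r [^]\<^bsub>D\<^esub> n = \<omega> c"
  shows "compose (carrier W \<times> carrier W) \<omega> (carry_cocycle c) \<in> B2 W D"
proof -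
  interpret D: cohomology W D using D group_W by (simp add: cohomology_def)
  interpret \<omega>: group_hom C D \<omega>
    using \<omega> by (simp add: group_hom_def group_hom_axioms_def C.is_group D.C.is_group)
  define f where "f g = r [^]\<^bsub>D\<^esub> sigma g" for g
  have f: "f \<in> carrier W \<rightarrow> carrier D" "f \<one>\<^bsub>W\<^esub> = \<one>\<^bsub>D\<^esub>" using r by (auto simp: f_def sigma_one)
  have "compose (carrier W \<times> carrier W) \<omega> (carry_cocycle c) = D.cobd f"
  proof (rule extensionalityI[of _ "carrier W \<times> carrier W"])
    fix p assume "p \<in> carrier W \<times> carrier W"
    then obtain g h where p: "p = (g, h)" "g \<in> carrier W" "h \<in> carrier W" by blast
    let ?s = "sigma g + sigma h"
    have "\<omega> (c [^]\<^bsub>C\<^esub> (?s div int n)) = r [^]\<^bsub>D\<^esub> (int n * (?s div int n))"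
      using c r by (simp add: \<omega>.hom_int_pow D.C.int_pow_pow[symmetric] int_pow_int)
    also have "int n * (?s div int n) = ?s - ?s mod int n" by (simp add: minus_mod_eq_mult_div)
    also have "r [^]\<^bsub>D\<^esub> (?s - ?s mod int n) = f g \<otimes>\<^bsub>D\<^esub> f h \<otimes>\<^bsub>D\<^esub> inv\<^bsub>D\<^esub> f (g \<otimes>\<^bsub>W\<^esub> h)"
      using r p by (simp add: f_def sigma_mult D.C.int_pow_diff D.C.int_pow_mult)
    finally show "compose (carrier W \<times> carrier W) \<omega> (carry_cocycle c) p = D.cobd f p"
      using p by (simp add: compose_eq carry_cocycle_def D.cobd_apply)
  qed (simp_all add: D.cobd_def)
  then show ?thesis using f by (auto simp: D.B2_eq)
qed

lemma dual_equivalent_carry: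
  assumes \<xi>: "\<xi> \<in> carrier (Z2 W C)" and c: "c \<in> carrier C"
  shows "dual_equivalent W C (B2 W C #>\<^bsub>Z2 W C\<^esub> \<xi>) (B2 W C #>\<^bsub>Z2 W C\<^esub> (carry_cocycle c \<otimes>\<^bsub>Z2 W C\<^esub> \<xi>))"
  unfolding dual_equivalent_def
proof
  fix \<omega> assume \<omega>: "\<omega> \<in> hom C circle_group"
  interpret T: cohomology W circle_group using comm_group_circle group_W by (simp add: cohomology_def)
  let ?c = "compose (carrier W \<times> carrier W) \<omega>"
  have \<omega>c: "\<omega> c \<in> carrier circle_group" using \<omega> c by (auto simp: hom_def)
  obtain r where r: "r \<in> carrier circle_group" "r [^]\<^bsub>circle_group\<^esub> n = \<omega> c"
    using circle_root[OF \<omega>c, of n] n2 by auto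
  have "?c (carry_cocycle c \<otimes>\<^bsub>Z2 W C\<^esub> \<xi>) = ?c (carry_cocycle c) \<otimes>\<^bsub>Z2 W circle_group\<^esub> ?c \<xi>"
    using \<omega> by (auto simp: compose_def coh.Z2_mult T.Z2_mult hom_def fun_eq_iff
        coh.Z2_closed[OF \<xi>] coh.Z2_closed[OF carry_cocycle_Z2[OF c]])
  then show "H2_map W circle_group \<omega> (B2 W C #>\<^bsub>Z2 W C\<^esub> \<xi>)
      = H2_map W circle_group \<omega> (B2 W C #>\<^bsub>Z2 W C\<^esub> (carry_cocycle c \<otimes>\<^bsub>Z2 W C\<^esub> \<xi>))"
    using coh.H2_map_coset[OF comm_group_circle \<omega>] \<xi> coh.Z2_mult_closed[OF carry_cocycle_Z2[OF c] \<xi>]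
      T.coset_absorb[OF carry_cocycle_coboundary[OF comm_group_circle \<omega> c r]] by simp
qed

lemma central_ext_cocycle_extension:
  assumes \<xi>: "\<xi> \<in> carrier (Z2 W C)"
  shows "central_ext \<Gamma> I \<phi> n (cocycle_extension W C \<xi>) snd"
    "kernel (cocycle_extension W C \<xi>) W snd = carrier C \<times> {\<one>\<^bsub>W\<^esub>}"
proof -
  let ?E = "cocycle_extension W C \<xi>"
  show k: "kernel ?E W snd = carrier C \<times> {\<one>\<^bsub>W\<^esub>}"
    by (auto simp: kernel_def cocycle_extension_def)
  have e: "snd \<in> epi ?E W"
    using C.one_closed by (auto simp: epi_def hom_def cocycle_extension_def image_iff)
  show "central_ext \<Gamma> I \<phi> n ?E snd"
  proof (rule central_ext.intro[OF wreath_axioms central_ext_axioms.intro[OF coh.group_cocycle_extension[OF \<xi>] e]])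
    fix l x assume "l \<in> kernel ?E W snd" "x \<in> carrier ?E"
    then show "l \<otimes>\<^bsub>?E\<^esub> x = x \<otimes>\<^bsub>?E\<^esub> l"
      unfolding k by (auto simp: cocycle_extension_def coh.Z2_normalized[OF \<xi>] C.m_comm)
  qed
qed

lemma kernel_hom:
  assumes \<xi>: "\<xi> \<in> carrier (Z2 W C)"
  shows "(\<lambda>a. (a, \<one>\<^bsub>W\<^esub>)) \<in> hom C (cocycle_extension W C \<xi>)"
  by (rule homI) (auto simp: cocycle_extension_def coh.Z2_normalized[OF \<xi>])

lemma kernel_pow:
  assumes \<xi>: "\<xi> \<in> carrier (Z2 W C)" and a: "a \<in> carrier C"
  shows "(a, \<one>\<^bsub>W\<^esub>) [^]\<^bsub>cocycle_extension W C \<xi>\<^esub> (k::int) = (a [^]\<^bsub>C\<^esub> k, \<one>\<^bsub>W\<^esub>)"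
    and "(a, \<one>\<^bsub>W\<^esub>) [^]\<^bsub>cocycle_extension W C \<xi>\<^esub> (m::nat) = (a [^]\<^bsub>C\<^esub> m, \<one>\<^bsub>W\<^esub>)"
proof -
  interpret \<iota>: group_hom C "cocycle_extension W C \<xi>" "\<lambda>a. (a, \<one>\<^bsub>W\<^esub>)"
    using kernel_hom[OF \<xi>] coh.group_cocycle_extension[OF \<xi>]
    by (simp add: group_hom_def group_hom_axioms_def)
  show "(a, \<one>\<^bsub>W\<^esub>) [^]\<^bsub>cocycle_extension W C \<xi>\<^esub> (k::int) = (a [^]\<^bsub>C\<^esub> k, \<one>\<^bsub>W\<^esub>)"
    using \<iota>.hom_int_pow[OF a, of k] by simp
  show "(a, \<one>\<^bsub>W\<^esub>) [^]\<^bsub>cocycle_extension W C \<xi>\<^esub> (m::nat) = (a [^]\<^bsub>C\<^esub> m, \<one>\<^bsub>W\<^esub>)"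
    using \<iota>.hom_nat_pow[OF a, of m] by simp
qed

text \<open>The identity map on pairs: the same power of \<open>c\<close> enters once through the
  cocycle and once through the twisted product.\<close>

lemma twist_cocycle_extension:
  assumes \<xi>: "\<xi> \<in> carrier (Z2 W C)" and c: "c \<in> carrier C"
  shows "cocycle_extension W C (carry_cocycle c \<otimes>\<^bsub>Z2 W C\<^esub> \<xi>)
    \<cong> twist (cocycle_extension W C \<xi>) n (sigma \<circ> snd) (c, \<one>\<^bsub>W\<^esub>)" (is "?E' \<cong> ?T")
proof -
  let ?E = "cocycle_extension W C \<xi>"
  note pow = kernel_pow(1)[OF \<xi> c]
  have "(\<lambda>x. x) \<in> hom ?E' ?T"
  proof (rule homI)
    fix x y assume *: "x \<in> carrier ?E'" "y \<in> carrier ?E'"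
    obtain a g where x0: "x = (a, g)" by (cases x)
    obtain b h where y0: "y = (b, h)" by (cases y)
    have x: "x = (a, g)" "a \<in> carrier C" "g \<in> carrier W" and y: "y = (b, h)" "b \<in> carrier C" "h \<in> carrier W"
      using * x0 y0 by (simp_all add: cocycle_extension_def)
    let ?k = "(sigma g + sigma h) div int n"
    have gh: "g \<otimes>\<^bsub>W\<^esub> h \<in> carrier W" using x y by (intro W.m_closed)
    have \<xi>c: "\<xi> (g, h) \<in> carrier C" "\<xi> (g \<otimes>\<^bsub>W\<^esub> h, \<one>\<^bsub>W\<^esub>) = \<one>\<^bsub>C\<^esub>"
      using coh.Z2_closed[OF \<xi>] coh.Z2_normalized(2)[OF \<xi> gh] x y by auto
    have mult: "(d, g') \<otimes>\<^bsub>?E\<^esub> (d', h') = (d \<otimes>\<^bsub>C\<^esub> d' \<otimes>\<^bsub>C\<^esub> \<xi> (g', h'), g' \<otimes>\<^bsub>W\<^esub> h')" for d g' d' h'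
      by (simp add: cocycle_extension_def)
    have "x \<otimes>\<^bsub>?E'\<^esub> y = (a \<otimes>\<^bsub>C\<^esub> b \<otimes>\<^bsub>C\<^esub> (c [^]\<^bsub>C\<^esub> ?k \<otimes>\<^bsub>C\<^esub> \<xi> (g, h)), g \<otimes>\<^bsub>W\<^esub> h)"
      using x y by (simp add: cocycle_extension_def coh.Z2_mult carry_cocycle_def)
    also have "a \<otimes>\<^bsub>C\<^esub> b \<otimes>\<^bsub>C\<^esub> (c [^]\<^bsub>C\<^esub> ?k \<otimes>\<^bsub>C\<^esub> \<xi> (g, h)) = a \<otimes>\<^bsub>C\<^esub> b \<otimes>\<^bsub>C\<^esub> \<xi> (g, h) \<otimes>\<^bsub>C\<^esub> c [^]\<^bsub>C\<^esub> ?k"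
      using x(2) y(2) c \<xi>c(1) by (simp add: C.m_assoc C.m_comm[of "c [^]\<^bsub>C\<^esub> ?k"])
    also have "(a \<otimes>\<^bsub>C\<^esub> b \<otimes>\<^bsub>C\<^esub> \<xi> (g, h) \<otimes>\<^bsub>C\<^esub> c [^]\<^bsub>C\<^esub> ?k, g \<otimes>\<^bsub>W\<^esub> h)
        = (a \<otimes>\<^bsub>C\<^esub> b \<otimes>\<^bsub>C\<^esub> \<xi> (g, h), g \<otimes>\<^bsub>W\<^esub> h) \<otimes>\<^bsub>?E\<^esub> (c [^]\<^bsub>C\<^esub> ?k, \<one>\<^bsub>W\<^esub>)"
      unfolding mult using x(2) y(2) c \<xi>c gh by (simp only: W.r_one C.m_closed C.int_pow_closed C.r_one)
    also have "\<dots> = x \<otimes>\<^bsub>?T\<^esub> y"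
      by (simp only: x(1) y(1) twist_def monoid.simps mult pow comp_apply snd_conv)
    finally show "x \<otimes>\<^bsub>?E'\<^esub> y = x \<otimes>\<^bsub>?T\<^esub> y" .
  qed (simp add: twist_def cocycle_extension_def)
  moreover have "bij_betw (\<lambda>x. x) (carrier ?E') (carrier ?T)"
    by (simp add: bij_betw_def inj_on_def twist_def cocycle_extension_def)
  ultimately show ?thesis by (auto simp: is_iso_def iso_def)
qed

lemma kernel_power_image:
  assumes \<xi>: "\<xi> \<in> carrier (Z2 W C)" and ne: "(\<lambda>c. c [^]\<^bsub>C\<^esub> n) ` carrier C \<noteq> carrier C"
  shows "(\<lambda>c. c [^]\<^bsub>cocycle_extension W C \<xi>\<^esub> n) ` kernel (cocycle_extension W C \<xi>) W snd
    \<noteq> kernel (cocycle_extension W C \<xi>) W snd"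
proof -
  let ?E = "cocycle_extension W C \<xi>"
  note pow = kernel_pow(2)[OF \<xi>]
  have "(\<lambda>c. c [^]\<^bsub>?E\<^esub> n) ` (carrier C \<times> {\<one>\<^bsub>W\<^esub>}) = ((\<lambda>c. c [^]\<^bsub>C\<^esub> n) ` carrier C) \<times> {\<one>\<^bsub>W\<^esub>}"
    using pow[of _ n] by (auto simp: image_iff)
  then show ?thesis
    using ne C.one_closed unfolding central_ext_cocycle_extension(2)[OF \<xi>] by (auto simp only: times_eq_iff)
qed

end

text \<open>The extension is abstract here, so the hypothesis on n-th powers in \<open>C\<close> is
  carried to the kernel along the injective homomorphism \<open>\<iota>\<close>.\<close>

lemma not_W_star_superrigid_of_central_extension:
  fixes E :: "('e, 'm) monoid_scheme"
  assumes W: "wreath_infinite \<Gamma> I \<phi> n" and cnt: "countable (carrier \<Gamma>)"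
    and C: "comm_group C" "countable (carrier C)"
    and ne: "(\<lambda>c. c [^]\<^bsub>C\<^esub> n) ` carrier C \<noteq> carrier C"
    and E: "is_central_extension (generalized_wreath n I \<Gamma> \<phi>) C E"
  shows "\<not> W_star_superrigid E"
proof -
  interpret wreath_infinite \<Gamma> I \<phi> n by (rule W)
  interpret C: comm_group C by (rule C(1))
  obtain \<iota> \<pi> where gE: "group E" and \<iota>: "\<iota> \<in> mon C E" and \<pi>: "\<pi> \<in> epi E W"
    and im: "\<iota> ` carrier C = kernel E W \<pi>"
    and central: "\<forall>c\<in>carrier C. \<forall>e\<in>carrier E. \<iota> c \<otimes>\<^bsub>E\<^esub> e = e \<otimes>\<^bsub>E\<^esub> \<iota> c"
    using E unfolding is_central_extension_def by metis
  interpret E: central_ext \<Gamma> I \<phi> n E \<pi>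
  proof (rule central_ext.intro[OF wreath_axioms central_ext_axioms.intro[OF gE \<pi>]])
    fix k e assume "k \<in> kernel E W \<pi>" and e: "e \<in> carrier E"
    then have "k \<in> \<iota> ` carrier C" by (simp only: im)
    then show "k \<otimes>\<^bsub>E\<^esub> e = e \<otimes>\<^bsub>E\<^esub> k" using central e by blast
  qed
  have hom: "\<iota> \<in> hom C E" and inj: "inj_on \<iota> (carrier C)" using \<iota> by (simp_all add: mon_def)
  have pow: "\<iota> (c [^]\<^bsub>C\<^esub> n) = \<iota> c [^]\<^bsub>E\<^esub> n" if "c \<in> carrier C" for c
    using group_hom.hom_nat_pow[of C E \<iota> c n] hom that
    by (simp add: group_hom_def group_hom_axioms_def C.is_group gE)
  have "(\<lambda>c. c [^]\<^bsub>E\<^esub> n) ` E.K \<noteq> E.K"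
  proof
    assume "(\<lambda>c. c [^]\<^bsub>E\<^esub> n) ` E.K = E.K"
    then have "(\<lambda>c. \<iota> c [^]\<^bsub>E\<^esub> n) ` carrier C = \<iota> ` carrier C" by (simp add: im[symmetric] image_image)
    then have "\<iota> ` ((\<lambda>c. c [^]\<^bsub>C\<^esub> n) ` carrier C) = \<iota> ` carrier C"
      by (simp add: image_image pow cong: image_cong)
    moreover have "(\<lambda>c. c [^]\<^bsub>C\<^esub> n) ` carrier C \<subseteq> carrier C" by (rule image_subsetI) simp
    ultimately have "(\<lambda>c. c [^]\<^bsub>C\<^esub> n) ` carrier C = carrier C"
      using inj_on_image_eq_iff[OF inj] by blast
    then show False using ne by simp
  qed
  moreover have "countable (carrier E)"
    by (rule E.countable_E[OF cnt]) (use C(2) in \<open>simp flip: im\<close>)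
  ultimately obtain H :: "nat monoid" where "group H" "vN_equivalent E H" "\<not> E \<cong> H"
    using E.exists_noniso_vN_equivalent[OF W] by blast
  then show ?thesis unfolding W_star_superrigid_def by blast
qed

text \<open>Classes are cosets, while extensions are built from cocycles. The conclusion is
  therefore claimed for all representatives and reduced, by the isomorphisms between cohomologous
  extensions, to \<open>\<xi>0\<close> and its twist.\<close>

lemma exists_dual_equivalent_noniso:
  fixes \<Gamma> :: "'g monoid" and C :: "'c monoid"
  assumes W: "wreath_infinite \<Gamma> I \<phi> n" and two: "i \<in> I" "j \<in> I" "i \<noteq> j" and C: "comm_group C"
    and ne: "(\<lambda>c. c [^]\<^bsub>C\<^esub> n) ` carrier C \<noteq> carrier C"
    and \<Omega>: "\<Omega> \<in> carrier (H2 (generalized_wreath n I \<Gamma> \<phi>) C)"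
  shows "\<exists>\<Omega>'\<in>carrier (H2 (generalized_wreath n I \<Gamma> \<phi>) C).
    dual_equivalent (generalized_wreath n I \<Gamma> \<phi>) C \<Omega> \<Omega>' \<and>
    (\<forall>\<xi>\<in>\<Omega>. \<forall>\<xi>'\<in>\<Omega>'.
       vN_equivalent (cocycle_extension (generalized_wreath n I \<Gamma> \<phi>) C \<xi>)
         (cocycle_extension (generalized_wreath n I \<Gamma> \<phi>) C \<xi>') \<and>
       \<not> cocycle_extension (generalized_wreath n I \<Gamma> \<phi>) C \<xi> \<cong>
           cocycle_extension (generalized_wreath n I \<Gamma> \<phi>) C \<xi>')"
proof -
  interpret wreath_coefficients \<Gamma> I \<phi> n C
    using wreath_infinite.axioms(1)[OF W] C by (simp add: wreath_coefficients_def)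
  obtain \<xi>0 where \<xi>0: "\<xi>0 \<in> carrier (Z2 W C)" and \<Omega>_eq: "\<Omega> = B2 W C #>\<^bsub>Z2 W C\<^esub> \<xi>0"
    using \<Omega> unfolding coh.H2_carrier by blast
  let ?E = "cocycle_extension W C \<xi>0"
  interpret E: central_ext \<Gamma> I \<phi> n ?E snd by (rule central_ext_cocycle_extension(1)[OF \<xi>0])
  obtain z where z: "z \<in> kernel ?E W snd" and ni: "\<not> ?E \<cong> twist ?E n (sigma \<circ> snd) z"
    using wreath_infinite.exists_noniso_carry_twist[OF W two E.central_ext_axioms kernel_power_image[OF \<xi>0 ne]] by blast
  obtain c where c: "c \<in> carrier C" and zc: "z = (c, \<one>\<^bsub>W\<^esub>)"
    using z unfolding central_ext_cocycle_extension(2)[OF \<xi>0] by blast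
  let ?T = "twist ?E n (sigma \<circ> snd) z"
  let ?\<eta> = "carry_cocycle c \<otimes>\<^bsub>Z2 W C\<^esub> \<xi>0"
  have \<eta>: "?\<eta> \<in> carrier (Z2 W C)" by (rule coh.Z2_mult_closed[OF carry_cocycle_Z2[OF c] \<xi>0])
  have T: "group ?T" using central_twist.group_twist[OF E.central_twist[OF z]] .
  have vET: "vN_equivalent ?E ?T" using E.vN_equivalent_carry_twist[OF z] by (simp add: E.carry_twist_def)
  show ?thesis
  proof (intro bexI conjI ballI)
    show "B2 W C #>\<^bsub>Z2 W C\<^esub> ?\<eta> \<in> carrier (H2 W C)" using \<eta> unfolding coh.H2_carrier by blast
    show "dual_equivalent W C \<Omega> (B2 W C #>\<^bsub>Z2 W C\<^esub> ?\<eta>)"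
      unfolding \<Omega>_eq by (rule dual_equivalent_carry[OF \<xi>0 c])
    fix \<xi> \<xi>' assume \<xi>: "\<xi> \<in> \<Omega>" and \<xi>': "\<xi>' \<in> B2 W C #>\<^bsub>Z2 W C\<^esub> ?\<eta>"
    have mem: "\<zeta> \<in> carrier (Z2 W C)"
      if "\<theta> \<in> carrier (Z2 W C)" "\<zeta> \<in> B2 W C #>\<^bsub>Z2 W C\<^esub> \<theta>" for \<theta> \<zeta>
      using monoid.r_coset_subset_G[OF group.is_monoid[OF coh.group_Z2] subgroup.subset[OF coh.subgroup_B2] that(1)] that(2)
      by blast
    have g: "group (cocycle_extension W C \<xi>)" and g': "group (cocycle_extension W C \<xi>')"
      using mem[OF \<xi>0] mem[OF \<eta> \<xi>'] \<xi> by (auto simp: \<Omega>_eq intro: coh.group_cocycle_extension)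
    have i: "cocycle_extension W C \<xi> \<cong> ?E"
      by (rule coh.cohomologous_extensions_iso[OF \<xi>0]) (use \<xi> in \<open>simp add: \<Omega>_eq\<close>)
    have i': "cocycle_extension W C \<xi>' \<cong> ?T"
      using iso_trans[OF coh.cohomologous_extensions_iso[OF \<eta> \<xi>'] twist_cocycle_extension[OF \<xi>0 c]]
      by (simp add: zc)
    show "vN_equivalent (cocycle_extension W C \<xi>) (cocycle_extension W C \<xi>')"
      by (rule vN_equivalent_trans[OF iso_vN_equivalent[OF g E.E i]
            vN_equivalent_trans[OF vET iso_vN_equivalent[OF T g' group.iso_sym[OF g' i']]]])
    show "\<not> cocycle_extension W C \<xi> \<cong> cocycle_extension W C \<xi>'"
    proof
      assume "cocycle_extension W C \<xi> \<cong> cocycle_extension W C \<xi>'"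
      then have "?E \<cong> ?T" using iso_trans[OF iso_trans[OF group.iso_sym[OF g i]] i'] by blast
      then show False using ni by simp
    qed
  qed
qed

text \<open>The second claim asks for two points because it fails for one. Let \<Gamma> be trivial,
  n = p a prime, and \<open>C\<close> the direct sum of infinitely many copies of each cyclic group
  of order p^k, k >= 1. An extension of the cyclic group of order p by \<open>C\<close> is
  determined by an element of \<open>C\<close> modulo p-th multiples, which lies in a finite direct
  summand; the extension is the sum of a finite abelian p-group and a complement that still contains
  infinitely many copies of each summand. So all extensions are isomorphic to \<open>C\<close>,
  although p C is not \<open>C\<close>. The first claim covers this case as well.\<close>

theorem proposition9p2:
  fixes \<Gamma> :: "'g monoid" and I :: "'i set" and \<phi> :: "'g \<Rightarrow> 'i \<Rightarrow> 'i"
    and n :: nat and C :: "'c monoid"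
  defines "G \<equiv> generalized_wreath n I \<Gamma> \<phi>"
  assumes "group \<Gamma>" and "countable (carrier \<Gamma>)"
    and "faithful_action \<Gamma> I \<phi>" and "transitive_action \<Gamma> I \<phi>" and "I \<noteq> {}"
    and "\<And>i j. i \<in> I \<Longrightarrow> j \<in> I \<Longrightarrow> i \<noteq> j \<Longrightarrow> infinite ((\<lambda>g. \<phi> g j) ` stabilizer \<Gamma> \<phi> i)"
    and "n \<ge> 1"
    and "comm_group C" and "countable (carrier C)"
    and "(\<lambda>c. c [^]\<^bsub>C\<^esub> n) ` carrier C \<noteq> carrier C"
  shows "(\<forall>E :: 'e monoid. is_central_extension G C E \<longrightarrow> \<not> W_star_superrigid E) \<and>
    ((\<exists>i\<in>I. \<exists>j\<in>I. i \<noteq> j) \<longrightarrow>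
     (\<forall>\<Omega>\<in>carrier (H2 G C). \<exists>\<Omega>'\<in>carrier (H2 G C).
        dual_equivalent G C \<Omega> \<Omega>' \<and>
        (\<forall>\<xi>\<in>\<Omega>. \<forall>\<xi>'\<in>\<Omega>'.
           vN_equivalent (cocycle_extension G C \<xi>) (cocycle_extension G C \<xi>') \<and>
           \<not> cocycle_extension G C \<xi> \<cong> cocycle_extension G C \<xi>')))"
proof -
  interpret C: comm_group C by fact
  have "n \<noteq> 1"
  proof
    assume "n = 1"
    then have "(\<lambda>c. c [^]\<^bsub>C\<^esub> n) ` carrier C = (\<lambda>c. c) ` carrier C" by (intro image_cong) auto
    then show False using assms(11) by simp
  qed
  then have n: "n \<ge> 2" using assms(8) by simp
  have W: "wreath_infinite \<Gamma> I \<phi> n"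
    by (intro wreath_infinite.intro wreath.intro wreath_axioms.intro wreath_infinite_axioms.intro
        assms(2,4,5,6,7) n)
  show ?thesis
    unfolding G_def
    using not_W_star_superrigid_of_central_extension[OF W assms(3,9,10,11)]
      exists_dual_equivalent_noniso[OF W _ _ _ assms(9,11)] by blast
qed

end
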